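(* Let $(S,\omega)$ be a prequantizable symplectic manifold, and let $(M,\mu)$ be a compact $k$-dimensional manifold with volume form $\mu$ and $H^1(M)=0$. Fix a Riemannian metric $g$ on $S$, and use it to identify $T_{(N,\nu)}\mathrm{Gr}^{M,\mu}_{\mathrm{iso}}(S)=T_N\mathrm{Gr}^M_{\mathrm{iso}}(S)\times\mathbf d\Omega^{k-1}(N)$. Then the reduced symplectic form $\omega_0$ on $\mathrm{Gr}^{M,\mu}_{\mathrm{iso}}(S)$ is $$(\omega_0)_{(N,\nu)}\big((u_N,\mathbf d\gamma),(v_N,\mathbf d\lambda)\big)=\int_N\omega(u_N,v_N)\nu+\int_N(\mathbf i_{u_N}\omega)|_{TN}\wedge\lambda-\int_N(\mathbf i_{v_N}\omega)|_{TN}\wedge\gamma$$ $$=\int_N\big(\omega(u_N,v_N)\nu+h_{v_N}\mathbf d\gamma-h_{u_N}\mathbf d\lambda\big),$$ for all $u_N,v_N\in T_N\mathrm{Gr}^M_{\mathrm{iso}}(S)$ and $\gamma,\lambda\in\Omega^{k-1}(N)$, where $h_{u_N},h_{v_N}\in C^\infty(N)$ are functions with $(\mathbf i_{u_N}\omega)|_{TN}=\mathbf d h_{u_N}$ and $(\mathbf i_{v_N}\omega)|_{TN}=\mathbf d h_{v_N}$.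
   Context: A symplectic manifold $(S,\omega)$ is prequantizable if there is a principal circle bundle $p:P\to S$ with principal connection $\alpha\in\Omega^1(P)$ satisfying $\mathbf d\alpha=p^*\omega$. Spaces of maps and submanifolds carry their natural Fréchet manifold structures. $\mathrm{Emb}(M,S)$ is the manifold of embeddings; its tangent space at $f$ consists of vector fields on $S$ along $f$. It carries the 2-form $\bar\omega_f(u_f,v_f)=\int_M\omega(u_f,v_f)\mu$. $\mathrm{Emb}_{\mathrm{iso}}(M,S)=\{f\in\mathrm{Emb}(M,S):f^*\omega=0\}$. $\mathrm{Diff}_{\mathrm{vol}}(M)$ is the group of diffeomorphisms preserving $\mu$, acting on embeddings by composition on the right. $\mathrm{Gr}^M_{\mathrm{iso}}(S)=\mathrm{Emb}_{\mathrm{iso}}(M,S)/\mathrm{Diff}(M)$ is the manifold of isotropic submanifolds $N\subset S$ of type $M$ (images of isotropic embeddings of $M$). $\mathrm{Gr}^{M,\mu}_{\mathrm{iso}}(S)=\mathrm{Emb}_{\mathrm{iso}}(M,S)/\mathrm{Diff}_{\mathrm{vol}}(M)$ is the manifold of isotropic volume submanifolds of type $(M,\mu)$: pairs $(N,\nu)$ with $N\in\mathrm{Gr}^M_{\mathrm{iso}}(S)$, $\nu$ a volume form on $N$, $\int_N\nu=\int_M\mu$; the quotient map is $\pi^\mu(f)=(f(M),f_*\mu)$. The reduced symplectic form $\omega_0$ is the 2-form on $\mathrm{Gr}^{M,\mu}_{\mathrm{iso}}(S)$ such that $(\pi^\mu)^*\omega_0$ is the restriction of $\bar\omega$ to $\mathrm{Emb}_{\mathrm{iso}}(M,S)$.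 Tangent spaces: $T_N\mathrm{Gr}^M_{\mathrm{iso}}(S)=\{[v_N]\in\Gamma((TS|_N)/TN):(\mathbf i_{v_N}\omega)|_{TN}=\mathbf dh_0\text{ for some }h_0\in C^\infty(N)\}$, where $v_N\in\Gamma(TS|_N)$; using $g$, the normal bundle $(TS|_N)/TN$ is identified with the orthogonal complement $TN^{\perp_g}\subset TS|_N$, so $u_N,v_N$ are regarded as sections of $TN^{\perp_g}$. The identification $T_{(N,\nu)}\mathrm{Gr}^{M,\mu}_{\mathrm{iso}}(S)=T_N\mathrm{Gr}^M_{\mathrm{iso}}(S)\times\mathbf d\Omega^{k-1}(N)$ is the one for which, when $\pi^\mu(f)=(N,\nu)$ and $v$ is a Hamiltonian vector field on $S$, $T_f\pi^\mu(v\circ f)=\big(v|_N^{\perp_g},\pounds_{v|_N^{\parallel_g}}\nu\big)$, with $v|_N=v|_N^{\perp_g}+v|_N^{\parallel_g}$ the decomposition into $g$-orthogonal and tangential parts along $N$ and $\pounds$ the Lie derivative. *)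

theory Defs
  imports "HOL-Analysis.Analysis"
begin

section \<open>Smooth maps between Euclidean spaces\<close>

text \<open>Only used on open sets \<open>U\<close>.\<close>

primrec Ck_on :: "nat \<Rightarrow> 'a::euclidean_space set \<Rightarrow> ('a \<Rightarrow> 'b::real_normed_vector) \<Rightarrow> bool" where
  "Ck_on 0 U f \<longleftrightarrow> continuous_on U f"
| "Ck_on (Suc n) U f \<longleftrightarrow>
     (\<forall>x\<in>U. f differentiable (at x)) \<and> (\<forall>v. Ck_on n U (\<lambda>x. frechet_derivative f (at x) v))"

definition smooth_on :: "'a::euclidean_space set \<Rightarrow> ('a \<Rightarrow> 'b::real_normed_vector) \<Rightarrow> bool" where
  "smooth_on U f \<longleftrightarrow> (\<forall>n. Ck_on n U f)"


section \<open>Smooth manifolds\<close>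

text \<open>
  A manifold modelled on the Euclidean space \<open>'e\<close> is an abstract topology with a (not necessarily
  maximal) smooth atlas. A chart is a pair \<open>(U, \<phi>)\<close>; the values of \<open>\<phi>\<close> outside \<open>U\<close> are irrelevant.
  Since \<open>'e\<close> is a type, all manifolds have positive dimension \<open>DIM('e)\<close>.
\<close>

type_synonym ('a, 'e) chart = "'a set \<times> ('a \<Rightarrow> 'e)"

record ('a, 'e) mfd =
  mtop :: "'a topology"
  atlas :: "('a, 'e) chart set"

abbreviation pts :: "('a, 'e) mfd \<Rightarrow> 'a set" where
  "pts M \<equiv> topspace (mtop M)"

abbreviation cimg :: "('a, 'e) chart \<Rightarrow> 'e set" where
  "cimg c \<equiv> snd c ` fst c"

abbreviation cinv :: "('a, 'e) chart \<Rightarrow> 'e \<Rightarrow> 'a" where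
  "cinv c \<equiv> inv_into (fst c) (snd c)"

definition manifold :: "('a, 'e::euclidean_space) mfd \<Rightarrow> bool" where
  "manifold M \<longleftrightarrow>
     Hausdorff_space (mtop M) \<and> second_countable (mtop M) \<and>
     \<Union>(fst ` atlas M) = pts M \<and>
     (\<forall>c\<in>atlas M. openin (mtop M) (fst c) \<and> open (cimg c) \<and>
        homeomorphic_map (subtopology (mtop M) (fst c)) (top_of_set (cimg c)) (snd c)) \<and>
     (\<forall>c\<in>atlas M. \<forall>d\<in>atlas M. smooth_on (snd c ` (fst c \<inter> fst d)) (snd d \<circ> cinv c))"

definition smooth_map ::
  "('a, 'e::euclidean_space) mfd \<Rightarrow> ('b, 'f::euclidean_space) mfd \<Rightarrow> ('a \<Rightarrow> 'b) \<Rightarrow> bool" where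
  "smooth_map M N f \<longleftrightarrow>
     continuous_map (mtop M) (mtop N) f \<and>
     (\<forall>c\<in>atlas M. \<forall>d\<in>atlas N.
        smooth_on (snd c ` (fst c \<inter> f -` fst d)) (snd d \<circ> f \<circ> cinv c))"

definition smooth_fun :: "('a, 'e::euclidean_space) mfd \<Rightarrow> ('a \<Rightarrow> real) \<Rightarrow> bool" where
  "smooth_fun M h \<longleftrightarrow> (\<forall>c\<in>atlas M. smooth_on (cimg c) (h \<circ> cinv c))"

definition diffeo ::
  "('a, 'e::euclidean_space) mfd \<Rightarrow> ('b, 'f::euclidean_space) mfd \<Rightarrow> ('a \<Rightarrow> 'b) \<Rightarrow> bool" where
  "diffeo M N f \<longleftrightarrow>
     smooth_map M N f \<and> bij_betw f (pts M) (pts N) \<and> smooth_map N M (inv_into (pts M) f)"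


subsection \<open>Tangent vectors\<close>

text \<open>
  The tangent space at every point \<open>x\<close> is the model space \<open>'e\<close> itself: a tangent vector is given by
  its coordinates with respect to one chosen chart \<open>chart_at M x\<close> around \<open>x\<close>. The choice varies
  arbitrarily with \<open>x\<close>, so smoothness of tensor fields is always expressed after a change to the
  coordinates of a fixed chart (\<open>to_chart\<close>, \<open>from_chart\<close>).
\<close>

definition chart_at :: "('a, 'e) mfd \<Rightarrow> 'a \<Rightarrow> ('a, 'e) chart" where
  "chart_at M x = (SOME c. c \<in> atlas M \<and> x \<in> fst c)"

definition chart_change ::
  "('a, 'e::euclidean_space) chart \<Rightarrow> ('a, 'e) chart \<Rightarrow> 'a \<Rightarrow> 'e \<Rightarrow> 'e" where
  "chart_change c d x = frechet_derivative (snd d \<circ> cinv c) (at (snd c x))"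

definition to_chart ::
  "('a, 'e::euclidean_space) mfd \<Rightarrow> ('a, 'e) chart \<Rightarrow> 'a \<Rightarrow> 'e \<Rightarrow> 'e" where
  "to_chart M c x = chart_change (chart_at M x) c x"

definition from_chart ::
  "('a, 'e::euclidean_space) mfd \<Rightarrow> ('a, 'e) chart \<Rightarrow> 'a \<Rightarrow> 'e \<Rightarrow> 'e" where
  "from_chart M c x = chart_change c (chart_at M x) x"

definition tmap ::
  "('a, 'e::euclidean_space) mfd \<Rightarrow> ('b, 'f::euclidean_space) mfd \<Rightarrow> ('a \<Rightarrow> 'b) \<Rightarrow> 'a \<Rightarrow> 'e \<Rightarrow> 'f" where
  "tmap M N f x =
     frechet_derivative (snd (chart_at N (f x)) \<circ> f \<circ> cinv (chart_at M x)) (at (snd (chart_at M x) x))"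

text \<open>Smooth sections of \<open>f\<^sup>*TS\<close>; sections and forms are normalised to vanish off the manifold,
  so that equality of sections and of forms is equality of functions.\<close>

definition vfield_along ::
  "('a, 'e::euclidean_space) mfd \<Rightarrow> ('b, 'f::euclidean_space) mfd \<Rightarrow> ('a \<Rightarrow> 'b) \<Rightarrow> ('a \<Rightarrow> 'f) \<Rightarrow> bool" where
  "vfield_along M S f u \<longleftrightarrow>
     (\<forall>x. x \<notin> pts M \<longrightarrow> u x = 0) \<and>
     (\<forall>c\<in>atlas M. \<forall>d\<in>atlas S.
        smooth_on (snd c ` (fst c \<inter> f -` fst d))
          (\<lambda>y. to_chart S d (f (cinv c y)) (u (cinv c y))))"

definition vector_field :: "('a, 'e::euclidean_space) mfd \<Rightarrow> ('a \<Rightarrow> 'e) \<Rightarrow> bool" where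
  "vector_field M X \<longleftrightarrow> vfield_along M M (\<lambda>x. x) X"


subsection \<open>Constructions of manifolds\<close>

definition euclid :: "'e::euclidean_space set \<Rightarrow> ('e, 'e) mfd" where
  "euclid W = \<lparr> mtop = top_of_set W, atlas = {(W, \<lambda>x. x)} \<rparr>"

definition prod_mfd :: "('a, 'e) mfd \<Rightarrow> ('b, 'f) mfd \<Rightarrow> ('a \<times> 'b, 'e \<times> 'f) mfd" where
  "prod_mfd M N =
     \<lparr> mtop = prod_topology (mtop M) (mtop N),
       atlas = {(fst c \<times> fst d, map_prod (snd c) (snd d)) |c d. c \<in> atlas M \<and> d \<in> atlas N} \<rparr>"

definition open_sub :: "('a, 'e) mfd \<Rightarrow> 'a set \<Rightarrow> ('a, 'e) mfd" where
  "open_sub M U = \<lparr> mtop = subtopology (mtop M) U, atlas = {(fst c \<inter> U, snd c) |c. c \<in> atlas M} \<rparr>"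

text \<open>
  The subset \<open>N\<close> of \<open>S\<close> with the induced topology and the smooth structure of a submanifold of
  dimension \<open>DIM('d)\<close>: its charts are the inverses of local parametrisations, i.e. of smooth
  immersions into \<open>S\<close> that are homeomorphisms onto open subsets of \<open>N\<close>.
\<close>

definition submfd :: "('s, 'e::euclidean_space) mfd \<Rightarrow> 's set \<Rightarrow> ('s, 'd::euclidean_space) mfd" where
  "submfd S N =
     \<lparr> mtop = subtopology (mtop S) N,
       atlas = {c. openin (subtopology (mtop S) N) (fst c) \<and> open (cimg c) \<and>
                   homeomorphic_map (subtopology (mtop S) (fst c)) (top_of_set (cimg c)) (snd c) \<and>
                   smooth_map (euclid (cimg c)) S (cinv c) \<and>
                   (\<forall>y\<in>cimg c. inj (tmap (euclid (cimg c)) S (cinv c) y))} \<rparr>"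

definition circle :: "(complex, real) mfd" where
  "circle = submfd (euclid (UNIV :: complex set)) (sphere 0 1)"


section \<open>Differential forms\<close>

text \<open>A \<open>p\<close>-form takes a point and the list of its \<open>p\<close> arguments; it is \<open>0\<close> on lists of any other
  length.\<close>

type_synonym ('a, 'e) form = "'a \<Rightarrow> 'e list \<Rightarrow> real"

definition alt_multilinear :: "nat \<Rightarrow> ('e::real_vector list \<Rightarrow> real) \<Rightarrow> bool" where
  "alt_multilinear p w \<longleftrightarrow>
     (\<forall>vs. length vs \<noteq> p \<longrightarrow> w vs = 0) \<and>
     (\<forall>vs i. length vs = p \<and> i < p \<longrightarrow> linear (\<lambda>v. w (vs[i := v]))) \<and>
     (\<forall>vs i j. length vs = p \<and> i < j \<and> j < p \<and> vs ! i = vs ! j \<longrightarrow> w vs = 0)"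

definition in_chart ::
  "('a, 'e::euclidean_space) mfd \<Rightarrow> ('a, 'e) chart \<Rightarrow> ('a, 'e) form \<Rightarrow> ('e, 'e) form" where
  "in_chart M c \<omega> y vs = \<omega> (cinv c y) (map (from_chart M c (cinv c y)) vs)"

definition diff_form :: "('a, 'e::euclidean_space) mfd \<Rightarrow> nat \<Rightarrow> ('a, 'e) form \<Rightarrow> bool" where
  "diff_form M p \<omega> \<longleftrightarrow>
     (\<forall>x\<in>pts M. alt_multilinear p (\<omega> x)) \<and> (\<forall>x. x \<notin> pts M \<longrightarrow> \<omega> x = (\<lambda>_. 0)) \<and>
     (\<forall>c\<in>atlas M. \<forall>vs. smooth_on (cimg c) (\<lambda>y. in_chart M c \<omega> y vs))"

definition fun_form :: "('a, 'e) mfd \<Rightarrow> ('a \<Rightarrow> real) \<Rightarrow> ('a, 'e) form" where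
  "fun_form M h x vs = (if x \<in> pts M \<and> vs = [] then h x else 0)"

definition del_nth :: "nat \<Rightarrow> 'b list \<Rightarrow> 'b list" where
  "del_nth i vs = take i vs @ drop (Suc i) vs"

text \<open>\<open>(\<^bold>d\<omega>)(v\<^sub>0,\<dots>,v\<^sub>p) = \<Sum>\<^sub>i (-1)\<^sup>i D\<^bsub>v\<^sub>i\<^esub>(\<omega>(v\<^sub>0,\<dots>,v\<^sub>i omitted,\<dots>,v\<^sub>p))\<close>
  for \<open>v\<^sub>i\<close> constant in the chosen chart.\<close>

definition ext_d :: "('a, 'e::euclidean_space) mfd \<Rightarrow> ('a, 'e) form \<Rightarrow> ('a, 'e) form" where
  "ext_d M \<omega> x vs =
     (if x \<in> pts M
      then \<Sum>i<length vs. (-1) ^ i *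
             frechet_derivative (\<lambda>y. in_chart M (chart_at M x) \<omega> y (del_nth i vs))
               (at (snd (chart_at M x) x)) (vs ! i)
      else 0)"

definition pullback ::
  "('a, 'e::euclidean_space) mfd \<Rightarrow> ('b, 'f::euclidean_space) mfd \<Rightarrow> ('a \<Rightarrow> 'b) \<Rightarrow> ('b, 'f) form \<Rightarrow> ('a, 'e) form"
  where
  "pullback M N f \<omega> x vs = (if x \<in> pts M then \<omega> (f x) (map (tmap M N f x) vs) else 0)"

definition interior_prod :: "('a \<Rightarrow> 'e) \<Rightarrow> ('a, 'e) form \<Rightarrow> ('a, 'e) form" where
  "interior_prod X \<omega> x vs = \<omega> x (X x # vs)"

text \<open>\<open>f\<^sup>*(\<^bold>i\<^sub>u\<omega>)\<close> for a vector field \<open>u\<close> along \<open>f\<close>. For a submanifold \<open>N\<close> and the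
  inclusion \<open>\<lambda>x. x\<close> this is \<open>(\<^bold>i\<^sub>u\<omega>)|\<^bsub>TN\<^esub>\<close>.\<close>

definition interior_along ::
  "('a, 'e::euclidean_space) mfd \<Rightarrow> ('b, 'f::euclidean_space) mfd \<Rightarrow> ('a \<Rightarrow> 'b) \<Rightarrow> ('a \<Rightarrow> 'f) \<Rightarrow> ('b, 'f) form \<Rightarrow> ('a, 'e) form"
  where
  "interior_along M S f u \<omega> x vs = (if x \<in> pts M then \<omega> (f x) (u x # map (tmap M S f x) vs) else 0)"

definition wedge1 :: "('a, 'e) form \<Rightarrow> ('a, 'e) form \<Rightarrow> ('a, 'e) form" where
  "wedge1 \<alpha> \<beta> x vs = (\<Sum>i<length vs. (-1) ^ i * \<alpha> x [vs ! i] * \<beta> x (del_nth i vs))"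
  \<comment> \<open>exterior product of a 1-form \<open>\<alpha>\<close> with a form of arbitrary degree\<close>

text \<open>The Lie derivative, by its coordinate expression
  \<open>(\<pounds>\<^sub>X\<omega>)(v\<^sub>1,\<dots>,v\<^sub>p) = D\<^sub>X(\<omega>(v\<^sub>1,\<dots>,v\<^sub>p)) + \<Sum>\<^sub>i \<omega>(v\<^sub>1,\<dots>,D\<^bsub>v\<^sub>i\<^esub>X,\<dots>,v\<^sub>p)\<close>
  for \<open>v\<^sub>i\<close> constant in the chosen chart.\<close>

definition lie_deriv ::
  "('a, 'e::euclidean_space) mfd \<Rightarrow> ('a \<Rightarrow> 'e) \<Rightarrow> ('a, 'e) form \<Rightarrow> ('a, 'e) form" where
  "lie_deriv M X \<omega> x vs =
     (if x \<in> pts M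
      then let c = chart_at M x; y\<^sub>0 = snd c x in
             frechet_derivative (\<lambda>y. in_chart M c \<omega> y vs) (at y\<^sub>0) (X x) +
             (\<Sum>i<length vs. \<omega> x (vs[i :=
                frechet_derivative (\<lambda>y. to_chart M c (cinv c y) (X (cinv c y))) (at y\<^sub>0) (vs ! i)]))
      else 0)"

definition volume_form :: "('a, 'e::euclidean_space) mfd \<Rightarrow> ('a, 'e) form \<Rightarrow> bool" where
  "volume_form M \<mu> \<longleftrightarrow> diff_form M DIM('e) \<mu> \<and> (\<forall>x\<in>pts M. \<mu> x \<noteq> (\<lambda>_. 0))"

definition H1_zero :: "('a, 'e::euclidean_space) mfd \<Rightarrow> bool" where
  "H1_zero M \<longleftrightarrow>
     (\<forall>\<alpha>. diff_form M 1 \<alpha> \<and> ext_d M \<alpha> = (\<lambda>_ _. 0) \<longrightarrow> (\<exists>h. smooth_fun M h \<and> \<alpha> = ext_d M (fun_form M h)))"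


subsection \<open>Integration over compact manifolds\<close>

definition partition_of_unity ::
  "('a, 'e::euclidean_space) mfd \<Rightarrow> (('a, 'e) chart \<times> ('a \<Rightarrow> real)) list \<Rightarrow> bool" where
  "partition_of_unity M P \<longleftrightarrow>
     (\<forall>(c, \<rho>)\<in>set P. c \<in> atlas M \<and> smooth_fun M \<rho> \<and> (\<forall>x\<in>pts M. 0 \<le> \<rho> x) \<and>
        mtop M closure_of {x\<in>pts M. \<rho> x \<noteq> 0} \<subseteq> fst c) \<and>
     (\<forall>x\<in>pts M. (\<Sum>(c, \<rho>)\<leftarrow>P. \<rho> x) = 1)"

definition basis_list :: "'e::euclidean_space list" where
  "basis_list = (SOME bs. distinct bs \<and> set bs = Basis)"

text \<open>
  The integral of a top degree form \<open>\<tau>\<close> over the compact manifold \<open>M\<close> with the orientation in which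
  the volume form \<open>\<nu>\<close> is positive. The sign of \<open>\<nu>\<close> on the coordinate basis accounts for charts (and
  for an ordering of \<open>Basis\<close>) that are not positively oriented.
\<close>

definition form_integral ::
  "('a, 'e::euclidean_space) mfd \<Rightarrow> ('a, 'e) form \<Rightarrow> ('a, 'e) form \<Rightarrow> real" where
  "form_integral M \<nu> \<tau> =
     (\<Sum>(c, \<rho>)\<leftarrow>(SOME P. partition_of_unity M P).
        integral (cimg c) (\<lambda>y. \<rho> (cinv c y) * sgn (in_chart M c \<nu> y basis_list) * in_chart M c \<tau> y basis_list))"


section \<open>Symplectic, prequantizable and Riemannian structures\<close>

definition symplectic :: "('s, 'e::euclidean_space) mfd \<Rightarrow> ('s, 'e) form \<Rightarrow> bool" where
  "symplectic S \<omega> \<longleftrightarrow>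
     manifold S \<and> diff_form S 2 \<omega> \<and> ext_d S \<omega> = (\<lambda>_ _. 0) \<and>
     (\<forall>x\<in>pts S. \<forall>v. (\<forall>w. \<omega> x [v, w] = 0) \<longrightarrow> v = 0)"

definition hamiltonian_vf :: "('s, 'e::euclidean_space) mfd \<Rightarrow> ('s, 'e) form \<Rightarrow> ('s \<Rightarrow> 'e) \<Rightarrow> bool" where
  "hamiltonian_vf S \<omega> v \<longleftrightarrow>
     vector_field S v \<and> (\<exists>h. smooth_fun S h \<and> interior_prod v \<omega> = ext_d S (fun_form S h))"

definition principal_circle_bundle ::
  "('p, 'q::euclidean_space) mfd \<Rightarrow> ('s, 'e::euclidean_space) mfd \<Rightarrow> ('p \<Rightarrow> 's) \<Rightarrow> (complex \<Rightarrow> 'p \<Rightarrow> 'p) \<Rightarrow> bool"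
  where
  "principal_circle_bundle P S p act \<longleftrightarrow>
     manifold P \<and> smooth_map P S p \<and>
     smooth_map (prod_mfd circle P) P (\<lambda>(z, q). act z q) \<and>
     (\<forall>q\<in>pts P. act 1 q = q) \<and>
     (\<forall>z\<in>sphere 0 1. \<forall>w\<in>sphere 0 1. \<forall>q\<in>pts P. act z (act w q) = act (z * w) q) \<and>
     (\<forall>x\<in>pts S. \<exists>U \<Psi>. openin (mtop S) U \<and> x \<in> U \<and>
        diffeo (prod_mfd (open_sub S U) circle) (open_sub P (pts P \<inter> p -` U)) \<Psi> \<and>
        (\<forall>y\<in>U. \<forall>z\<in>sphere 0 1. p (\<Psi> (y, z)) = y \<and>
           (\<forall>w\<in>sphere 0 1. act w (\<Psi> (y, z)) = \<Psi> (y, w * z))))"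

text \<open>The Lie algebra of the circle is identified with the reals by \<open>t \<mapsto> cis t\<close>, so a principal
  connection is an invariant real 1-form taking the value 1 on the generator of \<open>act (cis t)\<close>.\<close>

definition principal_connection ::
  "('p, 'q::euclidean_space) mfd \<Rightarrow> (complex \<Rightarrow> 'p \<Rightarrow> 'p) \<Rightarrow> ('p, 'q) form \<Rightarrow> bool" where
  "principal_connection P act \<alpha> \<longleftrightarrow>
     diff_form P 1 \<alpha> \<and>
     (\<forall>z\<in>sphere 0 1. pullback P P (act z) \<alpha> = \<alpha>) \<and>
     (\<forall>q\<in>pts P. \<alpha> q [tmap (euclid (UNIV :: real set)) P (\<lambda>t. act (cis t) q) 0 1] = 1)"

text \<open>HOL cannot quantify over the types of the total space \<open>P\<close> and of its model space, hence the
  type arguments. As a theorem hypothesis with these types schematic, it covers all \<open>P\<close>.\<close>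

definition prequantizable ::
  "'p itself \<Rightarrow> 'q::euclidean_space itself \<Rightarrow> ('s, 'e::euclidean_space) mfd \<Rightarrow> ('s, 'e) form \<Rightarrow> bool" where
  "prequantizable _ _ S \<omega> \<longleftrightarrow>
     (\<exists>(P :: ('p, 'q) mfd) p act \<alpha>.
        principal_circle_bundle P S p act \<and> principal_connection P act \<alpha> \<and>
        ext_d P \<alpha> = pullback P S p \<omega>)"

definition riemannian_metric :: "('s, 'e::euclidean_space) mfd \<Rightarrow> ('s \<Rightarrow> 'e \<Rightarrow> 'e \<Rightarrow> real) \<Rightarrow> bool" where
  "riemannian_metric S g \<longleftrightarrow>
     (\<forall>x\<in>pts S. bilinear (g x) \<and> (\<forall>v w. g x v w = g x w v) \<and> (\<forall>v. v \<noteq> 0 \<longrightarrow> 0 < g x v v)) \<and>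
     (\<forall>c\<in>atlas S. \<forall>v w. smooth_on (cimg c)
        (\<lambda>y. g (cinv c y) (from_chart S c (cinv c y) v) (from_chart S c (cinv c y) w)))"


section \<open>Spaces of embeddings\<close>

definition Emb :: "('m, 'd::euclidean_space) mfd \<Rightarrow> ('s, 'e::euclidean_space) mfd \<Rightarrow> ('m \<Rightarrow> 's) set" where
  "Emb M S = {f \<in> extensional (pts M).
     smooth_map M S f \<and> embedding_map (mtop M) (mtop S) f \<and> (\<forall>x\<in>pts M. inj (tmap M S f x))}"

definition Emb_iso ::
  "('m, 'd::euclidean_space) mfd \<Rightarrow> ('s, 'e::euclidean_space) mfd \<Rightarrow> ('s, 'e) form \<Rightarrow> ('m \<Rightarrow> 's) set" where
  "Emb_iso M S \<omega> = {f \<in> Emb M S. pullback M S f \<omega> = (\<lambda>_ _. 0)}"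

text \<open>
  The tangent space at \<open>f\<close> of \<open>Emb_iso M S \<omega>\<close>, a submanifold of \<open>Emb M S\<close>. Since \<open>\<omega>\<close> is closed, the
  linearisation of the equation \<open>f\<^sup>*\<omega> = 0\<close> in the direction \<open>u\<close> is \<open>\<^bold>d(f\<^sup>*(\<^bold>i\<^sub>u\<omega>)) = 0\<close>.
\<close>

definition T_Emb_iso ::
  "('m, 'd::euclidean_space) mfd \<Rightarrow> ('s, 'e::euclidean_space) mfd \<Rightarrow> ('s, 'e) form \<Rightarrow> ('m \<Rightarrow> 's) \<Rightarrow> ('m \<Rightarrow> 'e) set"
  where
  "T_Emb_iso M S \<omega> f =
     {u. vfield_along M S f u \<and> ext_d M (interior_along M S f u \<omega>) = (\<lambda>_ _. 0)}"

definition omega_bar ::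
  "('m, 'd::euclidean_space) mfd \<Rightarrow> ('m, 'd) form \<Rightarrow> ('s, 'e::euclidean_space) form \<Rightarrow> ('m \<Rightarrow> 's) \<Rightarrow>
   ('m \<Rightarrow> 'e) \<Rightarrow> ('m \<Rightarrow> 'e) \<Rightarrow> real" where
  "omega_bar M \<mu> \<omega> f u v = form_integral M \<mu> (\<lambda>x vs. \<omega> (f x) [u x, v x] * \<mu> x vs)"

definition Diff_vol :: "('m, 'd::euclidean_space) mfd \<Rightarrow> ('m, 'd) form \<Rightarrow> ('m \<Rightarrow> 'm) set" where
  "Diff_vol M \<mu> = {\<phi> \<in> extensional (pts M). diffeo M M \<phi> \<and> pullback M M \<phi> \<mu> = \<mu>}"


section \<open>The isotropic volume Grassmannian\<close>

text \<open>Points are pairs \<open>(N, \<nu>)\<close>, with \<open>N\<close> carrying its submanifold structure.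
  \<open>Gr_iso_vol\<close> is the quotient by \<open>Diff_vol M \<mu>\<close>, i.e. the image of \<open>\<pi>\<^sup>\<mu>\<close>.\<close>

definition pi_mu ::
  "('m, 'd::euclidean_space) mfd \<Rightarrow> ('m, 'd) form \<Rightarrow> ('s, 'e::euclidean_space) mfd \<Rightarrow> ('m \<Rightarrow> 's) \<Rightarrow>
   ('s, 'd) mfd \<times> ('s, 'd) form" where
  "pi_mu M \<mu> S f =
     (let N = submfd S (f ` pts M) in (N, pullback N M (inv_into (pts M) f) \<mu>))"

definition Gr_iso_vol ::
  "('m, 'd::euclidean_space) mfd \<Rightarrow> ('m, 'd) form \<Rightarrow> ('s, 'e::euclidean_space) mfd \<Rightarrow> ('s, 'e) form \<Rightarrow>
   (('s, 'd) mfd \<times> ('s, 'd) form) set" where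
  "Gr_iso_vol M \<mu> S \<omega> = pi_mu M \<mu> S ` Emb_iso M S \<omega>"

text \<open>
  A tangent vector of \<open>Emb_iso/Diff_vol\<close> is a class of tangent vectors \<open>(f, u)\<close> of \<open>Emb_iso\<close>, modulo
  the action \<open>(f, u) \<mapsto> (f \<circ> \<phi>, u \<circ> \<phi>)\<close> of \<open>Diff_vol\<close> and modulo the tangent vectors \<open>Tf \<circ> X\<close> of the
  orbit through \<open>f\<close>, where \<open>X\<close> ranges over the vector fields on \<open>M\<close> with \<open>\<pounds>\<^sub>X\<mu> = 0\<close>.
  \<open>T_pi_mu \<dots> f u\<close> is the class of \<open>(f, u)\<close>.
\<close>

type_synonym ('m, 's, 'e) gr_vec = "(('m \<Rightarrow> 's) \<times> ('m \<Rightarrow> 'e)) set"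

definition T_pi_mu ::
  "('m, 'd::euclidean_space) mfd \<Rightarrow> ('m, 'd) form \<Rightarrow> ('s, 'e::euclidean_space) mfd \<Rightarrow>
   ('m \<Rightarrow> 's) \<Rightarrow> ('m \<Rightarrow> 'e) \<Rightarrow> ('m, 's, 'e) gr_vec" where
  "T_pi_mu M \<mu> S f u =
     {(f', u'). \<exists>\<phi> X. \<phi> \<in> Diff_vol M \<mu> \<and> vector_field M X \<and> lie_deriv M X \<mu> = (\<lambda>_ _. 0) \<and>
        f' = compose (pts M) f \<phi> \<and>
        u' = (\<lambda>x. if x \<in> pts M then u (\<phi> x) + tmap M S f' x (X x) else 0)}"

definition T_Gr_iso_vol ::
  "('m, 'd::euclidean_space) mfd \<Rightarrow> ('m, 'd) form \<Rightarrow> ('s, 'e::euclidean_space) mfd \<Rightarrow> ('s, 'e) form \<Rightarrow>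
   ('s, 'd) mfd \<times> ('s, 'd) form \<Rightarrow> ('m, 's, 'e) gr_vec set" where
  "T_Gr_iso_vol M \<mu> S \<omega> n =
     {T_pi_mu M \<mu> S f u |f u. f \<in> Emb_iso M S \<omega> \<and> pi_mu M \<mu> S f = n \<and> u \<in> T_Emb_iso M S \<omega> f}"

text \<open>
  The reduced symplectic form: the 2-form with \<open>(\<pi>\<^sup>\<mu>)\<^sup>*\<omega>\<^sub>0 = \<omega>_bar\<close> on \<open>Emb_iso\<close>. Because \<open>\<pi>\<^sup>\<mu>\<close> is a
  surjective submersion, this equation determines \<open>\<omega>\<^sub>0\<close> and implies that it is smooth.
\<close>

definition reduced_symplectic_form ::
  "('m, 'd::euclidean_space) mfd \<Rightarrow> ('m, 'd) form \<Rightarrow> ('s, 'e::euclidean_space) mfd \<Rightarrow> ('s, 'e) form \<Rightarrow>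
   (('s, 'd) mfd \<times> ('s, 'd) form \<Rightarrow> ('m, 's, 'e) gr_vec \<Rightarrow> ('m, 's, 'e) gr_vec \<Rightarrow> real) \<Rightarrow> bool" where
  "reduced_symplectic_form M \<mu> S \<omega> \<omega>\<^sub>0 \<longleftrightarrow>
     (\<forall>f\<in>Emb_iso M S \<omega>.
        (\<forall>u\<in>T_Emb_iso M S \<omega> f. \<forall>v\<in>T_Emb_iso M S \<omega> f.
           \<omega>\<^sub>0 (pi_mu M \<mu> S f) (T_pi_mu M \<mu> S f u) (T_pi_mu M \<mu> S f v) = omega_bar M \<mu> \<omega> f u v) \<and>
        (\<forall>u\<in>T_Emb_iso M S \<omega> f. \<forall>v\<in>T_Emb_iso M S \<omega> f.
           \<omega>\<^sub>0 (pi_mu M \<mu> S f) (T_pi_mu M \<mu> S f u) (T_pi_mu M \<mu> S f v) =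
           - \<omega>\<^sub>0 (pi_mu M \<mu> S f) (T_pi_mu M \<mu> S f v) (T_pi_mu M \<mu> S f u)) \<and>
        (\<forall>u\<in>T_Emb_iso M S \<omega> f. \<forall>v\<in>T_Emb_iso M S \<omega> f. \<forall>w\<in>T_Emb_iso M S \<omega> f. \<forall>a b.
           \<omega>\<^sub>0 (pi_mu M \<mu> S f) (T_pi_mu M \<mu> S f (\<lambda>x. a *\<^sub>R u x + b *\<^sub>R v x)) (T_pi_mu M \<mu> S f w) =
           a * \<omega>\<^sub>0 (pi_mu M \<mu> S f) (T_pi_mu M \<mu> S f u) (T_pi_mu M \<mu> S f w) +
           b * \<omega>\<^sub>0 (pi_mu M \<mu> S f) (T_pi_mu M \<mu> S f v) (T_pi_mu M \<mu> S f w)))"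


subsection \<open>The identification of tangent spaces given by a metric\<close>

text \<open>The tangential part of \<open>v|\<^sub>N\<close> is a vector field on \<open>N\<close>; the normal part is a section of \<open>TS|\<^sub>N\<close>.\<close>

definition tan_part ::
  "('s, 'e::euclidean_space) mfd \<Rightarrow> ('s \<Rightarrow> 'e \<Rightarrow> 'e \<Rightarrow> real) \<Rightarrow> ('s, 'd::euclidean_space) mfd \<Rightarrow> ('s \<Rightarrow> 'e) \<Rightarrow> 's \<Rightarrow> 'd"
  where
  "tan_part S g N v x =
     (if x \<in> pts N
      then THE t. \<forall>w. g x (v x - tmap N S (\<lambda>x. x) x t) (tmap N S (\<lambda>x. x) x w) = 0
      else 0)"

definition nor_part ::
  "('s, 'e::euclidean_space) mfd \<Rightarrow> ('s \<Rightarrow> 'e \<Rightarrow> 'e \<Rightarrow> real) \<Rightarrow> ('s, 'd::euclidean_space) mfd \<Rightarrow> ('s \<Rightarrow> 'e) \<Rightarrow> 's \<Rightarrow> 'e"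
  where
  "nor_part S g N v x =
     (if x \<in> pts N then v x - tmap N S (\<lambda>x. x) x (tan_part S g N v x) else 0)"

text \<open>\<open>T\<^sub>NGr\<^sup>M\<^bsub>iso\<^esub>(S)\<close>, as a space of sections of the \<open>g\<close>-orthogonal complement of \<open>TN\<close>.\<close>

definition T_Gr_iso ::
  "('s, 'e::euclidean_space) mfd \<Rightarrow> ('s, 'e) form \<Rightarrow> ('s \<Rightarrow> 'e \<Rightarrow> 'e \<Rightarrow> real) \<Rightarrow> ('s, 'd::euclidean_space) mfd \<Rightarrow>
   ('s \<Rightarrow> 'e) set" where
  "T_Gr_iso S \<omega> g N =
     {u. vfield_along N S (\<lambda>x. x) u \<and>
         (\<forall>x\<in>pts N. \<forall>w. g x (u x) (tmap N S (\<lambda>x. x) x w) = 0) \<and>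
         (\<exists>h. smooth_fun N h \<and> interior_along N S (\<lambda>x. x) u \<omega> = ext_d N (fun_form N h))}"

text \<open>The linear isomorphism from the tangent space at \<open>(N, \<nu>)\<close> to \<open>T\<^sub>NGr\<^sup>M\<^bsub>iso\<^esub>(S) \<times> \<^bold>d\<Omega>\<^bsup>k-1\<^esup>(N)\<close>
  prescribed on (restrictions of) Hamiltonian vector fields.\<close>

definition gr_identification ::
  "('m, 'd::euclidean_space) mfd \<Rightarrow> ('m, 'd) form \<Rightarrow> ('s, 'e::euclidean_space) mfd \<Rightarrow> ('s, 'e) form \<Rightarrow>
   ('s \<Rightarrow> 'e \<Rightarrow> 'e \<Rightarrow> real) \<Rightarrow> ('s, 'd) mfd \<Rightarrow> ('s, 'd) form \<Rightarrow>
   (('m, 's, 'e) gr_vec \<Rightarrow> ('s \<Rightarrow> 'e) \<times> ('s, 'd) form) \<Rightarrow> bool" where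
  "gr_identification M \<mu> S \<omega> g N \<nu> \<Phi> \<longleftrightarrow>
     bij_betw \<Phi> (T_Gr_iso_vol M \<mu> S \<omega> (N, \<nu>))
       (T_Gr_iso S \<omega> g N \<times> {ext_d N \<gamma> |\<gamma>. diff_form N (DIM('d) - 1) \<gamma>}) \<and>
     (\<forall>f\<in>Emb_iso M S \<omega>. pi_mu M \<mu> S f = (N, \<nu>) \<longrightarrow>
        (\<forall>u\<in>T_Emb_iso M S \<omega> f. \<forall>v\<in>T_Emb_iso M S \<omega> f. \<forall>a b.
           \<Phi> (T_pi_mu M \<mu> S f (\<lambda>x. a *\<^sub>R u x + b *\<^sub>R v x)) =
           (\<lambda>x. a *\<^sub>R fst (\<Phi> (T_pi_mu M \<mu> S f u)) x + b *\<^sub>R fst (\<Phi> (T_pi_mu M \<mu> S f v)) x,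
            \<lambda>x vs. a * snd (\<Phi> (T_pi_mu M \<mu> S f u)) x vs + b * snd (\<Phi> (T_pi_mu M \<mu> S f v)) x vs)) \<and>
        (\<forall>v. hamiltonian_vf S \<omega> v \<longrightarrow>
           \<Phi> (T_pi_mu M \<mu> S f (\<lambda>x. if x \<in> pts M then v (f x) else 0)) =
           (nor_part S g N v, lie_deriv N (tan_part S g N v) \<nu>)))"

end

(* Given a class (u, d gamma), solve i_X nu = gamma for a tangential field X on N. Since N is isotropic,
   i_{u + X} omega restricts to the exact form d h_u on N, so u + X extends to a Hamiltonian vector field
   on S: locally the Hamiltonian is prescribed to first order along N with the help of a retraction onto N,
   and finitely many local solutions, all with the same 1-jet along N, are patched by cut-off functions.
   The normal part of this field is u and the Lie derivative of nu along its tangential part X is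
   d i_X nu = d gamma, so it represents the class.

   With (v, d lambda) represented by v + Y in the same way, omega_0 becomes the integral over N of
   omega(u + X, v + Y) nu, by the change of variables along the embedding. Isotropy removes omega(X, Y);
   the mixed terms are omega(u, Y) nu = i_u omega /\ lambda and omega(X, v) nu = - i_v omega /\ gamma,
   because alpha(Y) nu = alpha /\ i_Y nu for 1-forms alpha. The second formula is Stokes' theorem for
   h lambda. *)
theory Submission
  imports Defs
begin

text \<open>The map \<open>\<Phi>\<close> is prescribed only on restrictions of globally defined
  Hamiltonian fields, so a pair \<open>(u, ext_d N \<gamma>)\<close> cannot be decoded directly: a
  Hamiltonian field must be found whose restriction is sent to it, and injectivity of
  \<open>\<Phi>\<close> then identifies the preimage. This is why an extension theorem from N to S
  stands at the centre. Constants of integration cause no trouble there, since all local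
  Hamiltonians take on N the values of one global function. Two further obstacles come from the
  encoding. Tangent vectors are read in a chart chosen separately at each point, so the exterior
  derivative must be shown independent of the chart; this rests on the symmetry of second
  derivatives. The integral is computed with a chosen partition of unity, so its independence of
  that choice needs the change of variables theorem. One local construction serves twice: the smooth
  left inverse of an immersion makes the transition maps of N smooth, and it is the retraction in
  the local Hamiltonians.\<close>

section \<open>Calculus of finitely often differentiable and smooth maps on open sets\<close>

abbreviation FD :: "('a::real_normed_vector \<Rightarrow> 'b::real_normed_vector) \<Rightarrow> 'a \<Rightarrow> 'a \<Rightarrow> 'b" where
  "FD f x \<equiv> frechet_derivative f (at x)"

lemma FD_eqI: "(f has_derivative f') (at x) \<Longrightarrow> FD f x = f'"
  using frechet_derivative_at by metis

text \<open>No differentiability is assumed: \<open>frechet_derivative\<close> picks from the set of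
  derivatives at \<open>x\<close>, and functions that agree near \<open>x\<close> have the same
  set.\<close>

lemma FD_cong:
  assumes "open U" "x \<in> U" "\<And>y. y \<in> U \<Longrightarrow> f y = g y"
  shows "FD f x = FD g x"
proof -
  have "(f has_derivative F) (at x) \<longleftrightarrow> (g has_derivative F) (at x)" for F
    using has_derivative_transform_within_open[OF _ assms(1,2), of f F UNIV g]
      has_derivative_transform_within_open[OF _ assms(1,2), of g F UNIV f] assms(3) by auto
  then show ?thesis
    by (simp add: frechet_derivative_def)
qed

lemma Ck_on_Suc_has_derivative:
  "Ck_on (Suc n) U f \<Longrightarrow> x \<in> U \<Longrightarrow> (f has_derivative FD f x) (at x)"
  by (simp add: frechet_derivative_works)

lemma Ck_on_cong:
  assumes "open U" "\<And>x. x \<in> U \<Longrightarrow> f x = g x" "Ck_on n U f"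
  shows "Ck_on n U g"
  using assms(2,3)
proof (induction n arbitrary: f g)
  case 0
  then show ?case by (simp cong: continuous_on_cong)
next
  case (Suc n)
  have "g differentiable (at x)" if "x \<in> U" for x
    using has_derivative_transform_within_open[OF Ck_on_Suc_has_derivative[OF Suc.prems(2) that] assms(1) that, of g]
      Suc.prems(1) by (auto simp: differentiable_def)
  moreover have "Ck_on n U (\<lambda>x. FD g x v)" for v
  proof (rule Suc.IH)
    show "FD f x v = FD g x v" if "x \<in> U" for x
      using FD_cong[OF assms(1) that, of f g] Suc.prems(1) by simp
    show "Ck_on n U (\<lambda>x. FD f x v)" using Suc.prems(2) by simp
  qed
  ultimately show ?case by simp
qed

lemma Ck_on_subset: "Ck_on n U f \<Longrightarrow> V \<subseteq> U \<Longrightarrow> Ck_on n V f"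
  by (induction n arbitrary: f) (auto intro: continuous_on_subset)

lemma Ck_on_local:
  assumes "\<And>x. x \<in> U \<Longrightarrow> \<exists>V. open V \<and> x \<in> V \<and> Ck_on n V f"
  shows "Ck_on n U f"
  using assms
proof (induction n arbitrary: f)
  case 0
  then have "isCont f x" if "x \<in> U" for x
    using that by (metis Ck_on.simps(1) continuous_on_eq_continuous_at)
  then show ?case by (simp add: continuous_at_imp_continuous_on)
next
  case (Suc n)
  show ?case
    unfolding Ck_on.simps
  proof (intro conjI ballI allI)
    show "f differentiable (at x)" if "x \<in> U" for x
      using Suc.prems[OF that] by auto
    show "Ck_on n U (\<lambda>x. FD f x v)" for v
    proof (rule Suc.IH)
      show "\<exists>V. open V \<and> x \<in> V \<and> Ck_on n V (\<lambda>x. FD f x v)" if "x \<in> U" for x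
        using Suc.prems[OF that] by auto
    qed
  qed
qed

lemma Ck_on_SucI:
  assumes "open U" "\<And>x. x \<in> U \<Longrightarrow> (f has_derivative f' x) (at x)"
    and "\<And>v. Ck_on n U (\<lambda>x. f' x v)"
  shows "Ck_on (Suc n) U f"
proof -
  have "Ck_on n U (\<lambda>x. FD f x v)" for v
    by (rule Ck_on_cong[OF assms(1) _ assms(3)[of v]]) (simp add: FD_eqI[OF assms(2)])
  then show ?thesis using assms(2) by (auto simp: differentiable_def)
qed

lemma Ck_on_SucD: "Ck_on (Suc n) U f \<Longrightarrow> Ck_on n U f"
proof (induction n arbitrary: f)
  case 0
  then show ?case
    by (auto intro!: continuous_at_imp_continuous_on differentiable_imp_continuous_within)
next
  case (Suc n)
  then show ?case by (simp only: Ck_on.simps(2)[of "Suc n"] Ck_on.simps(2)[of n]) auto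
qed

lemma Ck_on_const: "Ck_on n U (\<lambda>x. c)"
  by (induction n arbitrary: c) auto

lemma Ck_on_bounded_linear:
  assumes "open U" "bounded_linear h" "Ck_on n U f"
  shows "Ck_on n U (\<lambda>x. h (f x))"
  using assms(3)
proof (induction n arbitrary: f)
  case 0
  then show ?case using assms(2) by (simp add: bounded_linear.continuous_on)
next
  case (Suc n)
  show ?case
  proof (rule Ck_on_SucI[OF assms(1)])
    show "((\<lambda>x. h (f x)) has_derivative (\<lambda>v. h (FD f x v))) (at x)" if "x \<in> U" for x
      using bounded_linear.has_derivative[OF assms(2) Ck_on_Suc_has_derivative[OF Suc.prems that]] .
    show "Ck_on n U (\<lambda>x. h (FD f x v))" for v
      using Suc.prems by (intro Suc.IH) simp
  qed
qed

lemma Ck_on_ident: "Ck_on n U (\<lambda>x. x)"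
  by (cases n) (auto simp: Ck_on_const)

lemma Ck_on_linear:
  fixes h :: "'a::euclidean_space \<Rightarrow> 'b::real_normed_vector"
  shows "linear h \<Longrightarrow> open U \<Longrightarrow> Ck_on n U h"
  using Ck_on_bounded_linear[of U h n "\<lambda>x. x"] Ck_on_ident linear_conv_bounded_linear by blast

lemma Ck_on_add:
  assumes "open U" "Ck_on n U f" "Ck_on n U g"
  shows "Ck_on n U (\<lambda>x. f x + g x)"
  using assms(2,3)
proof (induction n arbitrary: f g)
  case 0
  then show ?case by (simp add: continuous_on_add)
next
  case (Suc n)
  show ?case
  proof (rule Ck_on_SucI[OF assms(1)])
    show "((\<lambda>x. f x + g x) has_derivative (\<lambda>v. FD f x v + FD g x v)) (at x)" if "x \<in> U" for x
      by (rule has_derivative_add[OF Ck_on_Suc_has_derivative[OF Suc.prems(1) that]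
            Ck_on_Suc_has_derivative[OF Suc.prems(2) that]])
    show "Ck_on n U (\<lambda>x. FD f x v + FD g x v)" for v
      using Suc.prems by (intro Suc.IH) simp_all
  qed
qed

lemma Ck_on_sum:
  "open U \<Longrightarrow> (\<And>i. i \<in> I \<Longrightarrow> Ck_on n U (f i)) \<Longrightarrow> Ck_on n U (\<lambda>x. \<Sum>i\<in>I. f i x)"
  by (induction I rule: infinite_finite_induct) (auto intro: Ck_on_const Ck_on_add)

lemma Ck_on_bilinear:
  assumes "open U" "bounded_bilinear h" "Ck_on n U f" "Ck_on n U g"
  shows "Ck_on n U (\<lambda>x. h (f x) (g x))"
  using assms(3,4)
proof (induction n arbitrary: f g)
  case 0
  then show ?case using assms(2) by (simp add: bounded_bilinear.continuous_on)
next
  case (Suc n)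
  show ?case
  proof (rule Ck_on_SucI[OF assms(1)])
    show "((\<lambda>x. h (f x) (g x)) has_derivative (\<lambda>v. h (f x) (FD g x v) + h (FD f x v) (g x))) (at x)"
      if "x \<in> U" for x
      by (rule bounded_bilinear.FDERIV[OF assms(2) Ck_on_Suc_has_derivative[OF Suc.prems(1) that]
            Ck_on_Suc_has_derivative[OF Suc.prems(2) that]])
    show "Ck_on n U (\<lambda>x. h (f x) (FD g x v) + h (FD f x v) (g x))" for v
      using Suc.prems Ck_on_SucD[OF Suc.prems(1)] Ck_on_SucD[OF Suc.prems(2)]
      by (intro Ck_on_add[OF assms(1)] Suc.IH) simp_all
  qed
qed

lemmas Ck_on_mult = Ck_on_bilinear[OF _ bounded_bilinear_mult]
  and Ck_on_scaleR = Ck_on_bilinear[OF _ bounded_bilinear_scaleR]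
  and Ck_on_inner = Ck_on_bilinear[OF _ bounded_bilinear_inner]

lemma linear_basis_expansion:
  fixes L :: "'a::euclidean_space \<Rightarrow> 'b::real_vector"
  assumes "linear L"
  shows "L v = (\<Sum>b\<in>Basis. (v \<bullet> b) *\<^sub>R L b)"
  by (subst euclidean_representation[of v, symmetric])
    (simp add: linear_sum[OF assms] linear_cmul[OF assms] del: euclidean_representation)

lemma Ck_on_compose:
  fixes g :: "'b::euclidean_space \<Rightarrow> 'c::real_normed_vector" and f :: "'a::euclidean_space \<Rightarrow> 'b"
  assumes "open U" "open V" "f ` U \<subseteq> V" "Ck_on n V g" "Ck_on n U f"
  shows "Ck_on n U (\<lambda>x. g (f x))"
  using assms(4,5)
proof (induction n arbitrary: g)
  case 0
  then show ?case using assms(3) by (auto intro: continuous_on_compose2)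
next
  case (Suc n)
  have fin: "f x \<in> V" if "x \<in> U" for x using assms(3) that by auto
  \<comment> \<open>The vector \<open>FD f x v\<close> moves with \<open>x\<close>, whereas
    \<open>Ck_on\<close> speaks of derivatives in a fixed direction. Expanding it in
    \<open>Basis\<close> reduces the claim to the induction hypothesis for the maps
    \<open>\<lambda>z. FD g z b\<close>.\<close>
  have eq: "FD g (f x) (FD f x v) = (\<Sum>b\<in>Basis. (FD f x v \<bullet> b) *\<^sub>R FD g (f x) b)" if "x \<in> U" for x v
    by (rule linear_basis_expansion) (use Suc.prems(1) fin[OF that] in \<open>auto intro: linear_frechet_derivative\<close>)
  show ?case
  proof (rule Ck_on_SucI[OF assms(1)])
    show "((\<lambda>x. g (f x)) has_derivative (\<lambda>v. FD g (f x) (FD f x v))) (at x)" if "x \<in> U" for x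
      using has_derivative_compose[OF Ck_on_Suc_has_derivative[OF Suc.prems(2) that]
          Ck_on_Suc_has_derivative[OF Suc.prems(1) fin[OF that]]] .
    show "Ck_on n U (\<lambda>x. FD g (f x) (FD f x v))" for v
    proof (rule Ck_on_cong[OF assms(1)])
      show "Ck_on n U (\<lambda>x. \<Sum>b\<in>Basis. (FD f x v \<bullet> b) *\<^sub>R FD g (f x) b)"
        using Suc.prems Ck_on_SucD[OF Suc.prems(2)]
        by (intro Ck_on_sum Ck_on_scaleR Ck_on_inner Ck_on_const Suc.IH assms(1)) simp_all
    qed (simp add: eq)
  qed
qed

lemma Ck_on_inverse:
  fixes f :: "'a::euclidean_space \<Rightarrow> real"
  assumes "open U" "\<And>x. x \<in> U \<Longrightarrow> f x \<noteq> 0" "Ck_on n U f"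
  shows "Ck_on n U (\<lambda>x. inverse (f x))"
  using assms(3)
proof (induction n)
  case 0
  then show ?case using assms(2) by (auto intro: continuous_on_inverse)
next
  case (Suc n)
  show ?case
  proof (rule Ck_on_SucI[OF assms(1)])
    show "((\<lambda>x. inverse (f x)) has_derivative (\<lambda>v. (-1) * (inverse (f x) * FD f x v * inverse (f x)))) (at x)"
      if "x \<in> U" for x
      using Deriv.has_derivative_inverse[OF assms(2)[OF that] Ck_on_Suc_has_derivative[OF Suc.prems that]] by simp
    show "Ck_on n U (\<lambda>x. (-1) * (inverse (f x) * FD f x v * inverse (f x)))" for v
      using Suc.prems Ck_on_SucD[OF Suc.prems]
      by (intro Ck_on_mult Ck_on_const Suc.IH assms(1)) simp_all
  qed
qed

lemma Ck_on_componentwise: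
  fixes f :: "'a::euclidean_space \<Rightarrow> 'b::euclidean_space"
  assumes "open U" "\<And>b. b \<in> Basis \<Longrightarrow> Ck_on n U (\<lambda>x. f x \<bullet> b)"
  shows "Ck_on n U f"
  by (rule Ck_on_cong[OF assms(1) _ Ck_on_sum[of U Basis n "\<lambda>b x. (f x \<bullet> b) *\<^sub>R b"]])
    (auto intro!: Ck_on_scaleR Ck_on_const assms simp: euclidean_representation)

lemma smooth_on_cong:
  "open U \<Longrightarrow> (\<And>x. x \<in> U \<Longrightarrow> f x = g x) \<Longrightarrow> smooth_on U f \<Longrightarrow> smooth_on U g"
  unfolding smooth_on_def by (meson Ck_on_cong)

lemma smooth_on_subset: "smooth_on U f \<Longrightarrow> V \<subseteq> U \<Longrightarrow> smooth_on V f"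
  unfolding smooth_on_def by (meson Ck_on_subset)

lemma smooth_on_local:
  "(\<And>x. x \<in> U \<Longrightarrow> \<exists>V. open V \<and> x \<in> V \<and> smooth_on V f) \<Longrightarrow> smooth_on U f"
  unfolding smooth_on_def by (meson Ck_on_local)

lemma smooth_on_imp_continuous_on: "smooth_on U f \<Longrightarrow> continuous_on U f"
  unfolding smooth_on_def by (metis Ck_on.simps(1))

lemma smooth_on_has_derivative: "smooth_on U f \<Longrightarrow> x \<in> U \<Longrightarrow> (f has_derivative FD f x) (at x)"
  unfolding smooth_on_def using Ck_on_Suc_has_derivative by blast

lemma smooth_on_differentiable: "smooth_on U f \<Longrightarrow> x \<in> U \<Longrightarrow> f differentiable (at x)"
  using smooth_on_has_derivative frechet_derivative_works by blast

lemma smooth_on_FD: "smooth_on U f \<Longrightarrow> smooth_on U (\<lambda>x. FD f x v)"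
  unfolding smooth_on_def using Ck_on.simps(2) by blast

lemma smooth_on_linear_FD: "smooth_on U f \<Longrightarrow> x \<in> U \<Longrightarrow> linear (FD f x)"
  using smooth_on_differentiable linear_frechet_derivative by blast

lemma smooth_on_const: "smooth_on U (\<lambda>x. c)"
  unfolding smooth_on_def by (simp add: Ck_on_const)

lemma smooth_on_ident: "smooth_on U (\<lambda>x. x)"
  unfolding smooth_on_def by (simp add: Ck_on_ident)

lemma smooth_on_linear:
  "linear (h :: 'a::euclidean_space \<Rightarrow> 'b::real_normed_vector) \<Longrightarrow> open U \<Longrightarrow> smooth_on U h"
  unfolding smooth_on_def by (simp add: Ck_on_linear)

lemma smooth_on_linear_compose:
  fixes h :: "'b::euclidean_space \<Rightarrow> 'c::real_normed_vector"
  shows "open U \<Longrightarrow> linear h \<Longrightarrow> smooth_on U f \<Longrightarrow> smooth_on U (\<lambda>x. h (f x))"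
  unfolding smooth_on_def using Ck_on_bounded_linear linear_conv_bounded_linear by blast

lemma smooth_on_add:
  "open U \<Longrightarrow> smooth_on U f \<Longrightarrow> smooth_on U g \<Longrightarrow> smooth_on U (\<lambda>x. f x + g x)"
  unfolding smooth_on_def by (simp add: Ck_on_add)

lemma smooth_on_sum:
  "open U \<Longrightarrow> (\<And>i. i \<in> I \<Longrightarrow> smooth_on U (f i)) \<Longrightarrow> smooth_on U (\<lambda>x. \<Sum>i\<in>I. f i x)"
  unfolding smooth_on_def by (simp add: Ck_on_sum)

lemma smooth_on_mult:
  fixes f g :: "'a::euclidean_space \<Rightarrow> real"
  shows "open U \<Longrightarrow> smooth_on U f \<Longrightarrow> smooth_on U g \<Longrightarrow> smooth_on U (\<lambda>x. f x * g x)"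
  unfolding smooth_on_def by (simp add: Ck_on_mult)

lemma smooth_on_scaleR:
  "open U \<Longrightarrow> smooth_on U f \<Longrightarrow> smooth_on U g \<Longrightarrow> smooth_on U (\<lambda>x. f x *\<^sub>R g x)"
  unfolding smooth_on_def by (simp add: Ck_on_scaleR)

lemma smooth_on_inner:
  "open U \<Longrightarrow> smooth_on U f \<Longrightarrow> smooth_on U g \<Longrightarrow> smooth_on U (\<lambda>x. f x \<bullet> g x)"
  unfolding smooth_on_def by (simp add: Ck_on_inner)

lemma smooth_on_minus:
  "open U \<Longrightarrow> smooth_on U f \<Longrightarrow> smooth_on U (\<lambda>x. - f x)"
  using smooth_on_scaleR[OF _ smooth_on_const[of U "-1 :: real"], of f] by simp

lemma smooth_on_diff:
  "open U \<Longrightarrow> smooth_on U f \<Longrightarrow> smooth_on U g \<Longrightarrow> smooth_on U (\<lambda>x. f x - g x)"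
  using smooth_on_add[OF _ _ smooth_on_minus[of U g], of f] by simp

lemma smooth_on_compose:
  fixes g :: "'b::euclidean_space \<Rightarrow> 'c::real_normed_vector" and f :: "'a::euclidean_space \<Rightarrow> 'b"
  shows "open U \<Longrightarrow> open V \<Longrightarrow> f ` U \<subseteq> V \<Longrightarrow> smooth_on V g \<Longrightarrow> smooth_on U f \<Longrightarrow> smooth_on U (\<lambda>x. g (f x))"
  unfolding smooth_on_def using Ck_on_compose by blast

lemma smooth_on_inverse:
  fixes f :: "'a::euclidean_space \<Rightarrow> real"
  shows "open U \<Longrightarrow> (\<And>x. x \<in> U \<Longrightarrow> f x \<noteq> 0) \<Longrightarrow> smooth_on U f \<Longrightarrow> smooth_on U (\<lambda>x. inverse (f x))"
  unfolding smooth_on_def by (simp add: Ck_on_inverse)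

lemma smooth_on_divide:
  fixes f g :: "'a::euclidean_space \<Rightarrow> real"
  shows "open U \<Longrightarrow> (\<And>x. x \<in> U \<Longrightarrow> g x \<noteq> 0) \<Longrightarrow> smooth_on U f \<Longrightarrow> smooth_on U g \<Longrightarrow> smooth_on U (\<lambda>x. f x / g x)"
  using smooth_on_mult[OF _ _ smooth_on_inverse[of U g], of f] by (simp add: divide_inverse)

lemma smooth_on_componentwise:
  fixes f :: "'a::euclidean_space \<Rightarrow> 'b::euclidean_space"
  shows "open U \<Longrightarrow> (\<And>b. b \<in> Basis \<Longrightarrow> smooth_on U (\<lambda>x. f x \<bullet> b)) \<Longrightarrow> smooth_on U f"
  unfolding smooth_on_def using Ck_on_componentwise by blast

lemma smooth_on_FD_apply:
  fixes f :: "'a::euclidean_space \<Rightarrow> 'b::real_normed_vector" and w :: "'a \<Rightarrow> 'a"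
  assumes "open U" "smooth_on U f" "smooth_on U w"
  shows "smooth_on U (\<lambda>x. FD f x (w x))"
  by (rule smooth_on_cong[OF assms(1) _ smooth_on_sum[of U Basis "\<lambda>b x. (w x \<bullet> b) *\<^sub>R FD f x b"]])
    (auto intro!: smooth_on_scaleR smooth_on_inner smooth_on_const smooth_on_FD assms
      linear_basis_expansion[symmetric] smooth_on_linear_FD[OF assms(2)])

section \<open>Rules of differentiation and the symmetry of second derivatives\<close>

lemma differentiable_has_FD: "f differentiable (at x) \<Longrightarrow> (f has_derivative FD f x) (at x)"
  by (simp add: frechet_derivative_works)

lemma FD_compose:
  assumes "f differentiable (at x)" "g differentiable (at (f x))"
  shows "FD (\<lambda>x. g (f x)) x v = FD g (f x) (FD f x v)"
  by (subst FD_eqI[OF has_derivative_compose[OF assms[THEN differentiable_has_FD]]]) simp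

lemma FD_add:
  assumes "f differentiable (at x)" "g differentiable (at x)"
  shows "FD (\<lambda>x. f x + g x) x v = FD f x v + FD g x v"
  by (subst FD_eqI[OF has_derivative_add[OF assms[THEN differentiable_has_FD]]]) simp

lemma FD_diff:
  assumes "f differentiable (at x)" "g differentiable (at x)"
  shows "FD (\<lambda>x. f x - g x) x v = FD f x v - FD g x v"
  by (subst FD_eqI[OF has_derivative_diff[OF assms[THEN differentiable_has_FD]]]) simp

lemma FD_mult:
  fixes f g :: "'a::real_normed_vector \<Rightarrow> real"
  assumes "f differentiable (at x)" "g differentiable (at x)"
  shows "FD (\<lambda>x. f x * g x) x v = f x * FD g x v + FD f x v * g x"
  by (subst FD_eqI[OF has_derivative_mult[OF assms[THEN differentiable_has_FD]]]) simp

lemma FD_sum: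
  assumes "\<And>i. i \<in> I \<Longrightarrow> f i differentiable (at x)"
  shows "FD (\<lambda>x. \<Sum>i\<in>I. f i x) x v = (\<Sum>i\<in>I. FD (f i) x v)"
  by (subst FD_eqI[OF has_derivative_sum[OF differentiable_has_FD[OF assms]]]) auto

lemma FD_linear_compose:
  assumes "bounded_linear h" "f differentiable (at x)"
  shows "FD (\<lambda>x. h (f x)) x v = h (FD f x v)"
  by (subst FD_eqI[OF bounded_linear.has_derivative[OF assms(1) differentiable_has_FD[OF assms(2)]]]) simp

lemma has_derivative_along_line:
  fixes f :: "'a::real_normed_vector \<Rightarrow> real"
  assumes "f differentiable (at (x + t *\<^sub>R v))"
  shows "((\<lambda>t. f (x + t *\<^sub>R v)) has_real_derivative FD f (x + t *\<^sub>R v) v) (at t)"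
proof -
  have "((\<lambda>t. x + t *\<^sub>R v) has_derivative (\<lambda>s. s *\<^sub>R v)) (at t)"
    by (auto intro!: derivative_eq_intros)
  from has_derivative_compose[OF this differentiable_has_FD[OF assms]]
  have "((\<lambda>t. f (x + t *\<^sub>R v)) has_derivative (\<lambda>s. FD f (x + t *\<^sub>R v) (s *\<^sub>R v))) (at t)" .
  moreover have "FD f (x + t *\<^sub>R v) (s *\<^sub>R v) = FD f (x + t *\<^sub>R v) v * s" for s
    using linear_cmul[OF linear_frechet_derivative[OF assms]] by simp
  ultimately show ?thesis by (simp add: has_field_derivative_def)
qed

text \<open>Two applications of the mean value theorem: first in the direction \<open>v\<close>, to
  the increment of \<open>f\<close> along \<open>h *\<^sub>R w\<close>, then in the direction
  \<open>w\<close>, to the derivative along \<open>v\<close>. The left side of the equation is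
  symmetric in \<open>v\<close> and \<open>w\<close>, and this is the source of the symmetry of
  second derivatives.\<close>

lemma second_difference_mean_value:
  fixes f :: "'a::euclidean_space \<Rightarrow> real"
  assumes f: "Ck_on 2 U f" and h: "0 < h"
    and in_U: "\<And>a b. a \<in> {0..h} \<Longrightarrow> b \<in> {0..h} \<Longrightarrow> x + a *\<^sub>R v + b *\<^sub>R w \<in> U"
  shows "\<exists>a\<in>{0..h}. \<exists>b\<in>{0..h}. f (x + h *\<^sub>R v + h *\<^sub>R w) - f (x + h *\<^sub>R v) - f (x + h *\<^sub>R w) + f x =
    h * h * FD (\<lambda>z. FD f z v) (x + a *\<^sub>R v + b *\<^sub>R w) w"
proof -
  have d1: "f differentiable (at z)" if "z \<in> U" for z
    using f that by (simp add: numeral_2_eq_2)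
  have d2: "(\<lambda>z. FD f z v) differentiable (at z)" if "z \<in> U" for z
    using f that by (simp add: numeral_2_eq_2)
  let ?p = "\<lambda>s. f (x + h *\<^sub>R w + s *\<^sub>R v) - f (x + s *\<^sub>R v)"
  have "\<exists>z>0. z < h \<and> ?p h - ?p 0 = (h - 0) * (FD f (x + h *\<^sub>R w + z *\<^sub>R v) v - FD f (x + z *\<^sub>R v) v)"
  proof (rule MVT2[OF h])
    fix s assume s: "0 \<le> s" "s \<le> h"
    have "x + h *\<^sub>R w + s *\<^sub>R v \<in> U" "x + s *\<^sub>R v \<in> U"
      using in_U[of s h] in_U[of s 0] s by (simp_all add: algebra_simps)
    then show "(?p has_real_derivative FD f (x + h *\<^sub>R w + s *\<^sub>R v) v - FD f (x + s *\<^sub>R v) v) (at s)"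
      by (intro DERIV_diff has_derivative_along_line d1)
  qed
  then obtain a where a: "0 < a" "a < h"
    "?p h - ?p 0 = h * (FD f (x + h *\<^sub>R w + a *\<^sub>R v) v - FD f (x + a *\<^sub>R v) v)" by auto
  let ?q = "\<lambda>t. FD f (x + a *\<^sub>R v + t *\<^sub>R w) v"
  have "\<exists>z>0. z < h \<and> ?q h - ?q 0 = (h - 0) * FD (\<lambda>z. FD f z v) (x + a *\<^sub>R v + z *\<^sub>R w) w"
  proof (rule MVT2[OF h])
    fix t assume t: "0 \<le> t" "t \<le> h"
    show "(?q has_real_derivative FD (\<lambda>z. FD f z v) (x + a *\<^sub>R v + t *\<^sub>R w) w) (at t)"
      using in_U[of a t] a t by (intro has_derivative_along_line d2) auto
  qed
  then obtain b where b: "0 < b" "b < h"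
    "?q h - ?q 0 = h * FD (\<lambda>z. FD f z v) (x + a *\<^sub>R v + b *\<^sub>R w) w" by auto
  have "?p h - ?p 0 = h * (?q h - ?q 0)"
    using a(3) by (simp add: algebra_simps)
  with a b show ?thesis
    by (intro bexI[of _ a] bexI[of _ b]) (auto simp: algebra_simps)
qed

text \<open>If the two mixed derivatives differed at \<open>x\<close>, continuity would keep them
  apart on a small parallelogram; but the symmetric second difference is \<open>h * h\<close> times
  a value of each of them there.\<close>

lemma second_derivative_symmetric_real:
  fixes f :: "'a::euclidean_space \<Rightarrow> real"
  assumes "open U" "x \<in> U" and f: "Ck_on 2 U f"
  shows "FD (\<lambda>z. FD f z v) x w = FD (\<lambda>z. FD f z w) x v"
proof (rule ccontr)
  let ?A = "\<lambda>z. FD (\<lambda>z. FD f z v) z w" and ?B = "\<lambda>z. FD (\<lambda>z. FD f z w) z v"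
  assume ne: "?A x \<noteq> ?B x"
  \<comment> \<open>Half of the gap: two values that lie within \<open>e\<close> of
    \<open>?A x\<close> and \<open>?B x\<close> respectively cannot coincide.\<close>
  define e where "e = \<bar>?A x - ?B x\<bar> / 2"
  have e: "e > 0" using ne by (simp add: e_def)
  have "isCont ?A x" "isCont ?B x"
    using f assms(1,2) by (auto simp: numeral_2_eq_2 continuous_on_eq_continuous_at)
  then have "\<exists>d>0. \<forall>z. dist z x < d \<longrightarrow> \<bar>?A z - ?A x\<bar> < e" "\<exists>d>0. \<forall>z. dist z x < d \<longrightarrow> \<bar>?B z - ?B x\<bar> < e"
    using e unfolding continuous_at_eps_delta dist_real_def by blast+
  then obtain d1 d2 where d: "d1 > 0" "d2 > 0" "\<And>z. dist z x < d1 \<Longrightarrow> \<bar>?A z - ?A x\<bar> < e"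
      "\<And>z. dist z x < d2 \<Longrightarrow> \<bar>?B z - ?B x\<bar> < e"
    by blast
  obtain d3 where d3: "d3 > 0" "\<And>z. dist z x < d3 \<Longrightarrow> z \<in> U"
    using assms(1,2) unfolding open_dist by blast
  define d where "d = Min {d1, d2, d3}"
  have d0: "d > 0" "d \<le> d1" "d \<le> d2" "d \<le> d3" using d d3 by (auto simp: d_def)
  \<comment> \<open>Small enough for the parallelogram spanned by \<open>h *\<^sub>R v\<close> and
    \<open>h *\<^sub>R w\<close> to lie in the ball of radius \<open>d\<close>; the summand 1 avoids
    division by zero when both vectors vanish.\<close>
  define h where "h = d / (2 * (norm v + norm w + 1))"
  have np: "0 < norm v + norm w + 1" by (simp add: add_nonneg_pos)
  have h: "h > 0" using d0 np by (simp add: h_def)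
  have close: "dist (x + a *\<^sub>R v + b *\<^sub>R w) x < d" if "a \<in> {0..h}" "b \<in> {0..h}" for a b
  proof -
    have "dist (x + a *\<^sub>R v + b *\<^sub>R w) x \<le> a * norm v + b * norm w"
      using norm_triangle_ineq[of "a *\<^sub>R v" "b *\<^sub>R w"] that by (simp add: dist_norm add.assoc)
    also have "\<dots> \<le> h * norm v + h * norm w"
      using that by (intro add_mono mult_right_mono) auto
    also have "\<dots> < h * (2 * (norm v + norm w + 1))"
    proof -
      have "0 \<le> h * norm v" "0 \<le> h * norm w" using h by simp_all
      then have "h * norm v + h * norm w < 2 * (h * norm v) + 2 * (h * norm w) + 2 * h" using h by linarith
      then show ?thesis by (simp add: algebra_simps)
    qed
    also have "\<dots> = d" using np by (simp add: h_def)
    finally show ?thesis .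
  qed
  have in_U: "x + a *\<^sub>R v + b *\<^sub>R w \<in> U" if "a \<in> {0..h}" "b \<in> {0..h}" for a b
    using close[OF that] d0 by (intro d3(2)) linarith
  have in_U': "x + a *\<^sub>R w + b *\<^sub>R v \<in> U" if "a \<in> {0..h}" "b \<in> {0..h}" for a b
    using in_U[OF that(2,1)] by (simp add: add.assoc add.commute[of "a *\<^sub>R w"])
  obtain a b where ab: "a \<in> {0..h}" "b \<in> {0..h}"
    "f (x + h *\<^sub>R v + h *\<^sub>R w) - f (x + h *\<^sub>R v) - f (x + h *\<^sub>R w) + f x = h * h * ?A (x + a *\<^sub>R v + b *\<^sub>R w)"
    using second_difference_mean_value[OF f h in_U] by blast
  obtain a' b' where ab': "a' \<in> {0..h}" "b' \<in> {0..h}"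
    "f (x + h *\<^sub>R w + h *\<^sub>R v) - f (x + h *\<^sub>R w) - f (x + h *\<^sub>R v) + f x = h * h * ?B (x + a' *\<^sub>R w + b' *\<^sub>R v)"
    using second_difference_mean_value[OF f h in_U'] by blast
  have "h * h * ?A (x + a *\<^sub>R v + b *\<^sub>R w) = h * h * ?B (x + b' *\<^sub>R v + a' *\<^sub>R w)"
    using ab(3) ab'(3) by (simp add: algebra_simps)
  then have "?A (x + a *\<^sub>R v + b *\<^sub>R w) = ?B (x + b' *\<^sub>R v + a' *\<^sub>R w)" using h by simp
  moreover have "\<bar>?A (x + a *\<^sub>R v + b *\<^sub>R w) - ?A x\<bar> < e" "\<bar>?B (x + b' *\<^sub>R v + a' *\<^sub>R w) - ?B x\<bar> < e"
    using close[OF ab(1,2)] close[OF ab'(2,1)] d0 by (auto intro!: d(3,4))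
  ultimately show False by (auto simp: e_def abs_if split: if_splits)
qed

lemma second_derivative_symmetric:
  fixes f :: "'a::euclidean_space \<Rightarrow> 'b::euclidean_space"
  assumes "open U" "x \<in> U" and f: "smooth_on U f"
  shows "FD (\<lambda>z. FD f z v) x w = FD (\<lambda>z. FD f z w) x v"
proof (rule euclidean_eqI)
  fix b :: 'b assume "b \<in> Basis"
  have fb: "smooth_on U (\<lambda>x. f x \<bullet> b)"
    by (intro smooth_on_inner assms smooth_on_const)
  have 1: "FD (\<lambda>z. f z \<bullet> b) z v = FD f z v \<bullet> b" if "z \<in> U" for z v
    by (rule FD_linear_compose[OF bounded_linear_inner_left smooth_on_differentiable[OF f that]])
  have "FD (\<lambda>z. FD f z v) x w \<bullet> b = FD (\<lambda>z. FD (\<lambda>z. f z \<bullet> b) z v) x w" for v w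
    using FD_cong[OF assms(1,2), of "\<lambda>z. FD (\<lambda>z. f z \<bullet> b) z v" "\<lambda>z. FD f z v \<bullet> b"] 1
    by (simp add: FD_linear_compose[OF bounded_linear_inner_left smooth_on_differentiable[OF smooth_on_FD[OF f] assms(2)]])
  moreover have "Ck_on 2 U (\<lambda>x. f x \<bullet> b)" using fb unfolding smooth_on_def by blast
  ultimately show "FD (\<lambda>z. FD f z v) x w \<bullet> b = FD (\<lambda>z. FD f z w) x v \<bullet> b"
    using second_derivative_symmetric_real[OF assms(1,2)] by simp
qed

subsection \<open>Smooth cut-off functions\<close>

text \<open>The polynomial parameter makes the family closed under differentiation, so that
  smoothness of all its members is a single induction.\<close>

definition flat_exp :: "real poly \<Rightarrow> real \<Rightarrow> real" where
  "flat_exp p t = (if t > 0 then poly p (1 / t) * exp (- (1 / t)) else 0)"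

lemma tendsto_poly_times_exp_minus: "((\<lambda>s. poly p s * exp (- s)) \<longlongrightarrow> 0) at_top" for p :: "real poly"
proof -
  have "((\<lambda>s. \<Sum>i\<le>degree p. coeff p i * (s ^ i / exp s)) \<longlongrightarrow> (\<Sum>i\<le>degree p. coeff p i * 0)) at_top"
    by (intro tendsto_intros tendsto_power_div_exp_0)
  then show ?thesis
    by (simp add: poly_altdef sum_distrib_right exp_minus divide_inverse mult.assoc)
qed

lemma flat_exp_tendsto_0: "(flat_exp p \<longlongrightarrow> 0) (at 0)"
proof (rule filterlim_split_at)
  show "(flat_exp p \<longlongrightarrow> 0) (at_left 0)"
    by (rule Lim_transform_eventually[OF tendsto_const])
      (auto simp: flat_exp_def eventually_at_left_field intro: exI[of _ "-1"])
  have "((\<lambda>t. poly p (inverse t) * exp (- inverse t)) \<longlongrightarrow> 0) (at_right 0)"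
    using filterlim_compose[OF tendsto_poly_times_exp_minus filterlim_inverse_at_top_right] .
  then show "(flat_exp p \<longlongrightarrow> 0) (at_right 0)"
    by (rule Lim_transform_eventually)
      (auto simp: flat_exp_def eventually_at_right_field divide_inverse intro: exI[of _ 1])
qed

text \<open>With \<open>s = 1 / t\<close> one has \<open>ds/dt = - s^2\<close>, so
  \<open>p(s) exp(-s)\<close> has the derivative \<open>s^2 (p(s) - p'(s)) exp(-s)\<close>; the
  factor \<open>s^2\<close> is the polynomial \<open>[:0, 0, 1:]\<close>. At 0 the difference
  quotient is itself a member of the family, hence tends to 0.\<close>

lemma flat_exp_has_derivative:
  "(flat_exp p has_real_derivative flat_exp ([:0, 0, 1:] * (p - pderiv p)) t) (at t)"
proof -
  let ?q = "[:0, 0, 1:] * (p - pderiv p)"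
  consider "t > 0" | "t < 0" | "t = 0" by linarith
  then show ?thesis
  proof cases
    case 1
    have "((\<lambda>t. poly p (1 / t) * exp (- (1 / t))) has_real_derivative flat_exp ?q t) (at t)"
      using 1 by (auto intro!: derivative_eq_intros DERIV_chain2[OF poly_DERIV] simp: flat_exp_def field_simps power2_eq_square)
    then show ?thesis
      by (rule DERIV_cong_ev[THEN iffD1, rotated 3, OF _ refl _ refl])
        (use 1 in \<open>auto simp: flat_exp_def eventually_nhds intro!: exI[of _ "{0<..}"]\<close>)
  next
    case 2
    have "((\<lambda>t. 0) has_real_derivative flat_exp ?q t) (at t)"
      using 2 by (auto simp: flat_exp_def)
    then show ?thesis
      by (rule DERIV_cong_ev[THEN iffD1, rotated 3, OF _ refl _ refl])
        (use 2 in \<open>auto simp: flat_exp_def eventually_nhds intro!: exI[of _ "{..<0}"]\<close>)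
  next
    case 3
    have "(\<lambda>h. (flat_exp p (0 + h) - flat_exp p 0) / h) = flat_exp ([:0, 1:] * p)"
      by (auto simp: flat_exp_def fun_eq_iff)
    then show ?thesis
      using flat_exp_tendsto_0[of "[:0,1:] * p"] 3 by (simp add: DERIV_def flat_exp_def)
  qed
qed

lemma smooth_on_flat_exp: "smooth_on UNIV (flat_exp p)"
proof -
  have "Ck_on n UNIV (flat_exp p)" for n
  proof (induction n arbitrary: p)
    case 0
    then show ?case
      using DERIV_isCont[OF flat_exp_has_derivative] by (auto intro!: continuous_at_imp_continuous_on)
  next
    case (Suc n)
    show ?case
      by (rule Ck_on_SucI[OF open_UNIV flat_exp_has_derivative[unfolded has_field_derivative_def]])
        (intro Ck_on_mult Suc.IH Ck_on_const open_UNIV)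
  qed
  then show ?thesis by (simp add: smooth_on_def)
qed

text \<open>The denominator is positive everywhere, because \<open>t\<close> and
  \<open>1 - t\<close> cannot both be nonpositive.\<close>

definition smooth_step :: "real \<Rightarrow> real" where
  "smooth_step t = flat_exp 1 t / (flat_exp 1 t + flat_exp 1 (1 - t))"

lemma smooth_step:
  shows "smooth_on UNIV smooth_step" "0 \<le> smooth_step t" "smooth_step t \<le> 1"
    "t \<le> 0 \<Longrightarrow> smooth_step t = 0" "t \<ge> 1 \<Longrightarrow> smooth_step t = 1"
proof -
  have nonneg: "flat_exp 1 s \<ge> 0" for s by (simp add: flat_exp_def)
  have pos: "flat_exp 1 s + flat_exp 1 (1 - s) > 0" for s
    by (auto simp: flat_exp_def add_pos_nonneg add_nonneg_pos)
  have "smooth_on UNIV (\<lambda>t. flat_exp 1 (1 - t))"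
    by (rule smooth_on_compose[OF open_UNIV open_UNIV _ smooth_on_flat_exp])
      (auto intro: smooth_on_diff smooth_on_const smooth_on_ident)
  then have "smooth_on UNIV (\<lambda>t. flat_exp 1 t / (flat_exp 1 t + flat_exp 1 (1 - t)))"
    using pos by (intro smooth_on_divide smooth_on_add smooth_on_flat_exp) (auto simp: less_imp_neq[symmetric])
  then show "smooth_on UNIV smooth_step" by (simp add: smooth_step_def[abs_def])
  show "0 \<le> smooth_step t" "smooth_step t \<le> 1"
    using nonneg[of t] nonneg[of "1 - t"] pos[of t] by (auto simp: smooth_step_def)
  show "t \<le> 0 \<Longrightarrow> smooth_step t = 0" by (simp add: smooth_step_def flat_exp_def)
  show "t \<ge> 1 \<Longrightarrow> smooth_step t = 1" by (simp add: smooth_step_def flat_exp_def)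
qed

lemma smooth_bump:
  fixes x0 :: "'a::euclidean_space"
  assumes "r > 0"
  obtains b :: "'a \<Rightarrow> real" where "smooth_on UNIV b" "\<And>x. 0 \<le> b x" "\<And>x. b x \<le> 1"
    "\<And>x. dist x0 x \<le> r \<Longrightarrow> b x = 1" "\<And>x. 2 * r \<le> dist x0 x \<Longrightarrow> b x = 0"
proof
  \<comment> \<open>Affine in the squared distance, which unlike the distance is smooth at
    \<open>x0\<close>. The constants make it 1 at distance \<open>r\<close> and 0 at distance
    \<open>2 * r\<close>, the two thresholds of \<open>smooth_step\<close>.\<close>
  define q where "q x = (4 * r\<^sup>2 - (x - x0) \<bullet> (x - x0)) * inverse (3 * r\<^sup>2)" for x
  have sq: "smooth_on UNIV q"
    unfolding q_def[abs_def]
    by (intro smooth_on_mult smooth_on_diff smooth_on_inner smooth_on_const smooth_on_ident open_UNIV)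
  let ?b = "\<lambda>x. smooth_step (q x)"
  have d: "(x - x0) \<bullet> (x - x0) = (dist x0 x)\<^sup>2" for x
    by (metis dist_commute dist_norm power2_norm_eq_inner)
  show "smooth_on UNIV ?b"
    using smooth_on_compose[OF open_UNIV open_UNIV _ smooth_step(1) sq] by simp
  show "0 \<le> ?b x" "?b x \<le> 1" for x by (rule smooth_step)+
  show "?b x = 1" if "dist x0 x \<le> r" for x
  proof (rule smooth_step(5))
    have "(dist x0 x)\<^sup>2 \<le> r\<^sup>2" using that by (intro power_mono) auto
    then show "1 \<le> q x" using assms by (simp add: q_def d field_simps)
  qed
  show "?b x = 0" if "2 * r \<le> dist x0 x" for x
  proof (rule smooth_step(4))
    have "(2 * r)\<^sup>2 \<le> (dist x0 x)\<^sup>2" using that assms by (intro power_mono) auto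
    then show "q x \<le> 0" using assms by (simp add: q_def d power_mult_distrib mult_le_0_iff)
  qed
qed

subsection \<open>Smooth inverse functions\<close>

lemma Ck_on_prod:
  fixes f :: "'i \<Rightarrow> 'a::euclidean_space \<Rightarrow> real"
  shows "open U \<Longrightarrow> (\<And>i. i \<in> I \<Longrightarrow> Ck_on n U (f i)) \<Longrightarrow> Ck_on n U (\<lambda>x. \<Prod>i\<in>I. f i x)"
  by (induction I rule: infinite_finite_induct) (auto intro: Ck_on_const Ck_on_mult)

lemma Ck_on_det:
  fixes A :: "'a::euclidean_space \<Rightarrow> real^'n^'n"
  assumes "open U" "\<And>i j. Ck_on n U (\<lambda>x. A x $ i $ j)"
  shows "Ck_on n U (\<lambda>x. det (A x))"
  unfolding det_def by (intro Ck_on_sum Ck_on_mult Ck_on_prod Ck_on_const assms)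

lemma Ck_on_vec_nth: "open U \<Longrightarrow> Ck_on n U f \<Longrightarrow> Ck_on n U (\<lambda>x. f x $ i)"
  for f :: "'a::euclidean_space \<Rightarrow> real^'n"
  by (rule Ck_on_bounded_linear[OF _ bounded_linear_vec_nth])

text \<open>By Cramer's rule the solution of a linear system depends on it as smoothly as its coefficients.\<close>

lemma Ck_on_linear_solve:
  fixes A :: "'a::euclidean_space \<Rightarrow> real^'n \<Rightarrow> real^'n"
  assumes "open U" and lin: "\<And>x. x \<in> U \<Longrightarrow> linear (A x)" and inj: "\<And>x. x \<in> U \<Longrightarrow> inj (A x)"
    and A: "\<And>v. Ck_on n U (\<lambda>x. A x v)" and b: "Ck_on n U b"
    and s: "\<And>x. x \<in> U \<Longrightarrow> A x (s x) = b x"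
  shows "Ck_on n U s"
proof -
  have entry: "Ck_on n U (\<lambda>x. matrix (A x) $ i $ j)" for i j
    unfolding matrix_def by (simp add: Ck_on_vec_nth[OF assms(1) A])
  have det: "det (matrix (A x)) \<noteq> 0" if "x \<in> U" for x
    using inj[OF that] lin[OF that] by (simp add: det_nz_iff_inj)
  have mv: "matrix (A x) *v z = A x z" if "x \<in> U" for x z
    using lin[OF that] by (simp add: matrix_works linear_matrix_vector_mul_eq)
  have sol: "s x $ k = det (\<chi> i j. if j = k then b x $ i else matrix (A x) $ i $ j) * inverse (det (matrix (A x)))"
    if "x \<in> U" for x k
  proof -
    have "matrix (A x) *v s x = b x" unfolding mv[OF that] by (rule s[OF that])
    then have "s x = (\<chi> k. det (\<chi> i j. if j = k then b x $ i else matrix (A x) $ i $ j) / det (matrix (A x)))"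
      unfolding cramer[OF det[OF that]] .
    then have "s x $ k = (\<chi> k. det (\<chi> i j. if j = k then b x $ i else matrix (A x) $ i $ j) / det (matrix (A x))) $ k"
      by (rule arg_cong)
    then show ?thesis unfolding vec_lambda_beta divide_inverse .
  qed
  have numerator: "Ck_on n U (\<lambda>x. det (\<chi> i j. if j = k then b x $ i else matrix (A x) $ i $ j))" for k
  proof (rule Ck_on_det[OF assms(1)])
    fix i j
    have eq: "(\<lambda>x. (\<chi> i j. if j = k then b x $ i else matrix (A x) $ i $ j) $ i $ j) =
        (if j = k then (\<lambda>x. b x $ i) else (\<lambda>x. matrix (A x) $ i $ j))"
      unfolding vec_lambda_beta by (cases "j = k") simp_all
    have "Ck_on n U (if j = k then (\<lambda>x. b x $ i) else (\<lambda>x. matrix (A x) $ i $ j))"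
      using Ck_on_vec_nth[OF assms(1) b, of i] entry[of i j] by (cases "j = k") simp_all
    then show "Ck_on n U (\<lambda>x. (\<chi> i j. if j = k then b x $ i else matrix (A x) $ i $ j) $ i $ j)"
      unfolding eq .
  qed
  have "Ck_on n U (\<lambda>x. inverse (det (matrix (A x))))"
    by (rule Ck_on_inverse[OF assms(1) det Ck_on_det[OF assms(1) entry]])
  note quotient = Ck_on_mult[OF assms(1) numerator this]
  have comp: "Ck_on n U (\<lambda>x. s x $ k)" for k
    by (rule Ck_on_cong[OF assms(1) _ quotient[of k]]) (rule sol[symmetric])
  show ?thesis
  proof (rule Ck_on_componentwise[OF assms(1)])
    fix c :: "real^'n" assume "c \<in> Basis"
    then obtain k where "c = axis k 1" by (auto simp: Basis_vec_def)
    then show "Ck_on n U (\<lambda>x. s x \<bullet> c)" using comp[of k] by (simp add: inner_axis)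
  qed
qed

lemma smooth_on_linear_solve:
  fixes A :: "'a::euclidean_space \<Rightarrow> real^'n \<Rightarrow> real^'n"
  assumes "open U" "\<And>x. x \<in> U \<Longrightarrow> linear (A x)" "\<And>x. x \<in> U \<Longrightarrow> inj (A x)"
    and "\<And>v. smooth_on U (\<lambda>x. A x v)" "smooth_on U b"
    and "\<And>x. x \<in> U \<Longrightarrow> A x (s x) = b x"
  shows "smooth_on U s"
  unfolding smooth_on_def
proof
  show "Ck_on n U s" for n
    by (rule Ck_on_linear_solve[of U A n b]) (use assms in \<open>auto simp: smooth_on_def\<close>)
qed

text \<open>The inverse function theorem yields \<open>G\<close> with a derivative
  \<open>g' y\<close> that solves a linear system with coefficients \<open>FD F (G y)\<close>. Once
  \<open>G\<close> is of class \<open>n\<close>, so are the coefficients, and by Cramer's rule so is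
  \<open>g'\<close>; hence \<open>G\<close> gains one order at each step of the induction.\<close>

lemma smooth_local_inverse:
  fixes F :: "real^'n \<Rightarrow> real^'n"
  assumes U: "open U" "x0 \<in> U" and F: "smooth_on U F" and id: "\<And>v. FD F x0 v = v"
  obtains U' W G where "open U'" "x0 \<in> U'" "U' \<subseteq> U" "open W" "homeomorphism U' W F G" "smooth_on W G"
proof -
  let ?f' = "\<lambda>x. Blinfun (FD F x)"
  have apply_f': "blinfun_apply (?f' x) = FD F x" if "x \<in> U" for x
    by (rule bounded_linear_Blinfun_apply)
      (use smooth_on_linear_FD[OF F that] in \<open>simp add: linear_conv_bounded_linear\<close>)
  have cont: "continuous_on U ?f'"
  proof (rule continuous_on_blinfun_componentwise)
    fix i :: "real^'n"
    show "continuous_on U (\<lambda>x. blinfun_apply (?f' x) i)"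
      using smooth_on_imp_continuous_on[OF smooth_on_FD[OF F, of i]] by (simp add: apply_f' cong: continuous_on_cong)
  qed
  obtain U' W G g' where *: "open U'" "U' \<subseteq> U" "x0 \<in> U'" "open W" "homeomorphism U' W F G"
    "\<And>y. y \<in> W \<Longrightarrow> (G has_derivative g' y) (at y)"
    "\<And>y. y \<in> W \<Longrightarrow> g' y = inv (blinfun_apply (?f' (G y)))"
    "\<And>y. y \<in> W \<Longrightarrow> bij (blinfun_apply (?f' (G y)))"
  proof (rule inverse_function_theorem[OF U(1) _ cont U(2), of F "id_blinfun"])
    show "(F has_derivative blinfun_apply (?f' x)) (at x)" if "x \<in> U" for x
      using smooth_on_has_derivative[OF F that] apply_f'[OF that] by simp
    show "id_blinfun o\<^sub>L ?f' x0 = id_blinfun"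
      by (rule blinfun_eqI) (simp add: apply_f'[OF U(2)] id)
  qed blast
  have GU: "G y \<in> U" if "y \<in> W" for y
    using *(2,5) that by (auto simp: homeomorphism_def)
  have bij: "bij (FD F (G y))" if "y \<in> W" for y
    using *(8)[OF that] apply_f'[OF GU[OF that]] by simp
  have solves: "FD F (G y) (g' y v) = v" if "y \<in> W" for y v
    using *(7)[OF that] apply_f'[OF GU[OF that]] bij[OF that] by (simp add: bij_is_surj surj_f_inv_f)
  have "Ck_on n W G" for n
  proof (induction n)
    case 0
    then show ?case using *(5) by (simp add: homeomorphism_def)
  next
    case (Suc n)
    show ?case
    proof (rule Ck_on_SucI[OF *(4,6)])
      fix v
      show "Ck_on n W (\<lambda>x. g' x v)"
      proof (rule Ck_on_linear_solve[OF *(4), of "\<lambda>y. FD F (G y)" n "\<lambda>_. v"])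
        show "linear (FD F (G y))" if "y \<in> W" for y
          using smooth_on_linear_FD[OF F GU[OF that]] .
        show "inj (FD F (G y))" if "y \<in> W" for y
          using bij[OF that] by (rule bij_is_inj)
        show "Ck_on n W (\<lambda>y. FD F (G y) v)" for v
          using smooth_on_FD[OF F] GU
          by (intro Ck_on_compose[OF *(4) U(1) _ _ Suc.IH]) (auto simp: smooth_on_def)
      qed (auto simp: solves Ck_on_const)
    qed
  qed
  then have "smooth_on W G" by (simp add: smooth_on_def)
  with * that show ?thesis by blast
qed

text \<open>The map \<open>p \<mapsto> \<psi> (A p) + p - L (A p)\<close>, with \<open>L\<close> the derivative of \<open>\<psi>\<close> and \<open>A\<close> a linear left inverse of \<open>L\<close>,
  extends \<open>\<psi>\<close> from the image of \<open>L\<close> to a local diffeomorphism.\<close>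

lemma immersion_local_left_inverse:
  fixes \<psi> :: "'d::euclidean_space \<Rightarrow> real^'n"
  assumes V: "open V" "y0 \<in> V" and \<psi>: "smooth_on V \<psi>" and inj: "inj (FD \<psi> y0)"
  obtains W V' r where "open W" "open V'" "y0 \<in> V'" "V' \<subseteq> V" "smooth_on W r"
    "\<psi> ` V' \<subseteq> W" "r ` W \<subseteq> V'" "\<And>y. y \<in> V' \<Longrightarrow> r (\<psi> y) = y"
proof -
  define L where "L = FD \<psi> y0"
  have L: "linear L" unfolding L_def using smooth_on_linear_FD[OF \<psi> V(2)] .
  obtain A where A: "linear A" "A \<circ> L = id"
    using linear_injective_left_inverse[OF L] inj by (auto simp: L_def)
  have AL: "A (L v) = v" for v using A(2) by (metis comp_apply id_apply)
  define F where "F p = \<psi> (A p) + (p - L (A p))" for p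
  define U where "U = A -` V"
  have contA: "continuous_on S A" for S by (rule linear_continuous_on) (use A linear_conv_bounded_linear in blast)
  have contL: "continuous_on S L" for S by (rule linear_continuous_on) (use L linear_conv_bounded_linear in blast)
  have U: "open U" "L y0 \<in> U"
    using V contA by (auto simp: U_def AL intro: open_vimage)
  have F: "smooth_on U F"
    unfolding F_def[abs_def]
    by (intro smooth_on_add smooth_on_diff smooth_on_ident U smooth_on_linear_compose[OF U(1) L]
        smooth_on_linear A(1) smooth_on_compose[OF U(1) V(1) _ \<psi>]) (auto simp: U_def)
  have bl: "bounded_linear A" "bounded_linear L" using A(1) L linear_conv_bounded_linear by blast+
  \<comment> \<open>The two terms \<open>L (A v)\<close> cancel, so the derivative at
    \<open>L y0\<close> is the identity, as \<open>smooth_local_inverse\<close> demands.\<close>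
  have "(F has_derivative (\<lambda>v. L (A v) + (v - L (A v)))) (at (L y0))"
    unfolding F_def[abs_def]
    using has_derivative_compose[OF bounded_linear.has_derivative[OF bl(1) has_derivative_ident],
        of \<psi> L "L y0" UNIV] smooth_on_has_derivative[OF \<psi> V(2)]
    unfolding AL L_def[symmetric]
    by (intro has_derivative_add has_derivative_diff has_derivative_ident
        bounded_linear.has_derivative[OF bl(2)] bounded_linear.has_derivative[OF bl(1)]) (simp add: AL)
  then have "FD F (L y0) v = v" for v by (simp add: FD_eqI)
  from smooth_local_inverse[OF U F this] obtain U' W G where
    *: "open U'" "L y0 \<in> U'" "U' \<subseteq> U" "open W" "homeomorphism U' W F G" "smooth_on W G" by blast
  define V' where "V' = V \<inter> L -` U'"
  have V': "open V'" "y0 \<in> V'" "V' \<subseteq> V"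
    using V *(1,2) contL by (auto simp: V'_def intro!: open_Int open_vimage)
  \<comment> \<open>Shrinking \<open>W\<close> to the preimage of \<open>V'\<close> makes the left
    inverse \<open>A \<circ> G\<close> take all its values in \<open>V'\<close>.\<close>
  define W' where "W' = W \<inter> (\<lambda>q. A (G q)) -` V'"
  have AG: "smooth_on W (\<lambda>q. A (G q))"
    by (rule smooth_on_linear_compose[OF *(4) A(1) *(6)])
  have F_L: "F (L y) = \<psi> y" for y by (simp add: F_def AL)
  have \<psi>W: "\<psi> y \<in> W" "A (G (\<psi> y)) = y" if "y \<in> V'" for y
  proof -
    have "F (L y) \<in> W" "G (F (L y)) = L y"
      using that *(5) by (auto simp: V'_def homeomorphism_def)
    then show "\<psi> y \<in> W" "A (G (\<psi> y)) = y" by (simp_all add: F_L AL)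
  qed
  show ?thesis
  proof
    show "open W'"
      unfolding W'_def using smooth_on_imp_continuous_on[OF AG] *(4) V'(1)
      by (simp add: continuous_on_open_vimage Int_commute)
    show "smooth_on W' (\<lambda>q. A (G q))" by (rule smooth_on_subset[OF AG]) (simp add: W'_def)
  qed (use V' \<psi>W in \<open>auto simp: W'_def\<close>)
qed

subsection \<open>Alternating forms\<close>

lemma length_del_nth: "i < length vs \<Longrightarrow> length (del_nth i vs) = length vs - 1"
  by (auto simp: del_nth_def)

lemma nth_del_nth: "i < length vs \<Longrightarrow> k < length vs - 1 \<Longrightarrow> del_nth i vs ! k = (if k < i then vs ! k else vs ! Suc k)"
  by (auto simp: del_nth_def nth_append)

lemma map_del_nth: "map f (del_nth i vs) = del_nth i (map f vs)"
  by (simp add: del_nth_def take_map drop_map)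

lemma del_nth_append: "length xs = i \<Longrightarrow> del_nth i (xs @ a # ys) = xs @ ys"
  by (auto simp: del_nth_def)

lemma del_nth_append_append:
  "length xs = i \<Longrightarrow> j = Suc (i + length ys) \<Longrightarrow> del_nth j (xs @ a # ys @ b # zs) = xs @ a # ys @ zs"
  using del_nth_append[of "xs @ a # ys" j b zs] by simp

lemma del_nth_update_same: "i < length vs \<Longrightarrow> del_nth i (vs[i := v]) = del_nth i vs"
  by (rule nth_equalityI) (auto simp: length_del_nth nth_del_nth)

lemma del_nth_update_other:
  "i < length vs \<Longrightarrow> m < length vs \<Longrightarrow> m \<noteq> i \<Longrightarrow>
   del_nth i (vs[m := v]) = (del_nth i vs)[(if m < i then m else m - 1) := v]"
  by (rule nth_equalityI) (auto simp: length_del_nth nth_del_nth nth_list_update)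

lemma list_split_two:
  assumes "i < j" "j < length vs"
  obtains xs ys zs where "vs = xs @ vs ! i # ys @ vs ! j # zs" "length xs = i" "j = Suc (i + length ys)"
proof
  have "drop (Suc i) vs = take (j - Suc i) (drop (Suc i) vs) @ vs ! j # drop (Suc j) vs"
    using id_take_nth_drop[of "j - Suc i" "drop (Suc i) vs"] assms by simp
  then show "vs = take i vs @ vs ! i # take (j - Suc i) (drop (Suc i) vs) @ vs ! j # drop (Suc j) vs"
    using id_take_nth_drop[of i vs] assms by simp
qed (use assms in auto)

lemma alt_multilinear_length: "alt_multilinear p w \<Longrightarrow> length vs \<noteq> p \<Longrightarrow> w vs = 0"
  by (simp add: alt_multilinear_def)

lemma alt_multilinear_linear:
  "alt_multilinear p w \<Longrightarrow> length vs = p \<Longrightarrow> i < p \<Longrightarrow> linear (\<lambda>v. w (vs[i := v]))"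
  by (simp add: alt_multilinear_def)

lemma alt_multilinear_repeat:
  "alt_multilinear p w \<Longrightarrow> i < j \<Longrightarrow> j < length vs \<Longrightarrow> vs ! i = vs ! j \<Longrightarrow> w vs = 0"
  unfolding alt_multilinear_def by (cases "length vs = p") blast+

lemma alt_multilinear_linear_append:
  assumes "alt_multilinear p w" "length xs + length ys + 1 = p"
  shows "linear (\<lambda>v. w (xs @ v # ys))"
  using alt_multilinear_linear[OF assms(1), of "xs @ undefined # ys" "length xs"] assms(2)
  by (simp add: list_update_append)

lemma alt_multilinear_repeat_append:
  "alt_multilinear p w \<Longrightarrow> w (xs @ a # ys @ a # zs) = 0"
  by (rule alt_multilinear_repeat[of p w "length xs" "Suc (length xs + length ys)"]) (auto simp: nth_append)

text \<open>Polarisation: the value with \<open>a + b\<close> in both slots vanishes, and so do two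
  of the four terms of its expansion.\<close>

lemma alt_multilinear_swap_append:
  assumes w: "alt_multilinear p w"
  shows "w (xs @ b # ys @ a # zs) = - w (xs @ a # ys @ b # zs)"
proof (cases "length xs + length ys + length zs + 2 = p")
  case True
  have l1: "linear (\<lambda>v. w (xs @ v # ys @ c # zs))" for c
    using alt_multilinear_linear_append[OF w, of xs "ys @ c # zs"] True by simp
  have l2: "linear (\<lambda>v. w (xs @ c # ys @ v # zs))" for c
    using alt_multilinear_linear_append[OF w, of "xs @ c # ys" zs] True by simp
  have "0 = w (xs @ (a + b) # ys @ (a + b) # zs)"
    by (simp add: alt_multilinear_repeat_append[OF w])
  also have "\<dots> = w (xs @ a # ys @ a # zs) + w (xs @ a # ys @ b # zs) + w (xs @ b # ys @ a # zs) + w (xs @ b # ys @ b # zs)"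
    using linear_add[OF l1] linear_add[OF l2] by simp
  finally show ?thesis by (simp add: alt_multilinear_repeat_append[OF w])
qed (simp add: alt_multilinear_length[OF w])

lemma alt_multilinear_move:
  assumes w: "alt_multilinear p w"
  shows "w (xs @ ys @ q # zs) = (-1) ^ length ys * w (xs @ q # ys @ zs)"
proof (induction ys arbitrary: xs)
  case (Cons y ys)
  show ?case
    using Cons[of "xs @ [y]"] alt_multilinear_swap_append[OF w, of xs y "[]" q "ys @ zs"] by simp
qed simp

lemma alt_multilinear_swap:
  assumes w: "alt_multilinear p w" and ij: "i < j" "j < length vs"
  shows "w (vs[i := vs ! j, j := vs ! i]) = - w vs"
proof -
  obtain xs ys zs where *: "vs = xs @ vs ! i # ys @ vs ! j # zs" "length xs = i" "j = Suc (i + length ys)"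
    by (rule list_split_two[OF ij])
  have "vs[i := c, j := d] = xs @ c # ys @ d # zs" for c d
    by (subst *(1)) (simp add: *(2,3) list_update_append)
  then show ?thesis
    using alt_multilinear_swap_append[OF w, of xs "vs ! j" ys "vs ! i" zs] *(1) by simp
qed

lemma alt_multilinear_map:
  assumes "alt_multilinear p w" "linear L"
  shows "alt_multilinear p (\<lambda>vs. w (map L vs))"
  unfolding alt_multilinear_def
proof (intro conjI allI impI)
  show "linear (\<lambda>v. w (map L (vs[i := v])))" if "length vs = p \<and> i < p" for vs :: "'b list" and i
    using linear_compose[OF assms(2) alt_multilinear_linear[OF assms(1), of "map L vs" i]] that
    by (simp add: map_update o_def)
  show "w (map L vs) = 0" if "length vs = p \<and> i < j \<and> j < p \<and> vs ! i = vs ! j" for vs :: "'b list" and i j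
    by (rule alt_multilinear_repeat[OF assms(1), of i j]) (use that in auto)
qed (simp add: alt_multilinear_length[OF assms(1)])

lemma alt_multilinear_cmult:
  assumes "alt_multilinear p w"
  shows "alt_multilinear p (\<lambda>vs. c * w vs)"
  unfolding alt_multilinear_def
proof (intro conjI allI impI)
  show "linear (\<lambda>v. c * w (vs[i := v]))" if "length vs = p \<and> i < p" for vs :: "'a list" and i
    using linear_compose_scale_right[OF alt_multilinear_linear[OF assms, of vs i], of c] that by simp
  show "c * w vs = 0" if "length vs = p \<and> i < j \<and> j < p \<and> vs ! i = vs ! j" for vs :: "'a list" and i j
    using alt_multilinear_repeat[OF assms, of i j vs] that by simp
qed (simp add: alt_multilinear_length[OF assms])

lemma alt_multilinear_add:
  "alt_multilinear p w \<Longrightarrow> alt_multilinear p w' \<Longrightarrow> alt_multilinear p (\<lambda>vs. w vs + w' vs)"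
  unfolding alt_multilinear_def by (auto intro: linear_compose_add)

lemma alt_multilinear_diff:
  "alt_multilinear p w \<Longrightarrow> alt_multilinear p w' \<Longrightarrow> alt_multilinear p (\<lambda>vs. w vs - w' vs)"
  unfolding alt_multilinear_def by (auto intro: linear_compose_sub)

text \<open>Serves both for the exterior derivative, where \<open>\<Theta> v\<close> is the
  derivative in the direction \<open>v\<close>, and for the wedge product with a 1-form, where
  \<open>\<Theta> v\<close> is a multiple of one form. When two arguments coincide, only the two
  terms that omit one of them survive; moving the remaining copy across the entries in between gives
  them opposite signs.\<close>

lemma alt_multilinear_wedge:
  fixes \<Theta> :: "'e::real_vector \<Rightarrow> 'e list \<Rightarrow> real"
  assumes alt: "\<And>v. alt_multilinear p (\<Theta> v)" and lin: "\<And>vs. length vs = p \<Longrightarrow> linear (\<lambda>v. \<Theta> v vs)"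
  shows "alt_multilinear (Suc p) (\<lambda>vs. \<Sum>i<length vs. (-1) ^ i * \<Theta> (vs ! i) (del_nth i vs))"
  unfolding alt_multilinear_def
proof (intro conjI allI impI)
  fix vs :: "'e list" assume "length vs \<noteq> Suc p"
  then show "(\<Sum>i<length vs. (-1) ^ i * \<Theta> (vs ! i) (del_nth i vs)) = 0"
    by (intro sum.neutral ballI) (auto simp: length_del_nth alt_multilinear_length[OF alt])
next
  fix vs :: "'e list" and m assume a: "length vs = Suc p \<and> m < Suc p"
  have "linear (\<lambda>v. \<Theta> (vs[m := v] ! i) (del_nth i (vs[m := v])))" if "i < Suc p" for i
  proof (cases "i = m")
    case True
    then show ?thesis using a lin[of "del_nth m vs"] by (simp add: del_nth_update_same length_del_nth)
  next
    case False
    then show ?thesis using a that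
      by (auto simp: del_nth_update_other length_del_nth intro!: alt_multilinear_linear[OF alt])
  qed
  then have "linear (\<lambda>v. \<Sum>i<Suc p. (-1) ^ i * \<Theta> (vs[m := v] ! i) (del_nth i (vs[m := v])))"
    by (intro linear_compose_sum ballI linear_compose_scale_right[where 'b=real, unfolded real_scaleR_def]) auto
  then show "linear (\<lambda>v. \<Sum>i<length (vs[m := v]). (-1) ^ i * \<Theta> (vs[m := v] ! i) (del_nth i (vs[m := v])))"
    using a by simp
next
  fix vs :: "'e list" and i j assume a: "length vs = Suc p \<and> i < j \<and> j < Suc p \<and> vs ! i = vs ! j"
  let ?T = "\<lambda>l. (-1) ^ l * \<Theta> (vs ! l) (del_nth l vs)"
  have "?T l = 0" if "l < Suc p" "l \<noteq> i" "l \<noteq> j" for l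
  proof -
    have "\<Theta> (vs ! l) (del_nth l vs) = 0"
      by (rule alt_multilinear_repeat[OF alt, of "if i < l then i else i - 1" "if j < l then j else j - 1"])
        (use a that in \<open>auto simp: nth_del_nth length_del_nth\<close>)
    then show ?thesis by simp
  qed
  then have "(\<Sum>l<length vs. ?T l) = (\<Sum>l\<in>{i, j}. ?T l)"
    using a by (intro sum.mono_neutral_right) auto
  also have "\<dots> = ?T i + ?T j" using a by simp
  also have "\<dots> = 0"
  proof -
    obtain xs ys zs where *: "vs = xs @ vs ! i # ys @ vs ! j # zs" "length xs = i" "j = Suc (i + length ys)"
      by (rule list_split_two[of i j vs]) (use a in auto)
    have "del_nth i vs = xs @ ys @ vs ! j # zs" "del_nth j vs = xs @ vs ! i # ys @ zs"
      using trans[OF arg_cong[OF *(1), of "del_nth i"] del_nth_append[OF *(2)]]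
        trans[OF arg_cong[OF *(1), of "del_nth j"] del_nth_append_append[OF *(2,3)]] by blast+
    then show ?thesis
      using a *(3) alt_multilinear_move[OF alt, of "vs ! j" xs ys "vs ! j" zs] by (simp add: power_add)
  qed
  finally show "(\<Sum>l<length vs. ?T l) = 0" .
qed

text \<open>This is the sum over the arguments in the coordinate formula of the Lie derivative. If
  two arguments coincide, the two surviving terms arise from each other by a swap and
  cancel.\<close>

lemma alt_multilinear_derivation:
  assumes w: "alt_multilinear p w" and A: "linear A"
  shows "alt_multilinear p (\<lambda>vs. \<Sum>i<length vs. w (vs[i := A (vs ! i)]))"
  unfolding alt_multilinear_def
proof (intro conjI allI impI)
  fix vs :: "'a list" and m assume a: "length vs = p \<and> m < p"
  have "linear (\<lambda>v. w ((vs[m := v])[i := A (vs[m := v] ! i)]))" if "i < p" for i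
  proof (cases "i = m")
    case True
    then show ?thesis
      using linear_compose[OF A alt_multilinear_linear[OF w, of vs m]] a by (simp add: o_def)
  next
    case False
    then show ?thesis
      using alt_multilinear_linear[OF w, of "vs[i := A (vs ! i)]" m] a by (simp add: list_update_swap)
  qed
  then show "linear (\<lambda>v. \<Sum>i<length (vs[m := v]). w ((vs[m := v])[i := A (vs[m := v] ! i)]))"
    using a by (auto intro!: linear_compose_sum)
next
  fix vs :: "'a list" and i j assume a: "length vs = p \<and> i < j \<and> j < p \<and> vs ! i = vs ! j"
  let ?T = "\<lambda>l. w (vs[l := A (vs ! l)])"
  have "?T l = 0" if "l < p" "l \<noteq> i" "l \<noteq> j" for l
    by (rule alt_multilinear_repeat[OF w, of i j]) (use a that in auto)
  then have "(\<Sum>l<length vs. ?T l) = (\<Sum>l\<in>{i, j}. ?T l)"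
    using a by (intro sum.mono_neutral_right) auto
  also have "\<dots> = ?T i + ?T j" using a by simp
  also have "?T j = w ((vs[i := A (vs ! i)])[i := vs[i := A (vs ! i)] ! j, j := vs[i := A (vs ! i)] ! i])"
    using a by (intro arg_cong[where f=w] nth_equalityI) (auto simp: nth_list_update)
  also have "\<dots> = - ?T i"
    by (rule alt_multilinear_swap[OF w]) (use a in auto)
  finally show "(\<Sum>l<length vs. ?T l) = 0" by simp
qed (auto simp: alt_multilinear_length[OF w] intro: sum.neutral)

lemma alt_multilinear_expand:
  fixes w :: "'e::euclidean_space list \<Rightarrow> real"
  assumes "alt_multilinear p w" "length vs = p" "i < p"
  shows "w (vs[i := v]) = (\<Sum>b\<in>Basis. (v \<bullet> b) * w (vs[i := b]))"
  using linear_basis_expansion[OF alt_multilinear_linear[OF assms], of v] by simp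

subsection \<open>Forms of top degree\<close>

lemma basis_list: "distinct (basis_list :: 'e::euclidean_space list)" "set (basis_list :: 'e list) = Basis"
proof -
  have "\<exists>bs :: 'e list. distinct bs \<and> set bs = Basis"
    using finite_distinct_list[OF finite_Basis] by blast
  from someI_ex[OF this] show "distinct (basis_list :: 'e list)" "set (basis_list :: 'e list) = Basis"
    by (simp_all add: basis_list_def)
qed

lemma length_basis_list: "length (basis_list :: 'e::euclidean_space list) = DIM('e)"
  using distinct_card[OF basis_list(1)[where 'e='e]] by (simp add: basis_list(2))

lemma basis_list_in_Basis: "i < DIM('e) \<Longrightarrow> basis_list ! i \<in> (Basis :: 'e::euclidean_space set)"
  using basis_list(2) length_basis_list by (metis nth_mem)

lemma basis_list_inner:
  "i < DIM('e) \<Longrightarrow> j < DIM('e) \<Longrightarrow> (basis_list ! i :: 'e::euclidean_space) \<bullet> basis_list ! j = (if i = j then 1 else 0)"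
  using basis_list(1)[where 'e='e] basis_list_in_Basis[where 'e='e]
  by (auto simp: inner_Basis nth_eq_iff_index_eq length_basis_list)

lemma sum_Basis_conv_basis_list:
  "(\<Sum>b\<in>(Basis :: 'e::euclidean_space set). f b) = (\<Sum>i<DIM('e). f (basis_list ! i))"
  using sum_list_distinct_conv_sum_set[OF basis_list(1), of f] basis_list(2)[where 'e='e]
  by (simp add: sum_list_sum_nth length_basis_list atLeast0LessThan)

text \<open>Sorting by transpositions: the downward induction treats lists that agree with
  \<open>basis_list\<close> in the first \<open>m\<close> places, and one swap brings the right
  vector to place \<open>m\<close>. Signs need no record because the value to be reached is
  0.\<close>

lemma alt_multilinear_basis_permutation:
  fixes w :: "'e::euclidean_space list \<Rightarrow> real"
  assumes w: "alt_multilinear DIM('e) w" and 0: "w basis_list = 0"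
    and "distinct vs" "set vs = Basis"
  shows "w vs = 0"
proof -
  let ?n = "DIM('e)"
  have "\<forall>vs. distinct vs \<and> set vs = Basis \<and> (\<forall>i<m. vs ! i = basis_list ! i) \<longrightarrow> w vs = 0" if "m \<le> ?n" for m
    using that
  proof (induction m rule: inc_induct)
    case base
    have "vs = basis_list" if "distinct vs" "set vs = (Basis :: 'e set)" "\<forall>i<?n. vs ! i = basis_list ! i" for vs
      by (rule nth_equalityI) (use that distinct_card[OF that(1)] in \<open>auto simp: length_basis_list\<close>)
    then show ?case using 0 by auto
  next
    case (step m)
    show ?case
    proof (intro allI impI, elim conjE)
      fix vs :: "'e list" assume vs: "distinct vs" "set vs = Basis" "\<forall>i<m. vs ! i = basis_list ! i"
      have len: "length vs = ?n" using distinct_card[OF vs(1)] vs(2) by simp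
      obtain j where j: "j < ?n" "vs ! j = basis_list ! m"
        using basis_list_in_Basis[where 'e='e, OF step(2)] vs(2) len by (metis in_set_conv_nth)
      have "\<not> j < m"
      proof
        assume "j < m"
        then have "basis_list ! m = (basis_list ! j :: 'e)" using vs(3) j by simp
        then show False using \<open>j < m\<close> step(2) basis_list(1)[where 'e='e] j(1)
          by (simp add: nth_eq_iff_index_eq length_basis_list)
      qed
      show "w vs = 0"
      proof (cases "j = m")
        case True
        then have "\<forall>i<Suc m. vs ! i = basis_list ! i" using vs(3) j less_Suc_eq by auto
        then show ?thesis using step.IH vs by blast
      next
        case False
        then have mj: "m < j" using \<open>\<not> j < m\<close> by simp
        let ?vs = "vs[m := vs ! j, j := vs ! m]"
        have "w ?vs = 0"
        proof (rule step.IH[rule_format], intro conjI allI impI)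
          show "distinct ?vs" using vs(1) mj j(1) len by (simp add: distinct_swap)
          show "set ?vs = Basis" using vs(2) mj j(1) len by (simp add: set_swap)
          show "?vs ! i = basis_list ! i" if "i < Suc m" for i
            using that vs(3) j mj len by (cases "i = m") (auto simp: nth_list_update)
        qed
        then show ?thesis using alt_multilinear_swap[OF w mj, of vs] j(1) len by simp
      qed
    qed
  qed
  from this[of 0] show ?thesis using assms by simp
qed

text \<open>A top form is determined by one value. In the induction \<open>m\<close> counts the
  leading arguments that are still arbitrary; for \<open>m = 0\<close> all arguments are basis
  vectors, and the list is either a permutation of \<open>Basis\<close> or has a repetition.\<close>

lemma alt_multilinear_top_zero:
  fixes w :: "'e::euclidean_space list \<Rightarrow> real"
  assumes w: "alt_multilinear DIM('e) w" and 0: "w basis_list = 0"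
  shows "w vs = 0"
proof -
  let ?n = "DIM('e)"
  have "\<forall>vs. length vs = ?n \<and> (\<forall>i. m \<le> i \<and> i < ?n \<longrightarrow> vs ! i \<in> Basis) \<longrightarrow> w vs = 0" if "m \<le> ?n" for m
    using that
  proof (induction m)
    case 0
    show ?case
    proof (intro allI impI, elim conjE)
      fix vs :: "'e list" assume vs: "length vs = ?n" "\<forall>i. 0 \<le> i \<and> i < ?n \<longrightarrow> vs ! i \<in> Basis"
      show "w vs = 0"
      proof (cases "distinct vs")
        case True
        have "set vs \<subseteq> Basis" using vs by (auto simp: in_set_conv_nth)
        moreover have "card (set vs) = card (Basis :: 'e set)" using distinct_card[OF True] vs by simp
        ultimately have "set vs = Basis" by (intro card_subset_eq) auto
        then show ?thesis by (rule alt_multilinear_basis_permutation[OF w assms(2) True])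
      next
        case False
        then obtain i j where "i < j" "j < length vs" "vs ! i = vs ! j"
          by (metis distinct_conv_nth linorder_neqE_nat)
        then show ?thesis by (rule alt_multilinear_repeat[OF w])
      qed
    qed
  next
    case (Suc m)
    show ?case
    proof (intro allI impI, elim conjE)
      fix vs :: "'e list" assume vs: "length vs = ?n" "\<forall>i. Suc m \<le> i \<and> i < ?n \<longrightarrow> vs ! i \<in> Basis"
      have "w vs = w (vs[m := vs ! m])" by simp
      also have "\<dots> = (\<Sum>b\<in>Basis. (vs ! m \<bullet> b) * w (vs[m := b]))"
        by (rule alt_multilinear_expand[OF w vs(1)]) (use Suc.prems in simp)
      also have "\<dots> = 0"
      proof (rule sum.neutral, rule ballI)
        fix b :: 'e assume "b \<in> Basis"
        then have "w (vs[m := b]) = 0"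
          using Suc vs by (auto simp: nth_list_update)
        then show "(vs ! m \<bullet> b) * w (vs[m := b]) = 0" by simp
      qed
      finally show "w vs = 0" .
    qed
  qed
  from this[of ?n] show ?thesis
    using alt_multilinear_length[OF w] by (cases "length vs = ?n") auto
qed

lemma alt_multilinear_top_eqI:
  fixes w w' :: "'e::euclidean_space list \<Rightarrow> real"
  assumes "alt_multilinear DIM('e) w" "alt_multilinear DIM('e) w'" "w basis_list = w' basis_list"
  shows "w = w'"
proof
  show "w vs = w' vs" for vs
    using alt_multilinear_top_zero[OF alt_multilinear_diff[OF assms(1,2)], of vs] assms(3) by simp
qed

text \<open>In the expansion of \<open>v\<close> every basis vector other than the replaced one
  already occurs in the list, so its term vanishes.\<close>

lemma alt_multilinear_top_update:
  fixes w :: "'e::euclidean_space list \<Rightarrow> real"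
  assumes w: "alt_multilinear DIM('e) w" and i: "i < DIM('e)"
  shows "w (basis_list[i := v]) = (v \<bullet> basis_list ! i) * w basis_list"
proof -
  have "w (basis_list[i := v]) = (\<Sum>j<DIM('e). (v \<bullet> basis_list ! j) * w (basis_list[i := basis_list ! j]))"
    using alt_multilinear_expand[OF w length_basis_list i, of v] by (simp add: sum_Basis_conv_basis_list)
  also have "\<dots> = (\<Sum>j\<in>{i}. (v \<bullet> basis_list ! j) * w (basis_list[i := basis_list ! j]))"
  proof (rule sum.mono_neutral_right)
    show "\<forall>j\<in>{..<DIM('e)} - {i}. (v \<bullet> basis_list ! j) * w (basis_list[i := basis_list ! j]) = 0"
    proof
      fix j assume j: "j \<in> {..<DIM('e)} - {i}"
      have "w (basis_list[i := basis_list ! j]) = 0"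
        by (rule alt_multilinear_repeat[OF w, of "min i j" "max i j"])
          (use i j in \<open>auto simp: length_basis_list min_def max_def\<close>)
      then show "(v \<bullet> basis_list ! j) * w (basis_list[i := basis_list ! j]) = 0" by simp
    qed
  qed (use i in auto)
  finally show ?thesis by simp
qed

text \<open>Ties abstract alternating forms to the determinant of matrices.
  \<open>basis_list\<close> enumerates \<open>Basis\<close> in an order that is chosen without
  regard to the index type, so \<open>pos\<close> looks up the position of each axis vector.\<close>

lemma det_form_exists:
  "\<exists>D :: (real^'k) list \<Rightarrow> real. alt_multilinear CARD('k) D \<and> D basis_list = 1 \<and>
    (\<forall>L. D (map L basis_list) = det (matrix L))"
proof -
  define pos where "pos i = (SOME m. m < CARD('k) \<and> basis_list ! m = (axis i 1 :: real^'k))" for i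
  have pos: "pos i < CARD('k)" "basis_list ! pos i = (axis i 1 :: real^'k)" for i
  proof -
    have "axis i 1 \<in> set (basis_list :: (real^'k) list)" by (simp add: basis_list)
    then have "\<exists>m. m < CARD('k) \<and> basis_list ! m = (axis i 1 :: real^'k)"
      by (auto simp: in_set_conv_nth length_basis_list)
    from someI_ex[OF this] show "pos i < CARD('k)" "basis_list ! pos i = (axis i 1 :: real^'k)"
      by (simp_all add: pos_def)
  qed
  have "inj pos"
  proof (rule injI)
    fix i j assume "pos i = pos j"
    then have "axis i (1::real) = axis j 1" using pos(2) by metis
    then show "i = j" by (simp add: axis_eq_axis)
  qed
  then have pos_surj: "\<exists>i. pos i = m" if "m < CARD('k)" for m
  proof -
    have "pos ` UNIV = {..<CARD('k)}"
      by (rule card_subset_eq) (use pos(1) card_image[OF \<open>inj pos\<close>] in auto)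
    then show ?thesis using that by (metis imageE lessThan_iff)
  qed
  define D where "D vs = (if length vs = CARD('k) then det (\<chi> i. vs ! pos i) else 0)" for vs :: "(real^'k) list"
  have D: "alt_multilinear CARD('k) D"
    unfolding alt_multilinear_def
  proof (intro conjI allI impI)
    fix vs :: "(real^'k) list" and m assume a: "length vs = CARD('k) \<and> m < CARD('k)"
    obtain i0 where i0: "pos i0 = m" using pos_surj a by blast
    have eq: "D (vs[m := v]) = det (\<chi> i. if i = i0 then v else vs ! pos i)" for v
    proof -
      have "(\<chi> i. vs[m := v] ! pos i) = (\<chi> i. if i = i0 then v else vs ! pos i)"
        using a i0 \<open>inj pos\<close> by (auto simp: vec_eq_iff nth_list_update inj_eq)
      then show ?thesis using a by (simp add: D_def)
    qed
    show "linear (\<lambda>v. D (vs[m := v]))"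
      unfolding eq
    proof (rule linearI)
      show "det (\<chi> i. if i = i0 then r *\<^sub>R b else vs ! pos i) = r *\<^sub>R det (\<chi> i. if i = i0 then b else vs ! pos i)" for r b
        using det_row_mul[of i0 r "\<lambda>_. b" "\<lambda>i. vs ! pos i"] unfolding scalar_mult_eq_scaleR real_scaleR_def .
      show "det (\<chi> i. if i = i0 then b1 + b2 else vs ! pos i) =
          det (\<chi> i. if i = i0 then b1 else vs ! pos i) + det (\<chi> i. if i = i0 then b2 else vs ! pos i)" for b1 b2
        by (rule det_row_add)
    qed
  next
    fix vs :: "(real^'k) list" and i j assume a: "length vs = CARD('k) \<and> i < j \<and> j < CARD('k) \<and> vs ! i = vs ! j"
    obtain i0 j0 where ij: "pos i0 = i" "pos j0 = j" using pos_surj a by (meson less_trans)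
    show "D vs = 0"
      using a ij by (auto simp: D_def row_def vec_eq_iff intro!: det_identical_rows[of i0 j0])
  qed (simp add: D_def)
  have D1: "D basis_list = 1"
  proof -
    have "(\<chi> i. basis_list ! pos i) = (mat 1 :: real^'k^'k)" by (simp add: pos(2) mat_def axis_def vec_eq_iff)
    then show ?thesis by (simp add: D_def length_basis_list)
  qed
  have DL: "D (map L basis_list) = det (matrix L)" for L
  proof -
    \<comment> \<open>The images of the axis vectors are the rows here but the columns of
      \<open>matrix L\<close>; the determinant is the same for the transpose.\<close>
    have "(\<chi> i. map L basis_list ! pos i) = transpose (matrix L)"
      by (simp add: pos length_basis_list vec_eq_iff transpose_def matrix_def)
    then show ?thesis by (simp add: D_def length_basis_list)
  qed
  show ?thesis using D D1 DL by blast
qed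

text \<open>By the uniqueness of top forms, \<open>w\<close> is \<open>w basis_list\<close> times
  the determinant form, whose value on \<open>map L basis_list\<close> is known.\<close>

lemma alt_multilinear_top_det:
  fixes w :: "(real^'k) list \<Rightarrow> real"
  assumes w: "alt_multilinear CARD('k) w" and L: "linear L"
  shows "w (map L basis_list) = det (matrix L) * w basis_list"
proof -
  obtain D :: "(real^'k) list \<Rightarrow> real" where D: "alt_multilinear CARD('k) D"
    and D1: "D basis_list = 1" and DL: "\<And>L. D (map L basis_list) = det (matrix L)"
    using det_form_exists by blast
  have "alt_multilinear DIM(real^'k) (\<lambda>vs. w vs - w basis_list * D vs)"
    using alt_multilinear_diff[OF w alt_multilinear_cmult[OF D]] by simp
  then have "w (map L basis_list) - w basis_list * D (map L basis_list) = 0"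
    by (rule alt_multilinear_top_zero[of "\<lambda>vs. w vs - w basis_list * D vs"]) (simp_all add: D1)
  then have "w (map L basis_list) = w basis_list * D (map L basis_list)" by simp
  then show ?thesis by (simp add: DL)
qed

subsection \<open>The exterior derivative in coordinates\<close>

text \<open>The coordinate expression inside \<open>ext_d\<close>, isolated so that its behaviour
  under changes of coordinates can be studied in Euclidean space.\<close>

definition dform :: "('e::euclidean_space, 'e) form \<Rightarrow> ('e, 'e) form" where
  "dform B y vs = (\<Sum>i<length vs. (-1) ^ i * FD (\<lambda>z. B z (del_nth i vs)) y (vs ! i))"

text \<open>\<open>B\<close> is known to be smooth only on constant arguments. The moving arguments
  are expanded in \<open>Basis\<close> one at a time, starting from the last; the tail
  \<open>xs\<close> receives the basis vectors.\<close>

lemma smooth_on_multilinear: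
  fixes B :: "'x::euclidean_space \<Rightarrow> 'e::euclidean_space list \<Rightarrow> real"
  assumes U: "open U" and alt: "\<And>z. z \<in> U \<Longrightarrow> alt_multilinear p (B z)"
    and B: "\<And>vs. smooth_on U (\<lambda>z. B z vs)" and ws: "\<And>w. w \<in> set ws \<Longrightarrow> smooth_on U w"
  shows "smooth_on U (\<lambda>z. B z (map (\<lambda>w. w z) ws @ xs))"
proof (cases "length ws + length xs = p")
  case False
  show ?thesis
    by (rule smooth_on_cong[OF U _ smooth_on_const[of U 0]]) (use False in \<open>simp add: alt_multilinear_length[OF alt]\<close>)
next
  case True
  then show ?thesis
    using ws
  proof (induction ws arbitrary: xs rule: rev_induct)
    case Nil
    then show ?case by (simp add: B)
  next
    case (snoc w ws)
    show ?case
    proof (rule smooth_on_cong[OF U])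
      show "smooth_on U (\<lambda>z. \<Sum>b\<in>Basis. (w z \<bullet> b) * B z (map (\<lambda>w. w z) ws @ b # xs))"
        using snoc by (intro smooth_on_sum U smooth_on_mult smooth_on_inner smooth_on_const) auto
      show "(\<Sum>b\<in>Basis. (w z \<bullet> b) * B z (map (\<lambda>w. w z) ws @ b # xs)) = B z (map (\<lambda>w. w z) (ws @ [w]) @ xs)"
        if "z \<in> U" for z
        using linear_basis_expansion[OF alt_multilinear_linear_append[OF alt[OF that]],
            of "map (\<lambda>w. w z) ws" xs "w z"] snoc.prems(1) by simp
    qed
  qed
qed

text \<open>The product rule for a varying form on varying arguments: one term from the form and one
  from each argument. As for smoothness, the constant tail \<open>xs\<close> is what makes the
  induction from the right go through.\<close>

lemma FD_multilinear:
  fixes B :: "'x::euclidean_space \<Rightarrow> 'e::euclidean_space list \<Rightarrow> real"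
  assumes U: "open U" "y \<in> U" and alt: "\<And>z. z \<in> U \<Longrightarrow> alt_multilinear p (B z)"
    and B: "\<And>vs. (\<lambda>z. B z vs) differentiable (at y)"
    and ws: "\<And>w. w \<in> set ws \<Longrightarrow> w differentiable (at y)"
    and p: "length ws + length xs = p"
  shows "(\<lambda>z. B z (map (\<lambda>w. w z) ws @ xs)) differentiable (at y) \<and>
    FD (\<lambda>z. B z (map (\<lambda>w. w z) ws @ xs)) y v =
    FD (\<lambda>z. B z (map (\<lambda>w. w y) ws @ xs)) y v +
    (\<Sum>j<length ws. B y ((map (\<lambda>w. w y) ws)[j := FD (ws ! j) y v] @ xs))"
  using ws p
proof (induction ws arbitrary: xs rule: rev_induct)
  case Nil
  then show ?case by (simp add: B)
next
  case (snoc w ws)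
  let ?ms = "\<lambda>z. map (\<lambda>w. w z) ws"
  have w: "w differentiable (at y)" using snoc.prems by simp
  have wb: "(\<lambda>z. w z \<bullet> b) differentiable (at y)" "FD (\<lambda>z. w z \<bullet> b) y v = FD w y v \<bullet> b" for b
    using FD_linear_compose[OF bounded_linear_inner_left w] w by (auto intro: differentiable_inner)
  have IH: "(\<lambda>z. B z (?ms z @ b # xs)) differentiable (at y)"
    "FD (\<lambda>z. B z (?ms z @ b # xs)) y v = FD (\<lambda>z. B z (?ms y @ b # xs)) y v +
      (\<Sum>j<length ws. B y ((?ms y)[j := FD (ws ! j) y v] @ b # xs))" for b
    using snoc.IH[of "b # xs"] snoc.prems by auto
  have exp: "B z (ls @ a # xs) = (\<Sum>b\<in>Basis. (a \<bullet> b) * B z (ls @ b # xs))"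
    if "z \<in> U" "length ls = length ws" for z ls a
    using linear_basis_expansion[OF alt_multilinear_linear_append[OF alt[OF that(1)], of ls xs], of a] snoc.prems(2) that(2)
    by simp
  let ?S = "\<lambda>z. \<Sum>b\<in>Basis. (w z \<bullet> b) * B z (?ms z @ b # xs)"
  have S: "?S z = B z (map (\<lambda>w. w z) (ws @ [w]) @ xs)" if "z \<in> U" for z
    using exp[OF that, of "?ms z" "w z"] by simp
  have d: "(\<lambda>z. (w z \<bullet> b) * B z (?ms z @ b # xs)) differentiable (at y)" for b
    by (intro differentiable_mult wb IH)
  have dS: "?S differentiable (at y)"
    by (intro differentiable_sum finite_Basis ballI d)
  have diff: "(\<lambda>z. B z (map (\<lambda>w. w z) (ws @ [w]) @ xs)) differentiable (at y)"
    using has_derivative_transform_within_open[OF differentiable_has_FD[OF dS] U S]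
    unfolding differentiable_def by blast
  have "FD (\<lambda>z. B z (map (\<lambda>w. w z) (ws @ [w]) @ xs)) y v = FD ?S y v"
    by (rule fun_cong[OF FD_cong[OF U S[symmetric]]])
  also have "\<dots> = (\<Sum>b\<in>Basis. (w y \<bullet> b) * FD (\<lambda>z. B z (?ms z @ b # xs)) y v + (FD w y v \<bullet> b) * B y (?ms y @ b # xs))"
    by (subst FD_sum[OF d]) (simp add: FD_mult[OF wb(1) IH(1)] wb(2))
  also have "\<dots> = (\<Sum>b\<in>Basis. (w y \<bullet> b) * FD (\<lambda>z. B z (?ms y @ b # xs)) y v)
      + (\<Sum>j<length ws. \<Sum>b\<in>Basis. (w y \<bullet> b) * B y ((?ms y)[j := FD (ws ! j) y v] @ b # xs))
      + (\<Sum>b\<in>Basis. (FD w y v \<bullet> b) * B y (?ms y @ b # xs))"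
    unfolding IH(2) distrib_left sum.distrib sum_distrib_left by (subst (2) sum.swap) (rule refl)
  also have "(\<Sum>b\<in>Basis. (FD w y v \<bullet> b) * B y (?ms y @ b # xs)) = B y (?ms y @ FD w y v # xs)"
    by (rule exp[OF U(2), symmetric]) simp
  also have "(\<Sum>j<length ws. \<Sum>b\<in>Basis. (w y \<bullet> b) * B y ((?ms y)[j := FD (ws ! j) y v] @ b # xs))
      = (\<Sum>j<length ws. B y ((?ms y)[j := FD (ws ! j) y v] @ w y # xs))"
    by (intro sum.cong refl exp[OF U(2), symmetric]) simp
  also have "(\<Sum>b\<in>Basis. (w y \<bullet> b) * FD (\<lambda>z. B z (?ms y @ b # xs)) y v) = FD (\<lambda>z. B z (?ms y @ w y # xs)) y v"
  proof -
    have "FD (\<lambda>z. B z (?ms y @ w y # xs)) y v = FD (\<lambda>z. \<Sum>b\<in>Basis. (w y \<bullet> b) * B z (?ms y @ b # xs)) y v"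
      by (rule fun_cong[OF FD_cong[OF U]]) (rule exp, simp_all)
    also have "\<dots> = (\<Sum>b\<in>Basis. (w y \<bullet> b) * FD (\<lambda>z. B z (?ms y @ b # xs)) y v)"
      by (subst FD_sum) (auto intro!: differentiable_mult B simp: FD_mult[OF differentiable_const B])
    finally show ?thesis by simp
  qed
  finally have "FD (\<lambda>z. B z (map (\<lambda>w. w z) (ws @ [w]) @ xs)) y v = FD (\<lambda>z. B z (?ms y @ w y # xs)) y v
      + (\<Sum>j<length ws. B y ((?ms y)[j := FD (ws ! j) y v] @ w y # xs)) + B y (?ms y @ FD w y v # xs)" .
  moreover have "(\<Sum>j<length (ws @ [w]). B y ((map (\<lambda>w. w y) (ws @ [w]))[j := FD ((ws @ [w]) ! j) y v] @ xs))
      = (\<Sum>j<length ws. B y ((?ms y)[j := FD (ws ! j) y v] @ w y # xs)) + B y (?ms y @ FD w y v # xs)"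
  proof -
    have "(\<Sum>j<length ws. B y ((map (\<lambda>w. w y) (ws @ [w]))[j := FD ((ws @ [w]) ! j) y v] @ xs))
        = (\<Sum>j<length ws. B y ((?ms y)[j := FD (ws ! j) y v] @ w y # xs))"
      by (rule sum.cong) (auto simp: nth_append list_update_append)
    moreover have "(map (\<lambda>w. w y) (ws @ [w]))[length ws := FD ((ws @ [w]) ! length ws) y v] = ?ms y @ [FD w y v]"
      by (simp add: list_update_append)
    ultimately show ?thesis by (simp only: length_append_singleton sum.lessThan_Suc append_assoc append.simps)
  qed
  ultimately show ?case
    using diff by (simp only: map_append list.map append_assoc append.simps simp_thms add.assoc)
qed

text \<open>The terms that could spoil the naturality of the exterior derivative, with
  \<open>Q i j\<close> a second derivative of the coordinate change in two of the directions. The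
  term that omits argument \<open>i\<close> and alters argument \<open>m\<close> is the negative of
  the one that omits \<open>m\<close> and alters \<open>i\<close>, since \<open>Q\<close> is
  symmetric and \<open>w\<close> alternates.\<close>

lemma alternating_second_derivative_cancel:
  fixes Q :: "nat \<Rightarrow> nat \<Rightarrow> 'e::euclidean_space"
  assumes w: "alt_multilinear p w" and us: "length us = Suc p" and Q: "\<And>i j. Q i j = Q j i"
  shows "(\<Sum>i<Suc p. (-1) ^ i * (\<Sum>j<p. w ((del_nth i us)[j := Q i (if j < i then j else Suc j)]))) = 0"
proof -
  \<comment> \<open>Both indices of \<open>T\<close> refer to positions in the full list
    \<open>us\<close>. Omitting entry \<open>i\<close> shifts the later entries down by one, hence
    \<open>m - 1\<close>.\<close>
  define T where "T i m = (if i = m then 0 else (-1) ^ i * w ((del_nth i us)[(if m < i then m else m - 1) := Q i m]))"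
    for i m
  have anti: "T i m = - T m i" if mi: "m < i" "i < Suc p" for i m
  proof -
    obtain xs ys zs where *: "us = xs @ us ! m # ys @ us ! i # zs" "length xs = m" "i = Suc (m + length ys)"
      by (rule list_split_two[of m i us]) (use mi us in auto)
    have d: "del_nth m us = xs @ ys @ us ! i # zs" "del_nth i us = xs @ us ! m # ys @ zs"
      using trans[OF arg_cong[OF *(1), of "del_nth m"] del_nth_append[OF *(2)]]
        trans[OF arg_cong[OF *(1), of "del_nth i"] del_nth_append_append[OF *(2,3)]] by blast+
    have "T i m = (-1) ^ i * w (xs @ Q i m # ys @ zs)"
      proof -
      have "(del_nth i us)[m := Q i m] = xs @ Q i m # ys @ zs"
        unfolding d(2) using *(2) by (simp add: list_update_append)
      then show ?thesis using mi by (simp add: T_def)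
    qed
    moreover have "T m i = (-1) ^ m * w (xs @ ys @ Q i m # zs)"
      proof -
      have "(del_nth m us)[i - 1 := Q m i] = xs @ ys @ Q i m # zs"
        unfolding d(1) using *(2,3) by (simp add: list_update_append) (rule Q)
      then show ?thesis using mi by (simp add: T_def)
    qed
    moreover have "(-1 :: real) ^ i = - ((-1) ^ m * (-1) ^ length ys)"
      by (simp add: *(3) power_add)
    ultimately show ?thesis
      unfolding alt_multilinear_move[OF w, of xs ys "Q i m" zs] by (simp only: mult_minus_left mult.assoc)
  qed
  have anti': "T i m = - T m i" if "m < Suc p" "i < Suc p" for i m
  proof (cases m i rule: linorder_cases)
    case less
    then show ?thesis using that by (intro anti)
  next
    case greater
    then have "T m i = - T i m" using that by (intro anti)
    then show ?thesis by simp
  qed (simp add: T_def)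
  have "(-1) ^ i * (\<Sum>j<p. w ((del_nth i us)[j := Q i (if j < i then j else Suc j)])) = (\<Sum>m<Suc p. T i m)"
    if i: "i < Suc p" for i
  proof -
    have "(\<Sum>m<Suc p. T i m) = (\<Sum>m\<in>{..<Suc p} - {i}. T i m)"
      by (rule sum.mono_neutral_right) (auto simp: T_def)
    also have "\<dots> = (\<Sum>j<p. T i (if j < i then j else Suc j))"
      by (rule sum.reindex_bij_witness[of _ "\<lambda>j. if j < i then j else Suc j" "\<lambda>m. if m < i then m else m - 1"])
        (use i in auto)
    also have "\<dots> = (\<Sum>j<p. (-1) ^ i * w ((del_nth i us)[j := Q i (if j < i then j else Suc j)]))"
    proof (rule sum.cong[OF refl])
      show "T i (if j < i then j else Suc j) = (-1) ^ i * w ((del_nth i us)[j := Q i (if j < i then j else Suc j)])" for j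
        by (cases "j < i") (simp_all add: T_def)
    qed
    finally show ?thesis unfolding sum_distrib_left by (rule sym)
  qed
  note inner = this
  define S where "S = (\<Sum>i<Suc p. \<Sum>m<Suc p. T i m)"
  have "S = (\<Sum>i<Suc p. \<Sum>m<Suc p. - T m i)"
    unfolding S_def
  proof (rule sum.cong[OF refl], rule sum.cong[OF refl])
    show "T i m = - T m i" if "i \<in> {..<Suc p}" "m \<in> {..<Suc p}" for i m
      by (rule anti') (use that in auto)
  qed
  also have "\<dots> = - (\<Sum>i<Suc p. \<Sum>m<Suc p. T m i)" unfolding sum_negf ..
  also have "(\<Sum>i<Suc p. \<Sum>m<Suc p. T m i) = S" unfolding S_def by (rule sum.swap)
  finally have "S = 0" by linarith
  moreover have "(\<Sum>i<Suc p. (-1) ^ i * (\<Sum>j<p. w ((del_nth i us)[j := Q i (if j < i then j else Suc j)]))) = S"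
    unfolding S_def
  proof (rule sum.cong[OF refl])
    fix i assume "i \<in> {..<Suc p}"
    then show "(-1) ^ i * (\<Sum>j<p. w ((del_nth i us)[j := Q i (if j < i then j else Suc j)])) = (\<Sum>m<Suc p. T i m)"
      using inner[of i] by blast
  qed
  ultimately show ?thesis by (rule trans[rotated])
qed

lemma dform_length:
  assumes "open U" "y \<in> U" "\<And>z. z \<in> U \<Longrightarrow> alt_multilinear p (B z)" "length vs \<noteq> Suc p"
  shows "dform B y vs = 0"
proof -
  have "FD (\<lambda>z. B z (del_nth i vs)) y = FD (\<lambda>z. 0) y" if "i < length vs" for i
    by (rule FD_cong[OF assms(1,2) alt_multilinear_length[OF assms(3)]])
      (use that assms(4) in \<open>auto simp: length_del_nth\<close>)
  then show ?thesis by (auto simp: dform_def intro!: sum.neutral)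
qed

lemma alt_multilinear_FD:
  fixes B :: "'x::euclidean_space \<Rightarrow> 'e::euclidean_space list \<Rightarrow> real"
  assumes U: "open U" "y \<in> U" and alt: "\<And>z. z \<in> U \<Longrightarrow> alt_multilinear p (B z)"
    and B: "\<And>vs. (\<lambda>z. B z vs) differentiable (at y)"
  shows "alt_multilinear p (\<lambda>vs. FD (\<lambda>z. B z vs) y v)"
proof -
  have 0: "FD (\<lambda>z. B z vs) y v = 0" if "\<And>z. z \<in> U \<Longrightarrow> B z vs = 0" for vs
    using FD_cong[OF U that] by simp
  show ?thesis
    unfolding alt_multilinear_def
  proof (intro conjI allI impI)
    fix vs :: "'e list" and i assume a: "length vs = p \<and> i < p"
    have lin: "linear (\<lambda>v. B z (vs[i := v]))" if "z \<in> U" for z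
      using alt_multilinear_linear[OF alt[OF that]] a by blast
    show "linear (\<lambda>u. FD (\<lambda>z. B z (vs[i := u])) y v)"
    proof (rule linearI)
      fix a b
      have "FD (\<lambda>z. B z (vs[i := a + b])) y = FD (\<lambda>z. B z (vs[i := a]) + B z (vs[i := b])) y"
        by (rule FD_cong[OF U]) (simp add: linear_add[OF lin])
      then show "FD (\<lambda>z. B z (vs[i := a + b])) y v = FD (\<lambda>z. B z (vs[i := a])) y v + FD (\<lambda>z. B z (vs[i := b])) y v"
        by (simp add: FD_add[OF B B])
    next
      fix r :: real and b
      have "FD (\<lambda>z. B z (vs[i := r *\<^sub>R b])) y = FD (\<lambda>z. r * B z (vs[i := b])) y"
        by (rule FD_cong[OF U]) (simp add: linear_cmul[OF lin])
      then show "FD (\<lambda>z. B z (vs[i := r *\<^sub>R b])) y v = r *\<^sub>R FD (\<lambda>z. B z (vs[i := b])) y v"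
        by (simp add: FD_mult[OF differentiable_const B])
    qed
  next
    fix vs :: "'e list" and i j assume "length vs = p \<and> i < j \<and> j < p \<and> vs ! i = vs ! j"
    then show "FD (\<lambda>z. B z vs) y v = 0"
      by (intro 0 alt_multilinear_repeat[OF alt, of _ i j]) auto
  qed (auto intro!: 0 alt_multilinear_length[OF alt])
qed

lemma alt_multilinear_dform:
  assumes U: "open U" "y \<in> U" and alt: "\<And>z. z \<in> U \<Longrightarrow> alt_multilinear p (B z)"
    and B: "\<And>vs. (\<lambda>z. B z vs) differentiable (at y)"
  shows "alt_multilinear (Suc p) (dform B y)"
  unfolding dform_def[abs_def]
proof (rule alt_multilinear_wedge)
  show "alt_multilinear p (\<lambda>vs. FD (\<lambda>z. B z vs) y v)" for v
    by (rule alt_multilinear_FD[OF assms])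
qed (rule linear_frechet_derivative[OF B])

text \<open>Naturality of the exterior derivative. Differentiating the pulled back form produces,
  besides the wanted term, terms with second derivatives of \<open>\<psi>\<close>; these cancel
  because second derivatives are symmetric while the form alternates.\<close>

lemma dform_pullback:
  fixes \<psi> :: "'x::euclidean_space \<Rightarrow> 'e::euclidean_space"
  assumes U: "open U" "y \<in> U" and V: "open V" "\<psi> ` U \<subseteq> V" and \<psi>: "smooth_on U \<psi>"
    and alt: "\<And>z. z \<in> V \<Longrightarrow> alt_multilinear p (B z)"
    and B: "\<And>vs. smooth_on V (\<lambda>z. B z vs)"
  shows "dform (\<lambda>z vs. B (\<psi> z) (map (FD \<psi> z) vs)) y vs = dform B (\<psi> y) (map (FD \<psi> y) vs)"
proof (cases "length vs = Suc p")
  case False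
  have "alt_multilinear p (\<lambda>vs. B (\<psi> z) (map (FD \<psi> z) vs))" if "z \<in> U" for z
    using alt_multilinear_map[OF alt smooth_on_linear_FD[OF \<psi> that]] V(2) that by blast
  then show ?thesis
    using dform_length[OF U, of p "\<lambda>z vs. B (\<psi> z) (map (FD \<psi> z) vs)" vs]
      dform_length[OF V(1), of "\<psi> y" p B "map (FD \<psi> y) vs"] alt V(2) U(2) False by auto
next
  case True
  define us where "us = map (FD \<psi> y) vs"
  define Q where "Q i j = FD (\<lambda>z. FD \<psi> z (vs ! j)) y (vs ! i)" for i j
  have \<psi>y: "\<psi> y \<in> V" using U V by auto
  have alt': "alt_multilinear p (B (\<psi> z))" if "z \<in> U" for z using alt V that by auto
  have diff: "(\<lambda>z. B (\<psi> z) vs) differentiable (at y)" for vs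
    by (rule smooth_on_differentiable[OF smooth_on_compose[OF U(1) V B \<psi>] U(2)])
  have summand: "FD (\<lambda>z. B (\<psi> z) (map (FD \<psi> z) (del_nth i vs))) y (vs ! i) =
      FD (\<lambda>q. B q (del_nth i us)) (\<psi> y) (us ! i) +
      (\<Sum>j<p. B (\<psi> y) ((del_nth i us)[j := Q i (if j < i then j else Suc j)]))"
    if i: "i < Suc p" for i
  proof -
    let ?ws = "map (\<lambda>v z. FD \<psi> z v) (del_nth i vs)"
    have len: "length (del_nth i vs) = p" using i True by (simp add: length_del_nth)
    have m: "map (\<lambda>w. w z) ?ws = map (FD \<psi> z) (del_nth i vs)" for z by (simp add: o_def)
    have "FD (\<lambda>z. B (\<psi> z) (map (\<lambda>w. w z) ?ws @ [])) y (vs ! i) =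
        FD (\<lambda>z. B (\<psi> z) (map (\<lambda>w. w y) ?ws @ [])) y (vs ! i) +
        (\<Sum>j<length ?ws. B (\<psi> y) ((map (\<lambda>w. w y) ?ws)[j := FD (?ws ! j) y (vs ! i)] @ []))"
      by (rule FD_multilinear[OF U alt' diff, THEN conjunct2])
        (auto simp: len intro: smooth_on_differentiable[OF smooth_on_FD[OF \<psi>] U(2)])
    moreover have "FD (\<lambda>z. B (\<psi> z) (map (FD \<psi> y) (del_nth i vs))) y (vs ! i) = FD (\<lambda>q. B q (del_nth i us)) (\<psi> y) (us ! i)"
      using FD_compose[OF smooth_on_differentiable[OF \<psi> U(2)] smooth_on_differentiable[OF B \<psi>y]] i True
      by (simp add: us_def flip: map_del_nth)
    moreover have "FD (?ws ! j) y (vs ! i) = Q i (if j < i then j else Suc j)" if "j < p" for j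
      using that i True len by (simp add: Q_def nth_del_nth)
    ultimately show ?thesis
      unfolding m by (simp add: len us_def flip: map_del_nth)
  qed
  have "dform (\<lambda>z vs. B (\<psi> z) (map (FD \<psi> z) vs)) y vs = dform B (\<psi> y) us
     + (\<Sum>i<Suc p. (-1) ^ i * (\<Sum>j<p. B (\<psi> y) ((del_nth i us)[j := Q i (if j < i then j else Suc j)])))"
    unfolding dform_def True by (simp add: summand us_def True distrib_left sum.distrib)
  also have "\<dots> = dform B (\<psi> y) us"
    using alternating_second_derivative_cancel[OF alt[OF \<psi>y], of us Q]
      second_derivative_symmetric[OF U \<psi>] True by (simp add: us_def Q_def)
  finally show ?thesis by (simp add: us_def)
qed

text \<open>The divergence formula behind \<open>\<pounds>\<^sub>X\<nu> = \<^bold>d(\<^bold>i\<^sub>X\<nu>)\<close>: the hypothesis on \<open>X\<close> says \<open>\<^bold>i\<^sub>X\<nu> = \<gamma>\<close>.\<close>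

lemma lie_derivative_top_form:
  fixes \<nu> \<gamma> :: "('e::euclidean_space, 'e) form"
  assumes U: "open U" "y \<in> U"
    and \<nu>: "\<And>z. z \<in> U \<Longrightarrow> alt_multilinear DIM('e) (\<nu> z)" "\<And>vs. smooth_on U (\<lambda>z. \<nu> z vs)"
    and \<gamma>: "\<And>z. z \<in> U \<Longrightarrow> alt_multilinear (DIM('e) - 1) (\<gamma> z)" "\<And>vs. smooth_on U (\<lambda>z. \<gamma> z vs)"
    and X: "smooth_on U X"
    and X\<gamma>: "\<And>z i. z \<in> U \<Longrightarrow> i < DIM('e) \<Longrightarrow>
       (X z \<bullet> basis_list ! i) * \<nu> z basis_list = (-1) ^ i * \<gamma> z (del_nth i basis_list)"
  shows "FD (\<lambda>z. \<nu> z vs) y (X y) + (\<Sum>i<length vs. \<nu> y (vs[i := FD X y (vs ! i)])) = dform \<gamma> y vs"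
proof -
  let ?n = "DIM('e)"
  have n: "Suc (?n - 1) = ?n" by simp
  have d: "(\<lambda>z. \<nu> z vs) differentiable (at y)" "(\<lambda>z. \<gamma> z vs) differentiable (at y)" "X differentiable (at y)" for vs
    using smooth_on_differentiable[OF _ U(2)] \<nu> \<gamma> X by blast+
  \<comment> \<open>Both sides are of top degree, so one comparison on \<open>basis_list\<close>
    suffices. There the two parts of the left side combine by the product rule into the divergence
    of the vector field with components
    \<open>(X z \<bullet> b) * \<nu> z basis_list\<close>.\<close>
  have "(\<lambda>vs. FD (\<lambda>z. \<nu> z vs) y (X y) + (\<Sum>i<length vs. \<nu> y (vs[i := FD X y (vs ! i)]))) = dform \<gamma> y"
  proof (rule alt_multilinear_top_eqI)
    show "alt_multilinear ?n (\<lambda>vs. FD (\<lambda>z. \<nu> z vs) y (X y) + (\<Sum>i<length vs. \<nu> y (vs[i := FD X y (vs ! i)])))"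
      by (intro alt_multilinear_add alt_multilinear_FD[OF U \<nu>(1) d(1)] alt_multilinear_derivation[OF \<nu>(1)]
          U linear_frechet_derivative d)
    show "alt_multilinear ?n (dform \<gamma> y)"
      using alt_multilinear_dform[OF U \<gamma>(1) d(2)] by (simp add: n)
    let ?b = "\<lambda>i. basis_list ! i :: 'e"
    have Xb: "(\<lambda>z. X z \<bullet> b) differentiable (at y)" "FD (\<lambda>z. X z \<bullet> b) y v = FD X y v \<bullet> b" for b v
      using FD_linear_compose[OF bounded_linear_inner_left d(3)] d(3) by (auto intro: differentiable_inner)
    have "FD (\<lambda>z. \<nu> z basis_list) y (X y) = (\<Sum>i<?n. (X y \<bullet> ?b i) * FD (\<lambda>z. \<nu> z basis_list) y (?b i))"
      using linear_basis_expansion[OF linear_frechet_derivative[OF d(1)], of basis_list "X y"]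
      by (simp add: sum_Basis_conv_basis_list)
    then have "FD (\<lambda>z. \<nu> z basis_list) y (X y) + (\<Sum>i<?n. \<nu> y (basis_list[i := FD X y (?b i)])) =
        (\<Sum>i<?n. (X y \<bullet> ?b i) * FD (\<lambda>z. \<nu> z basis_list) y (?b i) + (FD X y (?b i) \<bullet> ?b i) * \<nu> y basis_list)"
      by (simp add: sum.distrib alt_multilinear_top_update[OF \<nu>(1)[OF U(2)]])
    also have "\<dots> = (\<Sum>i<?n. FD (\<lambda>z. (X z \<bullet> ?b i) * \<nu> z basis_list) y (?b i))"
      by (simp add: FD_mult[OF Xb(1) d(1)] Xb(2))
    also have "\<dots> = (\<Sum>i<?n. FD (\<lambda>z. (-1) ^ i * \<gamma> z (del_nth i basis_list)) y (?b i))"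
      by (intro sum.cong refl fun_cong[OF FD_cong[OF U]] X\<gamma>) simp_all
    also have "\<dots> = dform \<gamma> y basis_list"
      by (simp add: dform_def length_basis_list FD_mult[OF differentiable_const d(2)])
    finally show "FD (\<lambda>z. \<nu> z basis_list) y (X y) + (\<Sum>i<length (basis_list :: 'e list). \<nu> y (basis_list[i := FD X y (?b i)])) = dform \<gamma> y basis_list"
      by (simp add: length_basis_list)
  qed
  from fun_cong[OF this, of vs] show ?thesis .
qed

subsection \<open>Charts\<close>

context
  fixes M :: "('a, 'e::euclidean_space) mfd"
  assumes M: "manifold M"
begin

lemma chart_openin: "c \<in> atlas M \<Longrightarrow> openin (mtop M) (fst c)"
  and open_cimg: "c \<in> atlas M \<Longrightarrow> open (cimg c)"
  and chart_homeomorphic: "c \<in> atlas M \<Longrightarrow>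
    homeomorphic_map (subtopology (mtop M) (fst c)) (top_of_set (cimg c)) (snd c)"
  using M by (auto simp: manifold_def)

lemma chart_subset: "c \<in> atlas M \<Longrightarrow> fst c \<subseteq> pts M"
  using chart_openin openin_subset by blast

lemma chart_exists: "x \<in> pts M \<Longrightarrow> \<exists>c\<in>atlas M. x \<in> fst c"
  using M by (auto simp: manifold_def)

lemma chart_at: "x \<in> pts M \<Longrightarrow> chart_at M x \<in> atlas M" "x \<in> pts M \<Longrightarrow> x \<in> fst (chart_at M x)"
  using someI_ex[of "\<lambda>c. c \<in> atlas M \<and> x \<in> fst c"] chart_exists unfolding chart_at_def by blast+

lemma chart_inj: "c \<in> atlas M \<Longrightarrow> inj_on (snd c) (fst c)"
  using homeomorphic_imp_injective_map[OF chart_homeomorphic] chart_subset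
  by (simp add: Int_absorb1)

lemma cinv_in: "y \<in> cimg c \<Longrightarrow> cinv c y \<in> fst c"
  by (rule inv_into_into)

lemma snd_cinv: "y \<in> cimg c \<Longrightarrow> snd c (cinv c y) = y"
  by (rule f_inv_into_f)

lemma cinv_snd: "c \<in> atlas M \<Longrightarrow> x \<in> fst c \<Longrightarrow> cinv c (snd c x) = x"
  by (rule inv_into_f_f[OF chart_inj])

lemma cinv_pts: "c \<in> atlas M \<Longrightarrow> y \<in> cimg c \<Longrightarrow> cinv c y \<in> pts M"
  by (rule subsetD[OF chart_subset cinv_in])

lemma open_chart_image:
  assumes "c \<in> atlas M" "openin (mtop M) W"
  shows "open (snd c ` (fst c \<inter> W))"
proof -
  have "openin (subtopology (mtop M) (fst c)) (fst c \<inter> W)"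
    using assms by (simp add: openin_subtopology_Int2)
  then have "openin (top_of_set (cimg c)) (snd c ` (fst c \<inter> W))"
    using homeomorphic_imp_open_map[OF chart_homeomorphic[OF assms(1)]] by (simp add: open_map_def)
  then show ?thesis using open_cimg[OF assms(1)] openin_open_trans by blast
qed

lemma openin_chart_vimage:
  assumes "c \<in> atlas M" "open W"
  shows "openin (mtop M) (fst c \<inter> snd c -` W)"
proof -
  have "continuous_map (subtopology (mtop M) (fst c)) (top_of_set (cimg c)) (snd c)"
    using chart_homeomorphic[OF assms(1)] homeomorphic_imp_continuous_map by blast
  moreover have "openin (top_of_set (cimg c)) (cimg c \<inter> W)"
    using assms by (simp add: openin_open_Int)
  ultimately have "openin (subtopology (mtop M) (fst c)) {x \<in> pts M \<inter> fst c. snd c x \<in> cimg c \<inter> W}"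
    using openin_continuous_map_preimage by fastforce
  moreover have "{x \<in> pts M \<inter> fst c. snd c x \<in> cimg c \<inter> W} = fst c \<inter> snd c -` W"
    using chart_subset[OF assms(1)] by auto
  ultimately show ?thesis
    using openin_trans_full[OF _ chart_openin[OF assms(1)]] by simp
qed

lemma continuous_map_cinv:
  assumes "c \<in> atlas M"
  shows "continuous_map (top_of_set (cimg c)) (mtop M) (cinv c)"
proof -
  obtain g where g: "homeomorphic_maps (subtopology (mtop M) (fst c)) (top_of_set (cimg c)) (snd c) g"
    using chart_homeomorphic[OF assms] homeomorphic_map_maps by blast
  have "g y = cinv c y" if "y \<in> cimg c" for y
  proof -
    have "g y \<in> fst c" "snd c (g y) = y"
      using g that by (auto simp: homeomorphic_maps_def continuous_map_def)
    then show ?thesis using cinv_snd[OF assms] by metis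
  qed
  moreover have "continuous_map (top_of_set (cimg c)) (mtop M) g"
    using g by (auto simp: homeomorphic_maps_def continuous_map_in_subtopology)
  ultimately show ?thesis
    using continuous_map_eq[of "top_of_set (cimg c)" "mtop M" g "cinv c"] by simp
qed

lemma transition:
  assumes "c \<in> atlas M" "d \<in> atlas M"
  shows "open (snd c ` (fst c \<inter> fst d))" "smooth_on (snd c ` (fst c \<inter> fst d)) (\<lambda>y. snd d (cinv c y))"
  using open_chart_image[OF assms(1) chart_openin[OF assms(2)]] assms M
  by (auto simp: manifold_def o_def)

lemma chart_change_eq_FD: "chart_change c d x = FD (\<lambda>y. snd d (cinv c y)) (snd c x)"
  by (simp add: chart_change_def o_def)

lemma linear_chart_change:
  assumes "c \<in> atlas M" "d \<in> atlas M" "x \<in> fst c" "x \<in> fst d"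
  shows "linear (chart_change c d x)"
  unfolding chart_change_eq_FD
  by (rule smooth_on_linear_FD[OF transition(2)[OF assms(1,2)]]) (use assms in auto)

lemma chart_change_self:
  assumes "c \<in> atlas M" "x \<in> fst c"
  shows "chart_change c c x v = v"
proof -
  have "FD (\<lambda>y. snd c (cinv c y)) (snd c x) = FD (\<lambda>y. y) (snd c x)"
    by (rule FD_cong[OF open_cimg[OF assms(1)]]) (use assms in \<open>auto simp: snd_cinv\<close>)
  then show ?thesis by (simp add: chart_change_eq_FD)
qed

lemma chart_change_chart_change:
  assumes "c \<in> atlas M" "d \<in> atlas M" "e \<in> atlas M" "x \<in> fst c" "x \<in> fst d" "x \<in> fst e"
  shows "chart_change d e x (chart_change c d x v) = chart_change c e x v"
proof -
  let ?U = "snd c ` (fst c \<inter> (fst d \<inter> fst e))"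
  have U: "open ?U" "snd c x \<in> ?U"
    using open_chart_image[OF assms(1) openin_Int[OF chart_openin[OF assms(2)] chart_openin[OF assms(3)]]] assms
    by auto
  have "(\<lambda>y. snd d (cinv c y)) differentiable (at (snd c x))"
    "(\<lambda>y. snd e (cinv d y)) differentiable (at (snd d x))"
    using smooth_on_differentiable[OF transition(2)[OF assms(1,2)]]
      smooth_on_differentiable[OF transition(2)[OF assms(2,3)]] assms by auto
  then have "FD (\<lambda>y. snd e (cinv d (snd d (cinv c y)))) (snd c x) v =
      FD (\<lambda>y. snd e (cinv d y)) (snd d x) (FD (\<lambda>y. snd d (cinv c y)) (snd c x) v)"
    using FD_compose[of "\<lambda>y. snd d (cinv c y)" "snd c x" "\<lambda>y. snd e (cinv d y)" v] assms
    by (simp add: cinv_snd)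
  moreover have "FD (\<lambda>y. snd e (cinv d (snd d (cinv c y)))) (snd c x) = FD (\<lambda>y. snd e (cinv c y)) (snd c x)"
    by (rule FD_cong[OF U]) (use assms in \<open>auto simp: cinv_snd\<close>)
  ultimately show ?thesis by (simp add: chart_change_eq_FD)
qed

lemma chart_at_point:
  assumes "c \<in> atlas M" "x \<in> fst c"
  shows "chart_at M x \<in> atlas M" "x \<in> fst (chart_at M x)"
  using chart_at[of x] chart_subset[OF assms(1)] assms(2) by auto

lemma to_chart_linear: "c \<in> atlas M \<Longrightarrow> x \<in> fst c \<Longrightarrow> linear (to_chart M c x)"
  unfolding to_chart_def[abs_def] by (intro linear_chart_change chart_at_point)

lemma from_chart_linear: "c \<in> atlas M \<Longrightarrow> x \<in> fst c \<Longrightarrow> linear (from_chart M c x)"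
  unfolding from_chart_def[abs_def] by (intro linear_chart_change chart_at_point)

lemma from_to_chart:
  assumes "c \<in> atlas M" "x \<in> fst c"
  shows "from_chart M c x (to_chart M c x v) = v"
  unfolding to_chart_def from_chart_def
  using chart_change_chart_change[of "chart_at M x" c "chart_at M x" x v] chart_change_self chart_at_point[OF assms] assms
  by simp

lemma to_from_chart:
  assumes "c \<in> atlas M" "x \<in> fst c"
  shows "to_chart M c x (from_chart M c x v) = v"
  unfolding to_chart_def from_chart_def
  using chart_change_chart_change[of c "chart_at M x" c x v] chart_change_self chart_at_point[OF assms] assms
  by simp

lemma from_chart_chart_change:
  "c \<in> atlas M \<Longrightarrow> d \<in> atlas M \<Longrightarrow> x \<in> fst c \<Longrightarrow> x \<in> fst d \<Longrightarrow>
   from_chart M d x (chart_change c d x v) = from_chart M c x v"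
  using chart_at[of x] chart_subset[of c] unfolding from_chart_def
  by (intro chart_change_chart_change) auto

lemma from_chart_at: "x \<in> pts M \<Longrightarrow> from_chart M (chart_at M x) x v = v"
  and to_chart_at: "x \<in> pts M \<Longrightarrow> to_chart M (chart_at M x) x v = v"
  using chart_at chart_change_self unfolding to_chart_def from_chart_def by blast+

lemma in_chart_at_point:
  "c \<in> atlas M \<Longrightarrow> x \<in> fst c \<Longrightarrow> in_chart M c \<tau> (snd c x) vs = \<tau> x (map (from_chart M c x) vs)"
  by (simp add: in_chart_def cinv_snd)

lemma in_chart_to_chart:
  "c \<in> atlas M \<Longrightarrow> x \<in> fst c \<Longrightarrow> in_chart M c \<tau> (snd c x) (map (to_chart M c x) vs) = \<tau> x vs"
  by (simp add: in_chart_at_point o_def from_to_chart)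

lemma in_chart_transition:
  assumes "c \<in> atlas M" "d \<in> atlas M" "x \<in> fst c" "x \<in> fst d"
  shows "in_chart M c \<tau> (snd c x) vs = in_chart M d \<tau> (snd d x) (map (chart_change c d x) vs)"
  using assms by (simp add: in_chart_at_point o_def from_chart_chart_change)

lemma alt_multilinear_in_chart:
  assumes "c \<in> atlas M" "y \<in> cimg c" "\<And>x. x \<in> pts M \<Longrightarrow> alt_multilinear p (\<tau> x)"
  shows "alt_multilinear p (in_chart M c \<tau> y)"
proof -
  have x: "cinv c y \<in> fst c" using assms(2) by (rule cinv_in)
  show ?thesis
    using alt_multilinear_map[OF assms(3) from_chart_linear[OF assms(1) x]] chart_subset[OF assms(1)] x
    by (auto simp: in_chart_def[abs_def])
qed

lemma smooth_fun_localI: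
  assumes "\<And>c x. c \<in> atlas M \<Longrightarrow> x \<in> fst c \<Longrightarrow>
    \<exists>W. openin (mtop M) W \<and> x \<in> W \<and> smooth_on (snd c ` (fst c \<inter> W)) (\<lambda>y. h (cinv c y))"
  shows "smooth_fun M h"
  unfolding smooth_fun_def
proof
  fix c assume c: "c \<in> atlas M"
  show "smooth_on (cimg c) (h \<circ> cinv c)"
  proof (rule smooth_on_local)
    fix y assume "y \<in> cimg c"
    then obtain x where x: "x \<in> fst c" "y = snd c x" by auto
    then obtain W where "openin (mtop M) W" "x \<in> W" "smooth_on (snd c ` (fst c \<inter> W)) (\<lambda>y. h (cinv c y))"
      using assms[OF c] by blast
    then show "\<exists>V. open V \<and> y \<in> V \<and> smooth_on V (h \<circ> cinv c)"
      using open_chart_image[OF c] x by (intro exI[of _ "snd c ` (fst c \<inter> W)"]) (auto simp: o_def)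
  qed
qed

lemma smooth_fun_in_chart: "c \<in> atlas M \<Longrightarrow> smooth_fun M h \<Longrightarrow> smooth_on (cimg c) (\<lambda>y. h (cinv c y))"
  by (simp add: smooth_fun_def o_def)

lemma smooth_fun_const: "smooth_fun M (\<lambda>x. a)"
  by (simp add: smooth_fun_def o_def smooth_on_const)

lemma smooth_fun_add: "smooth_fun M h \<Longrightarrow> smooth_fun M k \<Longrightarrow> smooth_fun M (\<lambda>x. h x + k x)"
  and smooth_fun_diff: "smooth_fun M h \<Longrightarrow> smooth_fun M k \<Longrightarrow> smooth_fun M (\<lambda>x. h x - k x)"
  and smooth_fun_mult: "smooth_fun M h \<Longrightarrow> smooth_fun M k \<Longrightarrow> smooth_fun M (\<lambda>x. h x * k x)"
  using open_cimg by (auto simp: smooth_fun_def o_def intro!: smooth_on_add smooth_on_diff smooth_on_mult)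

subsection \<open>The exterior derivative in charts\<close>

lemma diff_formD:
  assumes "diff_form M p \<tau>"
  shows "x \<in> pts M \<Longrightarrow> alt_multilinear p (\<tau> x)" "x \<notin> pts M \<Longrightarrow> \<tau> x = (\<lambda>_. 0)"
    "c \<in> atlas M \<Longrightarrow> smooth_on (cimg c) (\<lambda>y. in_chart M c \<tau> y vs)"
    "c \<in> atlas M \<Longrightarrow> y \<in> cimg c \<Longrightarrow> alt_multilinear p (in_chart M c \<tau> y)"
  using assms alt_multilinear_in_chart by (auto simp: diff_form_def)

lemma dform_cong:
  assumes "open U" "y \<in> U" "\<And>z vs. z \<in> U \<Longrightarrow> B z vs = B' z vs"
  shows "dform B y vs = dform B' y vs"
  unfolding dform_def
  by (intro sum.cong refl arg_cong2[where f="(*)"] fun_cong[OF FD_cong[OF assms(1,2)]] assms(3))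

lemma ext_d_eq_dform: "x \<in> pts M \<Longrightarrow> ext_d M \<tau> x vs = dform (in_chart M (chart_at M x) \<tau>) (snd (chart_at M x) x) vs"
  by (simp add: ext_d_def dform_def)

text \<open>\<open>ext_d\<close> is computed at each point in the chart chosen for that point, so it
  is not evident that its components in one fixed chart vary smoothly. Naturality under the
  transition map identifies them with \<open>dform\<close> in the fixed chart.\<close>

lemma in_chart_ext_d:
  assumes \<tau>: "diff_form M p \<tau>" and c: "c \<in> atlas M" and y: "y \<in> cimg c"
  shows "in_chart M c (ext_d M \<tau>) y vs = dform (in_chart M c \<tau>) y vs"
proof -
  define x where "x = cinv c y"
  have x: "x \<in> fst c" "snd c x = y" "x \<in> pts M"
    using y c by (auto simp: x_def intro: cinv_in snd_cinv cinv_pts)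
  define a where "a = chart_at M x"
  have a: "a \<in> atlas M" "x \<in> fst a" using chart_at[OF x(3)] by (auto simp: a_def)
  let ?U = "snd c ` (fst c \<inter> fst a)" and ?\<psi> = "\<lambda>y. snd a (cinv c y)"
  have \<psi>x: "?\<psi> y = snd a x" by (simp add: x_def)
  have "in_chart M c (ext_d M \<tau>) y vs = ext_d M \<tau> x (map (FD ?\<psi> y) vs)"
    by (simp add: in_chart_def x_def[symmetric] from_chart_def[abs_def] a_def[symmetric] chart_change_eq_FD x(2))
  also have "\<dots> = dform (in_chart M a \<tau>) (?\<psi> y) (map (FD ?\<psi> y) vs)"
    using x(3) by (simp add: ext_d_eq_dform a_def[symmetric] \<psi>x)
  also have "\<dots> = dform (\<lambda>z vs. in_chart M a \<tau> (?\<psi> z) (map (FD ?\<psi> z) vs)) y vs"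
    by (rule dform_pullback[symmetric, where U="?U" and V="cimg a" and p=p])
      (use transition[OF c a(1)] open_cimg[OF a(1)] x a c diff_formD[OF \<tau>] in \<open>auto simp: cinv_snd\<close>)
  also have "\<dots> = dform (in_chart M c \<tau>) y vs"
  proof (rule dform_cong[where U="?U"])
    fix z vs assume "z \<in> ?U"
    then show "in_chart M a \<tau> (?\<psi> z) (map (FD ?\<psi> z) vs) = in_chart M c \<tau> z vs"
      using in_chart_transition[OF c a(1)] c by (auto simp: cinv_snd chart_change_eq_FD)
  qed (use transition(1)[OF c a(1)] x a in auto)
  finally show ?thesis .
qed

lemma diff_form_ext_d:
  assumes \<tau>: "diff_form M p \<tau>"
  shows "diff_form M (Suc p) (ext_d M \<tau>)"
  unfolding diff_form_def
proof (intro conjI ballI allI impI)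
  fix x assume x: "x \<in> pts M"
  show "alt_multilinear (Suc p) (ext_d M \<tau> x)"
    unfolding ext_d_eq_dform[OF x, abs_def]
  proof (rule alt_multilinear_dform[where U="cimg (chart_at M x)"])
    show "(\<lambda>z. in_chart M (chart_at M x) \<tau> z vs) differentiable (at (snd (chart_at M x) x))" for vs
      by (rule smooth_on_differentiable[OF diff_formD(3)[OF \<tau> chart_at(1)[OF x]]]) (simp add: chart_at(2)[OF x])
    show "alt_multilinear p (in_chart M (chart_at M x) \<tau> z)" if "z \<in> cimg (chart_at M x)" for z
      by (rule diff_formD(4)[OF \<tau> chart_at(1)[OF x] that])
  qed (simp_all add: chart_at[OF x] open_cimg)
next
  fix c vs assume c: "c \<in> atlas M"
  show "smooth_on (cimg c) (\<lambda>y. in_chart M c (ext_d M \<tau>) y vs)"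
  proof (rule smooth_on_cong[OF open_cimg[OF c]])
    show "smooth_on (cimg c) (\<lambda>y. dform (in_chart M c \<tau>) y vs)"
      unfolding dform_def
      by (intro smooth_on_sum smooth_on_mult smooth_on_const smooth_on_FD open_cimg diff_formD[OF \<tau>] c)
  qed (simp add: in_chart_ext_d[OF \<tau> c])
qed (auto simp: ext_d_def)

lemma diff_form_fun_form: "smooth_fun M h \<Longrightarrow> diff_form M 0 (fun_form M h)"
  unfolding diff_form_def
proof (intro conjI ballI allI impI)
  fix c vs assume h: "smooth_fun M h" and c: "c \<in> atlas M"
  show "smooth_on (cimg c) (\<lambda>y. in_chart M c (fun_form M h) y vs)"
  proof (cases "vs = []")
    case True
    show ?thesis
      by (rule smooth_on_cong[OF open_cimg[OF c] _ smooth_fun_in_chart[OF c h]])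
        (simp add: True in_chart_def fun_form_def cinv_pts[OF c])
  next
    case False
    then show ?thesis by (simp add: in_chart_def fun_form_def smooth_on_const)
  qed
qed (auto simp: fun_form_def alt_multilinear_def)

lemma in_chart_ext_d_fun:
  assumes "smooth_fun M h" "c \<in> atlas M" "y \<in> cimg c"
  shows "in_chart M c (ext_d M (fun_form M h)) y [v] = FD (\<lambda>y. h (cinv c y)) y v"
proof -
  have "FD (\<lambda>z. in_chart M c (fun_form M h) z []) y = FD (\<lambda>y. h (cinv c y)) y"
    by (rule FD_cong[OF open_cimg[OF assms(2)] assms(3)]) (simp add: in_chart_def fun_form_def cinv_pts[OF assms(2)])
  then show ?thesis
    by (simp add: in_chart_ext_d[OF diff_form_fun_form[OF assms(1)] assms(2,3)] dform_def del_nth_def)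
qed

lemma ext_d_fun_from_chart:
  assumes "smooth_fun M h" "c \<in> atlas M" "x \<in> fst c"
  shows "ext_d M (fun_form M h) x [from_chart M c x v] = FD (\<lambda>y. h (cinv c y)) (snd c x) v"
  using in_chart_ext_d_fun[OF assms(1,2), of "snd c x" v] assms by (simp add: in_chart_at_point)

text \<open>Only lists of length 2 carry content; for them this is the symmetry of the second
  derivatives of \<open>h\<close> in the chart chosen at \<open>x\<close>.\<close>

lemma ext_d_ext_d_fun:
  assumes h: "smooth_fun M h"
  shows "ext_d M (ext_d M (fun_form M h)) = (\<lambda>_ _. 0)"
proof (intro ext)
  fix x vs
  show "ext_d M (ext_d M (fun_form M h)) x vs = 0"
  proof (cases "x \<in> pts M")
    case x: True
    let ?c = "chart_at M x" and ?dh = "ext_d M (fun_form M h)"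
    let ?y = "snd ?c x"
    have c: "?c \<in> atlas M" "x \<in> fst ?c" "?y \<in> cimg ?c" using chart_at[OF x] by auto
    have dh: "diff_form M 1 ?dh" using diff_form_ext_d[OF diff_form_fun_form[OF h]] by simp
    show ?thesis
    proof (cases "length vs = 2")
      case True
      then obtain v w where vs: "vs = [v, w]" by (auto simp: numeral_2_eq_2 length_Suc_conv)
      have FD: "FD (\<lambda>z. in_chart M ?c ?dh z [v]) ?y = FD (\<lambda>z. FD (\<lambda>y. h (cinv ?c y)) z v) ?y" for v
        by (rule FD_cong[OF open_cimg[OF c(1)] c(3)]) (rule in_chart_ext_d_fun[OF h c(1)])
      show ?thesis
        using second_derivative_symmetric[OF open_cimg[OF c(1)] c(3) smooth_fun_in_chart[OF c(1) h], of v w]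
        by (simp add: ext_d_eq_dform x vs dform_def numeral_2_eq_2 del_nth_def FD)
    next
      case False
      then show ?thesis
        using dform_length[OF open_cimg[OF c(1)] c(3), of 1] diff_formD(4)[OF dh c(1)]
        by (simp add: ext_d_eq_dform x)
    qed
  qed (simp add: ext_d_def)
qed

end

subsection \<open>Smooth maps\<close>

lemma vector_field_in_chart:
  assumes "vector_field M X" "c \<in> atlas M"
  shows "smooth_on (cimg c) (\<lambda>y. to_chart M c (cinv c y) (X (cinv c y)))"
proof -
  have "smooth_on (snd c ` (fst c \<inter> fst c)) (\<lambda>y. to_chart M c (cinv c y) (X (cinv c y)))"
    using assms unfolding vector_field_def vfield_along_def by fastforce
  then show ?thesis by simp
qed

context
  fixes M :: "('a, 'e::euclidean_space) mfd" and N :: "('b, 'f::euclidean_space) mfd" and f :: "'a \<Rightarrow> 'b"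
  assumes M: "manifold M" and N: "manifold N" and f: "smooth_map M N f"
begin

lemma smooth_map_pts: "x \<in> pts M \<Longrightarrow> f x \<in> pts N"
  using f by (auto simp: smooth_map_def continuous_map_def)

lemma openin_smooth_map_vimage:
  assumes "openin (mtop N) W"
  shows "openin (mtop M) {x \<in> pts M. f x \<in> W}"
  using f assms openin_continuous_map_preimage by (fastforce simp: smooth_map_def)

lemma smooth_map_in_charts:
  assumes c: "c \<in> atlas M" and d: "d \<in> atlas N"
  shows "open (snd c ` (fst c \<inter> f -` fst d))"
    "smooth_on (snd c ` (fst c \<inter> f -` fst d)) (\<lambda>y. snd d (f (cinv c y)))"
proof -
  have "fst c \<inter> f -` fst d = fst c \<inter> {x \<in> pts M. f x \<in> fst d}"
    using chart_subset[OF M c] by auto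
  then show "open (snd c ` (fst c \<inter> f -` fst d))"
    using open_chart_image[OF M c openin_smooth_map_vimage[OF chart_openin[OF N d]]] by simp
  show "smooth_on (snd c ` (fst c \<inter> f -` fst d)) (\<lambda>y. snd d (f (cinv c y)))"
    using f c d by (simp add: smooth_map_def o_def)
qed

lemma smooth_fun_smooth_map:
  assumes h: "smooth_fun N h"
  shows "smooth_fun M (\<lambda>x. h (f x))"
proof (rule smooth_fun_localI[OF M])
  fix c x assume c: "c \<in> atlas M" "x \<in> fst c"
  then have fx: "f x \<in> pts N" using smooth_map_pts chart_subset[OF M] by blast
  obtain d where d: "d \<in> atlas N" "f x \<in> fst d" using chart_exists[OF N fx] by blast
  let ?W = "{x \<in> pts M. f x \<in> fst d}" and ?U = "snd c ` (fst c \<inter> f -` fst d)"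
  have eq: "fst c \<inter> ?W = fst c \<inter> f -` fst d" using chart_subset[OF M c(1)] by auto
  have "smooth_on ?U (\<lambda>y. h (cinv d (snd d (f (cinv c y)))))"
    by (rule smooth_on_compose[OF smooth_map_in_charts(1)[OF c(1) d(1)] open_cimg[OF N d(1)] _
          smooth_fun_in_chart[OF N d(1) h] smooth_map_in_charts(2)[OF c(1) d(1)]])
      (use c in \<open>auto simp: cinv_snd[OF M]\<close>)
  then have "smooth_on ?U (\<lambda>y. h (f (cinv c y)))"
    by (rule smooth_on_cong[OF smooth_map_in_charts(1)[OF c(1) d(1)], rotated])
      (use c d in \<open>auto simp: cinv_snd[OF M] cinv_snd[OF N]\<close>)
  then show "\<exists>W. openin (mtop M) W \<and> x \<in> W \<and> smooth_on (snd c ` (fst c \<inter> W)) (\<lambda>y. h (f (cinv c y)))"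
    using openin_smooth_map_vimage[OF chart_openin[OF N d(1)]] c d chart_subset[OF M c(1)]
    by (intro exI[of _ ?W]) (auto simp: eq)
qed

text \<open>\<open>tmap\<close> is defined by the charts chosen at \<open>x\<close> and at
  \<open>f x\<close>. The local expression of \<open>f\<close> from \<open>c\<close> to the chosen
  chart at \<open>f x\<close> factors in two ways, through the chosen chart at \<open>x\<close> and
  through \<open>d\<close>; comparing the chain rule for both gives the formula in arbitrary
  charts.\<close>

lemma tmap_from_chart:
  assumes c: "c \<in> atlas M" "x \<in> fst c" and d: "d \<in> atlas N" "f x \<in> fst d"
  shows "tmap M N f x (from_chart M c x v) = from_chart N d (f x) (FD (\<lambda>y. snd d (f (cinv c y))) (snd c x) v)"
proof -
  define a b where "a = chart_at M x" and "b = chart_at N (f x)"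
  have a: "a \<in> atlas M" "x \<in> fst a" unfolding a_def by (rule chart_at_point[OF M c])+
  have b: "b \<in> atlas N" "f x \<in> fst b" unfolding b_def by (rule chart_at_point[OF N d])+
  let ?W = "fst a \<inter> {x \<in> pts M. f x \<in> fst b} \<inter> {x \<in> pts M. f x \<in> fst d}"
  let ?U = "snd c ` (fst c \<inter> ?W)"
  have U: "open ?U" "snd c x \<in> ?U"
    using open_chart_image[OF M c(1) openin_Int[OF openin_Int[OF chart_openin[OF M a(1)]
            openin_smooth_map_vimage[OF chart_openin[OF N b(1)]]] openin_smooth_map_vimage[OF chart_openin[OF N d(1)]]]]
      a b c d chart_subset[OF M c(1)] by auto
  have diff: "(\<lambda>y. snd e' (f (cinv e y))) differentiable (at (snd e x))"
    if "e \<in> atlas M" "x \<in> fst e" "e' \<in> atlas N" "f x \<in> fst e'" for e e'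
    by (rule smooth_on_differentiable[OF smooth_map_in_charts(2)[OF that(1,3)]]) (use that in auto)
  have diffM: "(\<lambda>y. snd a (cinv c y)) differentiable (at (snd c x))"
    by (rule smooth_on_differentiable[OF transition(2)[OF M c(1) a(1)]]) (use a c in auto)
  have diffN: "(\<lambda>y. snd b (cinv d y)) differentiable (at (snd d (f x)))"
    by (rule smooth_on_differentiable[OF transition(2)[OF N d(1) b(1)]]) (use b d in auto)
  have "FD (\<lambda>y. snd b (f (cinv a (snd a (cinv c y))))) (snd c x) v =
      FD (\<lambda>y. snd b (f (cinv a y))) (snd a x) (FD (\<lambda>y. snd a (cinv c y)) (snd c x) v)"
    using FD_compose[OF diffM, of "\<lambda>y. snd b (f (cinv a y))" v] diff[OF a b] c by (simp add: cinv_snd[OF M])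
  moreover have "FD (\<lambda>y. snd b (cinv d (snd d (f (cinv c y))))) (snd c x) v =
      FD (\<lambda>y. snd b (cinv d y)) (snd d (f x)) (FD (\<lambda>y. snd d (f (cinv c y))) (snd c x) v)"
    using FD_compose[OF diff[OF c d], of "\<lambda>y. snd b (cinv d y)" v] diffN c by (simp add: cinv_snd[OF M])
  moreover have "FD (\<lambda>y. snd b (f (cinv a (snd a (cinv c y))))) (snd c x) = FD (\<lambda>y. snd b (cinv d (snd d (f (cinv c y))))) (snd c x)"
    by (rule FD_cong[OF U]) (use a b c d in \<open>auto simp: cinv_snd[OF M] cinv_snd[OF N]\<close>)
  ultimately show ?thesis
    by (simp add: tmap_def from_chart_def chart_change_eq_FD[OF M] chart_change_eq_FD[OF N] o_def flip: a_def b_def)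
qed

lemma to_chart_tmap:
  assumes c: "c \<in> atlas M" "x \<in> fst c" and d: "d \<in> atlas N" "f x \<in> fst d"
  shows "to_chart N d (f x) (tmap M N f x v) = FD (\<lambda>y. snd d (f (cinv c y))) (snd c x) (to_chart M c x v)"
  using tmap_from_chart[OF assms, of "to_chart M c x v"] assms by (simp add: from_to_chart[OF M] to_from_chart[OF N])

lemma linear_tmap:
  assumes "x \<in> pts M"
  shows "linear (tmap M N f x)"
proof -
  obtain c where c: "c \<in> atlas M" "x \<in> fst c" using chart_exists[OF M assms] by blast
  obtain d where d: "d \<in> atlas N" "f x \<in> fst d" using chart_exists[OF N smooth_map_pts[OF assms]] by blast
  have "linear (FD (\<lambda>y. snd d (f (cinv c y))) (snd c x))"
    by (rule smooth_on_linear_FD[OF smooth_map_in_charts(2)[OF c(1) d(1)]]) (use c d in auto)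
  then have "linear (from_chart N d (f x) \<circ> FD (\<lambda>y. snd d (f (cinv c y))) (snd c x) \<circ> to_chart M c x)"
    by (intro linear_compose to_chart_linear[OF M c] from_chart_linear[OF N d])
  moreover have "tmap M N f x = from_chart N d (f x) \<circ> FD (\<lambda>y. snd d (f (cinv c y))) (snd c x) \<circ> to_chart M c x"
    using tmap_from_chart[OF c d, of "to_chart M c x v" for v] by (auto simp: from_to_chart[OF M c])
  ultimately show ?thesis by simp
qed

lemma smooth_fun_form_along:
  assumes \<omega>: "diff_form N p \<omega>" and ws: "\<And>w. w \<in> set ws \<Longrightarrow> vfield_along M N f w"
  shows "smooth_fun M (\<lambda>x. \<omega> (f x) (map (\<lambda>w. w x) ws))"
proof (rule smooth_fun_localI[OF M])
  fix c x assume c: "c \<in> atlas M" "x \<in> fst c"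
  then have fx: "f x \<in> pts N" using smooth_map_pts chart_subset[OF M] by blast
  obtain d where d: "d \<in> atlas N" "f x \<in> fst d" using chart_exists[OF N fx] by blast
  let ?W = "{x \<in> pts M. f x \<in> fst d}" and ?U = "snd c ` (fst c \<inter> f -` fst d)"
  have eq: "fst c \<inter> ?W = fst c \<inter> f -` fst d" using chart_subset[OF M c(1)] by auto
  have U: "open ?U" by (rule smooth_map_in_charts(1)[OF c(1) d(1)])
  have fU: "(\<lambda>y. snd d (f (cinv c y))) ` ?U \<subseteq> cimg d" using c by (auto simp: cinv_snd[OF M])
  let ?ws = "map (\<lambda>w y. to_chart N d (f (cinv c y)) (w (cinv c y))) ws"
  have "smooth_on ?U (\<lambda>y. in_chart N d \<omega> (snd d (f (cinv c y))) (map (\<lambda>w. w y) ?ws @ []))"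
  proof (rule smooth_on_multilinear[OF U])
    show "alt_multilinear p (in_chart N d \<omega> (snd d (f (cinv c z))))" if "z \<in> ?U" for z
      using diff_formD(4)[OF N \<omega> d(1)] fU that by blast
    show "smooth_on ?U (\<lambda>z. in_chart N d \<omega> (snd d (f (cinv c z))) vs)" for vs
      by (rule smooth_on_compose[OF U open_cimg[OF N d(1)] fU diff_formD(3)[OF N \<omega> d(1)]
            smooth_map_in_charts(2)[OF c(1) d(1)]])
    show "smooth_on ?U w" if "w \<in> set ?ws" for w
      using that ws c d by (auto simp: vfield_along_def)
  qed
  then have "smooth_on ?U (\<lambda>y. \<omega> (f (cinv c y)) (map (\<lambda>w. w (cinv c y)) ws))"
  proof (rule smooth_on_cong[OF U, rotated])
    fix y assume "y \<in> ?U"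
    then have "f (cinv c y) \<in> fst d" using c by (auto simp: cinv_snd[OF M])
    from in_chart_to_chart[OF N d(1) this, of \<omega> "map (\<lambda>w. w (cinv c y)) ws"]
    show "in_chart N d \<omega> (snd d (f (cinv c y))) (map (\<lambda>w. w y) ?ws @ []) = \<omega> (f (cinv c y)) (map (\<lambda>w. w (cinv c y)) ws)"
      by (simp add: o_def)
  qed
  then show "\<exists>W. openin (mtop M) W \<and> x \<in> W \<and>
      smooth_on (snd c ` (fst c \<inter> W)) (\<lambda>y. \<omega> (f (cinv c y)) (map (\<lambda>w. w (cinv c y)) ws))"
    using openin_smooth_map_vimage[OF chart_openin[OF N d(1)]] c d chart_subset[OF M c(1)]
    by (intro exI[of _ ?W]) (auto simp: eq)
qed

lemma vfield_along_vector_field: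
  assumes v: "vector_field N v"
  shows "vfield_along M N f (\<lambda>x. if x \<in> pts M then v (f x) else 0)"
  unfolding vfield_along_def
proof (intro conjI ballI)
  fix c d assume c: "c \<in> atlas M" and d: "d \<in> atlas N"
  let ?U = "snd c ` (fst c \<inter> f -` fst d)"
  have U: "open ?U" by (rule smooth_map_in_charts(1)[OF c d])
  have "smooth_on (cimg d) (\<lambda>y. to_chart N d (cinv d y) (v (cinv d y)))"
    by (rule vector_field_in_chart[OF v d])
  then have "smooth_on ?U (\<lambda>y. to_chart N d (cinv d (snd d (f (cinv c y)))) (v (cinv d (snd d (f (cinv c y))))))"
    by (rule smooth_on_compose[OF U open_cimg[OF N d] _ _ smooth_map_in_charts(2)[OF c d], rotated])
      (use c in \<open>auto simp: cinv_snd[OF M]\<close>)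
  then show "smooth_on ?U (\<lambda>y. to_chart N d (f (cinv c y)) (if cinv c y \<in> pts M then v (f (cinv c y)) else 0))"
    by (rule smooth_on_cong[OF U, rotated])
      (use c d chart_subset[OF M c] in \<open>auto simp: cinv_snd[OF M] cinv_snd[OF N]\<close>)
qed auto

lemma vfield_along_add:
  assumes "vfield_along M N f u" "vfield_along M N f w"
  shows "vfield_along M N f (\<lambda>x. u x + w x)"
  unfolding vfield_along_def
proof (intro conjI ballI)
  fix c d assume c: "c \<in> atlas M" and d: "d \<in> atlas N"
  let ?U = "snd c ` (fst c \<inter> f -` fst d)"
  have U: "open ?U" by (rule smooth_map_in_charts(1)[OF c d])
  have "smooth_on ?U (\<lambda>y. to_chart N d (f (cinv c y)) (u (cinv c y)) + to_chart N d (f (cinv c y)) (w (cinv c y)))"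
    using assms c d by (intro smooth_on_add U) (auto simp: vfield_along_def)
  then show "smooth_on ?U (\<lambda>y. to_chart N d (f (cinv c y)) (u (cinv c y) + w (cinv c y)))"
    by (rule smooth_on_cong[OF U, rotated])
      (use c d in \<open>auto simp: cinv_snd[OF M] linear_add[OF to_chart_linear[OF N d]]\<close>)
qed (use assms in \<open>auto simp: vfield_along_def\<close>)

lemma vfield_along_tmap:
  assumes X: "vector_field M X"
  shows "vfield_along M N f (\<lambda>x. if x \<in> pts M then tmap M N f x (X x) else 0)"
  unfolding vfield_along_def
proof (intro conjI ballI)
  fix c d assume c: "c \<in> atlas M" and d: "d \<in> atlas N"
  let ?U = "snd c ` (fst c \<inter> f -` fst d)"
  have U: "open ?U" by (rule smooth_map_in_charts(1)[OF c d])
  have "smooth_on (cimg c) (\<lambda>y. to_chart M c (cinv c y) (X (cinv c y)))"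
    by (rule vector_field_in_chart[OF X c])
  then have "smooth_on ?U (\<lambda>y. FD (\<lambda>y. snd d (f (cinv c y))) y (to_chart M c (cinv c y) (X (cinv c y))))"
    by (intro smooth_on_FD_apply U smooth_map_in_charts(2)[OF c d]) (auto elim: smooth_on_subset)
  then show "smooth_on ?U (\<lambda>y. to_chart N d (f (cinv c y)) (if cinv c y \<in> pts M then tmap M N f (cinv c y) (X (cinv c y)) else 0))"
    by (rule smooth_on_cong[OF U, rotated])
      (use c d chart_subset[OF M c] in \<open>auto simp: cinv_snd[OF M] to_chart_tmap\<close>)
qed auto

end

text \<open>The definition asks for the components in one chart as functions of the coordinates of
  another; composing with the transition map reduces this to a single chart.\<close>

lemma vector_fieldI:
  assumes M: "manifold M" and "\<And>x. x \<notin> pts M \<Longrightarrow> X x = 0"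
    and X: "\<And>d. d \<in> atlas M \<Longrightarrow> smooth_on (cimg d) (\<lambda>y. to_chart M d (cinv d y) (X (cinv d y)))"
  shows "vector_field M X"
  unfolding vector_field_def vfield_along_def
proof (intro conjI ballI allI impI)
  fix c d assume c: "c \<in> atlas M" and d: "d \<in> atlas M"
  let ?U = "snd c ` (fst c \<inter> fst d)"
  have "smooth_on ?U (\<lambda>y. to_chart M d (cinv d (snd d (cinv c y))) (X (cinv d (snd d (cinv c y)))))"
    by (rule smooth_on_compose[OF transition(1)[OF M c d] open_cimg[OF M d] _ X[OF d] transition(2)[OF M c d]])
      (auto simp: cinv_snd[OF M c])
  then have "smooth_on ?U (\<lambda>y. to_chart M d (cinv c y) (X (cinv c y)))"
    by (rule smooth_on_cong[OF transition(1)[OF M c d], rotated]) (auto simp: cinv_snd[OF M c] cinv_snd[OF M d])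
  then show "smooth_on (snd c ` (fst c \<inter> (\<lambda>x. x) -` fst d)) (\<lambda>y. to_chart M d (cinv c y) (X (cinv c y)))" by simp
qed (use assms in simp)

subsection \<open>Cut-off functions and partitions of unity\<close>

text \<open>A bump in a chart is extended by zero. The extension is smooth because the part
  \<open>K\<close> of the chart that contains the support is closed in all of \<open>M\<close>: it
  is compact and \<open>M\<close> is Hausdorff.\<close>

lemma manifold_bump:
  fixes M :: "('a, 'e::euclidean_space) mfd"
  assumes M: "manifold M" and W: "openin (mtop M) W" and x: "x \<in> W"
  obtains b V c where "smooth_fun M b" "\<forall>z. 0 \<le> b z \<and> b z \<le> 1"
    "openin (mtop M) V" "x \<in> V" "\<forall>z\<in>V. b z = 1"
    "c \<in> atlas M" "mtop M closure_of {z \<in> pts M. b z \<noteq> 0} \<subseteq> fst c \<inter> W"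
proof -
  have xM: "x \<in> pts M" using W x openin_subset by blast
  obtain c where c: "c \<in> atlas M" "x \<in> fst c" using chart_exists[OF M xM] by blast
  have "open (snd c ` (fst c \<inter> W))" by (rule open_chart_image[OF M c(1) W])
  moreover have "snd c x \<in> snd c ` (fst c \<inter> W)" using c x by simp
  ultimately obtain e where e: "e > 0" "cball (snd c x) e \<subseteq> snd c ` (fst c \<inter> W)"
    using open_contains_cball_eq by metis
  define r where "r = e / 2"
  have r: "r > 0" "cball (snd c x) (2 * r) \<subseteq> snd c ` (fst c \<inter> W)" using e by (auto simp: r_def)
  obtain \<beta> :: "'e \<Rightarrow> real" where \<beta>: "smooth_on UNIV \<beta>" "\<And>y. 0 \<le> \<beta> y" "\<And>y. \<beta> y \<le> 1"
    "\<And>y. dist (snd c x) y \<le> r \<Longrightarrow> \<beta> y = 1" "\<And>y. 2 * r \<le> dist (snd c x) y \<Longrightarrow> \<beta> y = 0"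
    using smooth_bump[OF r(1)] by blast
  define b where "b z = (if z \<in> fst c then \<beta> (snd c z) else 0)" for z
  define K where "K = cinv c ` cball (snd c x) (2 * r)"
  have K_sub: "K \<subseteq> fst c \<inter> W" 
  proof
    fix z assume "z \<in> K"
    then obtain y where "y \<in> snd c ` (fst c \<inter> W)" "z = cinv c y" unfolding K_def using r(2) by blast
    then show "z \<in> fst c \<inter> W" by (auto simp: cinv_snd[OF M c(1)])
  qed
  have K: "closedin (mtop M) K"
  proof (rule compactin_imp_closedin)
    have "compactin (top_of_set (cimg c)) (cball (snd c x) (2 * r))"
      using r(2) by (auto simp: compactin_subtopology)
    then show "compactin (mtop M) K"
      unfolding K_def using image_compactin[OF _ continuous_map_cinv[OF M c(1)]] by blast
  qed (use M in \<open>simp add: manifold_def\<close>)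
  have b0: "b z = 0" if "z \<notin> K" for z
  proof (cases "z \<in> fst c")
    case True
    then have "snd c z \<notin> cball (snd c x) (2 * r)"
      using that unfolding K_def by (metis M c(1) cinv_snd image_eqI)
    then show ?thesis using \<beta>(5) True by (simp add: b_def)
  qed (simp add: b_def)
  show ?thesis
  proof
    show "smooth_fun M b"
    proof (rule smooth_fun_localI[OF M])
      fix d z assume d: "d \<in> atlas M" "z \<in> fst d"
      show "\<exists>W. openin (mtop M) W \<and> z \<in> W \<and> smooth_on (snd d ` (fst d \<inter> W)) (\<lambda>y. b (cinv d y))"
      proof (cases "z \<in> fst c")
        case True
        have "smooth_on (snd d ` (fst d \<inter> fst c)) (\<lambda>y. \<beta> (snd c (cinv d y)))"
          by (rule smooth_on_compose[OF transition(1)[OF M d(1) c(1)] open_UNIV _ \<beta>(1) transition(2)[OF M d(1) c(1)]]) simp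
        then have "smooth_on (snd d ` (fst d \<inter> fst c)) (\<lambda>y. b (cinv d y))"
          by (rule smooth_on_cong[OF transition(1)[OF M d(1) c(1)], rotated])
            (auto simp: b_def cinv_snd[OF M d(1)])
        then show ?thesis using True chart_openin[OF M c(1)] by blast
      next
        case False
        have W: "openin (mtop M) (pts M - K)" using K by blast
        have "smooth_on (snd d ` (fst d \<inter> (pts M - K))) (\<lambda>y. b (cinv d y))"
          by (rule smooth_on_cong[OF open_chart_image[OF M d(1) W] _ smooth_on_const[of _ 0]])
            (auto simp: b0 cinv_snd[OF M d(1)])
        then show ?thesis using W False K_sub d chart_subset[OF M d(1)] by blast
      qed
    qed
    show "\<forall>z. 0 \<le> b z \<and> b z \<le> 1" using \<beta>(2,3) by (auto simp: b_def)
    show "openin (mtop M) (fst c \<inter> snd c -` ball (snd c x) r)"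
      by (rule openin_chart_vimage[OF M c(1) open_ball])
    show "x \<in> fst c \<inter> snd c -` ball (snd c x) r" using c r by simp
    show "\<forall>z\<in>fst c \<inter> snd c -` ball (snd c x) r. b z = 1"
      using \<beta>(4) by (simp add: b_def)
    have "mtop M closure_of {z \<in> pts M. b z \<noteq> 0} \<subseteq> K"
      by (rule closure_of_minimal[OF _ K]) (use b0 in auto)
    then show "mtop M closure_of {z \<in> pts M. b z \<noteq> 0} \<subseteq> fst c \<inter> W" using K_sub by blast
  qed (use c in auto)
qed

text \<open>From functions \<open>b\<^sub>1, b\<^sub>2, \<dots>\<close> with values in \<open>[0, 1]\<close> one passes to \<open>b\<^sub>1, (1 - b\<^sub>1) b\<^sub>2, \<dots>\<close>, whose sum is
  \<open>1 - \<Prod>\<^sub>i (1 - b\<^sub>i)\<close>; this avoids dividing by the sum.\<close>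

lemma telescoped_bumps:
  fixes M :: "('a, 'e::euclidean_space) mfd"
  assumes M: "manifold M"
    and L: "\<And>c b. (c, b) \<in> set L \<Longrightarrow> c \<in> atlas M \<and> smooth_fun M b \<and> (\<forall>z. 0 \<le> b z \<and> b z \<le> 1) \<and>
      mtop M closure_of {z \<in> pts M. b z \<noteq> 0} \<subseteq> fst c"
  shows "\<exists>P. (\<forall>(c, \<rho>)\<in>set P. c \<in> atlas M \<and> smooth_fun M \<rho> \<and> (\<forall>x\<in>pts M. 0 \<le> \<rho> x) \<and>
      mtop M closure_of {x \<in> pts M. \<rho> x \<noteq> 0} \<subseteq> fst c) \<and>
    (\<forall>x. (\<Sum>(c, \<rho>)\<leftarrow>P. \<rho> x) = 1 - (\<Prod>(c, b)\<leftarrow>L. 1 - b x))"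
  using L
proof (induction L)
  case Nil
  show ?case by (rule exI[of _ "[]"]) simp
next
  case (Cons a L)
  obtain c b where a: "a = (c, b)" by (cases a)
  have b: "c \<in> atlas M" "smooth_fun M b" "\<And>z. 0 \<le> b z" "\<And>z. b z \<le> 1"
    "mtop M closure_of {z \<in> pts M. b z \<noteq> 0} \<subseteq> fst c"
    using Cons.prems[of c b] a by auto
  have "\<exists>P. (\<forall>(c, \<rho>)\<in>set P. c \<in> atlas M \<and> smooth_fun M \<rho> \<and> (\<forall>x\<in>pts M. 0 \<le> \<rho> x) \<and>
      mtop M closure_of {x \<in> pts M. \<rho> x \<noteq> 0} \<subseteq> fst c) \<and>
    (\<forall>x. (\<Sum>(c, \<rho>)\<leftarrow>P. \<rho> x) = 1 - (\<Prod>(c, b)\<leftarrow>L. 1 - b x))"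
    by (rule Cons.IH, rule Cons.prems) simp
  then obtain P where P0: "\<forall>(c, \<rho>)\<in>set P. c \<in> atlas M \<and> smooth_fun M \<rho> \<and> (\<forall>x\<in>pts M. 0 \<le> \<rho> x) \<and>
      mtop M closure_of {x \<in> pts M. \<rho> x \<noteq> 0} \<subseteq> fst c"
    and P2: "\<And>x. (\<Sum>(c, \<rho>)\<leftarrow>P. \<rho> x) = 1 - (\<Prod>(c, b)\<leftarrow>L. 1 - b x)" by (elim exE conjE) blast
  have P1: "c \<in> atlas M \<and> smooth_fun M \<rho> \<and> (\<forall>x\<in>pts M. 0 \<le> \<rho> x) \<and>
      mtop M closure_of {x \<in> pts M. \<rho> x \<noteq> 0} \<subseteq> fst c" if "(c, \<rho>) \<in> set P" for c \<rho>
    using bspec[OF P0 that] by simp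
  let ?P = "(c, b) # map (\<lambda>(d, \<rho>). (d, \<lambda>x. (1 - b x) * \<rho> x)) P"
  have sum: "(\<Sum>(d, \<rho>)\<leftarrow>map (\<lambda>(d, \<rho>). (d, \<lambda>x. (1 - b x) * \<rho> x)) P. \<rho> x) = (1 - b x) * (\<Sum>(d, \<rho>)\<leftarrow>P. \<rho> x)" for x
    by (simp add: case_prod_unfold o_def sum_list_const_mult)
  have "(\<Sum>(d, \<rho>)\<leftarrow>?P. \<rho> x) = 1 - (\<Prod>(c, b)\<leftarrow>a # L. 1 - b x)" for x
    using sum[of x] P2[of x] by (simp add: a algebra_simps)
  moreover have "\<forall>(d, \<rho>)\<in>set ?P. d \<in> atlas M \<and> smooth_fun M \<rho> \<and> (\<forall>x\<in>pts M. 0 \<le> \<rho> x) \<and>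
      mtop M closure_of {x \<in> pts M. \<rho> x \<noteq> 0} \<subseteq> fst d"
  proof safe
    fix d \<rho> assume "(d, \<rho>) \<in> set ?P"
    then consider "d = c" "\<rho> = b" | \<sigma> where "(d, \<sigma>) \<in> set P" "\<rho> = (\<lambda>x. (1 - b x) * \<sigma> x)" by auto
    then have "d \<in> atlas M \<and> smooth_fun M \<rho> \<and> (\<forall>x\<in>pts M. 0 \<le> \<rho> x) \<and>
        mtop M closure_of {x \<in> pts M. \<rho> x \<noteq> 0} \<subseteq> fst d"
    proof cases
      case 1
      then show ?thesis using b by simp
    next
      case 2
      have "mtop M closure_of {x \<in> pts M. \<rho> x \<noteq> 0} \<subseteq> mtop M closure_of {x \<in> pts M. \<sigma> x \<noteq> 0}"
        by (rule closure_of_mono) (auto simp: 2(2))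
      then show ?thesis
        using P1[OF 2(1)] b unfolding 2(2)
        by (auto intro!: smooth_fun_mult[OF M] smooth_fun_diff[OF M] smooth_fun_const[OF M])
    qed
    then show "d \<in> atlas M" "smooth_fun M \<rho>" "\<And>x. x \<in> pts M \<Longrightarrow> 0 \<le> \<rho> x"
      "\<And>x. x \<in> mtop M closure_of {x \<in> pts M. \<rho> x \<noteq> 0} \<Longrightarrow> x \<in> fst d" by auto
  qed
  ultimately show ?case by blast
qed

lemma partition_of_unity_exists:
  fixes M :: "('a, 'e::euclidean_space) mfd"
  assumes M: "manifold M" and compact: "compact_space (mtop M)"
  shows "\<exists>P. partition_of_unity M P"
proof -
  define Q where "Q x b V c \<longleftrightarrow> smooth_fun M b \<and> (\<forall>z. 0 \<le> b z \<and> b z \<le> 1) \<and>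
    openin (mtop M) V \<and> x \<in> V \<and> (\<forall>z\<in>V. b z = 1) \<and>
    c \<in> atlas M \<and> mtop M closure_of {z \<in> pts M. b z \<noteq> 0} \<subseteq> fst c" for x b V c
  have "\<forall>x\<in>pts M. \<exists>t. Q x (fst t) (fst (snd t)) (snd (snd t))"
  proof
    fix x assume "x \<in> pts M"
    then obtain b V c where "smooth_fun M b" "\<forall>z. 0 \<le> b z \<and> b z \<le> 1"
      "openin (mtop M) V" "x \<in> V" "\<forall>z\<in>V. b z = 1"
      "c \<in> atlas M" "mtop M closure_of {z \<in> pts M. b z \<noteq> 0} \<subseteq> fst c \<inter> pts M"
      by (rule manifold_bump[OF M openin_topspace])
    then have "Q x b V c" by (simp add: Q_def)
    then show "\<exists>t. Q x (fst t) (fst (snd t)) (snd (snd t))" by (intro exI[of _ "(b, V, c)"]) simp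
  qed
  from bchoice[OF this] obtain t where t: "\<forall>x\<in>pts M. Q x (fst (t x)) (fst (snd (t x))) (snd (snd (t x)))"
    by blast
  define b V c where "b x = fst (t x)" and "V x = fst (snd (t x))" and "c x = snd (snd (t x))" for x
  have *: "\<And>x. x \<in> pts M \<Longrightarrow> smooth_fun M (b x)" "\<And>x z. x \<in> pts M \<Longrightarrow> 0 \<le> b x z \<and> b x z \<le> 1"
    "\<And>x. x \<in> pts M \<Longrightarrow> openin (mtop M) (V x)" "\<And>x. x \<in> pts M \<Longrightarrow> x \<in> V x"
    "\<And>x z. x \<in> pts M \<Longrightarrow> z \<in> V x \<Longrightarrow> b x z = 1"
    "\<And>x. x \<in> pts M \<Longrightarrow> c x \<in> atlas M" "\<And>x. x \<in> pts M \<Longrightarrow> mtop M closure_of {z \<in> pts M. b x z \<noteq> 0} \<subseteq> fst (c x)"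
    using t by (simp_all add: Q_def b_def V_def c_def)
  have "\<exists>\<F>. finite \<F> \<and> \<F> \<subseteq> V ` pts M \<and> pts M \<subseteq> \<Union>\<F>"
    using compact *(3,4) unfolding compact_space_def compactin_def
    by (elim conjE allE[of _ "V ` pts M"] impE) auto
  then obtain F where F: "finite F" "F \<subseteq> pts M" "pts M \<subseteq> \<Union>(V ` F)"
    using finite_subset_image by metis
  obtain xs where xs: "set xs = F" using finite_list[OF F(1)] by blast
  let ?L = "map (\<lambda>x. (c x, b x)) xs"
  obtain P where P: "\<forall>(c, \<rho>)\<in>set P. c \<in> atlas M \<and> smooth_fun M \<rho> \<and> (\<forall>x\<in>pts M. 0 \<le> \<rho> x) \<and>
      mtop M closure_of {x \<in> pts M. \<rho> x \<noteq> 0} \<subseteq> fst c"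
    "\<And>x. (\<Sum>(c, \<rho>)\<leftarrow>P. \<rho> x) = 1 - (\<Prod>(c, b)\<leftarrow>?L. 1 - b x)"
  proof -
    have "e \<in> atlas M \<and> smooth_fun M a \<and> (\<forall>z. 0 \<le> a z \<and> a z \<le> 1) \<and>
      mtop M closure_of {z \<in> pts M. a z \<noteq> 0} \<subseteq> fst e" if ea: "(e, a) \<in> set ?L" for e a
    proof -
      obtain x where "x \<in> F" "e = c x" "a = b x" using ea xs by auto
      moreover from this have "x \<in> pts M" using F(2) by blast
      ultimately show ?thesis using * by simp
    qed
    then have "\<exists>P. (\<forall>(c, \<rho>)\<in>set P. c \<in> atlas M \<and> smooth_fun M \<rho> \<and> (\<forall>x\<in>pts M. 0 \<le> \<rho> x) \<and>
        mtop M closure_of {x \<in> pts M. \<rho> x \<noteq> 0} \<subseteq> fst c) \<and>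
      (\<forall>x. (\<Sum>(c, \<rho>)\<leftarrow>P. \<rho> x) = 1 - (\<Prod>(c, b)\<leftarrow>?L. 1 - b x))"
      by (rule telescoped_bumps[OF M])
    then show ?thesis by (elim exE conjE) (rule that, assumption, erule spec)
  qed
  \<comment> \<open>Every point lies in some \<open>V y\<close> on which \<open>b y\<close> is 1, so
    one factor vanishes and the functions in \<open>P\<close> add up to 1.\<close>
  have "(\<Prod>(c, b)\<leftarrow>?L. 1 - b x) = 0" if xM: "x \<in> pts M" for x
  proof -
    obtain y where "y \<in> F" "x \<in> V y" using F(3) xM by blast
    then show ?thesis using *(5)[of y x] F(2) xs by (auto simp: prod_list_zero_iff image_iff subset_eq intro!: bexI[of _ y])
  qed
  then have "\<forall>x\<in>pts M. (\<Sum>(c, \<rho>)\<leftarrow>P. \<rho> x) = 1" using P(2) by simp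
  with P(1) show ?thesis unfolding partition_of_unity_def by blast
qed

subsection \<open>Change of variables\<close>

text \<open>Relabelling the coordinates maps boxes to boxes of the same content. As \<open>F\<close>
  vanishes off a box, the integral over the whole space is one over that box.\<close>

lemma has_integral_reindex:
  fixes h :: "'j::finite \<Rightarrow> 'k::finite" and F :: "real^'k \<Rightarrow> real"
  assumes h: "bij h" and F: "(F has_integral i) UNIV" and 0: "\<And>x. x \<notin> cbox a b \<Longrightarrow> F x = 0"
  shows "((\<lambda>y :: real^'j. F (\<chi> k. y $ inv h k)) has_integral i) UNIV"
proof -
  let ?g = "\<lambda>y :: real^'j. (\<chi> k. y $ inv h k) :: real^'k" and ?h = "\<lambda>x :: real^'k. (\<chi> j. x $ h j) :: real^'j"
  have inv: "h (inv h k) = k" "inv h (h j) = j" for k j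
    using h by (simp_all add: bij_is_inj bij_is_surj surj_f_inv_f)
  have gh: "?h (?g y) = y" "?g (?h x) = x" for x y by (simp_all add: vec_eq_iff inv)
  have box: "?g ` cbox u v = cbox (?g u) (?g v)" "?h ` cbox u' v' = cbox (?h u') (?h v')" for u v u' v'
  proof -
    have "?g y \<in> cbox (?g u) (?g v)" if "y \<in> cbox u v" for y u v
      using that by (simp add: mem_box_cart)
    moreover have h_in: "?h x \<in> cbox (?h u') (?h v')" if "x \<in> cbox u' v'" for x u' v'
      using that by (simp add: mem_box_cart)
    moreover have "x \<in> ?g ` cbox u v" if "x \<in> cbox (?g u) (?g v)" for x
      using h_in[OF that] gh by (intro image_eqI[of _ _ "?h x"]) simp_all
    moreover have "y \<in> ?h ` cbox u' v'" if "y \<in> cbox (?h u') (?h v')" for y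
    proof (rule image_eqI[of _ _ "?g y"])
      show "?g y \<in> cbox u' v'"
        unfolding mem_box_cart
      proof
        fix k show "u' $ k \<le> ?g y $ k \<and> ?g y $ k \<le> v' $ k"
          using that[unfolded mem_box_cart, THEN spec, of "inv h k"] by (simp add: inv)
      qed
    qed (simp add: inv)
    ultimately show "?g ` cbox u v = cbox (?g u) (?g v)" "?h ` cbox u' v' = cbox (?h u') (?h v')" by blast+
  qed
  have content: "measure lborel (?g ` cbox u v) = 1 * measure lborel (cbox u v)" for u v
  proof (cases "cbox u v = {}")
    case False
    then have "cbox (?g u) (?g v) \<noteq> {}" using box(1)[of u v] by blast
    then have "measure lborel (?g ` cbox u v) = (\<Prod>k\<in>UNIV. v $ inv h k - u $ inv h k)"
      by (simp add: box(1) content_cbox_cart)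
    also have "\<dots> = (\<Prod>j\<in>UNIV. v $ j - u $ j)"
      by (rule prod.reindex_bij_betw[OF bij_imp_bij_inv[OF h], of "\<lambda>j. v $ j - u $ j"])
    also have "\<dots> = measure lborel (cbox u v)" using False by (simp add: content_cbox_cart)
    finally show ?thesis by simp
  qed simp
  have "(F has_integral i) (cbox a b)"
  proof -
    have "(\<lambda>x. if x \<in> cbox a b then F x else 0) = F" using 0 by auto
    then show ?thesis using F has_integral_restrict_UNIV[of "cbox a b" F i] by simp
  qed
  then have "((\<lambda>y. F (?g y)) has_integral (1 / 1) *\<^sub>R i) (?h ` cbox a b)"
  proof (rule has_integral_twiddle[rotated -1])
    have "linear ?g" by (rule linearI) (simp_all add: vec_eq_iff)
    then show "continuous (at x) ?g" for x by (simp add: linear_continuous_at linear_conv_bounded_linear)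
  qed (use gh box content in \<open>auto intro: exI\<close>)
  then have "((\<lambda>y. F (?g y)) has_integral i) (?h ` cbox a b)" by simp
  then show ?thesis
  proof (rule has_integral_on_superset)
    show "F (?g y) = 0" if "y \<notin> ?h ` cbox a b" for y
    proof (rule 0)
      show "?g y \<notin> cbox a b" using that gh(1)[of y] by (metis image_eqI)
    qed
  qed simp
qed

text \<open>The determinant is the factor by which a linear map scales alternating forms of top
  degree, a description that does not mention the index type. A form is transported along the
  relabelling and the two factors are compared.\<close>

lemma det_matrix_reindex:
  fixes h :: "'j::finite \<Rightarrow> 'k::finite" and L :: "real^'k \<Rightarrow> real^'k"
  assumes h: "bij h" and L: "linear L"
  shows "det (matrix (\<lambda>y :: real^'j. (\<chi> j. L (\<chi> k. y $ inv h k) $ h j) :: real^'j)) = det (matrix L)"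
proof -
  let ?T' = "\<lambda>y :: real^'j. (\<chi> k. y $ inv h k) :: real^'k" and ?T = "\<lambda>x :: real^'k. (\<chi> j. x $ h j) :: real^'j"
  let ?A = "\<lambda>y. ?T (L (?T' y))"
  have inv: "h (inv h k) = k" "inv h (h j) = j" for k j
    using h by (simp_all add: bij_is_inj bij_is_surj surj_f_inv_f)
  have TT: "?T (?T' y) = y" "?T' (?T x) = x" for x y by (simp_all add: vec_eq_iff inv)
  have T: "linear ?T" "linear ?T'" by (auto intro!: linearI simp: vec_eq_iff)
  have A: "linear ?A" using linear_compose[OF linear_compose[OF T(2) L] T(1)] by (simp add: o_def)
  have card: "CARD('j) = CARD('k)" using h bij_betw_same_card by blast
  obtain D :: "(real^'j) list \<Rightarrow> real" where D: "alt_multilinear CARD('j) D" "D basis_list = 1"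
    using det_form_exists by blast
  define D' where "D' vs = D (map ?T vs)" for vs
  have D': "alt_multilinear CARD('k) D'"
    using alt_multilinear_map[OF D(1) T(1)] card by (simp add: D'_def[abs_def])
  have D'0: "D' basis_list \<noteq> 0"
  proof
    assume "D' basis_list = 0"
    then have "D' (map ?T' basis_list) = 0" using alt_multilinear_top_zero[of D'] D' by simp
    then show False by (simp add: D'_def o_def inv D(2))
  qed
  have "D (map ?A vs) = det (matrix ?A) * D vs" for vs
  proof -
    have "(\<lambda>vs. D (map ?A vs)) = (\<lambda>vs. det (matrix ?A) * D vs)"
      by (rule alt_multilinear_top_eqI)
        (use alt_multilinear_map[OF D(1) A] alt_multilinear_cmult[OF D(1)] alt_multilinear_top_det[OF D(1) A] in simp_all)
    then show ?thesis by meson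
  qed
  from this[of "map ?T basis_list"] have "D' (map L basis_list) = det (matrix ?A) * D' basis_list"
    by (simp add: D'_def o_def inv)
  moreover have "D' (map L basis_list) = det (matrix L) * D' basis_list"
    by (rule alt_multilinear_top_det[OF D' L])
  ultimately show ?thesis using D'0 by simp
qed

lemma absolutely_integrable_compact_support:
  fixes F :: "'a::euclidean_space \<Rightarrow> 'b::euclidean_space"
  assumes F: "continuous_on UNIV F" and C: "bounded C" and 0: "\<And>x. x \<notin> C \<Longrightarrow> F x = 0" and A: "C \<subseteq> A"
  shows "F absolutely_integrable_on A"
proof -
  obtain a b where ab: "C \<subseteq> cbox a b" using bounded_subset_cbox_symmetric[OF C] by blast
  have "F absolutely_integrable_on cbox a b"
    by (rule absolutely_integrable_continuous) (use F continuous_on_subset in blast)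
  moreover have "(\<lambda>x. if x \<in> B then F x else 0) = F" if "C \<subseteq> B" for B
    using that 0 by (auto simp: fun_eq_iff)
  ultimately show ?thesis
    using absolutely_integrable_restrict_UNIV[of "cbox a b" F] absolutely_integrable_restrict_UNIV[of A F] ab A by simp
qed

lemma continuous_on_zero_extension:
  fixes f :: "'a::t2_space \<Rightarrow> 'b::real_normed_vector"
  assumes "open V" "continuous_on V f" "compact C" "C \<subseteq> V" "\<And>x. x \<in> V - C \<Longrightarrow> f x = 0"
  shows "continuous_on UNIV (\<lambda>x. if x \<in> V then f x else 0)"
proof -
  have "continuous_on (V \<union> - C) (\<lambda>x. if x \<in> V then f x else 0)"
  proof (rule continuous_on_open_Un[OF assms(1)])
    show "open (- C)" using assms(3) by (simp add: compact_imp_closed open_Compl)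
    show "continuous_on V (\<lambda>x. if x \<in> V then f x else 0)"
      using assms(2) by (simp cong: continuous_on_cong)
    have "continuous_on (- C) (\<lambda>x. 0 :: 'b)" by (rule continuous_on_const)
    then show "continuous_on (- C) (\<lambda>x. if x \<in> V then f x else 0)"
      by (rule continuous_on_eq) (use assms(5) in auto)
  qed
  moreover have "V \<union> - C = UNIV" using assms by auto
  ultimately show ?thesis by simp
qed

text \<open>The library states the change of variables theorem for index types that are well-ordered;
  every finite index type is in bijection with one.\<close>

typedef ('a::finite) ordered_index = "{..<CARD('a)}" by (auto intro: exI[of _ 0])

instance ordered_index :: (finite) finite
proof
  have "finite (Rep_ordered_index ` (UNIV :: 'a ordered_index set))"
    by (rule finite_subset[of _ "{..<CARD('a)}"]) (use Rep_ordered_index in auto)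
  then show "finite (UNIV :: 'a ordered_index set)"
    by (rule finite_imageD) (simp add: inj_on_def Rep_ordered_index_inject)
qed

instantiation ordered_index :: (finite) wellorder
begin

definition "x \<le> y \<longleftrightarrow> Rep_ordered_index x \<le> Rep_ordered_index y"
definition "x < y \<longleftrightarrow> Rep_ordered_index x < Rep_ordered_index y"

instance
proof
  fix P :: "'a ordered_index \<Rightarrow> bool" and a
  assume step: "\<And>x. (\<And>y. y < x \<Longrightarrow> P y) \<Longrightarrow> P x"
  show "P a"
    by (induction a rule: measure_induct_rule[of Rep_ordered_index]) (rule step, simp add: less_ordered_index_def)
qed (auto simp: less_eq_ordered_index_def less_ordered_index_def Rep_ordered_index_inject)

end

lemma bij_ordered_index: "\<exists>h :: 'k::finite ordered_index \<Rightarrow> 'k. bij h"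
proof -
  have "card (UNIV :: 'k ordered_index set) = CARD('k)"
    using type_definition.card[OF type_definition_ordered_index] by simp
  then show ?thesis using finite_same_card_bij[of "UNIV :: 'k ordered_index set" "UNIV :: 'k set"] by auto
qed

text \<open>\<open>T\<close> and \<open>T'\<close> conjugate all data to the well-ordered index
  type. Moving the integrals back requires boxes off which the integrands vanish: boundedness of
  \<open>C\<close> provides one for \<open>F\<close>, and \<open>B\<close> one for the transformed
  integrand on \<open>V\<close>.\<close>

lemma change_of_variables_compact_support:
  fixes g :: "real^'k \<Rightarrow> real^'k" and F :: "real^'k \<Rightarrow> real"
  assumes V: "open V" and g: "\<And>x. x \<in> V \<Longrightarrow> (g has_derivative g' x) (at x)" and inj: "inj_on g V"
    and F: "continuous_on UNIV F" and C: "bounded C" "C \<subseteq> g ` V" "\<And>x. x \<notin> C \<Longrightarrow> F x = 0"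
    and B: "bounded {x \<in> V. F (g x) \<noteq> 0}"
  shows "integral V (\<lambda>x. \<bar>det (matrix (g' x))\<bar> * F (g x)) = integral UNIV F"
proof -
  obtain h :: "'k ordered_index \<Rightarrow> 'k" where h: "bij h" using bij_ordered_index by blast
  define T where "T x = (\<chi> j. x $ h j)" for x :: "real^'k"
  define T' where "T' y = (\<chi> k. y $ inv h k)" for y :: "real^'k ordered_index"
  have inv: "h (inv h k) = k" "inv h (h j) = j" for k j
    using h by (simp_all add: bij_is_inj bij_is_surj surj_f_inv_f)
  have TT: "T (T' y) = y" "T' (T x) = x" for x y by (simp_all add: T_def T'_def vec_eq_iff inv)
  have T: "linear T" "linear T'" by (auto intro!: linearI simp: vec_eq_iff T_def T'_def)
  then have bl: "bounded_linear T" "bounded_linear T'" by (simp_all add: linear_conv_bounded_linear)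
  have contT: "continuous_on X T'" for X using bl(2) by (rule linear_continuous_on)
  define S where "S = T ` V"
  define G where "G y = T (g (T' y))" for y
  define G' where "G' y = (\<lambda>v. T (g' (T' y) (T' v)))" for y
  \<comment> \<open>The theorem on change of variables concerns vector-valued integrands; a scalar
    enters as a vector with one component.\<close>
  define f where "f y = (vec (F (T' y)) :: real^1)" for y
  have S_eq: "S = T' -` V" using TT by (auto simp: S_def image_iff) (metis TT(1))
  have S: "open S" unfolding S_eq using V contT by (simp add: open_vimage)
  have G: "(G has_derivative G' y) (at y within S)" if "y \<in> S" for y
  proof -
    have "T' y \<in> V" using that by (simp add: S_eq)
    from has_derivative_compose[OF bounded_linear.has_derivative[OF bl(2) has_derivative_ident] g[OF this]]
    have "((\<lambda>y. g (T' y)) has_derivative (\<lambda>v. g' (T' y) (T' v))) (at y)" .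
    from bounded_linear.has_derivative[OF bl(1) this] show ?thesis
      unfolding G_def[abs_def] G'_def by (rule has_derivative_at_withinI)
  qed
  have injG: "inj_on G S"
  proof (rule inj_onI)
    fix x y assume "x \<in> S" "y \<in> S" "G x = G y"
    then have "g (T' x) = g (T' y)" by (metis G_def TT(2))
    then have "T' x = T' y" using inj \<open>x \<in> S\<close> \<open>y \<in> S\<close> by (auto simp: S_eq dest: inj_onD)
    then show "x = y" by (metis TT(1))
  qed
  have contf: "continuous_on UNIV f"
  proof -
    have "continuous_on UNIV (\<lambda>y. F (T' y))"
      by (rule continuous_on_compose2[OF F contT]) simp
    then have "continuous_on UNIV (\<lambda>y. (\<chi> i. F (T' y)) :: real^1)"
      by (intro continuous_on_vec_lambda)
    then show ?thesis unfolding f_def[abs_def] vec_def .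
  qed
  have suppf: "f y = 0" if "y \<notin> T ` C" for y
  proof -
    have "T' y \<notin> C" using that TT(1)[of y] by (metis image_eqI)
    then show ?thesis using C(3) by (simp add: f_def vec_eq_iff)
  qed
  have bC: "bounded (T ` C)" using bounded_linear_image[OF C(1) bl(1)] .
  have CG: "T ` C \<subseteq> G ` S"
  proof
    fix y assume "y \<in> T ` C"
    then obtain x where "x \<in> V" "y = T (g x)" using C(2) by blast
    then show "y \<in> G ` S" unfolding S_def G_def by (intro image_eqI[of _ _ "T x"]) (simp_all add: TT)
  qed
  have absf: "f absolutely_integrable_on (G ` S)" "f absolutely_integrable_on UNIV"
    using absolutely_integrable_compact_support[OF contf bC suppf] CG by auto
  have key: "(\<lambda>y. \<bar>det (matrix (G' y))\<bar> *\<^sub>R f (G y)) absolutely_integrable_on S \<and>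
      integral S (\<lambda>y. \<bar>det (matrix (G' y))\<bar> *\<^sub>R f (G y)) = integral (G ` S) f"
    using has_absolute_integral_change_of_variables[OF _ G injG, of f "integral (G ` S) f"] S absf(1)
    by (simp add: lborelD)
  have intf: "integral (G ` S) f = integral UNIV f"
  proof -
    have "(\<lambda>y. if y \<in> G ` S then f y else 0) = f" using suppf CG by (auto simp: fun_eq_iff)
    then show ?thesis using Henstock_Kurzweil_Integration.integral_restrict_UNIV[of "G ` S" f] by simp
  qed
  have comp: "(f y) $ 1 = F (T' y)" for y by (simp add: f_def)
  define f1 where "f1 x = (if x \<in> V then \<bar>det (matrix (g' x))\<bar> * F (g x) else 0)" for x
  have linV: "linear (g' x)" if "x \<in> V" for x using has_derivative_linear[OF g[OF that]] .
  have det: "det (matrix (G' y)) = det (matrix (g' (T' y)))" if "y \<in> S" for y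
    using det_matrix_reindex[OF h linV, of "T' y"] that by (simp add: G'_def T_def[abs_def] T'_def[abs_def] S_eq)
  have "((\<lambda>y. (\<bar>det (matrix (G' y))\<bar> *\<^sub>R f (G y)) $ 1) has_integral integral UNIV f $ 1) S"
    using has_integral_linear[OF integrable_integral bounded_linear_vec_nth[of 1],
        of "\<lambda>y. \<bar>det (matrix (G' y))\<bar> *\<^sub>R f (G y)" S] key intf
    by (simp add: absolutely_integrable_on_def o_def)
  then have "((\<lambda>y. f1 (T' y)) has_integral integral UNIV f $ 1) S"
    by (rule has_integral_cong[THEN iffD1, rotated]) (simp add: f1_def S_eq det comp G_def TT)
  then have "((\<lambda>y. f1 (T' y)) has_integral integral UNIV f $ 1) UNIV"
    by (rule has_integral_on_superset) (auto simp: f1_def S_eq)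
  moreover obtain a b where "{x \<in> V. F (g x) \<noteq> 0} \<subseteq> cbox a b" using bounded_subset_cbox_symmetric[OF B] by blast
  then have f1_0: "f1 (T' y) = 0" if "y \<notin> cbox (T a) (T b)" for y
  proof -
    have "T' y \<notin> cbox a b"
    proof
      assume "T' y \<in> cbox a b"
      then have "T (T' y) \<in> cbox (T a) (T b)" by (simp add: mem_box_cart T_def)
      then show False using that by (simp add: TT)
    qed
    then show ?thesis using \<open>{x \<in> V. F (g x) \<noteq> 0} \<subseteq> cbox a b\<close> by (auto simp: f1_def)
  qed
  ultimately have "((\<lambda>x. f1 (T' (\<chi> j. x $ inv (inv h) j))) has_integral integral UNIV f $ 1) UNIV"
    by (intro has_integral_reindex[OF bij_imp_bij_inv[OF h]])
  moreover have "T' (\<chi> j. x $ inv (inv h) j) = x" for x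
    using TT(2)[of x] by (simp add: T_def inv_inv_eq[OF h])
  ultimately have "integral UNIV f1 = integral UNIV f $ 1" by (simp add: integral_unique)
  moreover have "integral UNIV f1 = integral V (\<lambda>x. \<bar>det (matrix (g' x))\<bar> * F (g x))"
    unfolding f1_def by (rule Henstock_Kurzweil_Integration.integral_restrict_UNIV)
  moreover have "integral UNIV f $ 1 = integral UNIV F"
  proof -
    obtain a b where ab: "C \<subseteq> cbox a b" using bounded_subset_cbox_symmetric[OF C(1)] by blast
    have "F integrable_on UNIV"
      using absolutely_integrable_compact_support[OF F C(1) C(3) subset_UNIV] by (simp add: absolutely_integrable_on_def)
    then have "(F has_integral integral UNIV F) UNIV" by (rule integrable_integral)
    from has_integral_reindex[OF h this, of a b] C(3) ab
    have "((\<lambda>y. F (T' y)) has_integral integral UNIV F) UNIV" by (auto simp: T'_def)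
    then have "integral UNIV (\<lambda>y. f y $ 1) = integral UNIV F" by (simp add: comp integral_unique)
    moreover have "integral UNIV (\<lambda>y. f y $ 1) = integral UNIV f $ 1"
      by (rule integral_component_eq_cart) (use absf(2) in \<open>simp add: absolutely_integrable_on_def\<close>)
    ultimately show ?thesis by simp
  qed
  ultimately show ?thesis by simp
qed

subsection \<open>Integration on compact manifolds\<close>

definition chart_continuous :: "('a, 'e::euclidean_space) mfd \<Rightarrow> ('a \<Rightarrow> real) \<Rightarrow> bool" where
  "chart_continuous M h \<longleftrightarrow> (\<forall>c\<in>atlas M. continuous_on (cimg c) (\<lambda>y. h (cinv c y)))"

text \<open>Compared with \<open>diff_form\<close> in top degree this asks only for continuity of
  one coefficient per chart, and for nothing off the manifold. The integrands built from products
  and wedge products can then be handled without normalising them.\<close>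

definition top_form :: "('a, 'e::euclidean_space) mfd \<Rightarrow> ('a, 'e) form \<Rightarrow> bool" where
  "top_form M \<tau> \<longleftrightarrow> (\<forall>x\<in>pts M. alt_multilinear DIM('e) (\<tau> x)) \<and>
     (\<forall>c\<in>atlas M. continuous_on (cimg c) (\<lambda>y. in_chart M c \<tau> y basis_list))"

text \<open>The sign of \<open>\<nu>\<close> turns the coefficient of \<open>\<tau>\<close> into a
  density, so that charts of either orientation contribute correctly.\<close>

definition vol_density :: "('a, 'e::euclidean_space) mfd \<Rightarrow> ('a, 'e) form \<Rightarrow> ('a, 'e) form \<Rightarrow> ('a, 'e) chart \<Rightarrow> 'e \<Rightarrow> real" where
  "vol_density M \<nu> \<tau> c y = sgn (in_chart M c \<nu> y basis_list) * in_chart M c \<tau> y basis_list"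

lemma smooth_fun_chart_continuous: "smooth_fun M h \<Longrightarrow> chart_continuous M h"
  unfolding smooth_fun_def chart_continuous_def o_def using smooth_on_imp_continuous_on by blast

lemma top_form_diff_form: "manifold M \<Longrightarrow> diff_form M DIM('e) \<tau> \<Longrightarrow> top_form M \<tau>"
  for M :: "('a, 'e::euclidean_space) mfd"
  unfolding top_form_def diff_form_def using smooth_on_imp_continuous_on by blast

lemma in_chart_mult: "in_chart M c (\<lambda>x vs. h x * \<tau> x vs) y vs = h (cinv c y) * in_chart M c \<tau> y vs"
  by (simp add: in_chart_def)

lemma in_chart_add: "in_chart M c (\<lambda>x vs. \<tau> x vs + \<tau>' x vs) y vs = in_chart M c \<tau> y vs + in_chart M c \<tau>' y vs"
  by (simp add: in_chart_def)

lemma top_form_mult: "chart_continuous M h \<Longrightarrow> top_form M \<tau> \<Longrightarrow> top_form M (\<lambda>x vs. h x * \<tau> x vs)"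
  unfolding top_form_def chart_continuous_def in_chart_mult
  by (auto intro!: alt_multilinear_cmult continuous_on_mult)

lemma top_form_add: "top_form M \<tau> \<Longrightarrow> top_form M \<tau>' \<Longrightarrow> top_form M (\<lambda>x vs. \<tau> x vs + \<tau>' x vs)"
  unfolding top_form_def in_chart_add
  by (auto intro!: alt_multilinear_add continuous_on_add)

lemma chart_continuous_const: "chart_continuous M (\<lambda>x. a)"
  by (simp add: chart_continuous_def)

lemma vol_density_mult: "vol_density M \<nu> (\<lambda>x vs. h x * \<tau> x vs) c y = h (cinv c y) * vol_density M \<nu> \<tau> c y"
  by (simp add: vol_density_def in_chart_mult)

lemma vol_density_add:
  "vol_density M \<nu> (\<lambda>x vs. \<tau> x vs + \<tau>' x vs) c y = vol_density M \<nu> \<tau> c y + vol_density M \<nu> \<tau>' c y"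
  by (simp add: vol_density_def in_chart_add distrib_left)

lemma integral_sum_list:
  fixes f :: "'i \<Rightarrow> 'a::euclidean_space \<Rightarrow> real"
  assumes "\<And>i. i \<in> set P \<Longrightarrow> f i integrable_on S"
  shows "(\<lambda>y. \<Sum>i\<leftarrow>P. f i y) integrable_on S \<and> integral S (\<lambda>y. \<Sum>i\<leftarrow>P. f i y) = (\<Sum>i\<leftarrow>P. integral S (f i))"
  using assms
proof (induction P)
  case (Cons i P)
  then show ?case
    using Henstock_Kurzweil_Integration.integral_add[of "f i" S "\<lambda>y. \<Sum>i\<leftarrow>P. f i y"]
      Henstock_Kurzweil_Integration.integrable_add[of "f i" S "\<lambda>y. \<Sum>i\<leftarrow>P. f i y"] by simp
qed (simp add: integrable_0)

context
  fixes M :: "('a, real^'k) mfd" and \<nu> :: "('a, real^'k) form"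
  assumes M: "manifold M" and compact: "compact_space (mtop M)" and \<nu>: "volume_form M \<nu>"
begin

lemma volume_form_basis_nonzero:
  assumes "c \<in> atlas M" "y \<in> cimg c"
  shows "in_chart M c \<nu> y basis_list \<noteq> 0"
proof
  assume 0: "in_chart M c \<nu> y basis_list = 0"
  have \<nu>': "diff_form M DIM(real^'k) \<nu>" using \<nu> by (simp add: volume_form_def)
  let ?x = "cinv c y"
  have x: "?x \<in> fst c" "?x \<in> pts M" "snd c ?x = y"
    using assms(2) cinv_pts[OF M assms] cinv_in[OF M assms(2)] snd_cinv[OF M assms(2)] by auto
  have "\<nu> ?x vs = 0" for vs
    using in_chart_to_chart[OF M assms(1) x(1), of \<nu> vs]
      alt_multilinear_top_zero[OF diff_formD(4)[OF M \<nu>' assms] 0] x(3) by simp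
  then show False using \<nu> x(2) by (auto simp: volume_form_def)
qed

text \<open>The coefficient of a volume form has no zeros, and away from zero \<open>sgn\<close> is
  continuous.\<close>

lemma continuous_on_sgn_volume_form:
  assumes c: "c \<in> atlas M"
  shows "continuous_on (cimg c) (\<lambda>y. sgn (in_chart M c \<nu> y basis_list))"
proof -
  have "diff_form M DIM(real^'k) \<nu>" using \<nu> by (simp add: volume_form_def)
  then show ?thesis
    using smooth_on_imp_continuous_on[OF diff_formD(3)[OF M _ c]] volume_form_basis_nonzero[OF c]
    by (intro continuous_on_sgn) auto
qed

lemma compact_chart_image:
  assumes c: "c \<in> atlas M" and K: "closedin (mtop M) K" "K \<subseteq> fst c"
  shows "compact (snd c ` K)" "snd c ` K \<subseteq> cimg c"
proof -
  have "compactin (mtop M) K" using closedin_compact_space[OF compact K(1)] .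
  then have "compactin (subtopology (mtop M) (fst c)) K" using K(2) by (simp add: compactin_subtopology)
  moreover have "continuous_map (subtopology (mtop M) (fst c)) (top_of_set (cimg c)) (snd c)"
    using chart_homeomorphic[OF M c] homeomorphic_imp_continuous_map by blast
  ultimately have "compactin (top_of_set (cimg c)) (snd c ` K)" by (rule image_compactin)
  then show "compact (snd c ` K)" "snd c ` K \<subseteq> cimg c" by (auto simp: compactin_subtopology)
qed

text \<open>Both forms scale by the same determinant; the sign that it contributes through
  \<open>\<nu>\<close> turns the factor from \<open>\<tau>\<close> into an absolute value.\<close>

lemma vol_density_transition:
  assumes c: "c \<in> atlas M" "x \<in> fst c" and d: "d \<in> atlas M" "x \<in> fst d" and \<tau>: "top_form M \<tau>"
  shows "vol_density M \<nu> \<tau> c (snd c x) =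
    \<bar>det (matrix (FD (\<lambda>y. snd d (cinv c y)) (snd c x)))\<bar> * vol_density M \<nu> \<tau> d (snd d x)"
proof -
  have \<nu>': "diff_form M DIM(real^'k) \<nu>" using \<nu> by (simp add: volume_form_def)
  have trans: "in_chart M c \<sigma> (snd c x) basis_list = det (matrix (FD (\<lambda>y. snd d (cinv c y)) (snd c x))) * in_chart M d \<sigma> (snd d x) basis_list"
    if "\<And>x. x \<in> pts M \<Longrightarrow> alt_multilinear CARD('k) (\<sigma> x)" for \<sigma>
    using in_chart_transition[OF M c(1) d(1) c(2) d(2), of \<sigma> basis_list]
      alt_multilinear_top_det[OF alt_multilinear_in_chart[OF M d(1) _ that]
        linear_chart_change[OF M c(1) d(1) c(2) d(2)]] d
    by (simp add: chart_change_eq_FD[OF M])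
  show ?thesis
    unfolding vol_density_def
    using trans[of \<nu>] trans[of \<tau>] diff_formD(1)[OF M \<nu>'] \<tau>
    by (simp add: top_form_def sgn_mult abs_sgn)
qed

text \<open>\<open>K\<close> is compact, hence so is its image in the chart, and the density stays
  continuous when it is extended by zero from the open set \<open>cimg c\<close>.\<close>

lemma vol_density_supported:
  assumes c: "c \<in> atlas M" and \<tau>: "top_form M \<tau>" and K: "closedin (mtop M) K" "K \<subseteq> fst c"
    and 0: "\<And>x. x \<in> pts M \<Longrightarrow> x \<notin> K \<Longrightarrow> \<tau> x = (\<lambda>_. 0)"
  shows "continuous_on UNIV (\<lambda>y. if y \<in> cimg c then vol_density M \<nu> \<tau> c y else 0)"
    "y \<in> cimg c - snd c ` K \<Longrightarrow> vol_density M \<nu> \<tau> c y = 0"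
    "vol_density M \<nu> \<tau> c integrable_on cimg c"
proof -
  have zero: "vol_density M \<nu> \<tau> c y = 0" if y: "y \<in> cimg c - snd c ` K" for y
  proof -
    have "cinv c y \<notin> K" using y snd_cinv[OF M, of y c] by (metis DiffD1 DiffD2 image_eqI)
    then have "\<tau> (cinv c y) = (\<lambda>_. 0)" using 0 cinv_pts[OF M c] y by simp
    then show ?thesis by (simp add: vol_density_def in_chart_def)
  qed
  then show "y \<in> cimg c - snd c ` K \<Longrightarrow> vol_density M \<nu> \<tau> c y = 0" by blast
  have cont: "continuous_on (cimg c) (vol_density M \<nu> \<tau> c)"
    unfolding vol_density_def[abs_def] using \<tau> c
    by (intro continuous_on_mult continuous_on_sgn_volume_form) (auto simp: top_form_def)
  show ext: "continuous_on UNIV (\<lambda>y. if y \<in> cimg c then vol_density M \<nu> \<tau> c y else 0)"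
    by (rule continuous_on_zero_extension[OF open_cimg[OF M c] cont compact_chart_image[OF c K] zero])
  have "(\<lambda>y. if y \<in> cimg c then vol_density M \<nu> \<tau> c y else 0) absolutely_integrable_on UNIV"
    by (rule absolutely_integrable_compact_support[OF ext compact_imp_bounded[OF compact_chart_image(1)[OF c K]]])
      (use zero in auto)
  then show "vol_density M \<nu> \<tau> c integrable_on cimg c"
    using Henstock_Kurzweil_Integration.integrable_restrict_UNIV[of "cimg c" "vol_density M \<nu> \<tau> c"]
    by (simp add: absolutely_integrable_on_def)
qed

text \<open>Substitution by the transition map. Its domain is only the overlap of the charts, but
  the form is supported in \<open>K\<close>, which lies in both, so nothing is lost off the
  overlap.\<close>

lemma vol_density_change_chart:
  assumes c: "c \<in> atlas M" and d: "d \<in> atlas M" and \<tau>: "top_form M \<tau>"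
    and K: "closedin (mtop M) K" "K \<subseteq> fst c" "K \<subseteq> fst d"
    and 0: "\<And>x. x \<in> pts M \<Longrightarrow> x \<notin> K \<Longrightarrow> \<tau> x = (\<lambda>_. 0)"
  shows "integral (cimg c) (vol_density M \<nu> \<tau> c) = integral (cimg d) (vol_density M \<nu> \<tau> d)"
proof -
  let ?V = "snd c ` (fst c \<inter> fst d)" and ?\<psi> = "\<lambda>y. snd d (cinv c y)"
  let ?F = "\<lambda>y. if y \<in> cimg d then vol_density M \<nu> \<tau> d y else 0"
  have V: "open ?V" "smooth_on ?V ?\<psi>" using transition[OF M c d] by auto
  have dens: "vol_density M \<nu> \<tau> c y = \<bar>det (matrix (FD ?\<psi> y))\<bar> * ?F (?\<psi> y)" if "y \<in> ?V" for y
    using that vol_density_transition[OF c _ d _ \<tau>] by (auto simp: cinv_snd[OF M c])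
  have "integral ?V (\<lambda>y. \<bar>det (matrix (FD ?\<psi> y))\<bar> * ?F (?\<psi> y)) = integral UNIV ?F"
  proof (rule change_of_variables_compact_support[where C="snd d ` K"])
    show "(?\<psi> has_derivative FD ?\<psi> y) (at y)" if "y \<in> ?V" for y
      by (rule smooth_on_has_derivative[OF V(2) that])
    show "inj_on ?\<psi> ?V"
    proof (rule inj_onI)
      fix y z assume "y \<in> ?V" "z \<in> ?V" and eq: "?\<psi> y = ?\<psi> z"
      then obtain a b where "a \<in> fst c \<inter> fst d" "b \<in> fst c \<inter> fst d" "y = snd c a" "z = snd c b" by auto
      with eq show "y = z" using inj_onD[OF chart_inj[OF M d], of a b] by (simp add: cinv_snd[OF M c])
    qed
    show "continuous_on UNIV ?F" by (rule vol_density_supported(1)[OF d \<tau> K(1,3) 0])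
    show "bounded (snd d ` K)" by (rule compact_imp_bounded[OF compact_chart_image(1)[OF d K(1,3)]])
    show "snd d ` K \<subseteq> ?\<psi> ` ?V"
    proof
      fix z assume "z \<in> snd d ` K"
      then obtain a where "a \<in> K" "z = snd d a" by auto
      then show "z \<in> ?\<psi> ` ?V" using K(2,3) cinv_snd[OF M c, of a]
        by (intro image_eqI[of _ _ "snd c a"]) auto
    qed
    show "?F y = 0" if "y \<notin> snd d ` K" for y
      using vol_density_supported(2)[OF d \<tau> K(1,3) 0, of y] that by auto
    have "{y \<in> ?V. ?F (?\<psi> y) \<noteq> 0} \<subseteq> snd c ` K"
    proof
      fix y assume "y \<in> {y \<in> ?V. ?F (?\<psi> y) \<noteq> 0}"
      then obtain a where a: "a \<in> fst c" "a \<in> fst d" "y = snd c a" "vol_density M \<nu> \<tau> d (snd d a) \<noteq> 0"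
        by (auto simp: cinv_snd[OF M c] split: if_splits)
      then have "snd d a \<in> snd d ` K"
        using vol_density_supported(2)[OF d \<tau> K(1,3) 0, of "snd d a"] by auto
      then obtain b where b: "b \<in> K" "snd d a = snd d b" by auto
      then have "a = b" using inj_onD[OF chart_inj[OF M d], of a b] a(2) K(3) by blast
      then have "a \<in> K" using b by simp
      then show "y \<in> snd c ` K" using a by simp
    qed
    then show "bounded {y \<in> ?V. ?F (?\<psi> y) \<noteq> 0}"
      using compact_imp_bounded[OF compact_chart_image(1)[OF c K(1,2)]] bounded_subset by blast
  qed (rule V(1))
  moreover have "integral ?V (\<lambda>y. \<bar>det (matrix (FD ?\<psi> y))\<bar> * ?F (?\<psi> y)) = integral ?V (vol_density M \<nu> \<tau> c)"
    by (rule Henstock_Kurzweil_Integration.integral_cong) (simp only: dens)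
  moreover have "integral ?V (vol_density M \<nu> \<tau> c) = integral (cimg c) (vol_density M \<nu> \<tau> c)"
  proof -
    have "integral ?V (vol_density M \<nu> \<tau> c) = integral (?V \<inter> cimg c) (vol_density M \<nu> \<tau> c)"
      by (rule arg_cong2[where f=integral]) auto
    also have "\<dots> = integral (cimg c) (\<lambda>y. if y \<in> ?V then vol_density M \<nu> \<tau> c y else 0)"
      by (rule Henstock_Kurzweil_Integration.integral_restrict_Int[symmetric])
    also have "\<dots> = integral (cimg c) (vol_density M \<nu> \<tau> c)"
    proof (rule Henstock_Kurzweil_Integration.integral_cong)
      fix y assume y: "y \<in> cimg c"
      have "vol_density M \<nu> \<tau> c y = 0" if "y \<notin> ?V"
        using vol_density_supported(2)[OF c \<tau> K(1,2) 0, of y] that y K(2,3) by blast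
      then show "(if y \<in> ?V then vol_density M \<nu> \<tau> c y else 0) = vol_density M \<nu> \<tau> c y" by simp
    qed
    finally show ?thesis .
  qed
  moreover have "integral UNIV ?F = integral (cimg d) (vol_density M \<nu> \<tau> d)"
    by (rule Henstock_Kurzweil_Integration.integral_restrict_UNIV)
  ultimately show ?thesis by simp
qed

lemma partition_of_unityD:
  assumes "partition_of_unity M P" "(c, \<rho>) \<in> set P"
  shows "c \<in> atlas M" "smooth_fun M \<rho>" "chart_continuous M \<rho>"
    "closedin (mtop M) (mtop M closure_of {x \<in> pts M. \<rho> x \<noteq> 0})"
    "mtop M closure_of {x \<in> pts M. \<rho> x \<noteq> 0} \<subseteq> fst c"
    "x \<in> pts M \<Longrightarrow> x \<notin> mtop M closure_of {x \<in> pts M. \<rho> x \<noteq> 0} \<Longrightarrow> \<rho> x = 0"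
proof -
  show *: "c \<in> atlas M" "smooth_fun M \<rho>" "mtop M closure_of {x \<in> pts M. \<rho> x \<noteq> 0} \<subseteq> fst c"
    using assms by (auto simp: partition_of_unity_def)
  show "chart_continuous M \<rho>" by (rule smooth_fun_chart_continuous[OF *(2)])
  show "closedin (mtop M) (mtop M closure_of {x \<in> pts M. \<rho> x \<noteq> 0})" by simp
  show "x \<in> pts M \<Longrightarrow> x \<notin> mtop M closure_of {x \<in> pts M. \<rho> x \<noteq> 0} \<Longrightarrow> \<rho> x = 0"
    using closure_of_subset[of "{x \<in> pts M. \<rho> x \<noteq> 0}" "mtop M"] by blast
qed

lemma some_partition_of_unity: "partition_of_unity M (SOME P. partition_of_unity M P)"
  by (rule someI_ex[OF partition_of_unity_exists[OF M compact]])

lemma form_integral_alt: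
  "form_integral M \<nu> \<tau> = (\<Sum>(c, \<rho>)\<leftarrow>(SOME P. partition_of_unity M P).
     integral (cimg c) (vol_density M \<nu> (\<lambda>x vs. \<rho> x * \<tau> x vs) c))"
  unfolding form_integral_def vol_density_mult[abs_def] by (simp add: vol_density_def mult.assoc)

lemma form_integral_cong:
  assumes "\<And>x vs. x \<in> pts M \<Longrightarrow> length vs = CARD('k) \<Longrightarrow> \<tau> x vs = \<tau>' x vs"
  shows "form_integral M \<nu> \<tau> = form_integral M \<nu> \<tau>'"
proof -
  have "integral (cimg c) (\<lambda>y. \<rho> (cinv c y) * sgn (in_chart M c \<nu> y basis_list) * in_chart M c \<tau> y basis_list) =
      integral (cimg c) (\<lambda>y. \<rho> (cinv c y) * sgn (in_chart M c \<nu> y basis_list) * in_chart M c \<tau>' y basis_list)"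
    if "(c, \<rho>) \<in> set (SOME P. partition_of_unity M P)" for c \<rho>
    by (rule Henstock_Kurzweil_Integration.integral_cong)
      (use partition_of_unityD(1)[OF some_partition_of_unity that] in
        \<open>simp add: in_chart_def assms cinv_pts[OF M] length_basis_list\<close>)
  then show ?thesis
    unfolding form_integral_def by (intro arg_cong[where f=sum_list] map_cong refl) auto
qed

lemma partition_integrable:
  assumes "partition_of_unity M P" "(c, \<rho>) \<in> set P" "top_form M \<tau>"
  shows "vol_density M \<nu> (\<lambda>x vs. \<rho> x * \<tau> x vs) c integrable_on cimg c"
  by (rule vol_density_supported(3)[OF _ top_form_mult[OF _ assms(3)]])
    (use partition_of_unityD[OF assms(1,2)] in \<open>auto simp: fun_eq_iff\<close>)

lemma form_integral_add:
  assumes "top_form M \<tau>" "top_form M \<tau>'"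
  shows "form_integral M \<nu> (\<lambda>x vs. \<tau> x vs + \<tau>' x vs) = form_integral M \<nu> \<tau> + form_integral M \<nu> \<tau>'"
proof -
  let ?P = "SOME P. partition_of_unity M P"
  have "integral (cimg c) (vol_density M \<nu> (\<lambda>x vs. \<rho> x * (\<tau> x vs + \<tau>' x vs)) c) =
      integral (cimg c) (vol_density M \<nu> (\<lambda>x vs. \<rho> x * \<tau> x vs) c) +
      integral (cimg c) (vol_density M \<nu> (\<lambda>x vs. \<rho> x * \<tau>' x vs) c)"
    if "(c, \<rho>) \<in> set ?P" for c \<rho>
  proof -
    have "vol_density M \<nu> (\<lambda>x vs. \<rho> x * (\<tau> x vs + \<tau>' x vs)) c =
        (\<lambda>y. vol_density M \<nu> (\<lambda>x vs. \<rho> x * \<tau> x vs) c y + vol_density M \<nu> (\<lambda>x vs. \<rho> x * \<tau>' x vs) c y)"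
      by (simp add: vol_density_mult vol_density_add distrib_left fun_eq_iff)
    then show ?thesis
      using partition_integrable[OF some_partition_of_unity that] assms
      by (simp add: Henstock_Kurzweil_Integration.integral_add)
  qed
  then have "form_integral M \<nu> (\<lambda>x vs. \<tau> x vs + \<tau>' x vs) = (\<Sum>(c, \<rho>)\<leftarrow>?P.
      integral (cimg c) (vol_density M \<nu> (\<lambda>x vs. \<rho> x * \<tau> x vs) c) +
      integral (cimg c) (vol_density M \<nu> (\<lambda>x vs. \<rho> x * \<tau>' x vs) c))"
    unfolding form_integral_alt by (intro arg_cong[where f=sum_list] map_cong refl) auto
  also have "\<dots> = form_integral M \<nu> \<tau> + form_integral M \<nu> \<tau>'"
    unfolding form_integral_alt by (simp add: case_prod_unfold sum_list_addf)
  finally show ?thesis .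
qed

lemma form_integral_cmult: "form_integral M \<nu> (\<lambda>x vs. a * \<tau> x vs) = a * form_integral M \<nu> \<tau>"
proof -
  have "vol_density M \<nu> (\<lambda>x vs. \<rho> x * (a * \<tau> x vs)) c = (\<lambda>y. a * vol_density M \<nu> (\<lambda>x vs. \<rho> x * \<tau> x vs) c y)" for \<rho> c
    by (simp add: vol_density_def in_chart_def fun_eq_iff)
  then show ?thesis
    unfolding form_integral_alt by (simp add: case_prod_unfold sum_list_const_mult)
qed

lemma form_integral_sum_list:
  assumes "\<And>i. i \<in> set P \<Longrightarrow> top_form M (\<tau> i)"
  shows "form_integral M \<nu> (\<lambda>x vs. \<Sum>i\<leftarrow>P. \<tau> i x vs) = (\<Sum>i\<leftarrow>P. form_integral M \<nu> (\<tau> i)) \<and>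
    top_form M (\<lambda>x vs. \<Sum>i\<leftarrow>P. \<tau> i x vs)"
  using assms
proof (induction P)
  case Nil
  then show ?case
    using form_integral_cmult[of 0 "\<lambda>_ _. 0"]
    by (auto simp: top_form_def in_chart_def alt_multilinear_def intro: linear_zero)
next
  case (Cons i P)
  then show ?case
    using form_integral_add[of "\<tau> i" "\<lambda>x vs. \<Sum>i\<leftarrow>P. \<tau> i x vs"] top_form_add[of M "\<tau> i"] by simp
qed

text \<open>Each weighted piece is supported in \<open>c\<close> as well as in the chart of its
  weight, so its integral may be computed in \<open>c\<close>, where the weights add up to 1. This
  removes the dependence on the chosen partition.\<close>

lemma form_integral_supported:
  assumes c: "c \<in> atlas M" and \<tau>: "top_form M \<tau>" and K: "closedin (mtop M) K" "K \<subseteq> fst c"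
    and 0: "\<And>x. x \<in> pts M \<Longrightarrow> x \<notin> K \<Longrightarrow> \<tau> x = (\<lambda>_. 0)"
  shows "form_integral M \<nu> \<tau> = integral (cimg c) (vol_density M \<nu> \<tau> c)"
proof -
  let ?P = "SOME P. partition_of_unity M P"
  note P = some_partition_of_unity
  let ?f = "\<lambda>p. vol_density M \<nu> (\<lambda>x vs. snd p x * \<tau> x vs) c"
  have step: "integral (cimg d) (vol_density M \<nu> (\<lambda>x vs. \<sigma> x * \<tau> x vs) d) =
      integral (cimg c) (vol_density M \<nu> (\<lambda>x vs. \<sigma> x * \<tau> x vs) c) \<and>
      vol_density M \<nu> (\<lambda>x vs. \<sigma> x * \<tau> x vs) c integrable_on cimg c"
    if d\<sigma>: "(d, \<sigma>) \<in> set ?P" for d \<sigma>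
  proof
    let ?K = "K \<inter> mtop M closure_of {x \<in> pts M. \<sigma> x \<noteq> 0}"
    note D = partition_of_unityD[OF P d\<sigma>]
    have \<sigma>\<tau>: "top_form M (\<lambda>x vs. \<sigma> x * \<tau> x vs)" by (rule top_form_mult[OF D(3) \<tau>])
    have K': "closedin (mtop M) ?K" "?K \<subseteq> fst c" "?K \<subseteq> fst d" using K D(4,5) by auto
    have off: "(\<lambda>vs. \<sigma> x * \<tau> x vs) = (\<lambda>_. 0)" if "x \<in> pts M" "x \<notin> ?K" for x
      using that 0[of x] D(6)[of x] by auto
    show "integral (cimg d) (vol_density M \<nu> (\<lambda>x vs. \<sigma> x * \<tau> x vs) d) =
        integral (cimg c) (vol_density M \<nu> (\<lambda>x vs. \<sigma> x * \<tau> x vs) c)"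
      by (rule vol_density_change_chart[OF D(1) c \<sigma>\<tau> K'(1,3,2) off])
    show "vol_density M \<nu> (\<lambda>x vs. \<sigma> x * \<tau> x vs) c integrable_on cimg c"
      by (rule vol_density_supported(3)[OF c \<sigma>\<tau> K'(1,2) off])
  qed
  have "form_integral M \<nu> \<tau> = (\<Sum>p\<leftarrow>?P. integral (cimg c) (?f p))"
    unfolding form_integral_alt by (intro arg_cong[where f=sum_list] map_cong refl) (use step in auto)
  also have "\<dots> = integral (cimg c) (\<lambda>y. \<Sum>p\<leftarrow>?P. ?f p y)"
    using integral_sum_list[of ?P ?f "cimg c"] step by fastforce
  also have "\<dots> = integral (cimg c) (vol_density M \<nu> \<tau> c)"
  proof (rule Henstock_Kurzweil_Integration.integral_cong)
    fix y assume "y \<in> cimg c"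
    \<comment> \<open>\<open>c'\<close> stands for \<open>c\<close>, a name that the pattern
      \<open>(c, \<rho>)\<close> would capture inside the sum.\<close>
    then have "(\<Sum>(c, \<rho>)\<leftarrow>?P. \<rho> (cinv c' y)) = 1" if "c' = c" for c'
      using P cinv_pts[OF M c] that by (simp add: partition_of_unity_def)
    then show "(\<Sum>p\<leftarrow>?P. ?f p y) = vol_density M \<nu> \<tau> c y"
      by (simp add: vol_density_mult sum_list_mult_const case_prod_unfold)
  qed
  finally show ?thesis .
qed

text \<open>Continuous weights supported in charts and adding up to 1 compute the integral, not only
  the partition picked inside \<open>form_integral\<close>. This is what allows an embedding to
  carry a partition of its source over to its image.\<close>

lemma form_integral_partition:
  assumes P: "\<And>c \<rho>. (c, \<rho>) \<in> set P \<Longrightarrow> c \<in> atlas M \<and> chart_continuous M \<rho> \<and>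
      mtop M closure_of {x \<in> pts M. \<rho> x \<noteq> 0} \<subseteq> fst c"
    and sum: "\<And>x. x \<in> pts M \<Longrightarrow> (\<Sum>(c, \<rho>)\<leftarrow>P. \<rho> x) = 1" and \<tau>: "top_form M \<tau>"
  shows "form_integral M \<nu> \<tau> = (\<Sum>(c, \<rho>)\<leftarrow>P. integral (cimg c) (vol_density M \<nu> (\<lambda>x vs. \<rho> x * \<tau> x vs) c))"
proof -
  have top: "top_form M (\<lambda>x vs. snd p x * \<tau> x vs)" if "p \<in> set P" for p
    using P[of "fst p" "snd p"] that top_form_mult[OF _ \<tau>, of "snd p"] by simp
  have "form_integral M \<nu> \<tau> = form_integral M \<nu> (\<lambda>x vs. \<Sum>p\<leftarrow>P. snd p x * \<tau> x vs)"
    by (rule form_integral_cong) (use sum in \<open>simp add: sum_list_mult_const case_prod_unfold\<close>)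
  also have "\<dots> = (\<Sum>p\<leftarrow>P. form_integral M \<nu> (\<lambda>x vs. snd p x * \<tau> x vs))"
    using form_integral_sum_list[of P "\<lambda>p x vs. snd p x * \<tau> x vs"] top by blast
  also have "\<dots> = (\<Sum>(c, \<rho>)\<leftarrow>P. integral (cimg c) (vol_density M \<nu> (\<lambda>x vs. \<rho> x * \<tau> x vs) c))"
  proof (intro arg_cong[where f=sum_list] map_cong refl)
    fix p assume p: "p \<in> set P"
    obtain c \<rho> where p': "p = (c, \<rho>)" by (cases p)
    have "form_integral M \<nu> (\<lambda>x vs. \<rho> x * \<tau> x vs) = integral (cimg c) (vol_density M \<nu> (\<lambda>x vs. \<rho> x * \<tau> x vs) c)"
    proof (rule form_integral_supported[where K="mtop M closure_of {x \<in> pts M. \<rho> x \<noteq> 0}"])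
      show "(\<lambda>vs. \<rho> x * \<tau> x vs) = (\<lambda>_. 0)"
        if "x \<in> pts M" "x \<notin> mtop M closure_of {x \<in> pts M. \<rho> x \<noteq> 0}" for x
        using that closure_of_subset[of "{x \<in> pts M. \<rho> x \<noteq> 0}" "mtop M"] by auto
    qed (use P[of c \<rho>] p p' top[OF p] in auto)
    then show "form_integral M \<nu> (\<lambda>x vs. snd p x * \<tau> x vs) =
        (case p of (c, \<rho>) \<Rightarrow> integral (cimg c) (vol_density M \<nu> (\<lambda>x vs. \<rho> x * \<tau> x vs) c))"
      by (simp add: p')
  qed
  finally show ?thesis .
qed

end

subsection \<open>Stokes' theorem\<close>

text \<open>By translation invariance \<open>\<integral> G (x + t b) dx\<close> does not depend on \<open>t\<close>; differentiate at \<open>t = 0\<close>.\<close>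

lemma integral_derivative_compact_support:
  fixes G :: "'a::euclidean_space \<Rightarrow> real"
  assumes G: "\<And>y. (G has_derivative G' y) (at y)" and cont: "continuous_on UNIV (\<lambda>y. G' y b)"
    and C: "compact C" and 0: "\<And>y. y \<notin> C \<Longrightarrow> G y = 0"
  shows "integral UNIV (\<lambda>y. G' y b) = 0"
proof -
  obtain R where R: "\<And>x. x \<in> C \<Longrightarrow> norm x \<le> R" using compact_imp_bounded[OF C] unfolding bounded_iff by blast
  \<comment> \<open>A box that contains all translates of \<open>C\<close> by multiples of
    \<open>b\<close> with factor between -1 and 1, so that differentiation under the integral takes
    place over one fixed box.\<close>
  obtain l :: 'a where l: "cball 0 (R + norm b) \<subseteq> cbox (- l) l"
    using bounded_subset_cbox_symmetric[OF bounded_cball] by metis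
  have shift: "x - t *\<^sub>R b \<in> cbox (- l) l" if "x \<in> C" "\<bar>t\<bar> \<le> 1" for x t
  proof -
    have "norm (x - t *\<^sub>R b) \<le> norm x + \<bar>t\<bar> * norm b" using norm_triangle_ineq4[of x "t *\<^sub>R b"] by simp
    also have "\<dots> \<le> R + 1 * norm b" using R[OF that(1)] that(2) by (intro add_mono mult_right_mono) auto
    finally show ?thesis using l by auto
  qed
  have contG: "continuous_on X G" for X
    using has_derivative_continuous[OF G] by (intro continuous_at_imp_continuous_on) blast
  have intG: "(G has_integral integral UNIV G) X" if "C \<subseteq> X" "closed X \<or> X = UNIV" for X
  proof -
    have "G absolutely_integrable_on UNIV"
      by (rule absolutely_integrable_compact_support[OF contG compact_imp_bounded[OF C] 0]) auto
    then have "(G has_integral integral UNIV G) UNIV"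
      by (simp add: absolutely_integrable_on_def integrable_integral)
    moreover have "(\<lambda>x. if x \<in> X then G x else 0) = G" using 0 that(1) by (auto simp: fun_eq_iff)
    ultimately show ?thesis using has_integral_restrict_UNIV[of X G "integral UNIV G"] by simp
  qed
  let ?h = "\<lambda>t. integral (cbox (- l) l) (\<lambda>x. G (x + t *\<^sub>R b))"
  have h_const: "?h t = integral UNIV G" if "\<bar>t\<bar> \<le> 1" for t
  proof -
    have "C \<subseteq> cbox (- l + t *\<^sub>R b) (l + t *\<^sub>R b)"
    proof
      fix x assume "x \<in> C"
      from shift[OF this that] show "x \<in> cbox (- l + t *\<^sub>R b) (l + t *\<^sub>R b)"
        by (simp add: mem_box algebra_simps)
    qed
    then have "(G has_integral integral UNIV G) (cbox (- l + t *\<^sub>R b) (l + t *\<^sub>R b))"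
      by (intro intG) auto
    then have "((\<lambda>x. G (x + t *\<^sub>R b)) has_integral integral UNIV G) (cbox (- l) l)"
      using has_integral_shift_cbox_iff[of G "t *\<^sub>R b" "integral UNIV G" "- l" l] by (simp add: o_def add.commute)
    then show ?thesis by (rule integral_unique)
  qed
  have "(?h has_field_derivative integral (cbox (- l) l) (\<lambda>x. G' (x + 0 *\<^sub>R b) b)) (at 0 within {-1..1})"
  proof (rule leibniz_rule_field_derivative[where fx="\<lambda>t x. G' (x + t *\<^sub>R b) b"])
    fix t x
    have "(G has_derivative G' (x + t *\<^sub>R b)) (at (x + t *\<^sub>R b))" by (rule G)
    then have "((\<lambda>t. G (x + t *\<^sub>R b)) has_real_derivative G' (x + t *\<^sub>R b) b) (at t)"
      using has_derivative_along_line[of G x t b] by (metis FD_eqI differentiable_def)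
    then show "((\<lambda>t. G (x + t *\<^sub>R b)) has_real_derivative G' (x + t *\<^sub>R b) b) (at t within {-1..1})"
      by (rule has_field_derivative_at_within)
  next
    fix t
    have "continuous_on (cbox (- l) l) (\<lambda>x. G (x + t *\<^sub>R b))"
      by (rule continuous_on_compose2[OF contG[of UNIV]]) (auto intro!: continuous_intros)
    then show "(\<lambda>x. G (x + t *\<^sub>R b)) integrable_on cbox (- l) l" by (rule integrable_continuous)
  next
    show "continuous_on ({-1..1} \<times> cbox (- l) l) (\<lambda>(t, x). G' (x + t *\<^sub>R b) b)"
      unfolding case_prod_unfold
      by (rule continuous_on_compose2[OF cont]) (auto intro!: continuous_intros)
  qed auto
  moreover have "at 0 within {-1..1} = at (0 :: real)"
    by (rule at_within_interior) (simp add: interior_atLeastAtMost_real)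
  ultimately have "(?h has_field_derivative integral (cbox (- l) l) (\<lambda>x. G' x b)) (at 0)" by simp
  then have "integral (cbox (- l) l) (\<lambda>x. G' x b) = 0"
    by (rule DERIV_local_const[where d=1]) (use h_const[of 0] in \<open>auto simp: h_const\<close>)
  moreover have "integral (cbox (- l) l) (\<lambda>x. G' x b) = integral UNIV (\<lambda>x. G' x b)"
  proof -
    have "G' y b = 0" if "y \<notin> C" for y
    proof -
      have "((\<lambda>_. 0) has_derivative G' y) (at y)"
        by (rule has_derivative_transform_within_open[OF G, of "- C"])
          (use that C 0 in \<open>auto simp: compact_imp_closed\<close>)
      then show ?thesis using has_derivative_unique[OF _ has_derivative_const] by metis
    qed
    moreover have "C \<subseteq> cbox (- l) l" using shift[of _ 0] by auto
    ultimately have "(\<lambda>x. if x \<in> cbox (- l) l then G' x b else 0) = (\<lambda>x. G' x b)" by (auto simp: fun_eq_iff)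
    then show ?thesis
      using Henstock_Kurzweil_Integration.integral_restrict_UNIV[of "cbox (- l) l" "\<lambda>x. G' x b"] by simp
  qed
  ultimately show ?thesis by simp
qed

text \<open>The continuous sign \<open>s\<close> is only locally constant, since \<open>V\<close> need not be connected.\<close>

lemma integral_signed_derivative:
  fixes \<phi> :: "'a::euclidean_space \<Rightarrow> real"
  assumes V: "open V" and C: "compact C" "C \<subseteq> V" and \<phi>: "smooth_on V \<phi>"
    and 0: "\<And>y. y \<in> V - C \<Longrightarrow> \<phi> y = 0"
    and s: "continuous_on V s" "\<And>y. y \<in> V \<Longrightarrow> s y = 1 \<or> s y = -1"
  shows "(\<lambda>y. s y * FD \<phi> y b) integrable_on V" "integral V (\<lambda>y. s y * FD \<phi> y b) = 0"
proof -
  define G where "G y = (if y \<in> V then s y * \<phi> y else 0)" for y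
  define G' where "G' y w = (if y \<in> V then s y * FD \<phi> y w else 0)" for y w
  have oVC: "open (V - C)" using V C(1) by (simp add: compact_imp_closed open_Diff)
  have FD0: "FD \<phi> y w = 0" if "y \<in> V - C" for y w
    using FD_cong[OF oVC that, of \<phi> "\<lambda>_. 0"] 0 by simp
  have G: "(G has_derivative G' y) (at y)" for y
  proof (cases "y \<in> V")
    case True
    \<comment> \<open>The two possible values of \<open>s\<close> are at distance 2, so
      \<open>s\<close> is constant on this neighbourhood of \<open>y\<close>.\<close>
    let ?W = "V \<inter> s -` ball (s y) 1"
    have W: "open ?W" using continuous_open_preimage[OF s(1) V open_ball] by simp
    have sW: "s z = s y" if "z \<in> ?W" for z
      using that s(2)[of z] s(2)[OF True] by (auto simp: dist_real_def)
    have "((\<lambda>z. s y * \<phi> z) has_derivative (\<lambda>w. s y * FD \<phi> y w)) (at y)"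
      by (rule has_derivative_mult_right[OF smooth_on_has_derivative[OF \<phi> True]])
    then have "(G has_derivative (\<lambda>w. s y * FD \<phi> y w)) (at y)"
    proof (rule has_derivative_transform_within_open[OF _ W])
      show "s y * \<phi> z = G z" if "z \<in> ?W" for z
        using sW[OF that] that by (simp add: G_def)
    qed (use True in simp)
    then show ?thesis using True by (simp add: G'_def[abs_def])
  next
    case False
    have "((\<lambda>z. 0) has_derivative (\<lambda>w. 0)) (at y)" by (rule has_derivative_const)
    then have "(G has_derivative (\<lambda>w. 0)) (at y)"
      by (rule has_derivative_transform_within_open[of _ _ _ _ "- C"])
        (use False C 0 in \<open>auto simp: compact_imp_closed G_def\<close>)
    then show ?thesis using False by (simp add: G'_def[abs_def])
  qed
  have "continuous_on V (\<lambda>y. s y * FD \<phi> y b)"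
    by (intro continuous_on_mult s smooth_on_imp_continuous_on smooth_on_FD \<phi>)
  then have cont: "continuous_on UNIV (\<lambda>y. G' y b)"
    unfolding G'_def by (rule continuous_on_zero_extension[OF V _ C]) (simp add: FD0)
  have "(\<lambda>y. G' y b) absolutely_integrable_on UNIV"
    by (rule absolutely_integrable_compact_support[OF cont compact_imp_bounded[OF C(1)]])
      (auto simp: G'_def FD0)
  then show "(\<lambda>y. s y * FD \<phi> y b) integrable_on V"
    using Henstock_Kurzweil_Integration.integrable_restrict_UNIV[of V "\<lambda>y. s y * FD \<phi> y b"]
    by (simp add: absolutely_integrable_on_def G'_def)
  have "integral UNIV (\<lambda>y. G' y b) = 0"
    by (rule integral_derivative_compact_support[OF G cont C(1)]) (use C 0 in \<open>auto simp: G_def\<close>)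
  then show "integral V (\<lambda>y. s y * FD \<phi> y b) = 0"
    using Henstock_Kurzweil_Integration.integral_restrict_UNIV[of V "\<lambda>y. s y * FD \<phi> y b"] by (simp add: G'_def)
qed

section \<open>Linearity, locality and the Leibniz rule for the exterior derivative\<close>

context
  fixes M :: "('a, 'e::euclidean_space) mfd"
  assumes M: "manifold M"
begin

lemma diff_form_mult:
  assumes h: "smooth_fun M h" and \<tau>: "diff_form M p \<tau>"
  shows "diff_form M p (\<lambda>x vs. h x * \<tau> x vs)"
  using \<tau> unfolding diff_form_def in_chart_mult
  by (auto intro!: alt_multilinear_cmult smooth_on_mult open_cimg[OF M] smooth_fun_in_chart[OF M _ h])

lemma diff_form_add:
  assumes "diff_form M p \<tau>" "diff_form M p \<tau>'"
  shows "diff_form M p (\<lambda>x vs. \<tau> x vs + \<tau>' x vs)"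
  using assms unfolding diff_form_def in_chart_add
  by (auto intro!: alt_multilinear_add smooth_on_add open_cimg[OF M])

lemma differentiable_in_chart_at:
  assumes "diff_form M p \<tau>" "x \<in> pts M"
  shows "(\<lambda>y. in_chart M (chart_at M x) \<tau> y vs) differentiable (at (snd (chart_at M x) x))"
  by (rule smooth_on_differentiable[OF diff_formD(3)[OF M assms(1) chart_at(1)[OF M assms(2)]]])
    (simp add: chart_at(2)[OF M assms(2)])

lemma ext_d_cong:
  assumes "\<And>z vs. z \<in> pts M \<Longrightarrow> \<tau> z vs = \<tau>' z vs"
  shows "ext_d M \<tau> x vs = ext_d M \<tau>' x vs"
proof (cases "x \<in> pts M")
  case True
  show ?thesis
    unfolding ext_d_eq_dform[OF M True]
    by (rule dform_cong[OF M open_cimg[OF M chart_at(1)[OF M True]]])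
      (use chart_at[OF M True] in \<open>auto simp: in_chart_def assms cinv_snd[OF M] chart_subset[OF M, THEN subsetD]\<close>)
qed (simp add: ext_d_def)

lemma ext_d_add:
  assumes "diff_form M p \<tau>" "diff_form M p \<tau>'"
  shows "ext_d M (\<lambda>x vs. \<tau> x vs + \<tau>' x vs) x vs = ext_d M \<tau> x vs + ext_d M \<tau>' x vs"
  using differentiable_in_chart_at[OF assms(1), of x] differentiable_in_chart_at[OF assms(2), of x]
  by (simp add: ext_d_def in_chart_add FD_add sum.distrib distrib_left)

lemma ext_d_sum_list:
  assumes "\<And>i. i \<in> set P \<Longrightarrow> diff_form M p (\<tau> i)"
  shows "diff_form M p (\<lambda>x vs. \<Sum>i\<leftarrow>P. \<tau> i x vs) \<and>
    ext_d M (\<lambda>x vs. \<Sum>i\<leftarrow>P. \<tau> i x vs) x vs = (\<Sum>i\<leftarrow>P. ext_d M (\<tau> i) x vs)"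
  using assms
proof (induction P)
  case Nil
  have "diff_form M p (\<lambda>x vs. 0)"
    by (auto simp: diff_form_def in_chart_def alt_multilinear_def smooth_on_const intro: linear_zero)
  then show ?case by (auto simp: ext_d_def in_chart_def)
next
  case (Cons i P)
  then show ?case using ext_d_add[of p "\<tau> i"] diff_form_add[of p "\<tau> i"] by simp
qed

text \<open>In the chart chosen at \<open>x\<close> a tangent vector at \<open>x\<close> is its own
  coordinate vector, so the product rule for the coefficients is already the claim.\<close>

lemma ext_d_mult:
  assumes h: "smooth_fun M h" and \<tau>: "diff_form M p \<tau>" and x: "x \<in> pts M"
  shows "ext_d M (\<lambda>x vs. h x * \<tau> x vs) x vs = wedge1 (ext_d M (fun_form M h)) \<tau> x vs + h x * ext_d M \<tau> x vs"
proof -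
  let ?c = "chart_at M x"
  note c = chart_at[OF M x]
  let ?y = "snd ?c x"
  have hd: "(\<lambda>y. h (cinv ?c y)) differentiable (at ?y)"
    by (rule smooth_on_differentiable[OF smooth_fun_in_chart[OF M c(1) h]]) (use c in simp)
  have dh: "FD (\<lambda>y. h (cinv ?c y)) ?y v = ext_d M (fun_form M h) x [v]" for v
    using ext_d_fun_from_chart[OF M h c, of v] from_chart_at[OF M x, of v] by simp
  have \<tau>y: "in_chart M ?c \<tau> ?y ws = \<tau> x ws" for ws
    using in_chart_at_point[OF M c, of \<tau> ws] from_chart_at[OF M x] by (simp add: map_idI)
  have "(-1) ^ i * FD (\<lambda>y. h (cinv ?c y) * in_chart M ?c \<tau> y (del_nth i vs)) ?y (vs ! i) =
      (-1) ^ i * ext_d M (fun_form M h) x [vs ! i] * \<tau> x (del_nth i vs) +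
      h x * ((-1) ^ i * FD (\<lambda>y. in_chart M ?c \<tau> y (del_nth i vs)) ?y (vs ! i))" for i
    using FD_mult[OF hd differentiable_in_chart_at[OF \<tau> x], of "del_nth i vs" "vs ! i"] c
    by (simp add: dh \<tau>y cinv_snd[OF M] algebra_simps)
  then show ?thesis
    using x by (simp add: ext_d_def in_chart_mult wedge1_def sum.distrib sum_distrib_left)
qed

end

lemma top_form_cong:
  assumes M: "manifold M" and "top_form M \<tau>" "\<And>x vs. x \<in> pts M \<Longrightarrow> \<tau> x vs = \<tau>' x vs"
  shows "top_form M \<tau>'"
proof -
  have "\<tau>' x = \<tau> x" if "x \<in> pts M" for x using assms(3)[OF that] by auto
  moreover have "in_chart M c \<tau>' y = in_chart M c \<tau> y" if "c \<in> atlas M" "y \<in> cimg c" for c y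
    using assms(3)[OF cinv_pts[OF M that]] by (simp add: in_chart_def fun_eq_iff)
  ultimately show ?thesis using assms(2) by (simp add: top_form_def cong: continuous_on_cong)
qed

context
  fixes M :: "('a, real^'k) mfd" and \<nu> :: "('a, real^'k) form"
  assumes M: "manifold M" and compact: "compact_space (mtop M)" and \<nu>: "volume_form M \<nu>"
begin

text \<open>In coordinates the integrand is an alternating sum of partial derivatives of compactly
  supported coefficients, multiplied by a locally constant sign; each summand has integral
  zero.\<close>

lemma stokes_in_chart:
  assumes \<beta>: "diff_form M (CARD('k) - 1) \<beta>" and c: "c \<in> atlas M"
    and K: "closedin (mtop M) K" "K \<subseteq> fst c" and 0: "\<And>x. x \<in> pts M \<Longrightarrow> x \<notin> K \<Longrightarrow> \<beta> x = (\<lambda>_. 0)"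
  shows "form_integral M \<nu> (ext_d M \<beta>) = 0"
proof -
  let ?B = "in_chart M c \<beta>" and ?b = "basis_list :: (real^'k) list"
  let ?s = "\<lambda>y. sgn (in_chart M c \<nu> y ?b)"
  have d\<beta>: "diff_form M DIM(real^'k) (ext_d M \<beta>)"
    using diff_form_ext_d[OF M \<beta>] by simp
  have d0: "ext_d M \<beta> x vs = 0" if x: "x \<in> pts M" "x \<notin> K" for x vs
  proof -
    let ?a = "chart_at M x"
    note a = chart_at[OF M x(1)]
    let ?U = "snd ?a ` (fst ?a \<inter> (pts M - K))"
    have U: "open ?U" by (rule open_chart_image[OF M a(1)]) (use K in blast)
    have "ext_d M \<beta> x vs = dform (\<lambda>_ _. 0) (snd ?a x) vs"
      unfolding ext_d_eq_dform[OF M x(1)]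
      by (rule dform_cong[OF M U]) (use a x 0 in \<open>auto simp: in_chart_def cinv_snd[OF M]\<close>)
    then show ?thesis by (simp add: dform_def)
  qed
  have I: "(\<lambda>y. ?s y * FD (\<lambda>z. ?B z (del_nth i ?b)) y (?b ! i)) integrable_on cimg c"
    "integral (cimg c) (\<lambda>y. ?s y * FD (\<lambda>z. ?B z (del_nth i ?b)) y (?b ! i)) = 0" for i
  proof -
    have zero: "?B y (del_nth i ?b) = 0" if y: "y \<in> cimg c - snd c ` K" for y
    proof -
      have "cinv c y \<notin> K" using y snd_cinv[OF M, of y c] by (metis DiffD1 DiffD2 image_eqI)
      then have "\<beta> (cinv c y) = (\<lambda>_. 0)" using 0 cinv_pts[OF M c] y by simp
      then show ?thesis by (simp add: in_chart_def)
    qed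
    have sign: "?s y = 1 \<or> ?s y = -1" if "y \<in> cimg c" for y
      using volume_form_basis_nonzero[OF M compact \<nu> c that] by (simp add: sgn_if)
    note * = open_cimg[OF M c] compact_chart_image[OF M compact \<nu> c K] diff_formD(3)[OF M \<beta> c] zero
      continuous_on_sgn_volume_form[OF M compact \<nu> c] sign
    show "(\<lambda>y. ?s y * FD (\<lambda>z. ?B z (del_nth i ?b)) y (?b ! i)) integrable_on cimg c"
      by (rule integral_signed_derivative(1)[OF *])
    show "integral (cimg c) (\<lambda>y. ?s y * FD (\<lambda>z. ?B z (del_nth i ?b)) y (?b ! i)) = 0"
      by (rule integral_signed_derivative(2)[OF *])
  qed
  have "form_integral M \<nu> (ext_d M \<beta>) = integral (cimg c) (vol_density M \<nu> (ext_d M \<beta>) c)"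
    by (rule form_integral_supported[OF M compact \<nu> c top_form_diff_form[OF M d\<beta>] K]) (auto simp: d0)
  also have "\<dots> = integral (cimg c) (\<lambda>y. \<Sum>i<CARD('k). (-1) ^ i * (?s y * FD (\<lambda>z. ?B z (del_nth i ?b)) y (?b ! i)))"
    by (rule Henstock_Kurzweil_Integration.integral_cong)
      (simp add: vol_density_def in_chart_ext_d[OF M \<beta> c] dform_def length_basis_list sum_distrib_left mult.left_commute)
  also have "\<dots> = (\<Sum>i<CARD('k). integral (cimg c) (\<lambda>y. (-1) ^ i * (?s y * FD (\<lambda>z. ?B z (del_nth i ?b)) y (?b ! i))))"
  proof (rule Henstock_Kurzweil_Integration.integral_sum)
    fix i
    show "(\<lambda>y. (-1) ^ i * (?s y * FD (\<lambda>z. ?B z (del_nth i ?b)) y (?b ! i))) integrable_on cimg c"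
      using integrable_cmul[OF I(1)[of i], of "(-1) ^ i"] by simp
  qed simp
  also have "\<dots> = 0" by (simp add: I(2))
  finally show ?thesis .
qed

text \<open>A partition of unity cuts \<open>\<beta>\<close> into pieces supported in charts. As the
  weights add up to 1, the derivatives of the pieces add up to the derivative of
  \<open>\<beta>\<close>, without any separate account of the derivatives of the weights.\<close>

theorem stokes:
  assumes \<beta>: "diff_form M (CARD('k) - 1) \<beta>"
  shows "form_integral M \<nu> (ext_d M \<beta>) = 0"
proof -
  obtain P where P: "partition_of_unity M P" using partition_of_unity_exists[OF M compact] by blast
  let ?\<beta> = "\<lambda>p x vs. snd p x * \<beta> x vs"
  have d: "diff_form M (CARD('k) - 1) (?\<beta> p)" if "p \<in> set P" for p
    using diff_form_mult[OF M partition_of_unityD(2)[OF M compact \<nu> P, of "fst p" "snd p"] \<beta>] that by simp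
  have top: "top_form M (ext_d M (?\<beta> p))" if "p \<in> set P" for p
    using diff_form_ext_d[OF M d[OF that]] top_form_diff_form[OF M, of "ext_d M (?\<beta> p)"] by simp
  have "ext_d M \<beta> x vs = (\<Sum>p\<leftarrow>P. ext_d M (?\<beta> p) x vs)" for x vs
  proof -
    have "ext_d M \<beta> x vs = ext_d M (\<lambda>x vs. \<Sum>p\<leftarrow>P. ?\<beta> p x vs) x vs"
      by (rule ext_d_cong[OF M]) (use P in \<open>simp add: partition_of_unity_def sum_list_mult_const case_prod_unfold\<close>)
    also have "\<dots> = (\<Sum>p\<leftarrow>P. ext_d M (?\<beta> p) x vs)"
      by (rule conjunct2[OF ext_d_sum_list[OF M d]])
    finally show ?thesis .
  qed
  then have "form_integral M \<nu> (ext_d M \<beta>) = form_integral M \<nu> (\<lambda>x vs. \<Sum>p\<leftarrow>P. ext_d M (?\<beta> p) x vs)"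
    by (intro form_integral_cong[OF M compact \<nu>]) simp
  also have "\<dots> = (\<Sum>p\<leftarrow>P. form_integral M \<nu> (ext_d M (?\<beta> p)))"
    using form_integral_sum_list[OF M compact \<nu>, of P "\<lambda>p. ext_d M (?\<beta> p)"] top by blast
  also have "\<dots> = (\<Sum>p\<leftarrow>P. 0)"
  proof (intro arg_cong[where f=sum_list] map_cong refl)
    fix p assume p: "p \<in> set P"
    then have p': "(fst p, snd p) \<in> set P" by simp
    note D = partition_of_unityD[OF M compact \<nu> P p']
    show "form_integral M \<nu> (ext_d M (?\<beta> p)) = 0"
      by (rule stokes_in_chart[OF d[OF p] D(1) D(4,5)]) (use D(6) in auto)
  qed
  finally show ?thesis by simp
qed

end

subsection \<open>Submanifolds\<close>

text \<open>Makes the chart lemmas, which assume a manifold, applicable to one chart of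
  \<open>submfd\<close> before the whole is known to be a manifold.\<close>

lemma manifold_single_chart:
  assumes "Hausdorff_space X" "second_countable X" and c: "openin X (fst c)" "open (cimg c)"
    "homeomorphic_map (subtopology X (fst c)) (top_of_set (cimg c)) (snd c)"
  shows "manifold \<lparr>mtop = subtopology X (fst c), atlas = {c}\<rparr>"
proof -
  have sub: "fst c \<subseteq> topspace X" using c(1) openin_subset by blast
  have "smooth_on (cimg c) (snd c \<circ> cinv c)"
    by (rule smooth_on_cong[OF c(2) _ smooth_on_ident]) (simp add: f_inv_into_f)
  then show ?thesis
    unfolding manifold_def
    using assms sub
    by (simp add: Hausdorff_space_subtopology second_countable_subtopology subtopology_subtopology Int_absorb1
        openin_subtopology_refl)
qed

context
  fixes S :: "('s, real^'n) mfd" and A :: "'s set" and N :: "('s, 'd::euclidean_space) mfd"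
  assumes S: "manifold S" and A: "A \<subseteq> pts S" and N: "N = submfd S A"
begin

lemma submfd_mtop: "mtop N = subtopology (mtop S) A" and submfd_pts: "pts N = A"
  using A by (auto simp: N submfd_def)

lemma submfd_chart:
  assumes "c \<in> atlas N"
  shows "openin (mtop N) (fst c)" "open (cimg c)"
    "homeomorphic_map (subtopology (mtop N) (fst c)) (top_of_set (cimg c)) (snd c)"
    "smooth_map (euclid (cimg c)) S (cinv c)" "\<And>y. y \<in> cimg c \<Longrightarrow> inj (tmap (euclid (cimg c)) S (cinv c) y)"
    "fst c \<subseteq> A"
proof -
  show *: "openin (mtop N) (fst c)" "open (cimg c)"
    "smooth_map (euclid (cimg c)) S (cinv c)" "\<And>y. y \<in> cimg c \<Longrightarrow> inj (tmap (euclid (cimg c)) S (cinv c) y)"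
    using assms by (auto simp: N submfd_def)
  show "fst c \<subseteq> A" using openin_subset[OF *(1)] submfd_pts by simp
  then show "homeomorphic_map (subtopology (mtop N) (fst c)) (top_of_set (cimg c)) (snd c)"
    using assms by (auto simp: N submfd_def subtopology_subtopology Int_absorb1)
qed

lemma submfd_chart_manifold:
  assumes "c \<in> atlas N"
  shows "manifold \<lparr>mtop = subtopology (mtop N) (fst c), atlas = {c}\<rparr>"
  using S submfd_chart[OF assms]
  by (intro manifold_single_chart) (auto simp: submfd_mtop manifold_def Hausdorff_space_subtopology second_countable_subtopology)

lemma submfd_open_chart_image:
  assumes c: "c \<in> atlas N" and W: "openin (mtop N) W"
  shows "open (snd c ` (fst c \<inter> W))"
proof -
  have "openin (subtopology (mtop N) (fst c)) (fst c \<inter> W)" using W by (simp add: openin_subtopology_Int2)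
  from open_chart_image[OF submfd_chart_manifold[OF c], of c, simplified, OF this] show ?thesis by simp
qed

lemma submfd_openin_chart_vimage:
  assumes c: "c \<in> atlas N" and W: "open W"
  shows "openin (mtop N) (fst c \<inter> snd c -` W)"
  using openin_chart_vimage[OF submfd_chart_manifold[OF c], of c, simplified, OF W]
    openin_trans_full submfd_chart(1)[OF c] by blast

lemma submfd_cinv:
  assumes c: "c \<in> atlas N"
  shows "y \<in> cimg c \<Longrightarrow> cinv c y \<in> fst c" "y \<in> cimg c \<Longrightarrow> snd c (cinv c y) = y"
    "x \<in> fst c \<Longrightarrow> cinv c (snd c x) = x"
  using cinv_snd[OF submfd_chart_manifold[OF c], of c x] by (auto intro: inv_into_into f_inv_into_f)

lemma submfd_parametrisation:
  assumes c: "c \<in> atlas N" and d: "d \<in> atlas S"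
  shows "open (cimg c \<inter> cinv c -` fst d)"
    "smooth_on (cimg c \<inter> cinv c -` fst d) (\<lambda>y. snd d (cinv c y))"
    "\<And>y. y \<in> cimg c \<Longrightarrow> cinv c y \<in> fst d \<Longrightarrow> inj (FD (\<lambda>y. snd d (cinv c y)) y)"
proof -
  have o: "open (cimg c)" by (rule submfd_chart(2)[OF c])
  have id: "inv_into (cimg c) (\<lambda>x. x) y = y" if "y \<in> cimg c" for y
    using inv_into_f_f[of "\<lambda>x. x" "cimg c" y] that by simp
  have main: "open (cimg c \<inter> cinv c -` fst d)" "smooth_on (cimg c \<inter> cinv c -` fst d) (\<lambda>y. snd d (cinv c y))"
    if d: "d \<in> atlas S" for d
  proof -
    have "continuous_map (top_of_set (cimg c)) (mtop S) (cinv c)"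
      using submfd_chart(4)[OF c] by (simp add: smooth_map_def euclid_def)
    then have "openin (top_of_set (cimg c)) {y \<in> cimg c. cinv c y \<in> fst d}"
      using openin_continuous_map_preimage[OF _ chart_openin[OF S d]] by fastforce
    moreover have "{y \<in> cimg c. cinv c y \<in> fst d} = cimg c \<inter> cinv c -` fst d" by auto
    ultimately show 1: "open (cimg c \<inter> cinv c -` fst d)" using o openin_open_trans by metis
    have "smooth_on (cimg c \<inter> cinv c -` fst d) (snd d \<circ> cinv c \<circ> inv_into (cimg c) (\<lambda>x. x))"
      using submfd_chart(4)[OF c] d by (simp add: smooth_map_def euclid_def)
    then show "smooth_on (cimg c \<inter> cinv c -` fst d) (\<lambda>y. snd d (cinv c y))"
      by (rule smooth_on_cong[OF 1, rotated]) (simp add: id)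
  qed
  show "open (cimg c \<inter> cinv c -` fst d)" "smooth_on (cimg c \<inter> cinv c -` fst d) (\<lambda>y. snd d (cinv c y))"
    using main[OF d] .
  show "inj (FD (\<lambda>y. snd d (cinv c y)) y)" if y: "y \<in> cimg c" "cinv c y \<in> fst d" for y
  proof -
    let ?e = "chart_at S (cinv c y)"
    have e: "?e \<in> atlas S" "cinv c y \<in> fst ?e" by (rule chart_at_point[OF S d y(2)])+
    have "chart_at (euclid (cimg c)) y = (cimg c, \<lambda>x. x)"
      using y(1) by (auto simp: chart_at_def euclid_def)
    then have "tmap (euclid (cimg c)) S (cinv c) y = FD (snd ?e \<circ> cinv c \<circ> inv_into (cimg c) (\<lambda>x. x)) y"
      by (simp add: tmap_def)
    also have "\<dots> = FD (\<lambda>y. snd ?e (cinv c y)) y"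
      by (rule FD_cong[OF o y(1)]) (simp add: id)
    finally have inj: "inj (FD (\<lambda>y. snd ?e (cinv c y)) y)" using submfd_chart(5)[OF c y(1)] by simp
    let ?U = "(cimg c \<inter> cinv c -` fst ?e) \<inter> (cimg c \<inter> cinv c -` fst d)"
    have U: "open ?U" "y \<in> ?U" using main(1)[OF e(1)] main(1)[OF d] y e by auto
    \<comment> \<open>The immersion condition in \<open>submfd\<close> is read in the chosen chart
      \<open>?e\<close>. Its injective derivative factors through the derivative read in
      \<open>d\<close>, which is therefore injective too.\<close>
    have "FD (\<lambda>y. snd ?e (cinv c y)) y v = FD (\<lambda>z. snd ?e (cinv d z)) (snd d (cinv c y)) (FD (\<lambda>y. snd d (cinv c y)) y v)" for v
    proof -
      have "FD (\<lambda>y. snd ?e (cinv c y)) y = FD (\<lambda>y. snd ?e (cinv d (snd d (cinv c y)))) y"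
        by (rule FD_cong[OF U]) (auto simp: cinv_snd[OF S d])
      moreover have "FD (\<lambda>y. snd ?e (cinv d (snd d (cinv c y)))) y v =
          FD (\<lambda>z. snd ?e (cinv d z)) (snd d (cinv c y)) (FD (\<lambda>y. snd d (cinv c y)) y v)"
        by (rule FD_compose[OF smooth_on_differentiable[OF main(2)[OF d]] smooth_on_differentiable[OF transition(2)[OF S d e(1)]]])
          (use y e in auto)
      ultimately show ?thesis by simp
    qed
    then have "FD (\<lambda>y. snd ?e (cinv c y)) y = FD (\<lambda>z. snd ?e (cinv d z)) (snd d (cinv c y)) \<circ> FD (\<lambda>y. snd d (cinv c y)) y"
      by (auto simp: fun_eq_iff)
    then show ?thesis using inj inj_on_imageI2 by metis
  qed
qed

text \<open>The local left inverse of an immersion, applied to a parametrisation of \<open>N\<close>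
  read in a chart of \<open>S\<close>; composed with the parametrisation, \<open>r\<close> becomes a
  smooth retraction onto \<open>N\<close> near \<open>x\<close>.\<close>

lemma submfd_retraction:
  assumes c: "c \<in> atlas N" "x \<in> fst c" and d: "d \<in> atlas S" "x \<in> fst d"
  obtains W V r where "open W" "open V" "snd c x \<in> V" "V \<subseteq> cimg c \<inter> cinv c -` fst d" "smooth_on W r"
    "(\<lambda>y. snd d (cinv c y)) ` V \<subseteq> W" "r ` W \<subseteq> V" "\<And>y. y \<in> V \<Longrightarrow> r (snd d (cinv c y)) = y"
proof (rule immersion_local_left_inverse[of "cimg c \<inter> cinv c -` fst d" "snd c x" "\<lambda>y. snd d (cinv c y)"])
  show "snd c x \<in> cimg c \<inter> cinv c -` fst d" using c d submfd_cinv[OF c(1)] by auto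
  show "inj (FD (\<lambda>y. snd d (cinv c y)) (snd c x))"
    by (rule submfd_parametrisation(3)[OF c(1) d(1)]) (use c d submfd_cinv[OF c(1)] in auto)
qed (use submfd_parametrisation[OF c(1) d(1)] that in blast)+

text \<open>The inverse of a parametrisation is not smooth by definition. Locally it is the
  restriction of \<open>r\<close>, which is smooth on an open set of the ambient coordinates, so the
  transition map becomes a composition of smooth maps.\<close>

lemma submfd_transition:
  assumes c: "c \<in> atlas N" and d: "d \<in> atlas N"
  shows "smooth_on (snd c ` (fst c \<inter> fst d)) (snd d \<circ> cinv c)"
proof (rule smooth_on_local)
  fix y assume "y \<in> snd c ` (fst c \<inter> fst d)"
  then obtain x where x: "x \<in> fst c" "x \<in> fst d" "y = snd c x" by auto
  have "x \<in> pts S" using x(1) submfd_chart(6)[OF c] A by blast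
  then obtain e where e: "e \<in> atlas S" "x \<in> fst e" using chart_exists[OF S] by blast
  obtain W V r where r: "open W" "open V" "snd d x \<in> V" "V \<subseteq> cimg d \<inter> cinv d -` fst e" "smooth_on W r"
    "(\<lambda>y. snd e (cinv d y)) ` V \<subseteq> W" "r ` W \<subseteq> V" "\<And>y. y \<in> V \<Longrightarrow> r (snd e (cinv d y)) = y"
    using submfd_retraction[OF d x(2) e] by blast
  let ?U = "snd c ` (fst c \<inter> (fst d \<inter> snd d -` V))"
  have U: "open ?U" by (rule submfd_open_chart_image[OF c submfd_openin_chart_vimage[OF d r(2)]])
  have *: "cinv c z \<in> fst e" "snd e (cinv c z) \<in> W" "r (snd e (cinv c z)) = snd d (cinv c z)" "z \<in> cimg c" if "z \<in> ?U" for z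
  proof -
    obtain a where a: "a \<in> fst c" "a \<in> fst d" "snd d a \<in> V" "z = snd c a" using \<open>z \<in> ?U\<close> by auto
    have ca: "cinv c z = a" "cinv d (snd d a) = a" using a submfd_cinv(3)[OF c] submfd_cinv(3)[OF d] by auto
    show "cinv c z \<in> fst e" "snd e (cinv c z) \<in> W" "r (snd e (cinv c z)) = snd d (cinv c z)" "z \<in> cimg c"
      using a ca r(4,6) r(8)[OF a(3)] by auto
  qed
  have "smooth_on ?U (\<lambda>z. r (snd e (cinv c z)))"
    by (rule smooth_on_compose[OF U r(1) _ r(5) smooth_on_subset[OF submfd_parametrisation(2)[OF c e(1)]]])
      (use * in auto)
  then have "smooth_on ?U (snd d \<circ> cinv c)"
    by (rule smooth_on_cong[OF U, rotated]) (simp add: *)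
  then show "\<exists>V. open V \<and> y \<in> V \<and> smooth_on V (snd d \<circ> cinv c)"
    using U x r(3) by (intro exI[of _ ?U]) auto
qed

text \<open>The covering hypothesis carries the content: the charts that \<open>submfd\<close>
  collects need not cover an arbitrary subset \<open>A\<close>.\<close>

lemma manifold_submfd:
  assumes "\<Union> (fst ` atlas N) = A"
  shows "manifold N"
  unfolding manifold_def
proof (intro conjI)
  show "Hausdorff_space (mtop N)" "second_countable (mtop N)"
    using S by (simp_all add: submfd_mtop manifold_def Hausdorff_space_subtopology second_countable_subtopology)
  show "\<Union> (fst ` atlas N) = pts N" using assms submfd_pts by simp
qed (use submfd_chart(1-3) submfd_transition in blast)+

lemma smooth_map_submfd_inclusion: "smooth_map N S (\<lambda>x. x)"
  unfolding smooth_map_def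
proof (intro conjI ballI)
  show "continuous_map (mtop N) (mtop S) (\<lambda>x. x)"
    unfolding submfd_mtop by (simp add: continuous_map_from_subtopology)
  fix c d assume c: "c \<in> atlas N" and d: "d \<in> atlas S"
  have "snd c ` (fst c \<inter> (\<lambda>x. x) -` fst d) = cimg c \<inter> cinv c -` fst d"
    using submfd_cinv[OF c] by force
  then show "smooth_on (snd c ` (fst c \<inter> (\<lambda>x. x) -` fst d)) (snd d \<circ> (\<lambda>x. x) \<circ> cinv c)"
    using submfd_parametrisation(2)[OF c d] by (simp add: o_def)
qed

end

lemma diff_form_pullback:
  fixes M :: "('a, 'e::euclidean_space) mfd" and N :: "('b, 'f::euclidean_space) mfd"
  assumes M: "manifold M" and N: "manifold N" and f: "smooth_map M N f" and \<tau>: "diff_form N p \<tau>"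
  shows "diff_form M p (pullback M N f \<tau>)"
  unfolding diff_form_def
proof (intro conjI ballI allI impI)
  fix x assume x: "x \<in> pts M"
  have eq: "pullback M N f \<tau> x = (\<lambda>vs. \<tau> (f x) (map (tmap M N f x) vs))"
    using x by (auto simp: pullback_def fun_eq_iff)
  show "alt_multilinear p (pullback M N f \<tau> x)"
    unfolding eq
    by (rule alt_multilinear_map[OF diff_formD(1)[OF N \<tau> smooth_map_pts[OF M N f x]] linear_tmap[OF M N f x]])
next
  fix c vs assume c: "c \<in> atlas M"
  show "smooth_on (cimg c) (\<lambda>y. in_chart M c (pullback M N f \<tau>) y vs)"
  proof (rule smooth_on_local)
    fix y assume "y \<in> cimg c"
    then obtain x where x: "x \<in> fst c" "y = snd c x" by auto
    have "f x \<in> pts N" using x chart_subset[OF M c] smooth_map_pts[OF M N f] by blast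
    then obtain d where d: "d \<in> atlas N" "f x \<in> fst d" using chart_exists[OF N] by blast
    let ?U = "snd c ` (fst c \<inter> f -` fst d)" and ?\<rho> = "\<lambda>y. snd d (f (cinv c y))"
    note U = smooth_map_in_charts[OF M N f c d(1)]
    have \<rho>U: "?\<rho> ` ?U \<subseteq> cimg d" by (auto simp: cinv_snd[OF M c])
    let ?ws = "map (\<lambda>v y. FD ?\<rho> y v) vs"
    have "smooth_on ?U (\<lambda>y. in_chart N d \<tau> (?\<rho> y) (map (\<lambda>w. w y) ?ws @ []))"
    proof (rule smooth_on_multilinear[OF U(1)])
      show "alt_multilinear p (in_chart N d \<tau> (?\<rho> z))" if "z \<in> ?U" for z
        using diff_formD(4)[OF N \<tau> d(1)] \<rho>U that by blast
      show "smooth_on ?U (\<lambda>z. in_chart N d \<tau> (?\<rho> z) vs)" for vs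
        by (rule smooth_on_compose[OF U(1) open_cimg[OF N d(1)] \<rho>U diff_formD(3)[OF N \<tau> d(1)] U(2)])
      show "smooth_on ?U w" if "w \<in> set ?ws" for w
        using that smooth_on_FD[OF U(2)] by auto
    qed
    then have "smooth_on ?U (\<lambda>y. in_chart M c (pullback M N f \<tau>) y vs)"
    proof (rule smooth_on_cong[OF U(1), rotated])
      fix z assume "z \<in> ?U"
      then obtain a where a: "a \<in> fst c" "f a \<in> fst d" "z = snd c a" by auto
      have aM: "a \<in> pts M" using a(1) chart_subset[OF M c] by blast
      have "in_chart M c (pullback M N f \<tau>) z vs = \<tau> (f a) (map (\<lambda>v. tmap M N f a (from_chart M c a v)) vs)"
        using a aM by (simp add: in_chart_at_point[OF M c] pullback_def o_def)
      also have "\<dots> = \<tau> (f a) (map (\<lambda>v. from_chart N d (f a) (FD ?\<rho> z v)) vs)"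
        using tmap_from_chart[OF M N f c a(1) d(1) a(2)] a(3) by simp
      also have "\<dots> = in_chart N d \<tau> (?\<rho> z) (map (\<lambda>v. FD ?\<rho> z v) vs)"
        using in_chart_at_point[OF N d(1) a(2), of \<tau> "map (\<lambda>v. FD ?\<rho> z v) vs"] a by (simp add: cinv_snd[OF M c] o_def)
      finally show "in_chart N d \<tau> (?\<rho> z) (map (\<lambda>w. w z) ?ws @ []) = in_chart M c (pullback M N f \<tau>) z vs"
        by (simp add: o_def)
    qed
    then show "\<exists>V. open V \<and> y \<in> V \<and> smooth_on V (\<lambda>y. in_chart M c (pullback M N f \<tau>) y vs)"
      using U(1) x d by (intro exI[of _ ?U]) auto
  qed
qed (auto simp: pullback_def)

subsection \<open>The image of an embedding\<close>

text \<open>These charts cover the image of an embedding, and in them a form pushed forward from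
  \<open>M\<close> has the same components as the original in the chart \<open>c\<close>.\<close>

definition push_chart :: "('m, 'd) mfd \<Rightarrow> ('m \<Rightarrow> 's) \<Rightarrow> ('m, 'd) chart \<Rightarrow> ('s, 'd) chart" where
  "push_chart M f c = (f ` fst c, snd c \<circ> inv_into (pts M) f)"

context
  fixes M :: "('m, 'd::euclidean_space) mfd" and S :: "('s, real^'n) mfd" and f :: "'m \<Rightarrow> 's"
    and N :: "('s, 'd) mfd" and finv :: "'s \<Rightarrow> 'm"
  assumes M: "manifold M" and S: "manifold S" and f: "f \<in> Emb M S"
    and N: "N = submfd S (f ` pts M)" and finv: "finv = inv_into (pts M) f"
begin

lemma emb_smooth: "smooth_map M S f"
  using f by (simp add: Emb_def)

lemma emb_image_subset: "f ` pts M \<subseteq> pts S"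
  using smooth_map_pts[OF M S emb_smooth] by blast

lemma emb_mtop: "mtop N = subtopology (mtop S) (f ` pts M)" and emb_pts: "pts N = f ` pts M"
  using submfd_mtop[OF S emb_image_subset N] submfd_pts[OF S emb_image_subset N] by auto

lemma emb_homeomorphic: "homeomorphic_map (mtop M) (mtop N) f"
  using f unfolding emb_mtop by (simp add: Emb_def embedding_map_def)

lemma emb_inj: "inj_on f (pts M)"
  using homeomorphic_imp_injective_map[OF emb_homeomorphic] .

lemma finv_f: "x \<in> pts M \<Longrightarrow> finv (f x) = x"
  and f_finv: "z \<in> pts N \<Longrightarrow> f (finv z) = z"
  and finv_pts: "z \<in> pts N \<Longrightarrow> finv z \<in> pts M"
  using emb_inj unfolding finv emb_pts by (auto intro: inv_into_into f_inv_into_f)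

lemma finv_homeomorphic: "homeomorphic_map (mtop N) (mtop M) finv"
proof -
  obtain g where g: "homeomorphic_maps (mtop M) (mtop N) f g"
    using emb_homeomorphic homeomorphic_map_maps by blast
  have "homeomorphic_map (mtop N) (mtop M) g" using g homeomorphic_maps_map by blast
  moreover have "g z = finv z" if "z \<in> pts N" for z
  proof -
    have "g (f (finv z)) = finv z" using g finv_pts[OF that] by (simp add: homeomorphic_maps_def)
    then show ?thesis by (simp add: f_finv[OF that])
  qed
  ultimately show ?thesis by (rule homeomorphic_map_eq)
qed

lemma push_chart_simps:
  assumes c: "c \<in> atlas M"
  shows "fst (push_chart M f c) = f ` fst c" "cimg (push_chart M f c) = cimg c"
    "x \<in> fst c \<Longrightarrow> snd (push_chart M f c) (f x) = snd c x"
    "y \<in> cimg c \<Longrightarrow> cinv (push_chart M f c) y = f (cinv c y)"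
    "snd (push_chart M f c) = snd c \<circ> finv"
proof -
  note sub = chart_subset[OF M c, THEN subsetD]
  show 1: "fst (push_chart M f c) = f ` fst c" "snd (push_chart M f c) = snd c \<circ> finv"
    by (simp_all add: push_chart_def finv)
  show 2: "snd (push_chart M f c) (f x) = snd c x" if "x \<in> fst c" for x
    by (simp add: 1 finv_f[OF sub[OF that]])
  show 3: "cimg (push_chart M f c) = cimg c"
    unfolding 1(1) image_image using 2 by (auto cong: image_cong)
  show "cinv (push_chart M f c) y = f (cinv c y)" if y: "y \<in> cimg c"
  proof (rule inv_into_f_eq)
    show "inj_on (snd (push_chart M f c)) (fst (push_chart M f c))"
      using chart_inj[OF M c] 2 unfolding 1(1) by (auto simp: inj_on_def)
    show "f (cinv c y) \<in> fst (push_chart M f c)" using cinv_in[OF M y] by (simp add: 1)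
    show "snd (push_chart M f c) (f (cinv c y)) = y" using 2[OF cinv_in[OF M y]] snd_cinv[OF M y] by simp
  qed
qed

text \<open>On \<open>cimg c\<close> the inverse of the pushed chart is
  \<open>f \<circ> cinv c\<close>, so it inherits smoothness and an injective derivative from
  \<open>f\<close>; openness and the homeomorphism come from \<open>f\<close> being a topological
  embedding.\<close>

lemma push_chart_in_atlas:
  assumes c: "c \<in> atlas M"
  shows "push_chart M f c \<in> atlas N"
proof -
  let ?p = "push_chart M f c"
  note p = push_chart_simps[OF c]
  have sub: "fst c \<subseteq> pts M" by (rule chart_subset[OF M c])
  have o: "open (cimg c)" by (rule open_cimg[OF M c])
  have 1: "openin (subtopology (mtop S) (f ` pts M)) (fst ?p)"
    using homeomorphic_imp_open_map[OF emb_homeomorphic] chart_openin[OF M c]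
    unfolding p(1) by (simp add: open_map_def emb_mtop)
  have 3: "homeomorphic_map (subtopology (mtop S) (fst ?p)) (top_of_set (cimg ?p)) (snd ?p)"
  proof -
    have "finv ` f ` fst c = (\<lambda>x. x) ` fst c"
      unfolding image_image by (rule image_cong) (use sub finv_f in auto)
    moreover have "pts N \<inter> f ` fst c = f ` fst c" "pts M \<inter> fst c = fst c"
      unfolding emb_pts using sub by auto
    ultimately have "homeomorphic_map (subtopology (mtop N) (f ` fst c)) (subtopology (mtop M) (fst c)) finv"
      by (intro homeomorphic_map_subtopologies[OF finv_homeomorphic]) simp
    then have "homeomorphic_map (subtopology (mtop N) (f ` fst c)) (top_of_set (cimg c)) (snd c \<circ> finv)"
      by (rule homeomorphic_map_compose) (rule chart_homeomorphic[OF M c])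
    moreover have "subtopology (mtop N) (f ` fst c) = subtopology (mtop S) (f ` fst c)"
      unfolding emb_mtop subtopology_subtopology using sub by (simp add: Int_absorb1 image_mono)
    ultimately show ?thesis unfolding p(2) by (simp only: p(1,5))
  qed
  have id: "inv_into (cimg c) (\<lambda>x. x) y = y" if "y \<in> cimg c" for y
    using inv_into_f_f[of "\<lambda>x. x" "cimg c" y] that by simp
  have 4: "smooth_map (euclid (cimg ?p)) S (cinv ?p)"
    unfolding smooth_map_def
  proof (intro conjI ballI)
    have "continuous_map (top_of_set (cimg c)) (mtop S) (f \<circ> cinv c)"
      using continuous_map_compose[OF continuous_map_cinv[OF M c]] emb_smooth by (auto simp: smooth_map_def)
    then have "continuous_map (top_of_set (cimg c)) (mtop S) (cinv ?p)"
      by (rule continuous_map_eq) (simp add: p(4))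
    then show "continuous_map (mtop (euclid (cimg ?p))) (mtop S) (cinv ?p)" unfolding p(2) by (simp add: euclid_def)
    fix e d assume e: "e \<in> atlas (euclid (cimg ?p))" and d: "d \<in> atlas S"
    have e': "e = (cimg c, \<lambda>x. x)" using e unfolding p(2) by (simp add: euclid_def)
    note U = smooth_map_in_charts[OF M S emb_smooth c d]
    have eq: "cimg c \<inter> cinv ?p -` fst d = snd c ` (fst c \<inter> f -` fst d)"
      using cinv_in[OF M, of _ c] snd_cinv[OF M, of _ c] cinv_snd[OF M c] by (force simp: p(4))
    have "smooth_on (snd c ` (fst c \<inter> f -` fst d)) (snd d \<circ> cinv ?p \<circ> inv_into (cimg c) (\<lambda>x. x))"
      by (rule smooth_on_cong[OF U(1) _ U(2)]) (auto simp: id p(4))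
    then show "smooth_on (snd e ` (fst e \<inter> cinv ?p -` fst d)) (snd d \<circ> cinv ?p \<circ> cinv e)"
      by (simp add: e' eq)
  qed
  have 5: "inj (tmap (euclid (cimg ?p)) S (cinv ?p) y)" if y: "y \<in> cimg ?p" for y
  proof -
    have y': "y \<in> cimg c" using y p(2) by simp
    let ?x = "cinv c y"
    have x: "?x \<in> fst c" "?x \<in> pts M" "snd c ?x = y"
      using cinv_in[OF M y'] cinv_pts[OF M c y'] snd_cinv[OF M y'] .
    let ?e = "chart_at S (f ?x)"
    have fx: "f ?x \<in> pts S" by (rule smooth_map_pts[OF M S emb_smooth x(2)])
    note e = chart_at[OF S fx]
    have "chart_at (euclid (cimg c)) y = (cimg c, \<lambda>x. x)"
      using y' by (auto simp: chart_at_def euclid_def)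
    then have "tmap (euclid (cimg ?p)) S (cinv ?p) y = FD (snd ?e \<circ> cinv ?p \<circ> inv_into (cimg c) (\<lambda>x. x)) y"
      unfolding p(2) by (simp add: tmap_def p(4)[OF y'])
    also have "\<dots> = FD (\<lambda>y. snd ?e (f (cinv c y))) y"
      by (rule FD_cong[OF o y']) (simp add: id p(4))
    also have "\<dots> = tmap M S f ?x \<circ> from_chart M c ?x"
      using tmap_from_chart[OF M S emb_smooth c x(1) e] from_chart_at[OF S fx] x(3) by (auto simp: fun_eq_iff)
    finally have eq: "tmap (euclid (cimg ?p)) S (cinv ?p) y = tmap M S f ?x \<circ> from_chart M c ?x" .
    have "inj (tmap M S f ?x)" using f x(2) by (simp add: Emb_def)
    moreover have "inj (from_chart M c ?x)" using to_from_chart[OF M c x(1)] by (rule inj_on_inverseI)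
    ultimately show ?thesis unfolding eq by (rule inj_compose)
  qed
  show ?thesis
    unfolding N submfd_def mfd.simps mem_Collect_eq
    by (intro conjI ballI 1 3 4 5) (simp_all only: p(2) o)
qed

lemma manifold_emb: "manifold N"
proof (rule manifold_submfd[OF S emb_image_subset N])
  show "\<Union> (fst ` atlas N) = f ` pts M"
  proof
    show "\<Union> (fst ` atlas N) \<subseteq> f ` pts M" using submfd_chart(6)[OF S emb_image_subset N] by blast
    show "f ` pts M \<subseteq> \<Union> (fst ` atlas N)"
    proof
      fix z assume "z \<in> f ` pts M"
      then obtain x c where "z = f x" "c \<in> atlas M" "x \<in> fst c" using chart_exists[OF M] by blast
      then show "z \<in> \<Union> (fst ` atlas N)"
        using push_chart_in_atlas[of c] push_chart_simps(1)[of c] by (intro UN_I[of "push_chart M f c"]) auto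
    qed
  qed
qed

text \<open>Since \<open>snd c \<circ> finv\<close> is the coordinate map of
  \<open>push_chart M f c\<close>, the local expression of \<open>finv\<close> is a transition map
  of \<open>N\<close>.\<close>

lemma smooth_finv: "smooth_map N M finv"
  unfolding smooth_map_def
proof (intro conjI ballI)
  show "continuous_map (mtop N) (mtop M) finv" using finv_homeomorphic homeomorphic_imp_continuous_map by blast
  fix d c assume d: "d \<in> atlas N" and c: "c \<in> atlas M"
  note p = push_chart_simps[OF c] and T = transition[OF manifold_emb d push_chart_in_atlas[OF c]]
  have "z \<in> f ` fst c \<longleftrightarrow> finv z \<in> fst c" if "z \<in> fst d" for z
  proof
    have zN: "z \<in> pts N" using that chart_subset[OF manifold_emb d] by blast
    show "finv z \<in> fst c" if "z \<in> f ` fst c" using that chart_subset[OF M c] finv_f by auto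
    show "z \<in> f ` fst c" if "finv z \<in> fst c" using f_finv[OF zN] that by (intro image_eqI[of z f "finv z"]) auto
  qed
  then have eq: "fst d \<inter> fst (push_chart M f c) = fst d \<inter> finv -` fst c" unfolding p(1) by auto
  show "smooth_on (snd d ` (fst d \<inter> finv -` fst c)) (snd c \<circ> finv \<circ> cinv d)"
    using T(2) unfolding eq p(5) by (simp add: o_def)
qed

lemma compact_emb: "compact_space (mtop M) \<Longrightarrow> compact_space (mtop N)"
  using homeomorphic_compact_space emb_homeomorphic homeomorphic_map_imp_homeomorphic_space by blast

lemma in_chart_push_chart:
  assumes c: "c \<in> atlas M" and y: "y \<in> cimg c"
  shows "in_chart N (push_chart M f c) (pullback N M finv \<tau>) y vs = in_chart M c \<tau> y vs"
proof -
  let ?x = "cinv c y" and ?p = "push_chart M f c"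
  note p = push_chart_simps[OF c] and pN = push_chart_in_atlas[OF c]
  have x: "?x \<in> fst c" "?x \<in> pts M" "snd c ?x = y"
    using cinv_in[OF M y] cinv_pts[OF M c y] snd_cinv[OF M y] .
  have fx: "f ?x \<in> fst ?p" "f ?x \<in> pts N" "snd ?p (f ?x) = y" "finv (f ?x) = ?x"
    using x p(3)[OF x(1)] finv_f[OF x(2)] by (auto simp: p(1) emb_pts)
  have "FD (\<lambda>y. snd c (finv (cinv ?p y))) y = FD (\<lambda>y. y) y"
    by (rule FD_cong[OF open_cimg[OF M c] y])
      (simp add: p(4) finv_f cinv_pts[OF M c] snd_cinv[OF M])
  then have "tmap N M finv (f ?x) (from_chart N ?p (f ?x) v) = from_chart M c ?x v" for v
    using tmap_from_chart[OF manifold_emb M smooth_finv pN fx(1) c, of v] x fx by simp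
  then show ?thesis
    unfolding in_chart_def p(4)[OF y] by (simp add: pullback_def fx o_def)
qed

lemma tmap_inclusion_push_chart:
  assumes c: "c \<in> atlas M" and x: "x \<in> fst c"
  shows "tmap N S (\<lambda>x. x) (f x) (from_chart N (push_chart M f c) (f x) v) = tmap M S f x (from_chart M c x v)"
proof -
  let ?p = "push_chart M f c"
  note p = push_chart_simps[OF c] and pN = push_chart_in_atlas[OF c]
  have "f x \<in> pts S" using smooth_map_pts[OF M S emb_smooth] x chart_subset[OF M c] by blast
  then obtain e where e: "e \<in> atlas S" "f x \<in> fst e" using chart_exists[OF S] by blast
  have fx: "f x \<in> fst ?p" using x p(1) by simp
  have "FD (\<lambda>y. snd e (cinv ?p y)) (snd c x) = FD (\<lambda>y. snd e (f (cinv c y))) (snd c x)"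
    by (rule FD_cong[OF open_cimg[OF M c]]) (use x in \<open>auto simp: p(4)\<close>)
  then show ?thesis
    using tmap_from_chart[OF manifold_emb S smooth_map_submfd_inclusion[OF S emb_image_subset N] pN fx e, of v]
      tmap_from_chart[OF M S emb_smooth c x e, of v] p(3)[OF x] by simp
qed

text \<open>Tangent vectors of the image come from tangent vectors of \<open>M\<close>. This carries
  both the immersion property and isotropy from \<open>f\<close> over to the inclusion of
  \<open>N\<close>.\<close>

lemma range_tmap_inclusion:
  assumes "x \<in> pts M"
  shows "\<exists>a. tmap N S (\<lambda>x. x) (f x) v = tmap M S f x a \<and> (a = 0 \<longrightarrow> v = 0)"
proof -
  obtain c where c: "c \<in> atlas M" "x \<in> fst c" using chart_exists[OF M assms] by blast
  let ?p = "push_chart M f c"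
  have fx: "f x \<in> fst ?p" using c push_chart_simps(1)[OF c(1)] by simp
  note pN = push_chart_in_atlas[OF c(1)]
  let ?v = "to_chart N ?p (f x) v"
  have "tmap N S (\<lambda>x. x) (f x) v = tmap M S f x (from_chart M c x ?v)"
    using tmap_inclusion_push_chart[OF c, of ?v] from_to_chart[OF manifold_emb pN fx] by simp
  moreover have "v = 0" if "from_chart M c x ?v = 0"
  proof -
    have "?v = 0" using that to_from_chart[OF M c, of ?v] linear_0[OF to_chart_linear[OF M c]] by simp
    then show ?thesis
      using from_to_chart[OF manifold_emb pN fx, of v] linear_0[OF from_chart_linear[OF manifold_emb pN fx]] by simp
  qed
  ultimately show ?thesis by blast
qed

lemma inj_tmap_inclusion:
  assumes "z \<in> pts N"
  shows "inj (tmap N S (\<lambda>x. x) z)"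
proof -
  obtain x where x: "x \<in> pts M" "z = f x" using assms emb_pts by auto
  have lin: "linear (tmap N S (\<lambda>x. x) z)"
    by (rule linear_tmap[OF manifold_emb S smooth_map_submfd_inclusion[OF S emb_image_subset N] assms])
  have "v = 0" if "tmap N S (\<lambda>x. x) z v = 0" for v
  proof -
    obtain a where a: "tmap N S (\<lambda>x. x) (f x) v = tmap M S f x a" "a = 0 \<longrightarrow> v = 0"
      using range_tmap_inclusion[OF x(1)] by blast
    have "inj (tmap M S f x)" using f x by (simp add: Emb_def)
    then have "a = 0" using a(1) that x linear_0[OF linear_tmap[OF M S emb_smooth x(1)]] by (metis injD)
    then show ?thesis using a(2) by blast
  qed
  then show ?thesis by (simp add: linear_injective_0[OF lin])
qed

lemma isotropic_inclusion:
  assumes "pullback M S f \<omega> = (\<lambda>_ _. 0)" "z \<in> pts N"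
  shows "\<omega> z [tmap N S (\<lambda>x. x) z v, tmap N S (\<lambda>x. x) z w] = 0"
proof -
  obtain x where x: "x \<in> pts M" "z = f x" using assms(2) emb_pts by auto
  obtain a b where "tmap N S (\<lambda>x. x) z v = tmap M S f x a" "tmap N S (\<lambda>x. x) z w = tmap M S f x b"
    using range_tmap_inclusion[OF x(1)] x(2) by metis
  moreover have "pullback M S f \<omega> x [a, b] = 0" using assms(1) by metis
  ultimately show ?thesis using x by (simp add: pullback_def)
qed

end

section \<open>Transport of the volume form and of integrals along an embedding\<close>

context
  fixes M :: "('m, real^'k) mfd" and S :: "('s, real^'n) mfd" and f :: "'m \<Rightarrow> 's" and N :: "('s, real^'k) mfd"
    and \<mu> :: "('m, real^'k) form" and \<nu> :: "('s, real^'k) form"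
  assumes M: "manifold M" and S: "manifold S" and f: "f \<in> Emb M S"
    and N: "N = submfd S (f ` pts M)" and compact: "compact_space (mtop M)" and \<mu>: "volume_form M \<mu>"
    and \<nu>: "\<nu> = pullback N M (inv_into (pts M) f) \<mu>"
begin

lemma volume_form_push: "volume_form N \<nu>"
proof -
  note * = manifold_emb[OF M S f N refl] smooth_finv[OF M S f N refl]
  have "diff_form M DIM(real^'k) \<mu>" using \<mu> by (simp add: volume_form_def)
  then have "diff_form N DIM(real^'k) \<nu>" unfolding \<nu> by (rule diff_form_pullback[OF *(1) M *(2)])
  moreover have "\<nu> z \<noteq> (\<lambda>_. 0)" if z: "z \<in> pts N" for z
  proof
    assume 0: "\<nu> z = (\<lambda>_. 0)"
    obtain x where x: "x \<in> pts M" "z = f x" using z emb_pts[OF M S f N refl] by auto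
    obtain c where c: "c \<in> atlas M" "x \<in> fst c" using chart_exists[OF M x(1)] by blast
    have y: "snd c x \<in> cimg c" using c by simp
    have "in_chart M c \<mu> (snd c x) basis_list = in_chart N (push_chart M f c) \<nu> (snd c x) basis_list"
      unfolding \<nu> by (rule in_chart_push_chart[OF M S f N refl c(1) y, symmetric])
    also have "\<dots> = 0"
      using 0 push_chart_simps(4)[OF M S f N refl c(1) y] by (simp add: in_chart_def cinv_snd[OF M c] x(2))
    finally show False using volume_form_basis_nonzero[OF M compact \<mu> c(1) y] by simp
  qed
  ultimately show ?thesis by (simp add: volume_form_def)
qed

text \<open>The change of variables produces no Jacobian: in the pushed charts the components agree,
  and the pushed partition of unity computes the integral over \<open>N\<close>.\<close>

lemma form_integral_push:
  assumes \<tau>N: "top_form N \<tau>N"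
    and eq: "\<And>c y. c \<in> atlas M \<Longrightarrow> y \<in> cimg c \<Longrightarrow>
      in_chart N (push_chart M f c) \<tau>N y basis_list = in_chart M c \<tau>M y basis_list"
  shows "form_integral M \<mu> \<tau>M = form_integral N \<nu> \<tau>N"
proof -
  let ?g = "inv_into (pts M) f"
  note N' = manifold_emb[OF M S f N refl]
  let ?P = "SOME P. partition_of_unity M P"
  note P = some_partition_of_unity[OF M compact \<mu>]
  let ?Q = "map (\<lambda>(c, \<rho>). (push_chart M f c, \<rho> \<circ> ?g)) ?P"
  have "form_integral N \<nu> \<tau>N = (\<Sum>(c, \<rho>)\<leftarrow>?Q. integral (cimg c) (vol_density N \<nu> (\<lambda>x vs. \<rho> x * \<tau>N x vs) c))"
  proof (rule form_integral_partition[OF N' compact_emb[OF M S f N refl compact] volume_form_push _ _ \<tau>N])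
    fix d \<sigma> assume "(d, \<sigma>) \<in> set ?Q"
    then obtain c \<rho> where c: "(c, \<rho>) \<in> set ?P" "d = push_chart M f c" "\<sigma> = \<rho> \<circ> ?g" by auto
    note D = partition_of_unityD[OF M compact \<mu> P c(1)]
    have "chart_continuous N \<sigma>"
      unfolding c(3) o_def
      by (rule smooth_fun_chart_continuous[OF smooth_fun_smooth_map[OF N' M smooth_finv[OF M S f N refl] D(2)]])
    moreover have "mtop N closure_of {x \<in> pts N. \<sigma> x \<noteq> 0} \<subseteq> fst d"
    proof -
      have "{x \<in> pts N. \<sigma> x \<noteq> 0} = f ` {x \<in> pts M. \<rho> x \<noteq> 0}"
        unfolding emb_pts[OF M S f N refl] c(3) using finv_f[OF M S f N refl] by auto
      then have "mtop N closure_of {x \<in> pts N. \<sigma> x \<noteq> 0} = f ` (mtop M closure_of {x \<in> pts M. \<rho> x \<noteq> 0})"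
        by (simp add: homeomorphic_map_closure_of[OF emb_homeomorphic[OF M S f N refl]])
      then show ?thesis using D(5) push_chart_simps(1)[OF M S f N refl D(1)] c(2) by auto
    qed
    ultimately show "d \<in> atlas N \<and> chart_continuous N \<sigma> \<and> mtop N closure_of {x \<in> pts N. \<sigma> x \<noteq> 0} \<subseteq> fst d"
      using push_chart_in_atlas[OF M S f N refl D(1)] c(2) by simp
  next
    fix z assume "z \<in> pts N"
    then have "?g z \<in> pts M" by (rule finv_pts[OF M S f N refl])
    then have "(\<Sum>(c, \<rho>)\<leftarrow>?P. \<rho> (?g z)) = 1" using P unfolding partition_of_unity_def by blast
    then show "(\<Sum>(c, \<rho>)\<leftarrow>?Q. \<rho> z) = 1" by (simp only: map_map o_def case_prod_unfold fst_conv snd_conv)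
  qed
  also have "\<dots> = (\<Sum>(c, \<rho>)\<leftarrow>?P. integral (cimg c) (vol_density M \<mu> (\<lambda>x vs. \<rho> x * \<tau>M x vs) c))"
    unfolding map_map
  proof (intro arg_cong[where f=sum_list] map_cong refl)
    fix q assume q: "q \<in> set ?P"
    obtain c \<rho> where q': "q = (c, \<rho>)" by (cases q)
    have c: "c \<in> atlas M" using partition_of_unityD(1)[OF M compact \<mu> P] q q' by blast
    note p = push_chart_simps[OF M S f N refl c]
    have "integral (cimg (push_chart M f c)) (vol_density N \<nu> (\<lambda>x vs. (\<rho> \<circ> ?g) x * \<tau>N x vs) (push_chart M f c)) =
        integral (cimg c) (vol_density M \<mu> (\<lambda>x vs. \<rho> x * \<tau>M x vs) c)"
      unfolding p(2)
    proof (rule Henstock_Kurzweil_Integration.integral_cong)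
      fix y assume y: "y \<in> cimg c"
      have "in_chart N (push_chart M f c) \<nu> y basis_list = in_chart M c \<mu> y basis_list"
        unfolding \<nu> by (rule in_chart_push_chart[OF M S f N refl c y])
      then show "vol_density N \<nu> (\<lambda>x vs. (\<rho> \<circ> ?g) x * \<tau>N x vs) (push_chart M f c) y =
          vol_density M \<mu> (\<lambda>x vs. \<rho> x * \<tau>M x vs) c y"
        using eq[OF c y]
        by (simp add: vol_density_mult p(4)[OF y] finv_f[OF M S f N refl cinv_pts[OF M c y]]) (simp add: vol_density_def)
    qed
    then show "((\<lambda>(c, \<rho>). integral (cimg c) (vol_density N \<nu> (\<lambda>x vs. \<rho> x * \<tau>N x vs) c)) \<circ>
          (\<lambda>(c, \<rho>). (push_chart M f c, \<rho> \<circ> ?g))) q =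
        (case q of (c, \<rho>) \<Rightarrow> integral (cimg c) (vol_density M \<mu> (\<lambda>x vs. \<rho> x * \<tau>M x vs) c))"
      by (simp add: q')
  qed
  also have "\<dots> = form_integral M \<mu> \<tau>M"
    by (rule form_integral_alt[OF M compact \<mu>, symmetric])
  finally show ?thesis by simp
qed

end

subsection \<open>Hamiltonian vector fields with prescribed values on a submanifold\<close>

lemma two_form_linear:
  assumes "alt_multilinear 2 w"
  shows "linear (\<lambda>u. w [u, v])" "linear (\<lambda>v. w [u, v])"
  using alt_multilinear_linear_append[OF assms, of "[]" "[v]"] alt_multilinear_linear_append[OF assms, of "[u]" "[]"]
  by simp_all

lemma linear_scaleR_const: "linear f \<Longrightarrow> linear (\<lambda>u. f u *\<^sub>R b)"
  by (rule linearI) (simp_all add: linear_add linear_cmul scaleR_add_left)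

lemma one_form_linear: "alt_multilinear 1 w \<Longrightarrow> linear (\<lambda>v. w [v])"
  using alt_multilinear_linear_append[of 1 w "[]" "[]"] by simp

section \<open>Hamiltonian vector fields of functions on the symplectic manifold\<close>

context
  fixes S :: "('s, real^'n) mfd" and \<omega> :: "('s, real^'n) form"
  assumes \<omega>: "symplectic S \<omega>"
begin

lemma symplectic_manifold: "manifold S" and symplectic_diff_form: "diff_form S 2 \<omega>"
  and symplectic_nondegenerate: "x \<in> pts S \<Longrightarrow> (\<And>v. \<omega> x [u, v] = 0) \<Longrightarrow> u = 0"
  using \<omega> by (auto simp: symplectic_def)

lemma symplectic_linear:
  assumes "x \<in> pts S"
  shows "linear (\<lambda>u. \<omega> x [u, v])" "linear (\<lambda>v. \<omega> x [u, v])"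
  using two_form_linear diff_formD(1)[OF symplectic_manifold symplectic_diff_form assms] by blast+

lemma symplectic_swap:
  assumes "x \<in> pts S"
  shows "\<omega> x [u, v] = - \<omega> x [v, u]"
  using alt_multilinear_swap_append[OF diff_formD(1)[OF symplectic_manifold symplectic_diff_form assms], of "[]" u "[]" v "[]"]
  by simp

lemma ext_d_fun_linear:
  assumes "smooth_fun S H" "x \<in> pts S"
  shows "linear (\<lambda>v. ext_d S (fun_form S H) x [v])"
  using one_form_linear diff_formD(1)[OF symplectic_manifold
      diff_form_ext_d[OF symplectic_manifold diff_form_fun_form[OF symplectic_manifold assms(1)]] assms(2)]
  by simp

text \<open>Nondegeneracy makes the map from vectors to covectors injective, hence surjective by
  equality of dimensions; \<open>T\<close> represents a covector by its values on
  \<open>Basis\<close>.\<close>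

lemma hamiltonian_vector_exists:
  assumes H: "smooth_fun S H" and x: "x \<in> pts S"
  shows "\<exists>u. \<forall>v. \<omega> x [u, v] = ext_d S (fun_form S H) x [v]"
proof -
  define T where "T u = (\<Sum>b\<in>Basis. \<omega> x [u, b] *\<^sub>R b)" for u
  have T: "linear T"
    unfolding T_def[abs_def] by (intro linear_compose_sum ballI linear_scaleR_const symplectic_linear(1)[OF x])
  have Tb: "T u \<bullet> b = \<omega> x [u, b]" if "b \<in> Basis" for u b
    unfolding T_def using that by (simp add: inner_sum_left inner_Basis if_distrib sum.delta cong: if_cong)
  have "inj T"
    unfolding linear_injective_0[OF T]
  proof (intro allI impI)
    fix u assume "T u = 0"
    then have "\<omega> x [u, b] = 0" if "b \<in> Basis" for b using Tb[OF that, of u] by simp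
    then have "\<omega> x [u, v] = 0" for v
      using linear_basis_expansion[OF symplectic_linear(2)[OF x], of u v] by simp
    then show "u = 0" by (rule symplectic_nondegenerate[OF x])
  qed
  then have "surj T" using linear_injective_imp_surjective[OF T] by simp
  then obtain u where u: "(\<Sum>b\<in>Basis. ext_d S (fun_form S H) x [b] *\<^sub>R b) = T u" by (rule surjE)
  have "\<omega> x [u, b] = ext_d S (fun_form S H) x [b]" if "b \<in> Basis" for b
    unfolding Tb[OF that, symmetric] u[symmetric] using that
    by (simp add: inner_sum_left inner_Basis if_distrib sum.delta cong: if_cong)
  then have "\<omega> x [u, v] = ext_d S (fun_form S H) x [v]" for v
    using linear_basis_expansion[OF symplectic_linear(2)[OF x], of u v]
      linear_basis_expansion[OF ext_d_fun_linear[OF H x], of v] by simp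
  then show ?thesis by blast
qed

text \<open>The field is given pointwise only. In a chart it solves a linear system whose
  coefficients and right side are smooth, and Cramer's rule passes smoothness on to the
  solution.\<close>

lemma smooth_hamiltonian_in_chart:
  assumes H: "smooth_fun S H" and v: "\<And>x u. x \<in> pts S \<Longrightarrow> \<omega> x [v x, u] = ext_d S (fun_form S H) x [u]"
    and d: "d \<in> atlas S"
  shows "smooth_on (cimg d) (\<lambda>y. to_chart S d (cinv d y) (v (cinv d y)))"
proof -
  note S = symplectic_manifold
  define A where "A y u = (\<Sum>b\<in>Basis. in_chart S d \<omega> y [u, b] *\<^sub>R b)" for y u
  have o: "open (cimg d)" by (rule open_cimg[OF S d])
  have lin: "linear (\<lambda>u. in_chart S d \<omega> y [u, b])" "linear (\<lambda>b. in_chart S d \<omega> y [u, b])" if "y \<in> cimg d" for y u b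
    using two_form_linear[OF diff_formD(4)[OF S symplectic_diff_form d that]] by blast+
  show ?thesis
  proof (rule smooth_on_linear_solve[OF o, of A])
    show "linear (A y)" if "y \<in> cimg d" for y
      unfolding A_def[abs_def] by (intro linear_compose_sum ballI linear_scaleR_const lin(1)[OF that])
    note linA = this
    show "inj (A y)" if y: "y \<in> cimg d" for y
      unfolding linear_injective_0[OF linA[OF y]]
    proof (intro allI impI)
      fix u assume Au: "A y u = 0"
      let ?x = "cinv d y"
      have x: "?x \<in> fst d" "?x \<in> pts S" using cinv_in[OF S y] cinv_pts[OF S d y] .
      have "in_chart S d \<omega> y [u, b] = 0" if "b \<in> Basis" for b
      proof -
        have "A y u \<bullet> b = in_chart S d \<omega> y [u, b]"
          unfolding A_def using that by (simp add: inner_sum_left inner_Basis if_distrib sum.delta cong: if_cong)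
        then show ?thesis using Au by simp
      qed
      then have "in_chart S d \<omega> y [u, b] = 0" for b
        using linear_basis_expansion[OF lin(2)[OF y], of u b] by simp
      then have "\<omega> ?x [from_chart S d ?x u, from_chart S d ?x b] = 0" for b by (simp add: in_chart_def)
      then have "\<omega> ?x [from_chart S d ?x u, z] = 0" for z
        using from_to_chart[OF S d x(1), of z] by metis
      then have "from_chart S d ?x u = 0" by (rule symplectic_nondegenerate[OF x(2)])
      then show "u = 0"
        using to_from_chart[OF S d x(1), of u] linear_0[OF to_chart_linear[OF S d x(1)]] by simp
    qed
    show "smooth_on (cimg d) (\<lambda>y. A y u)" for u
      unfolding A_def
      by (intro smooth_on_sum smooth_on_scaleR smooth_on_const o diff_formD(3)[OF S symplectic_diff_form d])
    show "smooth_on (cimg d) (\<lambda>y. \<Sum>b\<in>Basis. FD (\<lambda>y. H (cinv d y)) y b *\<^sub>R b)"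
      by (intro smooth_on_sum smooth_on_scaleR smooth_on_const o smooth_on_FD smooth_fun_in_chart[OF S d H])
    show "A y (to_chart S d (cinv d y) (v (cinv d y))) = (\<Sum>b\<in>Basis. FD (\<lambda>y. H (cinv d y)) y b *\<^sub>R b)" if y: "y \<in> cimg d" for y
    proof -
      let ?x = "cinv d y"
      have x: "?x \<in> fst d" "?x \<in> pts S" "snd d ?x = y" using cinv_in[OF S y] cinv_pts[OF S d y] snd_cinv[OF S y] .
      have "in_chart S d \<omega> y [to_chart S d ?x (v ?x), b] = FD (\<lambda>y. H (cinv d y)) y b" for b
        using ext_d_fun_from_chart[OF S H d x(1), of b] v[OF x(2), of "from_chart S d ?x b"] x(3)
        by (simp add: in_chart_def from_to_chart[OF S d x(1)])
      then show ?thesis by (simp add: A_def)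
    qed
  qed
qed

lemma hamiltonian_vector_field_exists:
  assumes H: "smooth_fun S H"
  obtains v where "hamiltonian_vf S \<omega> v" "\<And>x u. x \<in> pts S \<Longrightarrow> \<omega> x [v x, u] = ext_d S (fun_form S H) x [u]"
proof -
  note S = symplectic_manifold
  define v where "v x = (if x \<in> pts S then SOME u. \<forall>z. \<omega> x [u, z] = ext_d S (fun_form S H) x [z] else 0)" for x
  have v: "\<omega> x [v x, u] = ext_d S (fun_form S H) x [u]" if "x \<in> pts S" for x u
    using someI_ex[OF hamiltonian_vector_exists[OF H that]] that by (simp add: v_def)
  have "vector_field S v"
    by (rule vector_fieldI[OF S _ smooth_hamiltonian_in_chart[OF H v]]) (simp_all add: v_def)
  moreover have "interior_prod v \<omega> = ext_d S (fun_form S H)"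
  proof (intro ext)
    fix x vs
    note dH = diff_form_ext_d[OF S diff_form_fun_form[OF S H]]
    show "interior_prod v \<omega> x vs = ext_d S (fun_form S H) x vs"
    proof (cases "x \<in> pts S")
      case True
      show ?thesis
      proof (cases "length vs = 1")
        case True
        then obtain u where "vs = [u]" by (auto simp: length_Suc_conv)
        then show ?thesis using v[OF \<open>x \<in> pts S\<close>] by (simp add: interior_prod_def)
      next
        case False
        then show ?thesis
          using alt_multilinear_length[OF diff_formD(1)[OF S symplectic_diff_form \<open>x \<in> pts S\<close>], of "v x # vs"]
            alt_multilinear_length[OF diff_formD(1)[OF S dH \<open>x \<in> pts S\<close>], of vs]
          by (simp add: interior_prod_def)
      qed
    qed (simp add: interior_prod_def diff_formD(2)[OF S symplectic_diff_form] ext_d_def)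
  qed
  ultimately have "hamiltonian_vf S \<omega> v" using H by (auto simp: hamiltonian_vf_def)
  with v that show ?thesis by blast
qed

end

section \<open>Extension of a field along a submanifold to a Hamiltonian field\<close>

context
  fixes S :: "('s, real^'n) mfd" and \<omega> :: "('s, real^'n) form" and A :: "'s set"
    and N :: "('s, 'd::euclidean_space) mfd" and w :: "'s \<Rightarrow> real^'n" and h :: "'s \<Rightarrow> real"
  assumes \<omega>: "symplectic S \<omega>" and A: "A \<subseteq> pts S" and N: "N = submfd S A" and NM: "manifold N"
    and w: "vfield_along N S (\<lambda>x. x) w" and h: "smooth_fun N h"
    and wh: "interior_along N S (\<lambda>x. x) w \<omega> = ext_d N (fun_form N h)"
begin

text \<open>With \<open>r\<close> a local retraction onto \<open>N\<close>, the function
  \<open>q \<mapsto> h (r q) + \<omega>\<^bsub>r q\<^esub>(w (r q), q - r q)\<close> has along \<open>N\<close> the value \<open>h\<close> and the differential \<open>\<^bold>i\<^sub>w\<omega>\<close>.\<close>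

lemma local_hamiltonian:
  assumes x0: "x0 \<in> pts N"
  obtains U d L where "openin (mtop S) U" "x0 \<in> U" "d \<in> atlas S" "U \<subseteq> fst d" "smooth_on (snd d ` U) L"
    "\<forall>x\<in>pts N \<inter> U. L (snd d x) = h x \<and> (\<forall>v. FD L (snd d x) v = \<omega> x [w x, from_chart S d x v])"
proof -
  note S = symplectic_manifold[OF \<omega>] and \<omega>2 = symplectic_diff_form[OF \<omega>]
  note inc = smooth_map_submfd_inclusion[OF S A N]
  have NS: "x \<in> pts S" if "x \<in> pts N" for x using that submfd_pts[OF S A N] A by blast
  obtain c where c: "c \<in> atlas N" "x0 \<in> fst c" using chart_exists[OF NM x0] by blast
  obtain d where d: "d \<in> atlas S" "x0 \<in> fst d" using chart_exists[OF S NS[OF x0]] by blast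
  let ?\<psi> = "\<lambda>y. snd d (cinv c y)"
  obtain W V r where r: "open W" "open V" "snd c x0 \<in> V" "V \<subseteq> cimg c \<inter> cinv c -` fst d" "smooth_on W r"
    "?\<psi> ` V \<subseteq> W" "r ` W \<subseteq> V" "\<And>y. y \<in> V \<Longrightarrow> r (?\<psi> y) = y"
    using submfd_retraction[OF S A N c d] by blast
  define \<alpha> where "\<alpha> y q = in_chart S d \<omega> (?\<psi> y) [to_chart S d (cinv c y) (w (cinv c y)), q]" for y q
  have \<psi>: "smooth_on V ?\<psi>"
    using smooth_on_subset[OF submfd_parametrisation(2)[OF S A N c(1) d(1)] r(4)] .
  have \<psi>V: "?\<psi> ` V \<subseteq> cimg d" using r(4) by auto
  have \<alpha>_smooth: "smooth_on V (\<lambda>y. \<alpha> y q)" for q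
  proof -
    have "smooth_on V (\<lambda>y. in_chart S d \<omega> (?\<psi> y) (map (\<lambda>w. w y) [\<lambda>y. to_chart S d (cinv c y) (w (cinv c y))] @ [q]))"
    proof (rule smooth_on_multilinear[OF r(2)])
      show "alt_multilinear 2 (in_chart S d \<omega> (?\<psi> y))" if "y \<in> V" for y
        using diff_formD(4)[OF S \<omega>2 d(1)] \<psi>V that by blast
      show "smooth_on V (\<lambda>y. in_chart S d \<omega> (?\<psi> y) vs)" for vs
        by (rule smooth_on_compose[OF r(2) open_cimg[OF S d(1)] \<psi>V diff_formD(3)[OF S \<omega>2 d(1)] \<psi>])
      have "snd c ` (fst c \<inter> (\<lambda>x. x) -` fst d) = cimg c \<inter> cinv c -` fst d"
        using submfd_cinv[OF S A N c(1)] by force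
      moreover have "smooth_on (snd c ` (fst c \<inter> (\<lambda>x. x) -` fst d)) (\<lambda>y. to_chart S d (cinv c y) (w (cinv c y)))"
        using w c(1) d(1) by (simp add: vfield_along_def)
      ultimately have "smooth_on V (\<lambda>y. to_chart S d (cinv c y) (w (cinv c y)))"
        using r(4) by (auto elim: smooth_on_subset)
      then show "smooth_on V z" if "z \<in> set [\<lambda>y. to_chart S d (cinv c y) (w (cinv c y))]" for z using that by simp
    qed
    then show ?thesis by (simp add: \<alpha>_def[abs_def])
  qed
  have \<alpha>_lin: "linear (\<alpha> y)" if "y \<in> V" for y
    unfolding \<alpha>_def[abs_def] using two_form_linear(2)[OF diff_formD(4)[OF S \<omega>2 d(1)]] \<psi>V that by blast
  have rW: "r q \<in> V" if "q \<in> W" for q using r(7) that by blast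
  let ?R = "\<lambda>q. q - ?\<psi> (r q)"
  \<comment> \<open>The remainder \<open>?R\<close> vanishes along \<open>N\<close>, so the
    derivative there sees the product only through the derivative of \<open>?R\<close>. The sum over
    \<open>Basis\<close> separates \<open>?R\<close> from the covector
    \<open>\<alpha> (r q)\<close>, which also moves with \<open>q\<close>.\<close>
  define L where "L q = h (cinv c (r q)) + (\<Sum>b\<in>Basis. (?R q \<bullet> b) * \<alpha> (r q) b)" for q
  have hr: "smooth_on W (\<lambda>q. h (cinv c (r q)))"
    by (rule smooth_on_compose[OF r(1) submfd_chart(2)[OF S A N c(1)] _ smooth_fun_in_chart[OF NM c(1) h] r(5)])
      (use rW r(4) in blast)
  have \<psi>r: "smooth_on W (\<lambda>q. ?\<psi> (r q))"
    by (rule smooth_on_compose[OF r(1,2) r(7) \<psi> r(5)])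
  have R: "smooth_on W ?R" by (intro smooth_on_diff smooth_on_ident r(1) \<psi>r)
  have Rb: "smooth_on W (\<lambda>q. ?R q \<bullet> b)" for b by (intro smooth_on_inner R smooth_on_const r(1))
  have \<alpha>r: "smooth_on W (\<lambda>q. \<alpha> (r q) b)" for b
    by (rule smooth_on_compose[OF r(1,2) r(7) \<alpha>_smooth r(5)])
  have L: "smooth_on W L"
    unfolding L_def[abs_def] by (intro smooth_on_add hr smooth_on_sum smooth_on_mult Rb \<alpha>r r(1))
  have "openin (mtop N) (fst c \<inter> snd c -` V)" by (rule submfd_openin_chart_vimage[OF S A N c(1) r(2)])
  \<comment> \<open>\<open>W\<close> may meet points of \<open>N\<close> outside the part of the
    chart \<open>c\<close> over \<open>V\<close>, and there \<open>r\<close> need not recover the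
    point; intersecting with \<open>O'\<close> excludes them.\<close>
  then obtain O' where O': "openin (mtop S) O'" "fst c \<inter> snd c -` V = O' \<inter> A"
    unfolding submfd_mtop[OF S A N] openin_subtopology by blast
  define U where "U = (fst d \<inter> snd d -` W) \<inter> O'"
  have U: "openin (mtop S) U" unfolding U_def by (intro openin_Int openin_chart_vimage[OF S d(1) r(1)] O'(1))
  have on_N: "x \<in> fst c" "snd c x \<in> V" "cinv c (snd c x) = x" "r (snd d x) = snd c x" "snd d x \<in> W" "x \<in> fst d"
    if "x \<in> pts N" "x \<in> U" for x
  proof -
    have "x \<in> fst c \<inter> snd c -` V" using that submfd_pts[OF S A N] unfolding O'(2) U_def by blast
    then show 1: "x \<in> fst c" "snd c x \<in> V" by auto
    show 2: "cinv c (snd c x) = x" using submfd_cinv(3)[OF S A N c(1) 1(1)] .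
    show "r (snd d x) = snd c x" using r(8)[OF 1(2)] by (simp add: 2)
    show "snd d x \<in> W" "x \<in> fst d" using that(2) by (auto simp: U_def)
  qed
  show ?thesis
  proof
    show "openin (mtop S) U" by (rule U)
    have "snd d x0 \<in> W" using r(3,6) submfd_cinv(3)[OF S A N c] by force
    moreover have "x0 \<in> fst c \<inter> snd c -` V" using c r(3) by simp
    ultimately show "x0 \<in> U" using d unfolding O'(2) U_def by blast
    show "d \<in> atlas S" "U \<subseteq> fst d" using d by (auto simp: U_def)
    show "smooth_on (snd d ` U) L" by (rule smooth_on_subset[OF L]) (auto simp: U_def)
    show "\<forall>x\<in>pts N \<inter> U. L (snd d x) = h x \<and> (\<forall>v. FD L (snd d x) v = \<omega> x [w x, from_chart S d x v])"
    proof (intro ballI conjI allI)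
      fix x assume "x \<in> pts N \<inter> U"
      then have x: "x \<in> pts N" "x \<in> U" by auto
      let ?q = "snd d x" and ?y = "snd c x"
      note * = on_N[OF x]
      show "L ?q = h x" by (simp add: L_def *)
      fix v
      have diffs: "(\<lambda>q. h (cinv c (r q))) differentiable (at ?q)" "(\<lambda>q. ?R q \<bullet> b) differentiable (at ?q)"
        "(\<lambda>q. \<alpha> (r q) b) differentiable (at ?q)" "r differentiable (at ?q)" for b
        using smooth_on_differentiable[OF hr *(5)] smooth_on_differentiable[OF Rb *(5)]
          smooth_on_differentiable[OF \<alpha>r *(5)] smooth_on_differentiable[OF r(5) *(5)] .
      define a where "a = FD r ?q v"
      have \<psi>d: "?\<psi> differentiable (at ?y)" using smooth_on_differentiable[OF \<psi> *(2)] .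
      \<comment> \<open>In directions tangent to \<open>N\<close> the hypothesis on \<open>h\<close>
        already gives the right differential. With \<open>a\<close> the image of \<open>v\<close>
        under the derivative of \<open>r\<close>, this accounts for the tangential part of
        \<open>v\<close>, and the correction term will account for the rest.\<close>
      have FDh: "FD (\<lambda>q. h (cinv c (r q))) ?q v = \<alpha> ?y (FD ?\<psi> ?y a)"
      proof -
        have "(\<lambda>y. h (cinv c y)) differentiable (at (r ?q))"
          by (rule smooth_on_differentiable[OF smooth_fun_in_chart[OF NM c(1) h]]) (use * in simp)
        from FD_compose[OF diffs(4) this] have "FD (\<lambda>q. h (cinv c (r q))) ?q v = FD (\<lambda>y. h (cinv c y)) ?y a"
          by (simp add: * a_def)
        also have "\<dots> = interior_along N S (\<lambda>x. x) w \<omega> x [from_chart N c x a]"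
          unfolding wh by (rule ext_d_fun_from_chart[OF NM h c(1) *(1), symmetric])
        also have "\<dots> = \<omega> x [w x, from_chart S d x (FD ?\<psi> ?y a)]"
          using x(1) tmap_from_chart[OF NM S inc c(1) *(1) d(1) *(6), of a] by (simp add: interior_along_def)
        also have "\<dots> = \<alpha> ?y (FD ?\<psi> ?y a)"
          by (simp add: \<alpha>_def * in_chart_at_point[OF S d(1)] from_to_chart[OF S d(1)])
        finally show ?thesis .
      qed
      have FDR: "FD (\<lambda>q. ?R q \<bullet> b) ?q v = (v - FD ?\<psi> ?y a) \<bullet> b" for b
      proof -
        have "((\<lambda>q. ?\<psi> (r q)) has_derivative (\<lambda>v. FD ?\<psi> ?y (FD r ?q v))) (at ?q)"
          using has_derivative_compose[OF differentiable_has_FD[OF diffs(4)], of ?\<psi> "FD ?\<psi> ?y"] differentiable_has_FD[OF \<psi>d] *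
          by simp
        then have "(?R has_derivative (\<lambda>v. v - FD ?\<psi> ?y (FD r ?q v))) (at ?q)"
          by (intro has_derivative_diff has_derivative_ident)
        from FD_eqI[OF bounded_linear.has_derivative[OF bounded_linear_inner_left this]]
        show ?thesis by (simp add: a_def)
      qed
      have "FD L ?q v = \<alpha> ?y (FD ?\<psi> ?y a) + (\<Sum>b\<in>Basis. FD (\<lambda>q. (?R q \<bullet> b) * \<alpha> (r q) b) ?q v)"
        unfolding L_def[abs_def]
        by (subst FD_add[OF diffs(1) differentiable_sum], simp, intro ballI differentiable_mult diffs)
          (simp add: FDh FD_sum[OF differentiable_mult[OF diffs(2,3)]])
      also have "(\<Sum>b\<in>Basis. FD (\<lambda>q. (?R q \<bullet> b) * \<alpha> (r q) b) ?q v) = (\<Sum>b\<in>Basis. ((v - FD ?\<psi> ?y a) \<bullet> b) * \<alpha> ?y b)"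
        by (rule sum.cong[OF refl]) (subst FD_mult[OF diffs(2,3)], simp add: FDR *)
      also have "\<dots> = \<alpha> ?y (v - FD ?\<psi> ?y a)"
        using linear_basis_expansion[OF \<alpha>_lin[OF *(2)], of "v - FD ?\<psi> ?y a"] by simp
      also have "\<alpha> ?y (FD ?\<psi> ?y a) + \<dots> = \<alpha> ?y v"
        using linear_add[OF \<alpha>_lin[OF *(2)], of "FD ?\<psi> ?y a" "v - FD ?\<psi> ?y a"] by simp
      also have "\<dots> = \<omega> x [w x, from_chart S d x v]"
        by (simp add: \<alpha>_def * in_chart_at_point[OF S d(1)] from_to_chart[OF S d(1)])
      finally show "FD L ?q v = \<omega> x [w x, from_chart S d x v]" .
    qed
  qed
qed

text \<open>The value is prescribed together with the differential because interpolation by a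
  cut-off \<open>b\<close> creates the differential of \<open>b\<close> times the difference of the
  two functions.\<close>

definition good_hamiltonian :: "('s \<Rightarrow> real) \<Rightarrow> 's \<Rightarrow> bool" where
  "good_hamiltonian H x \<longleftrightarrow> H x = h x \<and> (\<forall>v. ext_d S (fun_form S H) x [v] = \<omega> x [w x, v])"

lemma good_hamiltonian_in_chart:
  assumes "smooth_fun S H" "d \<in> atlas S" "x \<in> fst d"
  shows "good_hamiltonian H x \<longleftrightarrow> H x = h x \<and>
    (\<forall>v. FD (\<lambda>y. H (cinv d y)) (snd d x) v = \<omega> x [w x, from_chart S d x v])"
proof -
  note S = symplectic_manifold[OF \<omega>]
  have "(\<forall>v. ext_d S (fun_form S H) x [v] = \<omega> x [w x, v]) \<longleftrightarrow>
      (\<forall>v. ext_d S (fun_form S H) x [from_chart S d x v] = \<omega> x [w x, from_chart S d x v])"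
    using from_to_chart[OF S assms(2,3)] by metis
  then show ?thesis
    using ext_d_fun_from_chart[OF S assms] by (simp add: good_hamiltonian_def)
qed

text \<open>Interpolating with a cut-off keeps what was already achieved, because along \<open>N\<close> both functions have the
  same 1-jet. Hence no partition of unity is needed.\<close>

lemma patch_hamiltonian:
  assumes x0: "x0 \<in> pts N"
  shows "\<exists>V. openin (mtop S) V \<and> x0 \<in> V \<and> (\<forall>H. smooth_fun S H \<longrightarrow>
    (\<exists>H'. smooth_fun S H' \<and> (\<forall>x\<in>pts N. x \<in> V \<or> good_hamiltonian H x \<longrightarrow> good_hamiltonian H' x)))"
proof -
  note S = symplectic_manifold[OF \<omega>]
  obtain U d L where U: "openin (mtop S) U" "x0 \<in> U" "d \<in> atlas S" "U \<subseteq> fst d" and L1: "smooth_on (snd d ` U) L"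
    and L0: "\<forall>x\<in>pts N \<inter> U. L (snd d x) = h x \<and> (\<forall>v. FD L (snd d x) v = \<omega> x [w x, from_chart S d x v])"
    by (rule local_hamiltonian[OF x0])
  have L: "smooth_on (snd d ` U) L"
    "\<And>x. x \<in> pts N \<Longrightarrow> x \<in> U \<Longrightarrow> L (snd d x) = h x"
    "\<And>x v. x \<in> pts N \<Longrightarrow> x \<in> U \<Longrightarrow> FD L (snd d x) v = \<omega> x [w x, from_chart S d x v]"
    using L1 L0 by simp_all
  obtain b V and e :: "('s, real^'n) chart" where b': "smooth_fun S b" "\<forall>z. 0 \<le> b z \<and> b z \<le> 1"
    "openin (mtop S) V" "x0 \<in> V" "\<forall>z\<in>V. b z = 1"
    "e \<in> atlas S" "mtop S closure_of {z \<in> pts S. b z \<noteq> 0} \<subseteq> fst e \<inter> U"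
    by (rule manifold_bump[OF S U(1,2)])
  then have b: "smooth_fun S b" "openin (mtop S) V" "x0 \<in> V" "\<And>z. z \<in> V \<Longrightarrow> b z = 1"
    "mtop S closure_of {z \<in> pts S. b z \<noteq> 0} \<subseteq> U"
    by simp_all
  let ?K = "mtop S closure_of {z \<in> pts S. b z \<noteq> 0}"
  have K: "closedin (mtop S) ?K" "?K \<subseteq> U" using b(5) by simp_all
  have b0: "b z = 0" if "z \<in> pts S" "z \<notin> ?K" for z
    using that closure_of_subset[of "{z \<in> pts S. b z \<noteq> 0}" "mtop S"] by blast
  have oK: "openin (mtop S) (pts S - ?K)" using K(1) by blast
  have dU: "fst d \<inter> U = U" using U(4) by blast
  have oU: "open (snd d ` U)" using open_chart_image[OF S U(3,1)] unfolding dU .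
  define bL where "bL x = (if x \<in> U then b x * L (snd d x) else 0)" for x
  have bL: "smooth_fun S bL"
  proof (rule smooth_fun_localI[OF S])
    fix c x assume c: "c \<in> atlas S" "x \<in> fst c"
    show "\<exists>W. openin (mtop S) W \<and> x \<in> W \<and> smooth_on (snd c ` (fst c \<inter> W)) (\<lambda>y. bL (cinv c y))"
    proof (cases "x \<in> U")
      case True
      let ?W = "snd c ` (fst c \<inter> U)"
      have W: "open ?W" by (rule open_chart_image[OF S c(1) U(1)])
      have "smooth_on ?W (\<lambda>y. b (cinv c y) * L (snd d (cinv c y)))"
      proof (rule smooth_on_mult[OF W])
        show "smooth_on ?W (\<lambda>y. b (cinv c y))"
          by (rule smooth_on_subset[OF smooth_fun_in_chart[OF S c(1) b(1)]]) auto
        show "smooth_on ?W (\<lambda>y. L (snd d (cinv c y)))"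
          by (rule smooth_on_compose[OF W oU _ L(1) smooth_on_subset[OF transition(2)[OF S c(1) U(3)]]])
            (use U(4) in \<open>auto simp: cinv_snd[OF S c(1)]\<close>)
      qed
      then have "smooth_on ?W (\<lambda>y. bL (cinv c y))"
        by (rule smooth_on_cong[OF W, rotated]) (auto simp: bL_def cinv_snd[OF S c(1)])
      then show ?thesis using True U(1) by blast
    next
      case False
      have "smooth_on (snd c ` (fst c \<inter> (pts S - ?K))) (\<lambda>y. bL (cinv c y))"
        by (rule smooth_on_cong[OF open_chart_image[OF S c(1) oK] _ smooth_on_const[of _ 0]])
          (auto simp: bL_def cinv_snd[OF S c(1)] b0)
      then show ?thesis
        using False K(2) c chart_subset[OF S c(1)] oK by (intro exI[of _ "pts S - ?K"]) auto
    qed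
  qed
  show ?thesis
  proof (intro exI[of _ V] conjI allI impI b(2,3))
    fix H assume H: "smooth_fun S H"
    \<comment> \<open>This is \<open>(1 - b) H + b L\<close>, with \<open>b L\<close> extended by
      zero off \<open>U\<close>.\<close>
    let ?H' = "\<lambda>x. H x - b x * H x + bL x"
    have H': "smooth_fun S ?H'"
      by (intro smooth_fun_add[OF S] smooth_fun_diff[OF S] smooth_fun_mult[OF S] H b(1) bL)
    have "good_hamiltonian ?H' x" if x: "x \<in> pts N" "x \<in> V \<or> good_hamiltonian H x" for x
    proof -
      have xS: "x \<in> pts S" using x(1) submfd_pts[OF S A N] A by blast
      show ?thesis
      proof (cases "x \<in> U")
        case True
        then have xd: "x \<in> fst d" using U(4) by blast
        let ?y = "snd d x"
        have y: "?y \<in> snd d ` U" "?y \<in> cimg d" using True xd by auto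
        have Lx: "L ?y = h x" by (rule L(2)[OF x(1) True])
        have diff: "(\<lambda>y. H (cinv d y)) differentiable (at ?y)" "(\<lambda>y. b (cinv d y)) differentiable (at ?y)"
          "L differentiable (at ?y)"
          using smooth_on_differentiable[OF smooth_fun_in_chart[OF S U(3) H] y(2)]
            smooth_on_differentiable[OF smooth_fun_in_chart[OF S U(3) b(1)] y(2)]
            smooth_on_differentiable[OF L(1) y(1)] .
        let ?Hd = "\<lambda>y. H (cinv d y)" and ?bd = "\<lambda>y. b (cinv d y)"
        have "FD (\<lambda>y. ?H' (cinv d y)) ?y = FD (\<lambda>y. ?Hd y + ?bd y * (L y - ?Hd y)) ?y"
        proof (rule FD_cong[OF oU y(1)])
          fix z assume "z \<in> snd d ` U"
          then have "cinv d z \<in> U" "snd d (cinv d z) = z" using U(4) cinv_snd[OF S U(3)] by auto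
          then show "?H' (cinv d z) = ?Hd z + ?bd z * (L z - ?Hd z)" by (simp add: bL_def algebra_simps)
        qed
        then have FD': "FD (\<lambda>y. ?H' (cinv d y)) ?y v = FD ?Hd ?y v + (b x * (FD L ?y v - FD ?Hd ?y v) + FD ?bd ?y v * (h x - H x))" for v
          using diff by (simp add: FD_add FD_mult FD_diff cinv_snd[OF S U(3) xd] Lx)
        have val: "?H' x = H x + b x * (h x - H x)" using True by (simp add: bL_def Lx algebra_simps)
        \<comment> \<open>If \<open>H\<close> is already good at \<open>x\<close>, the differences
          of values and of differentials in \<open>FD'\<close> both vanish. Otherwise
          \<open>x\<close> lies in the open set \<open>V\<close>, where \<open>b\<close> is
          constantly 1, so its derivative is zero and the local solution takes over.\<close>
        show ?thesis
        proof (cases "good_hamiltonian H x")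
          case True
          then show ?thesis
            unfolding good_hamiltonian_in_chart[OF H' U(3) xd] good_hamiltonian_in_chart[OF H U(3) xd] FD' val
            using L(3)[OF x(1) \<open>x \<in> U\<close>] by simp
        next
          case False
          then have xV: "x \<in> V" using x(2) by blast
          have "FD ?bd ?y = FD (\<lambda>_. 1) ?y"
            by (rule FD_cong[OF open_chart_image[OF S U(3) b(2)]])
              (use xV xd b(4) in \<open>auto simp: cinv_snd[OF S U(3)]\<close>)
          then have "FD ?bd ?y v = 0" for v by simp
          then show ?thesis
            unfolding good_hamiltonian_in_chart[OF H' U(3) xd] FD' val
            using L(3)[OF x(1) \<open>x \<in> U\<close>] b(4)[OF xV] by simp
        qed
      next
        case False
        then have xK: "x \<notin> ?K" using K(2) by blast
        then have bx: "b x = 0" using b0 xS by blast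
        then have good: "good_hamiltonian H x" using x(2) b(4)[of x] by auto
        obtain c where c: "c \<in> atlas S" "x \<in> fst c" using chart_exists[OF S xS] by blast
        have "FD (\<lambda>y. ?H' (cinv c y)) (snd c x) = FD (\<lambda>y. H (cinv c y)) (snd c x)"
          by (rule FD_cong[OF open_chart_image[OF S c(1) oK]])
            (use c xK xS in \<open>auto simp: bL_def cinv_snd[OF S c(1)] b0\<close>)
        then show ?thesis
          using good unfolding good_hamiltonian_in_chart[OF H' c] good_hamiltonian_in_chart[OF H c]
          by (simp add: bx bL_def False)
      qed
    qed
    then show "\<exists>H'. smooth_fun S H' \<and> (\<forall>x\<in>pts N. x \<in> V \<or> good_hamiltonian H x \<longrightarrow> good_hamiltonian H' x)"
      using H' by blast
  qed
qed

text \<open>As \<open>patch_hamiltonian\<close> accepts every \<open>H\<close>, patches can be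
  applied one after the other: each makes one more member of a finite cover good and keeps the
  earlier ones.\<close>

lemma global_hamiltonian:
  assumes compact: "compact_space (mtop N)"
  shows "\<exists>H. smooth_fun S H \<and> (\<forall>x\<in>pts N. good_hamiltonian H x)"
proof -
  note S = symplectic_manifold[OF \<omega>]
  define Q where "Q x V \<longleftrightarrow> openin (mtop S) V \<and> x \<in> V \<and> (\<forall>H. smooth_fun S H \<longrightarrow>
    (\<exists>H'. smooth_fun S H' \<and> (\<forall>x\<in>pts N. x \<in> V \<or> good_hamiltonian H x \<longrightarrow> good_hamiltonian H' x)))" for x V
  have "\<forall>x\<in>pts N. \<exists>V. Q x V"
    unfolding Q_def by (rule ballI) (rule patch_hamiltonian)
  then obtain V where Q: "\<forall>x\<in>pts N. Q x (V x)" by (elim bchoice[THEN exE])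
  have V: "openin (mtop S) (V x)" "x \<in> V x"
    "smooth_fun S H \<Longrightarrow> \<exists>H'. smooth_fun S H' \<and>
       (\<forall>z\<in>pts N. z \<in> V x \<or> good_hamiltonian H z \<longrightarrow> good_hamiltonian H' z)"
    if "x \<in> pts N" for x H
    using bspec[OF Q that] by (simp_all add: Q_def)
  have "compactin (mtop S) A"
    using compact unfolding submfd_mtop[OF S A N] by (simp add: compact_space_subtopology compactin_subspace A)
  moreover have AN: "A = pts N" using submfd_pts[OF S A N] by simp
  ultimately have "\<exists>\<F>. finite \<F> \<and> \<F> \<subseteq> V ` pts N \<and> pts N \<subseteq> \<Union>\<F>"
    using V(1,2) unfolding compactin_def by (elim conjE allE[of _ "V ` pts N"] impE) auto
  then obtain F where F: "finite F" "F \<subseteq> pts N" "pts N \<subseteq> \<Union>(V ` F)"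
    using finite_subset_image by metis
  have "\<exists>H. smooth_fun S H \<and> (\<forall>x\<in>pts N \<inter> \<Union>(V ` F). good_hamiltonian H x)"
    using F(1,2)
  proof (induction F)
    case empty
    then show ?case using smooth_fun_const[OF S] by auto
  next
    case (insert p F)
    then obtain H where H: "smooth_fun S H" "\<forall>x\<in>pts N \<inter> \<Union>(V ` F). good_hamiltonian H x" by auto
    from V(3)[OF _ H(1), of p] insert.prems obtain H' where "smooth_fun S H'"
      "\<forall>z\<in>pts N. z \<in> V p \<or> good_hamiltonian H z \<longrightarrow> good_hamiltonian H' z" by blast
    then show ?case using H(2) by (intro exI[of _ H']) auto
  qed
  then show ?thesis using F(3) by blast
qed

text \<open>By nondegeneracy a Hamiltonian field is determined at each point by the differential of
  its function, so prescribing that differential along \<open>N\<close> prescribes the field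
  there.\<close>

lemma hamiltonian_extension:
  assumes "compact_space (mtop N)"
  obtains v where "hamiltonian_vf S \<omega> v" "\<And>x. x \<in> pts N \<Longrightarrow> v x = w x"
proof -
  note S = symplectic_manifold[OF \<omega>]
  obtain H where H: "smooth_fun S H" "\<And>x. x \<in> pts N \<Longrightarrow> good_hamiltonian H x"
    using global_hamiltonian[OF assms] by blast
  obtain v where v: "hamiltonian_vf S \<omega> v" "\<And>x u. x \<in> pts S \<Longrightarrow> \<omega> x [v x, u] = ext_d S (fun_form S H) x [u]"
    using hamiltonian_vector_field_exists[OF \<omega> H(1)] by blast
  have "v x = w x" if x: "x \<in> pts N" for x
  proof -
    have xS: "x \<in> pts S" using x submfd_pts[OF S A N] A by blast
    have "\<omega> x [v x - w x, u] = 0" for u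
      using v(2)[OF xS, of u] H(2)[OF x] linear_diff[OF symplectic_linear(1)[OF \<omega> xS], of "v x" "w x" u]
      by (simp add: good_hamiltonian_def)
    then have "v x - w x = 0" by (rule symplectic_nondegenerate[OF \<omega> xS])
    then show ?thesis by simp
  qed
  with v(1) that show ?thesis by blast
qed

end

subsection \<open>Contraction of the volume form\<close>

context
  fixes N :: "('s, real^'k) mfd" and \<nu> :: "('s, real^'k) form"
  assumes N: "manifold N" and compact: "compact_space (mtop N)" and \<nu>: "volume_form N \<nu>"
begin

lemma volume_diff_form: "diff_form N DIM(real^'k) \<nu>"
  using \<nu> by (simp add: volume_form_def)

text \<open>The identity \<open>\<alpha>(X) \<nu> = \<alpha> \<and> \<gamma>\<close> for all 1-forms \<open>\<alpha>\<close> is the equation \<open>\<^bold>i\<^sub>X\<nu> = \<gamma>\<close>.\<close>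

lemma contraction_exists:
  assumes \<gamma>: "diff_form N (CARD('k) - 1) \<gamma>"
  obtains X where "vector_field N X" "\<forall>x. x \<notin> pts N \<longrightarrow> X x = 0"
    "\<forall>x\<in>pts N. \<forall>L vs. linear L \<longrightarrow>
      L (X x) * \<nu> x vs = (\<Sum>i<length vs. (-1) ^ i * L (vs ! i) * \<gamma> x (del_nth i vs))"
    "lie_deriv N X \<nu> = ext_d N \<gamma>"
proof -
  let ?b = "basis_list :: (real^'k) list" and ?k = "CARD('k)"
  have k: "Suc (?k - 1) = ?k" by simp
  \<comment> \<open>In the contraction identity, a coordinate functional for \<open>L\<close> and
    \<open>basis_list\<close> for \<open>vs\<close> leave a single term; this forces these
    components.\<close>
  define X where "X x = (if x \<in> pts N then \<Sum>i<?k. ((-1) ^ i * \<gamma> x (del_nth i ?b) / \<nu> x ?b) *\<^sub>R ?b ! i else 0)" for x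
  have \<nu>0: "\<nu> x ?b \<noteq> 0" if x: "x \<in> pts N" for x
  proof -
    have "in_chart N (chart_at N x) \<nu> (snd (chart_at N x) x) ?b \<noteq> 0"
      by (rule volume_form_basis_nonzero[OF N compact \<nu>]) (use chart_at[OF N x] in auto)
    then show ?thesis by (simp add: in_chart_at_point[OF N chart_at[OF N x]] from_chart_at[OF N x] map_idI)
  qed
  have contraction: "L (X x) * \<nu> x vs = (\<Sum>i<length vs. (-1) ^ i * L (vs ! i) * \<gamma> x (del_nth i vs))"
    if x: "x \<in> pts N" and L: "linear L" for x L vs
  proof -
    have "(\<lambda>vs. L (X x) * \<nu> x vs) = (\<lambda>vs. \<Sum>i<length vs. (-1) ^ i * (L (vs ! i) * \<gamma> x (del_nth i vs)))"
    proof (rule alt_multilinear_top_eqI)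
      show "alt_multilinear DIM(real^'k) (\<lambda>vs. L (X x) * \<nu> x vs)"
        by (rule alt_multilinear_cmult[OF diff_formD(1)[OF N volume_diff_form x]])
      have "alt_multilinear (Suc (?k - 1)) (\<lambda>vs. \<Sum>i<length vs. (-1) ^ i * (L (vs ! i) * \<gamma> x (del_nth i vs)))"
      proof (rule alt_multilinear_wedge)
        show "alt_multilinear (?k - 1) (\<lambda>vs. L v * \<gamma> x vs)" for v
          by (rule alt_multilinear_cmult[OF diff_formD(1)[OF N \<gamma> x]])
        show "linear (\<lambda>v. L v * \<gamma> x vs)" for vs
          using L by (auto intro!: linearI simp: linear_add linear_cmul distrib_right)
      qed
      then show "alt_multilinear DIM(real^'k) (\<lambda>vs. \<Sum>i<length vs. (-1) ^ i * (L (vs ! i) * \<gamma> x (del_nth i vs)))"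
        by (simp add: k)
      have "L (X x) = (\<Sum>i<?k. ((-1) ^ i * \<gamma> x (del_nth i ?b) / \<nu> x ?b) * L (?b ! i))"
        using x L by (simp add: X_def linear_sum linear_cmul)
      then show "L (X x) * \<nu> x ?b = (\<Sum>i<length ?b. (-1) ^ i * (L (?b ! i) * \<gamma> x (del_nth i ?b)))"
        using \<nu>0[OF x] by (simp add: length_basis_list sum_distrib_right mult_ac sum_divide_distrib[symmetric])
    qed
    from fun_cong[OF this, of vs] show ?thesis by (simp add: mult.assoc)
  qed
  have X0: "X x = 0" if "x \<notin> pts N" for x using that by (simp add: X_def)
  \<comment> \<open>\<open>X\<close> is written in the charts chosen at the single points. The
    contraction identity holds for every linear \<open>L\<close>; a coordinate of the fixed chart
    \<open>c\<close> in place of \<open>L\<close> yields the components there.\<close>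
  have X_chart: "(to_chart N c (cinv c y) (X (cinv c y)) \<bullet> ?b ! i) * in_chart N c \<nu> y ?b = (-1) ^ i * in_chart N c \<gamma> y (del_nth i ?b)"
    if c: "c \<in> atlas N" and y: "y \<in> cimg c" and i: "i < ?k" for c y i
  proof -
    let ?x = "cinv c y"
    have x: "?x \<in> fst c" "?x \<in> pts N" using cinv_in[OF N y] cinv_pts[OF N c y] .
    let ?L = "\<lambda>v. to_chart N c ?x v \<bullet> ?b ! i"
    have "linear ?L"
      using to_chart_linear[OF N c x(1)] by (auto simp: linear_add linear_cmul inner_add_left intro!: linearI)
    from contraction[OF x(2) this, of "map (from_chart N c ?x) ?b"]
    have "?L (X ?x) * in_chart N c \<nu> y ?b =
        (\<Sum>j<?k. (-1) ^ j * (?b ! j \<bullet> ?b ! i) * in_chart N c \<gamma> y (del_nth j ?b))"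
      by (simp add: in_chart_def length_basis_list to_from_chart[OF N c x(1)] flip: map_del_nth)
    also have "\<dots> = (\<Sum>j<?k. if j = i then (-1) ^ j * in_chart N c \<gamma> y (del_nth j ?b) else 0)"
      using i by (intro sum.cong refl) (simp add: basis_list_inner)
    also have "\<dots> = (-1) ^ i * in_chart N c \<gamma> y (del_nth i ?b)" using i by simp
    finally show ?thesis .
  qed
  have X_smooth: "smooth_on (cimg c) (\<lambda>y. to_chart N c (cinv c y) (X (cinv c y)))" if c: "c \<in> atlas N" for c
  proof (rule smooth_on_componentwise[OF open_cimg[OF N c]])
    fix e :: "real^'k" assume "e \<in> Basis"
    then obtain i where i: "i < ?k" "e = ?b ! i"
      using basis_list(2)[where 'e="real^'k"] length_basis_list[where 'e="real^'k"] by (metis DIM_cart DIM_real in_set_conv_nth mult.right_neutral)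
    have "smooth_on (cimg c) (\<lambda>y. (-1) ^ i * in_chart N c \<gamma> y (del_nth i ?b) / in_chart N c \<nu> y ?b)"
      by (intro smooth_on_divide smooth_on_mult smooth_on_const open_cimg[OF N c] volume_form_basis_nonzero[OF N compact \<nu> c]
          diff_formD(3)[OF N \<gamma> c] diff_formD(3)[OF N volume_diff_form c])
    then show "smooth_on (cimg c) (\<lambda>y. to_chart N c (cinv c y) (X (cinv c y)) \<bullet> e)"
    proof (rule smooth_on_cong[OF open_cimg[OF N c], rotated])
      fix y assume y: "y \<in> cimg c"
      show "(-1) ^ i * in_chart N c \<gamma> y (del_nth i ?b) / in_chart N c \<nu> y ?b = to_chart N c (cinv c y) (X (cinv c y)) \<bullet> e"
        using X_chart[OF c y i(1)] volume_form_basis_nonzero[OF N compact \<nu> c y] i(2) by (simp add: field_simps)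
    qed
  qed
  have XN: "vector_field N X" by (rule vector_fieldI[OF N X0 X_smooth])
  have "lie_deriv N X \<nu> x vs = ext_d N \<gamma> x vs" for x vs
  proof (cases "x \<in> pts N")
    case x: True
    let ?c = "chart_at N x"
    note c = chart_at[OF N x]
    let ?y = "snd ?c x" and ?X = "\<lambda>y. to_chart N ?c (cinv ?c y) (X (cinv ?c y))"
    have y: "?y \<in> cimg ?c" using c by simp
    have "?X ?y = X x" by (simp add: cinv_snd[OF N c] to_chart_at[OF N x])
    moreover have "in_chart N ?c \<nu> ?y vs = \<nu> x vs" for vs
      by (simp add: in_chart_at_point[OF N c] from_chart_at[OF N x] map_idI)
    moreover have "FD (\<lambda>z. in_chart N ?c \<nu> z vs) ?y (?X ?y) +
        (\<Sum>i<length vs. in_chart N ?c \<nu> ?y (vs[i := FD ?X ?y (vs ! i)])) = dform (in_chart N ?c \<gamma>) ?y vs"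
    proof (rule lie_derivative_top_form[OF open_cimg[OF N c(1)] y])
      show "alt_multilinear DIM(real^'k) (in_chart N ?c \<nu> z)" "alt_multilinear (DIM(real^'k) - 1) (in_chart N ?c \<gamma> z)"
        if "z \<in> cimg ?c" for z
        using diff_formD(4)[OF N volume_diff_form c(1) that] diff_formD(4)[OF N \<gamma> c(1) that] by simp_all
      show "(?X z \<bullet> ?b ! i) * in_chart N ?c \<nu> z ?b = (-1) ^ i * in_chart N ?c \<gamma> z (del_nth i ?b)"
        if "z \<in> cimg ?c" "i < DIM(real^'k)" for z i
        using X_chart[OF c(1) that(1), of i] that(2) by simp
    qed (rule diff_formD(3)[OF N volume_diff_form c(1)] diff_formD(3)[OF N \<gamma> c(1)] X_smooth[OF c(1)])+
    ultimately show ?thesis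
      using x by (simp add: lie_deriv_def Let_def ext_d_eq_dform[OF N x])
  qed (simp add: lie_deriv_def ext_d_def)
  then have "lie_deriv N X \<nu> = ext_d N \<gamma>" by (intro ext)
  then show ?thesis
    using that XN X0 contraction by blast
qed

text \<open>Integration by parts: the wedge product is \<open>d(h \<beta>) - h d\<beta>\<close> by
  the Leibniz rule, and the first term integrates to zero by Stokes. The same identity shows that
  the wedge product is a \<open>top_form\<close>.\<close>

lemma integral_wedge_d:
  assumes h: "smooth_fun N h" and \<beta>: "diff_form N (CARD('k) - 1) \<beta>"
  shows "top_form N (wedge1 (ext_d N (fun_form N h)) \<beta>)"
    "form_integral N \<nu> (wedge1 (ext_d N (fun_form N h)) \<beta>) = - form_integral N \<nu> (\<lambda>x vs. h x * ext_d N \<beta> x vs)"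
    "top_form N (\<lambda>x vs. h x * ext_d N \<beta> x vs)"
proof -
  let ?w = "wedge1 (ext_d N (fun_form N h)) \<beta>" and ?h\<beta> = "\<lambda>x vs. h x * \<beta> x vs" and ?hd = "\<lambda>x vs. h x * ext_d N \<beta> x vs"
  have h\<beta>: "diff_form N (CARD('k) - 1) ?h\<beta>" by (rule diff_form_mult[OF N h \<beta>])
  have top_d: "top_form N (ext_d N \<sigma>)" if "diff_form N (CARD('k) - 1) \<sigma>" for \<sigma>
    using diff_form_ext_d[OF N that] by (intro top_form_diff_form[OF N]) simp
  show hd: "top_form N ?hd"
    by (rule top_form_mult[OF smooth_fun_chart_continuous[OF h] top_d[OF \<beta>]])
  have minus: "top_form N (\<lambda>x vs. -1 * ?hd x vs)"
    using top_form_mult[OF chart_continuous_const hd, of "-1"] by simp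
  have w: "?w x vs = ext_d N ?h\<beta> x vs + -1 * ?hd x vs" if "x \<in> pts N" for x vs
    using ext_d_mult[OF N h \<beta> that, of vs] by simp
  show "top_form N ?w"
    by (rule top_form_cong[OF N top_form_add[OF top_d[OF h\<beta>] minus]]) (simp add: w)
  have "form_integral N \<nu> ?w = form_integral N \<nu> (\<lambda>x vs. ext_d N ?h\<beta> x vs + -1 * ?hd x vs)"
    by (rule form_integral_cong[OF N compact \<nu>]) (rule w)
  also have "\<dots> = form_integral N \<nu> (ext_d N ?h\<beta>) + -1 * form_integral N \<nu> ?hd"
    unfolding form_integral_add[OF N compact \<nu> top_d[OF h\<beta>] minus] form_integral_cmult[OF N compact \<nu>] ..
  finally show "form_integral N \<nu> ?w = - form_integral N \<nu> ?hd"
    using stokes[OF N compact \<nu> h\<beta>] by simp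
qed

end

subsection \<open>Hamiltonian vector fields along isotropic embeddings\<close>

lemma ext_d_fun_smooth_map:
  assumes M: "manifold M" and S: "manifold S" and f: "smooth_map M S f" and H: "smooth_fun S H" and x: "x \<in> pts M"
  shows "ext_d M (fun_form M (\<lambda>x. H (f x))) x [a] = ext_d S (fun_form S H) (f x) [tmap M S f x a]"
proof -
  obtain c where c: "c \<in> atlas M" "x \<in> fst c" using chart_exists[OF M x] by blast
  obtain d where d: "d \<in> atlas S" "f x \<in> fst d" using chart_exists[OF S smooth_map_pts[OF M S f x]] by blast
  let ?\<rho> = "\<lambda>y. snd d (f (cinv c y))" and ?a = "to_chart M c x a"
  note U = smooth_map_in_charts[OF M S f c(1) d(1)]
  have y: "snd c x \<in> snd c ` (fst c \<inter> f -` fst d)" using c d by auto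
  have diff: "?\<rho> differentiable (at (snd c x))" "(\<lambda>y. H (cinv d y)) differentiable (at (?\<rho> (snd c x)))"
    using smooth_on_differentiable[OF U(2) y] smooth_on_differentiable[OF smooth_fun_in_chart[OF S d(1) H]] c d
    by (auto simp: cinv_snd[OF M])
  have "ext_d M (fun_form M (\<lambda>x. H (f x))) x [a] = FD (\<lambda>y. H (f (cinv c y))) (snd c x) ?a"
    using ext_d_fun_from_chart[OF M smooth_fun_smooth_map[OF M S f H] c, of ?a] by (simp add: from_to_chart[OF M c])
  also have "FD (\<lambda>y. H (f (cinv c y))) (snd c x) = FD (\<lambda>y. H (cinv d (?\<rho> y))) (snd c x)"
    by (rule FD_cong[OF U(1) y]) (auto simp: cinv_snd[OF M c(1)] cinv_snd[OF S d(1)])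
  also have "FD (\<lambda>y. H (cinv d (?\<rho> y))) (snd c x) ?a = FD (\<lambda>y. H (cinv d y)) (snd d (f x)) (FD ?\<rho> (snd c x) ?a)"
    using FD_compose[OF diff] by (simp add: cinv_snd[OF M c])
  also have "\<dots> = ext_d S (fun_form S H) (f x) [from_chart S d (f x) (FD ?\<rho> (snd c x) ?a)]"
    by (rule ext_d_fun_from_chart[OF S H d, symmetric])
  also have "from_chart S d (f x) (FD ?\<rho> (snd c x) ?a) = tmap M S f x a"
    using tmap_from_chart[OF M S f c d, of ?a] by (simp add: from_to_chart[OF M c])
  finally show ?thesis .
qed

text \<open>Contracted with \<open>\<omega>\<close> along \<open>f\<close>, the field gives the
  differential of \<open>H \<circ> f\<close>. That is closed, which is the linearised isotropy
  condition in \<open>T_Emb_iso\<close>.\<close>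

lemma hamiltonian_T_Emb_iso:
  fixes M :: "('m, 'd::euclidean_space) mfd" and S :: "('s, real^'n) mfd"
  assumes M: "manifold M" and \<omega>: "symplectic S \<omega>" and f: "smooth_map M S f" and v: "hamiltonian_vf S \<omega> v"
  shows "(\<lambda>x. if x \<in> pts M then v (f x) else 0) \<in> T_Emb_iso M S \<omega> f"
proof -
  note S = symplectic_manifold[OF \<omega>] and \<omega>2 = symplectic_diff_form[OF \<omega>]
  obtain H where H: "vector_field S v" "smooth_fun S H" "interior_prod v \<omega> = ext_d S (fun_form S H)"
    using v by (auto simp: hamiltonian_vf_def)
  let ?v = "\<lambda>x. if x \<in> pts M then v (f x) else 0" and ?Hf = "\<lambda>x. H (f x)"
  have Hf: "smooth_fun M ?Hf" by (rule smooth_fun_smooth_map[OF M S f H(2)])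
  have dHf: "diff_form M 1 (ext_d M (fun_form M ?Hf))"
    using diff_form_ext_d[OF M diff_form_fun_form[OF M Hf]] by simp
  have "interior_along M S f ?v \<omega> = ext_d M (fun_form M ?Hf)"
  proof (intro ext)
    fix x vs
    show "interior_along M S f ?v \<omega> x vs = ext_d M (fun_form M ?Hf) x vs"
    proof (cases "x \<in> pts M")
      case x: True
      show ?thesis
      proof (cases "length vs = 1")
        case True
        then obtain a where vs: "vs = [a]" by (auto simp: length_Suc_conv)
        have "interior_along M S f ?v \<omega> x vs = interior_prod v \<omega> (f x) [tmap M S f x a]"
          using x by (simp add: interior_along_def interior_prod_def vs)
        also have "\<dots> = ext_d M (fun_form M ?Hf) x vs"
          unfolding H(3) vs by (rule ext_d_fun_smooth_map[OF M S f H(2) x, symmetric])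
        finally show ?thesis .
      next
        case False
        then show ?thesis
          using alt_multilinear_length[OF diff_formD(1)[OF S \<omega>2 smooth_map_pts[OF M S f x]], of "?v x # map (tmap M S f x) vs"]
            alt_multilinear_length[OF diff_formD(1)[OF M dHf x], of vs] x
          by (simp add: interior_along_def)
      qed
    qed (simp add: interior_along_def ext_d_def)
  qed
  then show ?thesis
    using ext_d_ext_d_fun[OF M Hf] vfield_along_vector_field[OF M S f H(1)] by (simp add: T_Emb_iso_def)
qed

text \<open>Uniqueness of the orthogonal splitting: the difference of two candidates for the
  tangential part is both tangent and orthogonal to \<open>N\<close>, hence zero by positivity of
  \<open>g\<close> and injectivity of the tangent map of the inclusion. This evaluates the
  \<open>THE\<close> in \<open>tan_part\<close>.\<close>

lemma tan_nor_part:
  fixes S :: "('s, 'e::euclidean_space) mfd" and N :: "('s, 'd::euclidean_space) mfd"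
  assumes g: "riemannian_metric S g" and NS: "pts N \<subseteq> pts S"
    and lin: "\<And>x. x \<in> pts N \<Longrightarrow> linear (tmap N S (\<lambda>x. x) x)" and inj: "\<And>x. x \<in> pts N \<Longrightarrow> inj (tmap N S (\<lambda>x. x) x)"
    and X0: "\<forall>x. x \<notin> pts N \<longrightarrow> X x = 0" and u0: "\<forall>x. x \<notin> pts N \<longrightarrow> u x = 0"
    and u: "\<forall>x\<in>pts N. \<forall>w. g x (u x) (tmap N S (\<lambda>x. x) x w) = 0"
    and v: "\<And>x. x \<in> pts N \<Longrightarrow> v x = u x + tmap N S (\<lambda>x. x) x (X x)"
  shows "tan_part S g N v = X" "nor_part S g N v = u"
proof -
  show tan: "tan_part S g N v = X"
  proof
    fix x
    show "tan_part S g N v x = X x"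
    proof (cases "x \<in> pts N")
      case x: True
      let ?T = "tmap N S (\<lambda>x. x) x"
      have gx: "bilinear (g x)" and pos: "\<And>v. v \<noteq> 0 \<Longrightarrow> 0 < g x v v"
        using g x NS by (auto simp: riemannian_metric_def)
      have split: "g x (v x - ?T t) (?T w) = g x (?T (X x - t)) (?T w)" for t w
        using bilinear_ladd[OF gx, of "u x" "?T (X x - t)" "?T w"] u x
        by (simp add: v[OF x] linear_diff[OF lin[OF x]] algebra_simps)
      have "(THE t. \<forall>w. g x (v x - ?T t) (?T w) = 0) = X x"
      proof (rule the_equality)
        show "\<forall>w. g x (v x - ?T (X x)) (?T w) = 0"
          unfolding split using linear_0[OF lin[OF x]] bilinear_lzero[OF gx] by simp
        fix t assume "\<forall>w. g x (v x - ?T t) (?T w) = 0"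
        then have "g x (?T (X x - t)) (?T (X x - t)) = 0" unfolding split by blast
        then have "?T (X x - t) = 0" using pos by force
        then have "X x - t = 0" using inj[OF x] linear_injective_0[OF lin[OF x]] by blast
        then show "t = X x" by simp
      qed
      then show ?thesis using x by (simp add: tan_part_def)
    qed (simp add: tan_part_def X0)
  qed
  show "nor_part S g N v = u"
    unfolding nor_part_def[abs_def] tan using v u0 by auto
qed

text \<open>Besides the fact that \<open>v\<close> represents the class, the conclusion keeps the
  splitting of \<open>v\<close> along \<open>N\<close> and the contraction identity for
  \<open>X\<close>, because the pairing of two representatives is later expanded point by
  point.\<close>

lemma hamiltonian_representative:
  fixes M :: "('m, real^'k) mfd" and S :: "('s, real^'n) mfd" and N :: "('s, real^'k) mfd"
  assumes \<omega>: "symplectic S \<omega>" and M: "manifold M" and compact: "compact_space (mtop M)" and \<mu>: "volume_form M \<mu>"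
    and g: "riemannian_metric S g" and f: "f \<in> Emb_iso M S \<omega>" and N: "N = submfd S (f ` pts M)"
    and \<nu>: "\<nu> = pullback N M (inv_into (pts M) f) \<mu>"
    and u: "u \<in> T_Gr_iso S \<omega> g N" and \<gamma>: "diff_form N (CARD('k) - 1) \<gamma>"
    and h: "smooth_fun N h" and uh: "interior_along N S (\<lambda>x. x) u \<omega> = ext_d N (fun_form N h)"
  obtains v X where "hamiltonian_vf S \<omega> v" "nor_part S g N v = u" "lie_deriv N (tan_part S g N v) \<nu> = ext_d N \<gamma>"
    "\<forall>x\<in>pts N. v x = u x + tmap N S (\<lambda>x. x) x (X x)"
    "\<forall>x\<in>pts N. \<forall>L vs. linear L \<longrightarrow>
      L (X x) * \<nu> x vs = (\<Sum>i<length vs. (-1) ^ i * L (vs ! i) * \<gamma> x (del_nth i vs))"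
    "vfield_along N S (\<lambda>x. x) (\<lambda>x. u x + (if x \<in> pts N then tmap N S (\<lambda>x. x) x (X x) else 0))"
proof -
  note S = symplectic_manifold[OF \<omega>] and \<omega>2 = symplectic_diff_form[OF \<omega>]
  have fE: "f \<in> Emb M S" and iso: "pullback M S f \<omega> = (\<lambda>_ _. 0)" using f by (simp_all add: Emb_iso_def)
  note N' = manifold_emb[OF M S fE N refl] and A = emb_image_subset[OF M S fE N refl]
  note cN = compact_emb[OF M S fE N refl compact] and V = volume_form_push[OF M S fE N compact \<mu> \<nu>]
  note inc = smooth_map_submfd_inclusion[OF S A N]
  have NS: "pts N \<subseteq> pts S" using A emb_pts[OF M S fE N refl] by simp
  obtain X where X: "vector_field N X" "\<forall>x. x \<notin> pts N \<longrightarrow> X x = 0"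
    "\<forall>x\<in>pts N. \<forall>L vs. linear L \<longrightarrow>
      L (X x) * \<nu> x vs = (\<Sum>i<length vs. (-1) ^ i * L (vs ! i) * \<gamma> x (del_nth i vs))"
    "lie_deriv N X \<nu> = ext_d N \<gamma>"
    by (rule contraction_exists[OF N' cN V \<gamma>])
  have uD: "vfield_along N S (\<lambda>x. x) u" "\<forall>x\<in>pts N. \<forall>w. g x (u x) (tmap N S (\<lambda>x. x) x w) = 0"
    "\<forall>x. x \<notin> pts N \<longrightarrow> u x = 0"
    using u by (auto simp: T_Gr_iso_def vfield_along_def)
  let ?w = "\<lambda>x. u x + (if x \<in> pts N then tmap N S (\<lambda>x. x) x (X x) else 0)"
  have w: "vfield_along N S (\<lambda>x. x) ?w"
    by (rule vfield_along_add[OF N' S inc uD(1) vfield_along_tmap[OF N' S inc X(1)]])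
  have "interior_along N S (\<lambda>x. x) ?w \<omega> = interior_along N S (\<lambda>x. x) u \<omega>"
  proof (intro ext)
    fix x vs
    show "interior_along N S (\<lambda>x. x) ?w \<omega> x vs = interior_along N S (\<lambda>x. x) u \<omega> x vs"
    proof (cases "x \<in> pts N")
      case x: True
      then have xS: "x \<in> pts S" using NS by blast
      show ?thesis
      proof (cases "length vs = 1")
        case True
        then obtain a where vs: "vs = [a]" by (auto simp: length_Suc_conv)
        show ?thesis
          using x linear_add[OF symplectic_linear(1)[OF \<omega> xS]] isotropic_inclusion[OF M S fE N refl iso x]
          by (simp add: interior_along_def vs)
      next
        case False
        then show ?thesis
          using alt_multilinear_length[OF diff_formD(1)[OF S \<omega>2 xS]] by (simp add: interior_along_def)
      qed
    qed (simp add: interior_along_def)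
  qed
  then have wh: "interior_along N S (\<lambda>x. x) ?w \<omega> = ext_d N (fun_form N h)" using uh by simp
  obtain v where v: "hamiltonian_vf S \<omega> v" "\<And>x. x \<in> pts N \<Longrightarrow> v x = ?w x"
    using hamiltonian_extension[OF \<omega> A N N' w h wh cN] by blast
  have vN: "v x = u x + tmap N S (\<lambda>x. x) x (X x)" if "x \<in> pts N" for x using v(2)[OF that] that by simp
  have part: "tan_part S g N v = X" "nor_part S g N v = u"
    by (rule tan_nor_part[OF g NS linear_tmap[OF N' S inc] inj_tmap_inclusion[OF M S fE N refl] X(2) uD(3,2) vN]; assumption)+
  show ?thesis
    by (rule that[OF v(1) part(2) _ _ X(3) w]) (simp_all add: part(1) X(4) vN)
qed

theorem theorem4p1:
  fixes M :: "('m, real ^ 'k) mfd" and \<mu> :: "('m, real ^ 'k) form"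
    and S :: "('s, real ^ 'n) mfd" and \<omega> :: "('s, real ^ 'n) form"
    and g :: "'s \<Rightarrow> real ^ 'n \<Rightarrow> real ^ 'n \<Rightarrow> real"
    and \<omega>\<^sub>0 :: "('s, real ^ 'k) mfd \<times> ('s, real ^ 'k) form \<Rightarrow>
               ('m, 's, real ^ 'n) gr_vec \<Rightarrow> ('m, 's, real ^ 'n) gr_vec \<Rightarrow> real"
    and N :: "('s, real ^ 'k) mfd" and \<nu> :: "('s, real ^ 'k) form"
    and \<Phi> :: "('m, 's, real ^ 'n) gr_vec \<Rightarrow> ('s \<Rightarrow> real ^ 'n) \<times> ('s, real ^ 'k) form"
    and u v :: "'s \<Rightarrow> real ^ 'n" and \<gamma> lam :: "('s, real ^ 'k) form" and hu hv :: "'s \<Rightarrow> real"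
  assumes "symplectic S \<omega>"
    and "prequantizable TYPE('p) TYPE('q::euclidean_space) S \<omega>"
    and "manifold M" and "compact_space (mtop M)" and "volume_form M \<mu>" and "H1_zero M"
    and "riemannian_metric S g"
    and "reduced_symplectic_form M \<mu> S \<omega> \<omega>\<^sub>0"
    and "(N, \<nu>) \<in> Gr_iso_vol M \<mu> S \<omega>"
    and "gr_identification M \<mu> S \<omega> g N \<nu> \<Phi>"
    and "u \<in> T_Gr_iso S \<omega> g N" and "v \<in> T_Gr_iso S \<omega> g N"
    and "diff_form N (CARD('k) - 1) \<gamma>" and "diff_form N (CARD('k) - 1) lam"
    and "smooth_fun N hu" and "interior_along N S (\<lambda>x. x) u \<omega> = ext_d N (fun_form N hu)"
    and "smooth_fun N hv" and "interior_along N S (\<lambda>x. x) v \<omega> = ext_d N (fun_form N hv)"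
  shows "\<omega>\<^sub>0 (N, \<nu>)
           (inv_into (T_Gr_iso_vol M \<mu> S \<omega> (N, \<nu>)) \<Phi> (u, ext_d N \<gamma>))
           (inv_into (T_Gr_iso_vol M \<mu> S \<omega> (N, \<nu>)) \<Phi> (v, ext_d N lam)) =
         form_integral N \<nu> (\<lambda>x vs. \<omega> x [u x, v x] * \<nu> x vs)
         + form_integral N \<nu> (wedge1 (interior_along N S (\<lambda>x. x) u \<omega>) lam)
         - form_integral N \<nu> (wedge1 (interior_along N S (\<lambda>x. x) v \<omega>) \<gamma>)
       \<and>
         form_integral N \<nu> (\<lambda>x vs. \<omega> x [u x, v x] * \<nu> x vs)
         + form_integral N \<nu> (wedge1 (interior_along N S (\<lambda>x. x) u \<omega>) lam)
         - form_integral N \<nu> (wedge1 (interior_along N S (\<lambda>x. x) v \<omega>) \<gamma>) =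
         form_integral N \<nu>
           (\<lambda>x vs. \<omega> x [u x, v x] * \<nu> x vs + hv x * ext_d N \<gamma> x vs - hu x * ext_d N lam x vs)"
proof -
  note \<omega> = assms(1) and M = assms(3) and compact = assms(4) and \<mu> = assms(5) and g = assms(7)
    and \<Phi> = assms(10) and \<gamma> = assms(13) and lam = assms(14) and hu = assms(15,16) and hv = assms(17,18)
  note S = symplectic_manifold[OF \<omega>] and \<omega>2 = symplectic_diff_form[OF \<omega>]
  \<comment> \<open>One embedding over \<open>(N, \<nu>)\<close> is fixed for both arguments,
    because the equation that determines \<open>\<omega>\<^sub>0\<close> compares two tangent
    vectors at the same \<open>f\<close>.\<close>
  obtain f where f: "f \<in> Emb_iso M S \<omega>" and pi: "pi_mu M \<mu> S f = (N, \<nu>)"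
    using assms(9) by (auto simp: Gr_iso_vol_def)
  have N: "N = submfd S (f ` pts M)" and \<nu>: "\<nu> = pullback N M (inv_into (pts M) f) \<mu>"
    using pi by (auto simp: pi_mu_def Let_def)
  have fE: "f \<in> Emb M S" and iso: "pullback M S f \<omega> = (\<lambda>_ _. 0)" using f by (simp_all add: Emb_iso_def)
  note N' = manifold_emb[OF M S fE N refl] and A = emb_image_subset[OF M S fE N refl] and fs = emb_smooth[OF M S fE N refl]
  note cN = compact_emb[OF M S fE N refl compact] and V = volume_form_push[OF M S fE N compact \<mu> \<nu>]
  note inc = smooth_map_submfd_inclusion[OF S A N]
  have NS: "pts N \<subseteq> pts S" using A emb_pts[OF M S fE N refl] by simp
  obtain v1 X where v1: "hamiltonian_vf S \<omega> v1" "nor_part S g N v1 = u" "lie_deriv N (tan_part S g N v1) \<nu> = ext_d N \<gamma>"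
    and v1_eq: "\<forall>x\<in>pts N. v1 x = u x + tmap N S (\<lambda>x. x) x (X x)"
    and X: "\<forall>x\<in>pts N. \<forall>L vs. linear L \<longrightarrow>
      L (X x) * \<nu> x vs = (\<Sum>i<length vs. (-1) ^ i * L (vs ! i) * \<gamma> x (del_nth i vs))"
    and w1: "vfield_along N S (\<lambda>x. x) (\<lambda>x. u x + (if x \<in> pts N then tmap N S (\<lambda>x. x) x (X x) else 0))"
    by (rule hamiltonian_representative[OF \<omega> M compact \<mu> g f N \<nu> assms(11) \<gamma> hu])
  obtain v2 Y where v2: "hamiltonian_vf S \<omega> v2" "nor_part S g N v2 = v" "lie_deriv N (tan_part S g N v2) \<nu> = ext_d N lam"
    and v2_eq: "\<forall>x\<in>pts N. v2 x = v x + tmap N S (\<lambda>x. x) x (Y x)"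
    and Y: "\<forall>x\<in>pts N. \<forall>L vs. linear L \<longrightarrow>
      L (Y x) * \<nu> x vs = (\<Sum>i<length vs. (-1) ^ i * L (vs ! i) * lam x (del_nth i vs))"
    and w2: "vfield_along N S (\<lambda>x. x) (\<lambda>x. v x + (if x \<in> pts N then tmap N S (\<lambda>x. x) x (Y x) else 0))"
    by (rule hamiltonian_representative[OF \<omega> M compact \<mu> g f N \<nu> assms(12) lam hv])
  let ?r = "\<lambda>v x. if x \<in> pts M then v (f x) else 0" and ?D = "T_Gr_iso_vol M \<mu> S \<omega> (N, \<nu>)"
  have inj: "inj_on \<Phi> ?D" using \<Phi> by (simp add: gr_identification_def bij_betw_def)
  \<comment> \<open>The class of a Hamiltonian restriction lies in the domain \<open>?D\<close>, and
    its value under \<open>\<Phi>\<close> is prescribed; injectivity turns this value into a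
    statement about \<open>inv_into\<close>.\<close>
  have preimage: "inv_into ?D \<Phi> (nor_part S g N z, lie_deriv N (tan_part S g N z) \<nu>) = T_pi_mu M \<mu> S f (?r z)"
    if z: "hamiltonian_vf S \<omega> z" for z
  proof (rule inv_into_f_eq[OF inj])
    show "T_pi_mu M \<mu> S f (?r z) \<in> ?D"
      using f pi hamiltonian_T_Emb_iso[OF M \<omega> fs z] by (auto simp: T_Gr_iso_vol_def)
    show "\<Phi> (T_pi_mu M \<mu> S f (?r z)) = (nor_part S g N z, lie_deriv N (tan_part S g N z) \<nu>)"
      using \<Phi> f pi z by (simp add: gr_identification_def)
  qed
  let ?\<omega>\<nu> = "\<lambda>x vs. \<omega> x [u x, v x] * \<nu> x vs" and ?du = "ext_d N (fun_form N hu)" and ?dv = "ext_d N (fun_form N hv)"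
  \<comment> \<open>These agree with \<open>v1\<close> and \<open>v2\<close> on \<open>N\<close> but
    vanish off \<open>N\<close>, which \<open>vfield_along\<close> demands; in this form the pairing
    is known to be smooth on \<open>N\<close>.\<close>
  let ?w1 = "\<lambda>x. u x + (if x \<in> pts N then tmap N S (\<lambda>x. x) x (X x) else 0)"
    and ?w2 = "\<lambda>x. v x + (if x \<in> pts N then tmap N S (\<lambda>x. x) x (Y x) else 0)"
  have \<nu>_top: "top_form N \<nu>" using V by (intro top_form_diff_form[OF N']) (simp add: volume_form_def)
  have pairing_top: "top_form N (\<lambda>x vs. \<omega> x [a x, b x] * \<nu> x vs)"
    if "vfield_along N S (\<lambda>x. x) a" "vfield_along N S (\<lambda>x. x) b" for a b
    using smooth_fun_form_along[OF N' S inc \<omega>2, of "[a, b]"] that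
    by (intro top_form_mult[OF smooth_fun_chart_continuous \<nu>_top]) auto
  have uv: "vfield_along N S (\<lambda>x. x) u" "vfield_along N S (\<lambda>x. x) v"
    using assms(11,12) by (simp_all add: T_Gr_iso_def)
  have "\<omega>\<^sub>0 (N, \<nu>) (inv_into ?D \<Phi> (u, ext_d N \<gamma>)) (inv_into ?D \<Phi> (v, ext_d N lam)) =
      \<omega>\<^sub>0 (pi_mu M \<mu> S f) (T_pi_mu M \<mu> S f (?r v1)) (T_pi_mu M \<mu> S f (?r v2))"
    using preimage[OF v1(1)] preimage[OF v2(1)] v1(2,3) v2(2,3) pi by simp
  also have "\<dots> = omega_bar M \<mu> \<omega> f (?r v1) (?r v2)"
    using assms(8) f hamiltonian_T_Emb_iso[OF M \<omega> fs v1(1)] hamiltonian_T_Emb_iso[OF M \<omega> fs v2(1)]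
    unfolding reduced_symplectic_form_def by blast
  also have "\<dots> = form_integral N \<nu> (\<lambda>x vs. \<omega> x [?w1 x, ?w2 x] * \<nu> x vs)"
    unfolding omega_bar_def
  proof (rule form_integral_push[OF M S fE N compact \<mu> \<nu> pairing_top[OF w1 w2]])
    fix c y assume c: "c \<in> atlas M" and y: "y \<in> cimg c"
    have fy: "f (cinv c y) \<in> pts N" "cinv c y \<in> pts M"
      using cinv_pts[OF M c y] emb_pts[OF M S fE N refl] by auto
    have "in_chart N (push_chart M f c) \<nu> y basis_list = in_chart M c \<mu> y basis_list"
      unfolding \<nu> by (rule in_chart_push_chart[OF M S fE N refl c y])
    moreover have "\<omega> (f (cinv c y)) [?w1 (f (cinv c y)), ?w2 (f (cinv c y))] = \<omega> (f (cinv c y)) [v1 (f (cinv c y)), v2 (f (cinv c y))]"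
      using v1_eq v2_eq fy by simp
    ultimately show "in_chart N (push_chart M f c) (\<lambda>x vs. \<omega> x [?w1 x, ?w2 x] * \<nu> x vs) y basis_list =
        in_chart M c (\<lambda>x vs. \<omega> (f x) [?r v1 x, ?r v2 x] * \<mu> x vs) y basis_list"
      unfolding in_chart_mult push_chart_simps(4)[OF M S fE N refl c y] using fy by simp
  qed
  \<comment> \<open>The difference is written as a sum with a factor -1 to match the additivity and
    homogeneity of the integral.\<close>
  also have "\<dots> = form_integral N \<nu> (\<lambda>x vs. (?\<omega>\<nu> x vs + wedge1 ?du lam x vs) + -1 * wedge1 ?dv \<gamma> x vs)"
  proof (rule form_integral_cong[OF N' cN V])
    fix x and vs :: "(real^'k) list" assume x: "x \<in> pts N"
    then have xS: "x \<in> pts S" using NS by blast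
    let ?T = "tmap N S (\<lambda>x. x) x"
    note l1 = linear_add[OF symplectic_linear(1)[OF \<omega> xS]] and l2 = linear_add[OF symplectic_linear(2)[OF \<omega> xS]]
    have du: "?du x [a] = \<omega> x [u x, ?T a]" for a using fun_cong[OF fun_cong[OF hu(2)], of x "[a]"] x by (simp add: interior_along_def)
    have dv: "?dv x [a] = \<omega> x [v x, ?T a]" for a using fun_cong[OF fun_cong[OF hv(2)], of x "[a]"] x by (simp add: interior_along_def)
    have "\<omega> x [?w1 x, ?w2 x] = \<omega> x [u x, v x] + \<omega> x [u x, ?T (Y x)] + \<omega> x [?T (X x), v x]"
      using x isotropic_inclusion[OF M S fE N refl iso x] by (simp add: l1 l2)
    also have "\<dots> = \<omega> x [u x, v x] + ?du x [Y x] - ?dv x [X x]"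
      using symplectic_swap[OF \<omega> xS, of "?T (X x)" "v x"] by (simp add: du dv)
    finally have eq: "\<omega> x [?w1 x, ?w2 x] = \<omega> x [u x, v x] + ?du x [Y x] - ?dv x [X x]" .
    have d1: "diff_form N 1 (ext_d N (fun_form N h))" if "smooth_fun N h" for h
      using diff_form_ext_d[OF N' diff_form_fun_form[OF N' that]] by simp
    have lin: "linear (\<lambda>a. ?du x [a])" "linear (\<lambda>a. ?dv x [a])"
      by (rule one_form_linear[OF diff_formD(1)[OF N' d1[OF hu(1)] x]])
        (rule one_form_linear[OF diff_formD(1)[OF N' d1[OF hv(1)] x]])
    have "?du x [Y x] * \<nu> x vs = wedge1 ?du lam x vs"
      using Y[rule_format, OF x lin(1), of vs] by (simp add: wedge1_def)
    moreover have "?dv x [X x] * \<nu> x vs = wedge1 ?dv \<gamma> x vs"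
      using X[rule_format, OF x lin(2), of vs] by (simp add: wedge1_def)
    ultimately show "\<omega> x [?w1 x, ?w2 x] * \<nu> x vs = (?\<omega>\<nu> x vs + wedge1 ?du lam x vs) + -1 * wedge1 ?dv \<gamma> x vs"
      unfolding eq by (simp add: algebra_simps)
  qed
  also have "\<dots> = form_integral N \<nu> ?\<omega>\<nu> + form_integral N \<nu> (wedge1 ?du lam) - form_integral N \<nu> (wedge1 ?dv \<gamma>)"
  proof -
    note t1 = integral_wedge_d(1)[OF N' cN V hu(1) lam] and t2 = integral_wedge_d(1)[OF N' cN V hv(1) \<gamma>]
    have t3: "top_form N (\<lambda>x vs. -1 * wedge1 ?dv \<gamma> x vs)"
      using top_form_mult[OF chart_continuous_const t2, of "-1"] by simp
    show ?thesis
      using form_integral_add[OF N' cN V top_form_add[OF pairing_top[OF uv] t1] t3]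
        form_integral_add[OF N' cN V pairing_top[OF uv] t1] form_integral_cmult[OF N' cN V, of "-1" "wedge1 ?dv \<gamma>"]
      by simp
  qed
  finally have first: "\<omega>\<^sub>0 (N, \<nu>) (inv_into ?D \<Phi> (u, ext_d N \<gamma>)) (inv_into ?D \<Phi> (v, ext_d N lam)) =
      form_integral N \<nu> ?\<omega>\<nu> + form_integral N \<nu> (wedge1 ?du lam) - form_integral N \<nu> (wedge1 ?dv \<gamma>)" .
  have second: "form_integral N \<nu> ?\<omega>\<nu> + form_integral N \<nu> (wedge1 ?du lam) - form_integral N \<nu> (wedge1 ?dv \<gamma>) =
      form_integral N \<nu> (\<lambda>x vs. \<omega> x [u x, v x] * \<nu> x vs + hv x * ext_d N \<gamma> x vs - hu x * ext_d N lam x vs)"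
  proof -
    note t1 = integral_wedge_d(3)[OF N' cN V hu(1) lam] and t2 = integral_wedge_d(3)[OF N' cN V hv(1) \<gamma>]
    have t3: "top_form N (\<lambda>x vs. -1 * (hu x * ext_d N lam x vs))"
      using top_form_mult[OF chart_continuous_const t1, of "-1"] by simp
    show ?thesis
      using form_integral_add[OF N' cN V top_form_add[OF pairing_top[OF uv] t2] t3]
        form_integral_add[OF N' cN V pairing_top[OF uv] t2]
        form_integral_cmult[OF N' cN V, of "-1" "\<lambda>x vs. hu x * ext_d N lam x vs"]
        integral_wedge_d(2)[OF N' cN V hu(1) lam] integral_wedge_d(2)[OF N' cN V hv(1) \<gamma>]
      by simp
  qed
  show ?thesis
    unfolding hu(2) hv(2) using first second by blast
qed

end
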